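(* Let $d\geq 2$ and let $n_1,\dots,n_d\in\mathbb{Z}_{\geq 0}$. Then the Euler–Zagier multiple zeta function $\zeta_d(s_1,\dots,s_d)$ can be continued meromorphically to the domain \[ D=\left\{(s_1,\dots,s_d)\in\mathbb{C}^d \;\middle|\; \Re(s_d(j))>d-j-n_j\ (j=1,\dots,d),\ \Re(s_{j-1})>-n_j-1\ (j=2,\dots,d)\right\}, \] and on $D$ it is represented by \begin{align*} \zeta_d(s_1,\dots,s_d)=&\frac{1}{\Gamma(s_1)\cdots\Gamma(s_d)}\sum_{k=0}^{n_1}\sum_{\substack{p_1+\cdots+p_d=k\\ p_i\in\mathbb{Z}_{\ge0}}}\frac{B_{p_1}\cdots B_{p_d}}{p_1!\cdots p_d!}\,\frac{1}{s_d(1)-d+k}\prod_{j=2}^{d}B\bigl(s_d(j)-d+j+p_d(j)-1,\;s_{j-1}\bigr)\\ &+\frac{1}{\Gamma(s_1)\cdots\Gamma(s_d)}\int_0^1 x_1^{s_d(1)-d+n_1}F_{\varphi}(x_1)\,dx_1 +\frac{1}{\Gamma(s_1)\cdots\Gamma(s_d)}\int_1^{\infty}\frac{x_1^{s_d(1)-d}}{e^{x_1}-1}F_{\psi}(x_1)\,dx_1, \end{align*} where $F_\varphi$ and $F_\psi$ are as defined in the context (with $f_a=\varphi_a$, resp. $f_a=\psi_a$). Moreover, all possible singularities of $\zeta_d$ in $D$ lie in the union, over $j=1,\dots,d$, of the sets $\{s_d(j)\in\mathbb{Z}_{\leq d-j+1}\}$ and $\{s_j\in\mathbb{Z}_{\leq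 0}\}$.
   Context: The Euler–Zagier multiple zeta function is $\zeta_d(s_1,\dots,s_d)=\sum_{m_1,\dots,m_d\geq 1}m_1^{-s_1}(m_1+m_2)^{-s_2}\cdots(m_1+\cdots+m_d)^{-s_d}$, defined where absolutely convergent. For a tuple $(s_1,\dots,s_d)$ write $s_d(n)=s_n+s_{n+1}+\cdots+s_d$; similarly $p_d(n)=p_n+\cdots+p_d$. $B_m$ is the $m$-th Bernoulli number, defined by $x/(e^x-1)=\sum_{m\ge0}B_mx^m/m!$; $B(x,y)$ is the beta function; $(a)_n=\Gamma(a+n)/\Gamma(a)$ is the Pochhammer symbol and $(a)_n^{-1}=1/(a)_n$. For $a=(a_2,\dots,a_d)\in\{0,1\}^{d-1}$ and $j=2,\dots,d$ put: $u_j=s_d(j)-d+j-2$, $v_j=s_{j-1}-1$, $t_j=x_j$ if $a_j=0$; and $u_j=s_{j-1}-1$, $v_j=s_d(j)-d+j-2$, $t_j=1-x_j$ if $a_j=1$. Define \[\varphi_a(x_1,\dots,x_d)=\Bigl(\prod_{j=2}^d(1-x_j)^{v_j}\Bigr)\sum_{k=n_1+1}^{\infty}\sum_{p_1+\cdots+p_d=k}\frac{B_{p_1}\cdots B_{p_d}}{p_1!\cdots p_d!}x_1^{k-n_1-1}t_2^{p_d(2)}\cdots t_d^{p_d(d)},\] \[\psi_a(x_1,\dots,x_d)=\prod_{j=2}^d(1-x_j)^{v_j}\,\frac{x_1t_2\cdots t_j}{e^{x_1t_2\cdots t_j}-1}.\] Let $\mathfrak{S}$ denote the set of bijections $\sigma:\{2,\dots,d\}\to\{2,\dots,d\}$.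 For a family of functions $f_a(x_1,\dots,x_d)$ indexed by $a\in\{0,1\}^{d-1}$ define \begin{align*} F_f(x_1)=&\sum_{a\in\{0,1\}^{d-1}}\sum_{m=1}^{d}\sum_{\substack{\sigma\in\mathfrak{S}\\ \sigma(2)<\cdots<\sigma(m)\\ \sigma(m+1)<\cdots<\sigma(d)}}\sum_{k_{\sigma(2)}=0}^{n_{\sigma(2)}}\cdots\sum_{k_{\sigma(m)}=0}^{n_{\sigma(m)}}\Bigl\{\prod_{j=2}^{m}(-1)^{k_{\sigma(j)}}(u_{\sigma(j)}+1)_{k_{\sigma(j)}+1}^{-1}\bigl(\tfrac12\bigr)^{u_{\sigma(j)}+k_{\sigma(j)}+1}\Bigr\}\\ &\times\Bigl\{\prod_{j=m+1}^{d}(-1)^{n_{\sigma(j)}+1}(u_{\sigma(j)}+1)_{n_{\sigma(j)}+1}^{-1}\Bigr\}\int_0^{1/2}\!\!\cdots\!\int_0^{1/2}\Bigl(\prod_{j=m+1}^{d}x_{\sigma(j)}^{u_{\sigma(j)}+n_{\sigma(j)}+1}\Bigr)\\ &\qquad\times\Bigl[\frac{\partial^{k_{\sigma(2)}}}{\partial x_{\sigma(2)}^{k_{\sigma(2)}}}\cdots\frac{\partial^{k_{\sigma(m)}}}{\partial x_{\sigma(m)}^{k_{\sigma(m)}}}\frac{\partial^{n_{\sigma(m+1)}+1}}{\partial x_{\sigma(m+1)}^{n_{\sigma(m+1)}+1}}\cdots\frac{\partial^{n_{\sigma(d)}+1}}{\partial x_{\sigma(d)}^{n_{\sigma(d)}+1}}f_a(x_1,\dots,x_d)\Bigr]_{x_{\sigma(2)}=\cdots=x_{\sigma(m)}=\frac12}dx_{\sigma(m+1)}\cdots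 dx_{\sigma(d)}, \end{align*} where for $m=1$ the first set of conditions, sums and products is empty and for $m=d$ there is no integration. $F_\varphi$ and $F_\psi$ denote $F_f$ with $f_a=\varphi_a$ and $f_a=\psi_a$ respectively. *)

theory Defs
  imports "HOL-Analysis.Analysis"
begin

section \<open>Holomorphic and meromorphic functions of several complex variables\<close>

text \<open>
  Complex Frechet differentiability at every point: the differential is the complex-linear
  form with coefficient vector (gradient) \<open>a\<close>. The set is meant to be open.
\<close>
definition holomorphic_multi :: "(complex ^ 'd::finite \<Rightarrow> complex) \<Rightarrow> (complex ^ 'd) set \<Rightarrow> bool"
  where "holomorphic_multi f S \<longleftrightarrow>
    (\<forall>z\<in>S. \<exists>a :: complex ^ 'd. (f has_derivative (\<lambda>v. \<Sum>i\<in>UNIV. a $ i * v $ i)) (at z))"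

text \<open>
  Locally a quotient of holomorphic functions whose denominator does not vanish identically.
  The value of \<open>f\<close> at the zeros of the denominator is unconstrained.
\<close>
definition meromorphic_multi :: "(complex ^ 'd::finite \<Rightarrow> complex) \<Rightarrow> (complex ^ 'd) set \<Rightarrow> bool"
  where "meromorphic_multi f S \<longleftrightarrow>
    (\<forall>z\<in>S. \<exists>U g h. open U \<and> connected U \<and> z \<in> U \<and> U \<subseteq> S \<and>
       holomorphic_multi g U \<and> holomorphic_multi h U \<and> (\<exists>w\<in>U. h w \<noteq> 0) \<and>
       (\<forall>w\<in>U. h w \<noteq> 0 \<longrightarrow> f w = g w / h w))"


section \<open>The Euler--Zagier multiple zeta function\<close>

text \<open>
  Tuples indexed by \<open>{1..d}\<close> are functions on \<open>nat\<close>; only their values on \<open>{1..d}\<close> matter.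
\<close>
definition ez_index :: "nat \<Rightarrow> (nat \<Rightarrow> nat) set"
  where "ez_index d = {1..d} \<rightarrow>\<^sub>E {1..}"

definition ez_term :: "nat \<Rightarrow> (nat \<Rightarrow> complex) \<Rightarrow> (nat \<Rightarrow> nat) \<Rightarrow> complex"
  where "ez_term d s m = (\<Prod>j=1..d. of_nat (\<Sum>i=1..j. m i) powr (- s j))"

definition ez_converges :: "nat \<Rightarrow> (nat \<Rightarrow> complex) \<Rightarrow> bool"
  where "ez_converges d s \<longleftrightarrow> (\<lambda>m. norm (ez_term d s m)) summable_on ez_index d"

definition ez_zeta :: "nat \<Rightarrow> (nat \<Rightarrow> complex) \<Rightarrow> complex"
  where "ez_zeta d s = infsum (ez_term d s) (ez_index d)"


section \<open>Domain and singular hyperplanes\<close>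

definition tail_sum :: "nat \<Rightarrow> (nat \<Rightarrow> 'a::comm_monoid_add) \<Rightarrow> nat \<Rightarrow> 'a"
  where "tail_sum d s j = (\<Sum>i=j..d. s i)"

definition ez_domain :: "nat \<Rightarrow> (nat \<Rightarrow> nat) \<Rightarrow> (nat \<Rightarrow> complex) set"
  where "ez_domain d n = {s.
    (\<forall>j\<in>{1..d}. Re (tail_sum d s j) > real d - real j - real (n j)) \<and>
    (\<forall>j\<in>{2..d}. Re (s (j - 1)) > - real (n j) - 1)}"

definition ez_singular :: "nat \<Rightarrow> (nat \<Rightarrow> complex) set"
  where "ez_singular d =
    (\<Union>j\<in>{1..d}. {s. \<exists>z::int. z \<le> int d - int j + 1 \<and> tail_sum d s j = of_int z}
               \<union> {s. \<exists>z::int. z \<le> 0 \<and> s j = of_int z})"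


section \<open>Ingredients of the representation formula\<close>

definition bernoulli :: "nat \<Rightarrow> complex"
  where "bernoulli m = fact m * fps_nth (fps_X / (fps_exp 1 - 1)) m"

definition compositions :: "nat \<Rightarrow> nat \<Rightarrow> (nat \<Rightarrow> nat) set"
  where "compositions d k = {p \<in> {1..d} \<rightarrow>\<^sub>E UNIV. (\<Sum>i=1..d. p i) = k}"

definition bern_coeff :: "nat \<Rightarrow> (nat \<Rightarrow> nat) \<Rightarrow> complex"
  where "bern_coeff d p = (\<Prod>i=1..d. bernoulli (p i) / fact (p i))"

definition u_exp :: "nat \<Rightarrow> (nat \<Rightarrow> complex) \<Rightarrow> (nat \<Rightarrow> nat) \<Rightarrow> nat \<Rightarrow> complex"
  where "u_exp d s a j =
    (if a j = 0 then tail_sum d s j - of_nat d + of_nat j - 2 else s (j - 1) - 1)"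

definition v_exp :: "nat \<Rightarrow> (nat \<Rightarrow> complex) \<Rightarrow> (nat \<Rightarrow> nat) \<Rightarrow> nat \<Rightarrow> complex"
  where "v_exp d s a j =
    (if a j = 0 then s (j - 1) - 1 else tail_sum d s j - of_nat d + of_nat j - 2)"

definition t_var :: "(nat \<Rightarrow> nat) \<Rightarrow> (nat \<Rightarrow> real) \<Rightarrow> nat \<Rightarrow> real"
  where "t_var a x j = (if a j = 0 then x j else 1 - x j)"

definition ez_phi ::
    "nat \<Rightarrow> (nat \<Rightarrow> nat) \<Rightarrow> (nat \<Rightarrow> complex) \<Rightarrow> (nat \<Rightarrow> nat) \<Rightarrow> (nat \<Rightarrow> real) \<Rightarrow> complex"
  where "ez_phi d n s a x =
    (\<Prod>j=2..d. of_real (1 - x j) powr v_exp d s a j) *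
    (\<Sum>\<^sub>\<infinity>k\<in>{n 1 + 1..}. \<Sum>p\<in>compositions d k.
       bern_coeff d p * of_real (x 1) ^ (k - n 1 - 1) *
       (\<Prod>j=2..d. of_real (t_var a x j) ^ tail_sum d p j))"

text \<open>The function \<open>y / (e\<^sup>y - 1)\<close> with its removable singularity at \<open>0\<close> filled in.\<close>
definition bern_gen :: "real \<Rightarrow> real"
  where "bern_gen y = (if y = 0 then 1 else y / (exp y - 1))"

definition ez_psi ::
    "nat \<Rightarrow> (nat \<Rightarrow> complex) \<Rightarrow> (nat \<Rightarrow> nat) \<Rightarrow> (nat \<Rightarrow> real) \<Rightarrow> complex"
  where "ez_psi d s a x =
    (\<Prod>j=2..d. of_real (1 - x j) powr v_exp d s a j *
               of_real (bern_gen (x 1 * (\<Prod>i=2..j. t_var a x i))))"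

definition partial_deriv ::
    "nat \<Rightarrow> ((nat \<Rightarrow> real) \<Rightarrow> complex) \<Rightarrow> (nat \<Rightarrow> real) \<Rightarrow> complex"
  where "partial_deriv j f x = vector_derivative (\<lambda>t. f (x(j := t))) (at (x j))"

text \<open>
  \<open>\<sigma>\<close> is extended to \<open>nat\<close> by the identity. The integration variables are the coordinates
  in \<open>\<sigma> ` {m+1..d}\<close>; over the empty index set the product measure is the point mass, so for
  \<open>m = d\<close> no integration takes place.
\<close>
definition ez_F ::
    "nat \<Rightarrow> (nat \<Rightarrow> nat) \<Rightarrow> (nat \<Rightarrow> complex) \<Rightarrow>
     ((nat \<Rightarrow> nat) \<Rightarrow> (nat \<Rightarrow> real) \<Rightarrow> complex) \<Rightarrow> real \<Rightarrow> complex"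
  where "ez_F d n s f x1 =
    (\<Sum>a\<in>{2..d} \<rightarrow>\<^sub>E {0, 1}. \<Sum>m=1..d.
     \<Sum>\<sigma>\<in>{\<sigma>. \<sigma> permutes {2..d} \<and> strict_mono_on {2..m} \<sigma> \<and> strict_mono_on {m+1..d} \<sigma>}.
     \<Sum>k\<in>Pi\<^sub>E (\<sigma> ` {2..m}) (\<lambda>j. {0..n j}).
       (\<Prod>j=2..m. (-1) ^ k (\<sigma> j)
                   * inverse (pochhammer (u_exp d s a (\<sigma> j) + 1) (k (\<sigma> j) + 1))
                   * (1/2) powr (u_exp d s a (\<sigma> j) + of_nat (k (\<sigma> j)) + 1)) *
       (\<Prod>j=m+1..d. (-1) ^ (n (\<sigma> j) + 1)
                   * inverse (pochhammer (u_exp d s a (\<sigma> j) + 1) (n (\<sigma> j) + 1))) *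
       (LINT y : Pi\<^sub>E (\<sigma> ` {m+1..d}) (\<lambda>_. {0..1/2}) | Pi\<^sub>M (\<sigma> ` {m+1..d}) (\<lambda>_. lborel).
          (\<Prod>j=m+1..d. of_real (y (\<sigma> j)) powr (u_exp d s a (\<sigma> j) + of_nat (n (\<sigma> j)) + 1)) *
          foldr (\<lambda>j. partial_deriv (\<sigma> j) ^^ (if j \<le> m then k (\<sigma> j) else n (\<sigma> j) + 1))
            [2..<d+1] (f a)
            (\<lambda>i. if i = 1 then x1 else if i \<in> \<sigma> ` {2..m} then 1/2 else y i)))"

definition ez_formula :: "nat \<Rightarrow> (nat \<Rightarrow> nat) \<Rightarrow> (nat \<Rightarrow> complex) \<Rightarrow> complex"
  where "ez_formula d n s =
    1 / (\<Prod>j=1..d. Gamma (s j)) *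
      (\<Sum>k=0..n 1. \<Sum>p\<in>compositions d k.
         bern_coeff d p * (1 / (tail_sum d s 1 - of_nat d + of_nat k)) *
         (\<Prod>j=2..d. Beta (tail_sum d s j - of_nat d + of_nat j + of_nat (tail_sum d p j) - 1)
                        (s (j - 1)))) +
    1 / (\<Prod>j=1..d. Gamma (s j)) *
      (LINT x:{0..1}|lborel.
         of_real x powr (tail_sum d s 1 - of_nat d + of_nat (n 1)) * ez_F d n s (ez_phi d n s) x) +
    1 / (\<Prod>j=1..d. Gamma (s j)) *
      (LINT x:{1..}|lborel.
         of_real x powr (tail_sum d s 1 - of_nat d) / of_real (exp x - 1) * ez_F d n s (ez_psi d s) x)"

text \<open>
  \<open>\<complex>\<^sup>d\<close> is \<open>complex ^ 'd\<close> together with an enumeration \<open>e\<close> of the coordinates by \<open>{1..d}\<close>;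
  this gives the tuple \<open>(s\<^sub>1, \<dots>, s\<^sub>d)\<close> of a point.
\<close>
definition coords :: "(nat \<Rightarrow> 'd::finite) \<Rightarrow> complex ^ 'd \<Rightarrow> nat \<Rightarrow> complex"
  where "coords e s j = s $ e j"

end

theory Submission
  imports Defs "HOL-Complex_Analysis.Complex_Analysis" "HOL-Real_Asymp.Real_Asymp"
begin

text \<open>
  At large real points, gamma integrals for the powers in the summand and a substitution turn
  \<open>\<Gamma>(s\<^sub>1) \<cdots> \<Gamma>(s\<^sub>d) \<zeta>\<^sub>d\<close> into an integral over \<open>x\<^sub>1 > 0\<close> and \<open>0 < x\<^sub>2, \<dots>, x\<^sub>d < 1\<close>.
  Splitting every \<open>x\<^sub>j\<close> with \<open>j \<ge> 2\<close> at \<open>1/2\<close> (reflecting the upper half) gives the sum over \<open>a\<close>; integrating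
  by parts \<open>n\<^sub>j + 1\<close> times in each variable produces one term for every \<open>q\<close> with \<open>0 \<le> q\<^sub>j \<le> n\<^sub>j + 1\<close>, where
  \<open>q\<^sub>j = n\<^sub>j + 1\<close> marks a surviving integral. The shuffles \<open>\<sigma>\<close> of the statement only enumerate the
  sets of surviving variables. On \<open>x\<^sub>1 \<le> 1\<close> the Taylor polynomial of degree \<open>n\<^sub>1\<close> in \<open>x\<^sub>1\<close> is integrated
  exactly into beta functions. Multiplied by a product of reciprocal gamma functions with zero set \<open>Sing\<close>,
  the formula is holomorphic on all of \<open>D\<close>. It equals the correspondingly multiplied zeta function first at
  large real points, then for large real parts by the identity theorem along the complex lines through the
  real and imaginary parts, then along the diagonal half-line into any point of absolute convergence,
  where dominated convergence covers the boundary of the region of convergence.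
\<close>

section \<open>Holomorphic functions of several variables and parametric integrals\<close>

text \<open>The split at 1/2 isolates the two branch points of
  \<open>x powr u * (1 - x) powr v\<close>: after the reflection the only factor that is not smooth
  on (0, 1/2] is the power at 0, and each integration by parts raises its exponent by one while the
  other factor keeps bounded derivatives. The price is the Pochhammer denominators, which vanish on
  hyperplanes that meet \<open>D\<close>. Clearing them by \<open>sing_factor\<close> before any
  continuation keeps every use of the identity theorem on a convex set, and a single numerator and
  denominator represent the function on the whole of \<open>D\<close>. The region of convergence is
  never described. Monotonicity replaces a description: the norm of each term decreases in every
  \<open>Re (s j)\<close>, so convergence at one point gives a dominating series wherever all real
  parts are at least as large. At real points everything is nonnegative. Sums and integrals are
  interchanged in \<open>ennreal\<close>, and integrability of the outer integral is deduced at the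
  end from the finite value of the zeta sum.\<close>

unbundle no fps_syntax

text \<open>A quadratic error bound survives integration, since its constant can be integrated
  pointwise; the limit in the definition of the derivative cannot be handled that way. This form is
  what \<open>holomorphic_multi_integral\<close> ends with.\<close>

lemma has_derivative_quadratic:
  fixes G :: "'a::real_normed_vector \<Rightarrow> 'b::real_normed_vector"
  assumes "bounded_linear L" "r > 0"
    and "\<And>v. norm v < r \<Longrightarrow> norm (G (z + v) - G z - L v) \<le> C * (norm v)\<^sup>2"
  shows "(G has_derivative L) (at z)"
  unfolding has_derivative_at
proof (intro conjI assms(1))
  have "((\<lambda>h::'a. C * norm h) \<longlongrightarrow> C * norm (0::'a)) (at 0)"
    by (intro tendsto_intros)
  then have "((\<lambda>h::'a. C * norm h) \<longlongrightarrow> 0) (at 0)" by simp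
  moreover have "\<forall>\<^sub>F h in at 0. norm (norm (G (z + h) - G z - L h) / norm h) \<le> C * norm h"
  proof -
    have "\<forall>\<^sub>F h in at (0::'a). h \<noteq> 0 \<and> dist h 0 < r"
      using assms(2) eventually_at by blast
    then show ?thesis
    proof eventually_elim
      case (elim h)
      then have "norm (G (z + h) - G z - L h) \<le> C * (norm h)\<^sup>2" using assms(3)[of h] by simp
      then show ?case using elim by (simp add: divide_simps power2_eq_square mult_ac)
    qed
  qed
  ultimately show "((\<lambda>h. norm (G (z + h) - G z - L h) / norm h) \<longlongrightarrow> 0) (at 0)"
    by (rule Lim_null_comparison[rotated])
qed

section \<open>Closure properties of complex differentiability\<close>

lemma bounded_linear_form:
  fixes a :: "complex ^ 'd::finite"
  shows "bounded_linear (\<lambda>v. \<Sum>i\<in>UNIV. a $ i * v $ i)"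
  by (intro bounded_linear_sum bounded_linear_mult_right bounded_linear_compose[OF bounded_linear_mult_right bounded_linear_vec_nth])

lemma norm_scale_vec: "norm (w *s (v :: complex ^ 'd::finite)) = norm w * norm v"
  by (simp add: norm_vec_def L2_set_def norm_mult power_mult_distrib flip: sum_distrib_left)
     (simp add: real_sqrt_mult)

lemma norm_axis_complex: "norm (axis i (c :: complex) :: complex ^ 'd::finite) = norm c"
proof -
  have "axis i c = c *s (axis i 1 :: complex ^ 'd)" by (auto simp: vec_eq_iff axis_def)
  then have "norm (axis i c :: complex ^ 'd) = norm (c *s (axis i 1 :: complex ^ 'd))" by (rule arg_cong)
  then show ?thesis unfolding norm_scale_vec norm_axis_1 by simp
qed

lemma holomorphic_multi_const: "holomorphic_multi (\<lambda>_. c) S"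
  unfolding holomorphic_multi_def by (auto intro!: exI[of _ 0])

lemma holomorphic_multi_nth: "holomorphic_multi (\<lambda>s. s $ i) S"
  unfolding holomorphic_multi_def
proof (intro ballI exI)
  fix z :: "complex ^ 'a"
  have "(\<lambda>v::complex^'a. \<Sum>j\<in>UNIV. axis i 1 $ j * v $ j) = (\<lambda>v. v $ i)"
    by (auto simp: axis_def if_distrib[of "\<lambda>x. x * _"] cong: if_cong)
  then show "((\<lambda>s. s $ i) has_derivative (\<lambda>v. \<Sum>j\<in>UNIV. axis i 1 $ j * v $ j)) (at z)"
    using bounded_linear_imp_has_derivative[OF bounded_linear_vec_nth[of i]] by simp
qed

lemma holomorphic_multi_add:
  assumes "holomorphic_multi f S" "holomorphic_multi g S"
  shows "holomorphic_multi (\<lambda>s. f s + g s) S"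
  unfolding holomorphic_multi_def
proof
  fix z assume "z \<in> S"
  then obtain a b where
    "(f has_derivative (\<lambda>v. \<Sum>i\<in>UNIV. a $ i * v $ i)) (at z)"
    "(g has_derivative (\<lambda>v. \<Sum>i\<in>UNIV. b $ i * v $ i)) (at z)"
    using assms unfolding holomorphic_multi_def by blast
  from has_derivative_add[OF this]
  show "\<exists>a. ((\<lambda>s. f s + g s) has_derivative (\<lambda>v. \<Sum>i\<in>UNIV. a $ i * v $ i)) (at z)"
    by (intro exI[of _ "a + b"]) (simp add: sum.distrib distrib_right)
qed

lemma holomorphic_multi_mult:
  assumes "holomorphic_multi f S" "holomorphic_multi g S"
  shows "holomorphic_multi (\<lambda>s. f s * g s) S"
  unfolding holomorphic_multi_def
proof
  fix z assume "z \<in> S"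
  then obtain a b where
    "(f has_derivative (\<lambda>v. \<Sum>i\<in>UNIV. a $ i * v $ i)) (at z)"
    "(g has_derivative (\<lambda>v. \<Sum>i\<in>UNIV. b $ i * v $ i)) (at z)"
    using assms unfolding holomorphic_multi_def by blast
  from has_derivative_mult[OF this]
  have "((\<lambda>s. f s * g s) has_derivative (\<lambda>v. \<Sum>i\<in>UNIV. (f z *s b + g z *s a) $ i * v $ i)) (at z)"
  proof (rule has_derivative_eq_rhs, intro ext)
    fix v
    show "f z * (\<Sum>i\<in>UNIV. b $ i * v $ i) + (\<Sum>i\<in>UNIV. a $ i * v $ i) * g z
        = (\<Sum>i\<in>UNIV. (f z *s b + g z *s a) $ i * v $ i)"
      unfolding sum_distrib_left sum_distrib_right sum.distrib[symmetric]
      by (intro sum.cong refl) (simp add: algebra_simps)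
  qed
  then show "\<exists>a. ((\<lambda>s. f s * g s) has_derivative (\<lambda>v. \<Sum>i\<in>UNIV. a $ i * v $ i)) (at z)" by blast
qed

lemma holomorphic_multi_compose:
  assumes "holomorphic_multi g S" "f holomorphic_on T" "open T" "g ` S \<subseteq> T"
  shows "holomorphic_multi (\<lambda>s. f (g s)) S"
  unfolding holomorphic_multi_def
proof
  fix z assume z: "z \<in> S"
  then obtain a where a: "(g has_derivative (\<lambda>v. \<Sum>i\<in>UNIV. a $ i * v $ i)) (at z)"
    using assms unfolding holomorphic_multi_def by blast
  have "(f has_field_derivative deriv f (g z)) (at (g z))"
    using assms z by (intro holomorphic_derivI[of f T]) auto
  then have "(f has_derivative (\<lambda>w. deriv f (g z) * w)) (at (g z))"
    by (simp add: has_field_derivative_def)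
  from has_derivative_compose[OF a this]
  show "\<exists>a. ((\<lambda>s. f (g s)) has_derivative (\<lambda>v. \<Sum>i\<in>UNIV. a $ i * v $ i)) (at z)"
    by (intro exI[of _ "deriv f (g z) *s a"]) (simp add: sum_distrib_left mult_ac)
qed

lemma holomorphic_multi_subset: "holomorphic_multi f S \<Longrightarrow> T \<subseteq> S \<Longrightarrow> holomorphic_multi f T"
  unfolding holomorphic_multi_def by blast

lemma holomorphic_multi_cong:
  assumes "holomorphic_multi f S" "open S" "\<And>s. s \<in> S \<Longrightarrow> g s = f s"
  shows "holomorphic_multi g S"
  unfolding holomorphic_multi_def
proof
  fix z assume z: "z \<in> S"
  then obtain a where a: "(f has_derivative (\<lambda>v. \<Sum>i\<in>UNIV. a $ i * v $ i)) (at z)"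
    using assms unfolding holomorphic_multi_def by blast
  have "(g has_derivative (\<lambda>v. \<Sum>i\<in>UNIV. a $ i * v $ i)) (at z)"
    by (rule has_derivative_transform_within_open[OF a assms(2) z]) (simp add: assms(3))
  then show "\<exists>a. (g has_derivative (\<lambda>v. \<Sum>i\<in>UNIV. a $ i * v $ i)) (at z)" by blast
qed

lemma holomorphic_multi_continuous_on: "holomorphic_multi f S \<Longrightarrow> continuous_on S f"
  unfolding holomorphic_multi_def
  by (meson continuous_at_imp_continuous_on has_derivative_continuous)

lemma holomorphic_multi_sum:
  "(\<And>i. i \<in> I \<Longrightarrow> holomorphic_multi (f i) S) \<Longrightarrow> holomorphic_multi (\<lambda>s. \<Sum>i\<in>I. f i s) S"
  by (induction I rule: infinite_finite_induct)
     (auto intro: holomorphic_multi_const holomorphic_multi_add)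

lemma holomorphic_multi_prod:
  "(\<And>i. i \<in> I \<Longrightarrow> holomorphic_multi (f i) S) \<Longrightarrow> holomorphic_multi (\<lambda>s. \<Prod>i\<in>I. f i s) S"
  by (induction I rule: infinite_finite_induct)
     (auto intro: holomorphic_multi_const holomorphic_multi_mult)

lemma holomorphic_multi_diff:
  assumes "holomorphic_multi f S" "holomorphic_multi g S"
  shows "holomorphic_multi (\<lambda>s. f s - g s) S"
  using holomorphic_multi_add[OF assms(1) holomorphic_multi_mult[OF holomorphic_multi_const[of "-1"] assms(2)]]
  by simp

lemma holomorphic_multi_divide:
  assumes "holomorphic_multi f S" "holomorphic_multi g S" "\<And>s. s \<in> S \<Longrightarrow> g s \<noteq> 0"
  shows "holomorphic_multi (\<lambda>s. f s / g s) S"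
proof -
  have "holomorphic_multi (\<lambda>s. inverse (g s)) S"
    using assms(3)
    by (intro holomorphic_multi_compose[OF assms(2), of inverse "- {0}"] holomorphic_intros) auto
  from holomorphic_multi_mult[OF assms(1) this] show ?thesis by (simp add: divide_inverse)
qed

lemma bounded_linear_scale_vec: "bounded_linear (\<lambda>w::complex. w *s (q :: complex ^ 'd::finite))"
  unfolding linear_conv_bounded_linear[symmetric]
  by (auto intro!: linearI simp: vec_eq_iff algebra_simps)

text \<open>Restriction to a complex line is the only access to one-variable theory used below:
  Cauchy estimates for integrals with a parameter and the identity theorem for the
  continuation.\<close>

lemma holomorphic_multi_line:
  assumes "holomorphic_multi f S"
  shows "(\<lambda>w. f (p + w *s q)) holomorphic_on {w. p + w *s q \<in> S}"
  unfolding holomorphic_on_def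
proof
  fix w assume "w \<in> {w. p + w *s q \<in> S}"
  then obtain a where a: "(f has_derivative (\<lambda>v. \<Sum>i\<in>UNIV. a $ i * v $ i)) (at (p + w *s q))"
    using assms unfolding holomorphic_multi_def by blast
  have "((\<lambda>w. p + w *s q) has_derivative (\<lambda>w. w *s q)) (at w)"
    using has_derivative_add[OF has_derivative_const bounded_linear_imp_has_derivative[OF bounded_linear_scale_vec]]
    by simp
  from has_derivative_compose[OF this a]
  have "((\<lambda>w. f (p + w *s q)) has_field_derivative (\<Sum>i\<in>UNIV. a $ i * q $ i)) (at w)"
    unfolding has_field_derivative_def
    by (rule has_derivative_eq_rhs) (simp add: fun_eq_iff mult_ac, simp only: sum_distrib_left simp_thms)
  then show "(\<lambda>w. f (p + w *s q)) field_differentiable at w within {w. p + w *s q \<in> S}"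
    using field_differentiable_at_within field_differentiable_def by blast
qed

text \<open>Cauchy's estimate for the second derivative on discs of radius \<open>R/4\<close> about
  the points of the unit disc gives \<open>2! * B / (R/4)^2\<close>, hence the constant 32. The
  condition \<open>R > 2\<close> keeps these discs inside the disc of radius
  \<open>R\<close>.\<close>

lemma holomorphic_taylor_bound:
  assumes "f holomorphic_on ball 0 R" "R > 2" "\<And>w. w \<in> ball 0 R \<Longrightarrow> norm (f w) \<le> B"
  shows "norm (f 1 - f 0 - deriv f 0) \<le> 32 * B / R\<^sup>2"
proof -
  have sub: "cball w (R/4) \<subseteq> ball 0 R" if "w \<in> cball 0 1" for w :: complex
  proof
    fix z assume "z \<in> cball w (R/4)"
    then have "norm z \<le> norm w + R/4"
      using norm_triangle_ineq2[of z w] by (simp add: dist_norm norm_minus_commute)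
    then show "z \<in> ball 0 R" using that assms(2) by simp
  qed
  have b: "norm ((deriv ^^ Suc 1) f w) \<le> 32 * B / R\<^sup>2" if w: "w \<in> cball 0 1" for w
  proof -
    have "norm ((deriv ^^ 2) f w) \<le> fact 2 * B / (R/4) ^ 2"
    proof (rule Cauchy_inequality)
      show "f holomorphic_on ball w (R/4)"
        by (meson assms(1) ball_subset_cball holomorphic_on_subset sub subset_trans w)
      show "continuous_on (cball w (R/4)) f"
        by (meson assms(1) continuous_on_subset holomorphic_on_imp_continuous_on sub w)
      show "0 < R/4" using assms by simp
      show "cmod (f x) \<le> B" if "cmod (w - x) = R/4" for x
        using sub[OF w] that by (intro assms(3)) (auto simp: dist_norm)
    qed
    then show ?thesis by (simp add: numeral_2_eq_2 power2_eq_square field_simps)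
  qed
  have "norm ((deriv ^^ 0) f 1 - (\<Sum>i\<le>1. (deriv ^^ i) f 0 * (1 - 0) ^ i / fact i))
        \<le> 32 * B / R\<^sup>2 * norm (1 - 0 :: complex) ^ Suc 1 / fact 1"
  proof (rule complex_Taylor[where S = "cball 0 1"])
    show "((deriv ^^ i) f has_field_derivative (deriv ^^ Suc i) f x) (at x within cball 0 1)"
      if "x \<in> cball 0 1" "i \<le> 1" for i x
    proof -
      have "(deriv ^^ i) f holomorphic_on ball 0 R"
        by (intro holomorphic_higher_deriv assms) auto
      then have "((deriv ^^ i) f has_field_derivative deriv ((deriv ^^ i) f) x) (at x)"
        using that assms(2) by (intro holomorphic_derivI[of _ "ball 0 R"]) auto
      then show ?thesis by (simp add: has_field_derivative_at_within)
    qed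
  qed (use b in auto)
  then show ?thesis by (simp add: algebra_simps)
qed

text \<open>Local domination of the integrand itself suffices: along complex lines Cauchy's estimate
  turns the bound \<open>B\<close> into a quadratic Taylor bound with constant a multiple of
  \<open>B x\<close>, and that constant is integrable. With a counting measure the same theorem
  covers series.\<close>

theorem holomorphic_multi_integral:
  fixes g :: "complex ^ 'd::finite \<Rightarrow> 'x \<Rightarrow> complex"
  assumes "open U"
    and hol: "\<And>x. x \<in> space M \<Longrightarrow> holomorphic_multi (\<lambda>s. g s x) U"
    and meas: "\<And>s. s \<in> U \<Longrightarrow> g s \<in> borel_measurable M"
    and dom: "\<And>z. z \<in> U \<Longrightarrow> \<exists>r>0. \<exists>B. integrable M B \<and>
                 (\<forall>s\<in>ball z r \<inter> U. \<forall>x\<in>space M. norm (g s x) \<le> B x)"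
  shows "holomorphic_multi (\<lambda>s. LINT x|M. g s x) U"
  unfolding holomorphic_multi_def
proof
  fix z assume z: "z \<in> U"
  obtain r1 B where r1: "r1 > 0" "integrable M B"
      "\<And>s x. s \<in> ball z r1 \<inter> U \<Longrightarrow> x \<in> space M \<Longrightarrow> norm (g s x) \<le> B x"
    using dom[OF z] by blast
  obtain r2 where r2: "r2 > 0" "ball z r2 \<subseteq> U" using assms(1) z openE by blast
  define r where "r = min r1 r2"
  have r: "r > 0" "ball z r \<subseteq> U" and B: "\<And>s x. s \<in> ball z r \<Longrightarrow> x \<in> space M \<Longrightarrow> norm (g s x) \<le> B x"
    using r1 r2 by (auto simp: r_def)
  have "\<forall>x\<in>space M. \<exists>a. ((\<lambda>s. g s x) has_derivative (\<lambda>v. \<Sum>i\<in>UNIV. a $ i * v $ i)) (at z)"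
    using hol z unfolding holomorphic_multi_def by blast
  then obtain a where a: "\<And>x. x \<in> space M \<Longrightarrow>
      ((\<lambda>s. g s x) has_derivative (\<lambda>v. \<Sum>i\<in>UNIV. a x $ i * v $ i)) (at z)" by metis
  define L where "L x v = (\<Sum>i\<in>UNIV. a x $ i * v $ i)" for x and v :: "complex ^ 'd"
  have L_axis: "L x (axis i c) = a x $ i * c" for x i c
  proof -
    have "a x $ j * axis i c $ j = (if j = i then a x $ i * c else 0)" for j by (simp add: axis_def)
    then show ?thesis by (simp add: L_def)
  qed
  \<comment> \<open>A displacement \<open>v\<close> is a step of length 1 along
    \<open>w \<mapsto> z + w *s v\<close>, which stays in the ball for
    \<open>norm w < r / norm v\<close>; this quotient is the radius \<open>R\<close> in the
    one-variable bound.\<close>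
  have taylor: "norm (g (z + v) x - g z x - L x v) \<le> 32 * B x / r\<^sup>2 * (norm v)\<^sup>2"
    if x: "x \<in> space M" and v: "norm v < r/2" for x v
  proof (cases "v = 0")
    case False
    define R where "R = r / norm v"
    have R: "R > 2" using v False r by (simp add: R_def field_simps)
    have inb: "z + w *s v \<in> ball z r" if "w \<in> ball 0 R" for w
      using that False by (simp add: dist_norm norm_scale_vec R_def field_simps)
    have h: "(\<lambda>w. g (z + w *s v) x) holomorphic_on ball 0 R"
      using holomorphic_multi_line[OF hol[OF x], of z v] inb r
      by (elim holomorphic_on_subset) auto
    have "norm ((\<lambda>w. g (z + w *s v) x) 1 - g (z + 0 *s v) x - deriv (\<lambda>w. g (z + w *s v) x) 0) \<le> 32 * B x / R\<^sup>2"
      using holomorphic_taylor_bound[OF h R, of "B x"] B[OF inb x] by simp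
    moreover have "deriv (\<lambda>w. g (z + w *s v) x) 0 = L x v"
    proof (rule DERIV_imp_deriv)
      have "((\<lambda>w. z + w *s v) has_derivative (\<lambda>w. w *s v)) (at 0)"
        using has_derivative_add[OF has_derivative_const bounded_linear_imp_has_derivative[OF bounded_linear_scale_vec]] by simp
      from has_derivative_compose[OF this, of "\<lambda>s. g s x" "L x"] a[OF x]
      have "((\<lambda>w. g (z + w *s v) x) has_derivative (\<lambda>w. L x (w *s v))) (at 0)"
        by (simp add: L_def[abs_def])
      then show "((\<lambda>w. g (z + w *s v) x) has_field_derivative L x v) (at 0)"
        unfolding has_field_derivative_def L_def
        by (rule has_derivative_eq_rhs) (simp add: fun_eq_iff mult_ac, simp only: sum_distrib_left simp_thms)
    qed
    ultimately show ?thesis by (simp add: R_def power_divide)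
  qed (simp add: L_def)
  have zr: "z + v \<in> ball z r" if "norm v < r" for v using that by (simp add: dist_norm)
  have zin: "z \<in> ball z r" using r by simp
  have Bnn: "0 \<le> B x" if "x \<in> space M" for x
    using B[OF zin that] norm_ge_zero order_trans by blast
  \<comment> \<open>The gradient was obtained by choice, so its measurability has to be recovered:
    it is a pointwise limit of difference quotients. The shift by 3 makes every step shorter than
    \<open>r/2\<close>, where the Taylor bound holds.\<close>
  have am: "(\<lambda>x. a x $ i) \<in> borel_measurable M" for i
  proof (rule borel_measurable_LIMSEQ_metric)
    define c where "c k = r / (real k + 3)" for k
    have c0: "c \<longlonglongrightarrow> 0" unfolding c_def by real_asymp
    have cp: "c k > 0" "c k < r / 2" for k using r by (auto simp: c_def field_simps intro!: add_pos_nonneg mult_nonneg_nonneg)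
    let ?v = "\<lambda>k. axis i (of_real (c k)) :: complex ^ 'd"
    have nv: "norm (?v k) = c k" for k using cp[of k] by (simp add: norm_axis_complex)
    show "(\<lambda>x. (g (z + ?v k) x - g z x) / of_real (c k)) \<in> borel_measurable M" for k
    proof -
      have "z + ?v k \<in> U" using zr[of "?v k"] nv[of k] cp[of k] r by auto
      then show ?thesis using meas z by (intro borel_measurable_divide borel_measurable_diff) auto
    qed
    show "(\<lambda>k. (g (z + ?v k) x - g z x) / of_real (c k)) \<longlonglongrightarrow> a x $ i" if x: "x \<in> space M" for x
    proof (rule LIM_zero_cancel, rule Lim_null_comparison)
      have L: "L x (?v k) = a x $ i * of_real (c k)" for k by (rule L_axis)
      show "\<forall>\<^sub>F k in sequentially. norm ((g (z + ?v k) x - g z x) / of_real (c k) - a x $ i)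
              \<le> 32 * B x / r\<^sup>2 * c k"
      proof (rule always_eventually, rule allI)
        fix k
        have "(g (z + ?v k) x - g z x) / of_real (c k) - a x $ i
            = (g (z + ?v k) x - g z x - L x (?v k)) / of_real (c k)"
          using cp(1)[of k] unfolding L by (simp add: diff_divide_distrib)
        then show "norm ((g (z + ?v k) x - g z x) / of_real (c k) - a x $ i) \<le> 32 * B x / r\<^sup>2 * c k"
          using taylor[OF x, of "?v k"] cp[of k] unfolding nv
          by (simp add: norm_divide pos_divide_le_eq power2_eq_square mult.assoc)
      qed
      show "(\<lambda>k. 32 * B x / r\<^sup>2 * c k) \<longlonglongrightarrow> 0"
        by (rule tendsto_mult_right_zero[OF c0])
    qed
  qed
  \<comment> \<open>The Taylor bound at a step of length \<open>r/4\<close> along an axis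
    contributes \<open>2 * B x\<close> and the two values of \<open>g\<close> another
    \<open>2 * B x\<close>; dividing by \<open>r/4\<close> gives the factor 16.\<close>
  have ab: "norm (a x $ i) \<le> 16 * B x / r" if x: "x \<in> space M" for x i
  proof -
    let ?v = "axis i (of_real (r/4)) :: complex ^ 'd"
    have nv: "norm ?v = r/4" using r by (simp add: norm_axis_complex)
    have L: "L x ?v = a x $ i * of_real (r/4)"
      by (rule L_axis)
    have "norm (L x ?v) \<le> norm (g (z + ?v) x - g z x - L x ?v) + norm (g (z + ?v) x) + norm (g z x)"
      using norm_triangle_ineq4[of "g (z + ?v) x - g z x" "g (z + ?v) x - g z x - L x ?v"]
        norm_triangle_ineq4[of "g (z + ?v) x" "g z x"] by simp
    also have "\<dots> \<le> 32 * B x / r\<^sup>2 * (r/4)\<^sup>2 + B x + B x"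
            using taylor[OF x, of ?v] B[OF zr[of ?v] x] B[OF zin x] r unfolding nv by linarith
    also have "\<dots> = 4 * B x" using r by (simp add: power2_eq_square)
    finally have "norm (a x $ i) * (r/4) \<le> 4 * B x" using r unfolding L norm_mult by simp
    then show ?thesis using r by (simp add: pos_le_divide_eq)
  qed
  have ai: "integrable M (\<lambda>x. a x $ i)" for i
    by (rule Bochner_Integration.integrable_bound[of M "\<lambda>x. 16 * B x / r"])
       (use r1(2) am ab Bnn r in \<open>auto intro!: AE_I2 simp: abs_of_nonneg\<close>)
  have gi: "integrable M (g s)" if "s \<in> ball z r" for s
    by (rule Bochner_Integration.integrable_bound[of M B])
       (use r1(2) B[OF that] Bnn meas r that in \<open>auto intro!: AE_I2 simp: abs_of_nonneg\<close>)
  define A where "A = (\<chi> i. LINT x|M. a x $ i)"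
  have AL: "(\<Sum>i\<in>UNIV. A $ i * v $ i) = (LINT x|M. L x v)" for v
    using ai by (simp add: A_def L_def)
  have Li: "integrable M (\<lambda>x. L x v)" for v using ai by (simp add: L_def)
  have "((\<lambda>s. LINT x|M. g s x) has_derivative (\<lambda>v. \<Sum>i\<in>UNIV. A $ i * v $ i)) (at z)"
  proof (rule has_derivative_quadratic[where r = "r/2" and C = "32 / r\<^sup>2 * (LINT x|M. B x)"])
    fix v :: "complex ^ 'd" assume v: "norm v < r/2"
    have gz: "integrable M (g (z + v))" using v r(1) by (intro gi zr) simp
    have "(LINT x|M. g (z + v) x) - (LINT x|M. g z x) - (\<Sum>i\<in>UNIV. A $ i * v $ i)
        = (LINT x|M. g (z + v) x - g z x - L x v)"
      unfolding AL by (subst Bochner_Integration.integral_diff | intro Bochner_Integration.integrable_diff gz gi zin Li refl)+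
    also have "norm \<dots> \<le> (LINT x|M. norm (g (z + v) x - g z x - L x v))" by (rule integral_norm_bound)
    also have "\<dots> \<le> (LINT x|M. 32 * B x / r\<^sup>2 * (norm v)\<^sup>2)"
      by (intro integral_mono integrable_norm Bochner_Integration.integrable_diff gz gi zin Li
            integrable_mult_left integrable_mult_right integrable_divide r1(2) taylor v)
    finally show "norm ((LINT x|M. g (z + v) x) - (LINT x|M. g z x) - (\<Sum>i\<in>UNIV. A $ i * v $ i))
        \<le> 32 / r\<^sup>2 * (LINT x|M. B x) * (norm v)\<^sup>2" by simp
  qed (use r in \<open>auto intro: bounded_linear_form\<close>)
  then show "\<exists>a. ((\<lambda>s. LINT x|M. g s x) has_derivative (\<lambda>v. \<Sum>i\<in>UNIV. a $ i * v $ i)) (at z)" by blast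
qed

section \<open>Smooth families of moderate growth\<close>

text \<open>Coordinate 1 is the outer variable and is never differentiated. The set \<open>X\<close>
  will be (0, 1] for phi, a closed half-line for psi, and a single point where the coordinate is
  only a placeholder.\<close>

definition open_box :: "nat \<Rightarrow> real set \<Rightarrow> (nat \<Rightarrow> real) set"
  where "open_box d X = {x. x 1 \<in> X \<and> (\<forall>j\<in>{2..d}. 0 < x j \<and> x j < 1)}"

definition half_box :: "nat \<Rightarrow> real set \<Rightarrow> (nat \<Rightarrow> real) set"
  where "half_box d X = {x. x 1 \<in> X \<and> (\<forall>j\<in>{2..d}. 0 < x j \<and> x j \<le> 1/2)}"

text \<open>
  The derivatives are needed on the open box, where they are computed, but their growth only on
  the half box over which they are integrated.
\<close>
definition tame :: "nat \<Rightarrow> real set \<Rightarrow> (complex ^ 'v::finite \<Rightarrow> (nat \<Rightarrow> real) \<Rightarrow> complex) \<Rightarrow> bool"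
  where "tame d X f \<longleftrightarrow>
    (\<forall>x\<in>open_box d X. holomorphic_multi (\<lambda>s. f s x) UNIV) \<and>
    (\<forall>s. continuous_on (open_box d X) (f s)) \<and>
    (\<forall>z. \<exists>\<epsilon>>0. \<exists>C\<ge>0. \<exists>N. \<forall>s\<in>ball z \<epsilon>. \<forall>x\<in>half_box d X. norm (f s x) \<le> C * (1 + x 1) ^ N)"

text \<open>The derivative is an existentially quantified family and not
  \<open>partial_deriv\<close>, so whatever the sum, product or chain rule produces can be supplied
  as it stands, and the closure lemmas become inductions on the order.\<close>

primrec tame_upto :: "nat \<Rightarrow> real set \<Rightarrow> nat \<Rightarrow> (complex ^ 'v::finite \<Rightarrow> (nat \<Rightarrow> real) \<Rightarrow> complex) \<Rightarrow> bool"
  where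
    "tame_upto d X 0 f = tame d X f"
  | "tame_upto d X (Suc k) f \<longleftrightarrow> tame d X f \<and>
       (\<forall>j\<in>{2..d}. \<exists>g. tame_upto d X k g \<and>
          (\<forall>s. \<forall>x\<in>open_box d X. ((\<lambda>t. f s (x(j := t))) has_vector_derivative g s x) (at (x j))))"

definition tame_smooth :: "nat \<Rightarrow> real set \<Rightarrow> (complex ^ 'v::finite \<Rightarrow> (nat \<Rightarrow> real) \<Rightarrow> complex) \<Rightarrow> bool"
  where "tame_smooth d X f \<longleftrightarrow> (\<forall>k. tame_upto d X k f)"

section \<open>Algebra of tame families\<close>

lemma half_box_subset: "half_box d X \<subseteq> open_box d X"
proof
  fix x assume x: "x \<in> half_box d X"
  show "x \<in> open_box d X"
    unfolding open_box_def
  proof (clarsimp, intro conjI ballI)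
    show "x (Suc 0) \<in> X" using x by (simp add: half_box_def)
    fix j assume "j \<in> {2..d}"
    then have "0 < x j \<and> x j \<le> 1/2" using x unfolding half_box_def by blast
    then show "0 < x j" "x j < 1" by auto
  qed
qed

lemma open_box_upd:
  "x \<in> open_box d X \<Longrightarrow> j \<in> {2..d} \<Longrightarrow> 0 < t \<Longrightarrow> t < 1 \<Longrightarrow> x(j := t) \<in> open_box d X"
  unfolding open_box_def by auto

lemma open_box_nth: "x \<in> open_box d X \<Longrightarrow> j \<in> {2..d} \<Longrightarrow> 0 < x j \<and> x j < 1"
  unfolding open_box_def by auto

lemma half_box_nth: "x \<in> half_box d X \<Longrightarrow> j \<in> {2..d} \<Longrightarrow> 0 < x j \<and> x j \<le> 1/2"
  unfolding half_box_def by blast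

lemma tame_cong:
  assumes "tame d X f" "\<And>s x. x \<in> open_box d X \<Longrightarrow> f' s x = f s x"
  shows "tame d X f'"
proof -
  have "\<forall>x\<in>open_box d X. holomorphic_multi (\<lambda>s. f' s x) UNIV"
    using assms by (simp add: tame_def)
  moreover have "\<forall>s. continuous_on (open_box d X) (f' s)"
  proof
    fix s
    have "continuous_on (open_box d X) (f s)" using assms unfolding tame_def by blast
    then show "continuous_on (open_box d X) (f' s)"
      by (rule continuous_on_eq) (simp add: assms(2))
  qed
  moreover have "\<forall>z. \<exists>\<epsilon>>0. \<exists>C\<ge>0. \<exists>N. \<forall>s\<in>ball z \<epsilon>. \<forall>x\<in>half_box d X. norm (f' s x) \<le> C * (1 + x 1) ^ N"
  proof
    fix z
    obtain \<epsilon> C N where "\<epsilon> > 0" "C \<ge> 0" "\<forall>s\<in>ball z \<epsilon>. \<forall>x\<in>half_box d X. norm (f s x) \<le> C * (1 + x 1) ^ N"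
      using assms(1) unfolding tame_def by blast
    moreover have "f' s x = f s x" if "x \<in> half_box d X" for s x
      using that half_box_subset[of d X] by (intro assms(2)) auto
    ultimately show "\<exists>\<epsilon>>0. \<exists>C\<ge>0. \<exists>N. \<forall>s\<in>ball z \<epsilon>. \<forall>x\<in>half_box d X. norm (f' s x) \<le> C * (1 + x 1) ^ N"
      by (intro exI[of _ \<epsilon>] exI[of _ C] exI[of _ N] conjI ballI) simp_all
  qed
  ultimately show ?thesis unfolding tame_def by blast
qed

lemma partial_has_vector_derivative_cong:
  assumes "((\<lambda>t. f (x(j := t))) has_vector_derivative D) (at (x j))"
    and "x \<in> open_box d X" "j \<in> {2..d}" "\<And>x. x \<in> open_box d X \<Longrightarrow> f' x = f x"
  shows "((\<lambda>t. f' (x(j := t))) has_vector_derivative D) (at (x j))"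
proof (rule has_vector_derivative_transform_within_open[OF assms(1)])
  show "open {0<..<1::real}" "x j \<in> {0<..<1}" using open_box_nth[OF assms(2,3)] by auto
  show "f (x(j := t)) = f' (x(j := t))" if "t \<in> {0<..<1}" for t
    using assms(4)[OF open_box_upd[OF assms(2,3)]] that by simp
qed

lemma tame_upto_SucD:
  "tame_upto d X (Suc k) f \<Longrightarrow> j \<in> {2..d} \<Longrightarrow> \<exists>g. tame_upto d X k g \<and>
     (\<forall>s. \<forall>x\<in>open_box d X. ((\<lambda>t. f s (x(j := t))) has_vector_derivative g s x) (at (x j)))"
  unfolding tame_upto.simps by blast

lemma tame_upto_SucI:
  "tame d X f \<Longrightarrow> (\<And>j. j \<in> {2..d} \<Longrightarrow> \<exists>g. tame_upto d X k g \<and>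
     (\<forall>s. \<forall>x\<in>open_box d X. ((\<lambda>t. f s (x(j := t))) has_vector_derivative g s x) (at (x j)))) \<Longrightarrow>
   tame_upto d X (Suc k) f"
  unfolding tame_upto.simps by blast

lemma tame_upto_cong:
  assumes "tame_upto d X k f" "\<And>s x. x \<in> open_box d X \<Longrightarrow> f' s x = f s x"
  shows "tame_upto d X k f'"
proof (cases k)
  case 0 then show ?thesis using tame_cong[of d X f f'] assms by simp
next
  case (Suc m)
  have "\<exists>g. tame_upto d X m g \<and> (\<forall>s. \<forall>x\<in>open_box d X. ((\<lambda>t. f' s (x(j := t))) has_vector_derivative g s x) (at (x j)))"
    if j: "j \<in> {2..d}" for j
  proof -
    obtain g where g: "tame_upto d X m g"
      "\<forall>s. \<forall>x\<in>open_box d X. ((\<lambda>t. f s (x(j := t))) has_vector_derivative g s x) (at (x j))"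
      using tame_upto_SucD[OF assms(1)[unfolded Suc] j] by blast
    have "\<forall>s. \<forall>x\<in>open_box d X. ((\<lambda>t. f' s (x(j := t))) has_vector_derivative g s x) (at (x j))"
    proof (intro allI ballI)
      fix s x assume x: "x \<in> open_box d X"
      show "((\<lambda>t. f' s (x(j := t))) has_vector_derivative g s x) (at (x j))"
        by (rule partial_has_vector_derivative_cong[where f = "f s" and d = d and X = X])
           (use g(2) x j assms(2) in blast)+
    qed
    then show ?thesis using g by blast
  qed
  moreover have "tame d X f'" using assms tame_cong[of d X f f'] unfolding Suc by simp
  ultimately show ?thesis unfolding Suc by (intro tame_upto_SucI)
qed

lemma tame_smooth_cong:
  "tame_smooth d X f \<Longrightarrow> (\<And>s x. x \<in> open_box d X \<Longrightarrow> f' s x = f s x) \<Longrightarrow> tame_smooth d X f'"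
  unfolding tame_smooth_def using tame_upto_cong by blast

lemma tame_upto_tame: "tame_upto d X k f \<Longrightarrow> tame d X f"
  by (cases k) auto

lemma tame_upto_decr: "tame_upto d X (Suc k) f \<Longrightarrow> tame_upto d X k f"
  by (induction k arbitrary: f) (simp, simp, blast)

lemma tame_const_hol:
  assumes "holomorphic_multi c UNIV" "X \<subseteq> {0..}"
  shows "tame d X (\<lambda>s x. c s)"
  unfolding tame_def
proof (intro conjI ballI allI)
  fix z
  have "continuous_on UNIV c" using assms holomorphic_multi_continuous_on by blast
  then have "isCont c z" by (simp add: continuous_on_eq_continuous_at)
  then obtain \<epsilon> where e: "\<epsilon> > 0" "\<And>s. dist s z < \<epsilon> \<Longrightarrow> dist (c s) (c z) < 1"
    unfolding continuous_at_eps_delta using zero_less_one by blast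
  have "norm (c s) \<le> norm (c z) + 1" if "s \<in> ball z \<epsilon>" for s
    using e(2)[of s] that norm_triangle_ineq2[of "c s" "c z"] by (simp add: dist_norm norm_minus_commute)
  then show "\<exists>\<epsilon>>0. \<exists>C\<ge>0. \<exists>N. \<forall>s\<in>ball z \<epsilon>. \<forall>x\<in>half_box d X. norm (c s) \<le> C * (1 + x 1) ^ N"
    using e(1) by (intro exI[of _ \<epsilon>] exI[of _ "norm (c z) + 1"] exI[of _ 0] conjI) auto
qed (use assms in auto)

lemma tame_upto_const_hol:
  assumes "X \<subseteq> {0..}" "holomorphic_multi c UNIV"
  shows "tame_upto d X k (\<lambda>s x. c s)"
  using assms(2)
proof (induction k arbitrary: c)
  case (Suc k)
  have "\<exists>g. tame_upto d X k g \<and> (\<forall>s. \<forall>x\<in>open_box d X. ((\<lambda>t. c s) has_vector_derivative g s x) (at (x j)))" for j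
    by (intro exI[of _ "\<lambda>s x. 0"] conjI) (auto intro!: Suc.IH[of "\<lambda>_. 0"] holomorphic_multi_const)
  then show ?case by (intro tame_upto_SucI tame_const_hol[OF Suc.prems assms(1)])
qed (use tame_const_hol assms in auto)

lemma tame_add:
  assumes "tame d X f" "tame d X g" "X \<subseteq> {0..}"
  shows "tame d X (\<lambda>s x. f s x + g s x)"
  unfolding tame_def
proof (intro conjI ballI allI)
  fix z
  obtain e1 C1 N1 where 1: "e1 > 0" "C1 \<ge> 0"
    "\<And>s x. s \<in> ball z e1 \<Longrightarrow> x \<in> half_box d X \<Longrightarrow> norm (f s x) \<le> C1 * (1 + x 1) ^ N1"
    using assms(1) unfolding tame_def by meson
  obtain e2 C2 N2 where 2: "e2 > 0" "C2 \<ge> 0"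
    "\<And>s x. s \<in> ball z e2 \<Longrightarrow> x \<in> half_box d X \<Longrightarrow> norm (g s x) \<le> C2 * (1 + x 1) ^ N2"
    using assms(2) unfolding tame_def by meson
  have "norm (f s x + g s x) \<le> (C1 + C2) * (1 + x 1) ^ (N1 + N2)"
    if s: "s \<in> ball z (min e1 e2)" and x: "x \<in> half_box d X" for s x
  proof -
    have x1: "1 \<le> 1 + x 1" using assms(3) x by (auto simp: half_box_def)
    have "norm (f s x + g s x) \<le> C1 * (1 + x 1) ^ N1 + C2 * (1 + x 1) ^ N2"
      using 1(3)[of s x] 2(3)[of s x] s x norm_triangle_ineq[of "f s x" "g s x"] by auto
    also have "\<dots> \<le> C1 * (1 + x 1) ^ (N1 + N2) + C2 * (1 + x 1) ^ (N1 + N2)"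
      using 1 2 x1 by (intro add_mono mult_left_mono power_increasing) auto
    finally show ?thesis by (simp add: algebra_simps)
  qed
  then show "\<exists>\<epsilon>>0. \<exists>C\<ge>0. \<exists>N. \<forall>s\<in>ball z \<epsilon>. \<forall>x\<in>half_box d X. norm (f s x + g s x) \<le> C * (1 + x 1) ^ N"
    using 1 2 by (intro exI[of _ "min e1 e2"] exI[of _ "C1 + C2"] exI[of _ "N1 + N2"] conjI ballI) (auto simp del: min_less_iff_conj)
qed (use assms in \<open>auto simp: tame_def intro!: holomorphic_multi_add continuous_on_add\<close>)

lemma tame_mult:
  assumes "tame d X f" "tame d X g" "X \<subseteq> {0..}"
  shows "tame d X (\<lambda>s x. f s x * g s x)"
  unfolding tame_def
proof (intro conjI ballI allI)
  fix z
  obtain e1 C1 N1 where 1: "e1 > 0" "C1 \<ge> 0"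
    "\<And>s x. s \<in> ball z e1 \<Longrightarrow> x \<in> half_box d X \<Longrightarrow> norm (f s x) \<le> C1 * (1 + x 1) ^ N1"
    using assms(1) unfolding tame_def by meson
  obtain e2 C2 N2 where 2: "e2 > 0" "C2 \<ge> 0"
    "\<And>s x. s \<in> ball z e2 \<Longrightarrow> x \<in> half_box d X \<Longrightarrow> norm (g s x) \<le> C2 * (1 + x 1) ^ N2"
    using assms(2) unfolding tame_def by meson
  have "norm (f s x * g s x) \<le> (C1 * C2) * (1 + x 1) ^ (N1 + N2)"
    if s: "s \<in> ball z (min e1 e2)" and x: "x \<in> half_box d X" for s x
  proof -
    have x1: "1 \<le> 1 + x 1" using assms(3) x by (auto simp: half_box_def)
    have "norm (f s x * g s x) \<le> (C1 * (1 + x 1) ^ N1) * (C2 * (1 + x 1) ^ N2)"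
      using 1 2 s x x1 unfolding norm_mult by (intro mult_mono) auto
    then show ?thesis by (simp add: power_add mult_ac)
  qed
  then show "\<exists>\<epsilon>>0. \<exists>C\<ge>0. \<exists>N. \<forall>s\<in>ball z \<epsilon>. \<forall>x\<in>half_box d X. norm (f s x * g s x) \<le> C * (1 + x 1) ^ N"
    using 1 2 by (intro exI[of _ "min e1 e2"] exI[of _ "C1 * C2"] exI[of _ "N1 + N2"] conjI ballI) (auto simp del: min_less_iff_conj)
qed (use assms in \<open>auto simp: tame_def intro!: holomorphic_multi_mult continuous_on_mult\<close>)

lemma tame_upto_add:
  assumes "X \<subseteq> {0..}"
  shows "tame_upto d X k f \<Longrightarrow> tame_upto d X k g \<Longrightarrow> tame_upto d X k (\<lambda>s x. f s x + g s x)"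
proof (induction k arbitrary: f g)
  case (Suc k)
  have "\<exists>h. tame_upto d X k h \<and> (\<forall>s. \<forall>x\<in>open_box d X.
      ((\<lambda>t. f s (x(j := t)) + g s (x(j := t))) has_vector_derivative h s x) (at (x j)))" if j: "j \<in> {2..d}" for j
  proof -
    obtain f' g' where "tame_upto d X k f'" "tame_upto d X k g'"
      "\<forall>s. \<forall>x\<in>open_box d X. ((\<lambda>t. f s (x(j := t))) has_vector_derivative f' s x) (at (x j))"
      "\<forall>s. \<forall>x\<in>open_box d X. ((\<lambda>t. g s (x(j := t))) has_vector_derivative g' s x) (at (x j))"
      using tame_upto_SucD[OF Suc.prems(1) j] tame_upto_SucD[OF Suc.prems(2) j] by blast
    then show ?thesis
      by (intro exI[of _ "\<lambda>s x. f' s x + g' s x"] conjI allI ballI)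
         (simp_all add: Suc.IH has_vector_derivative_add)
  qed
  moreover have "tame d X f" "tame d X g" using Suc.prems by simp_all
  ultimately show ?case by (intro tame_upto_SucI tame_add assms)
qed (use tame_add assms in auto)

lemma tame_upto_mult:
  assumes "X \<subseteq> {0..}"
  shows "tame_upto d X k f \<Longrightarrow> tame_upto d X k g \<Longrightarrow> tame_upto d X k (\<lambda>s x. f s x * g s x)"
proof (induction k arbitrary: f g)
  case (Suc k)
  have "\<exists>h. tame_upto d X k h \<and> (\<forall>s. \<forall>x\<in>open_box d X.
      ((\<lambda>t. f s (x(j := t)) * g s (x(j := t))) has_vector_derivative h s x) (at (x j)))" if j: "j \<in> {2..d}" for j
  proof -
    obtain f' g' where 1: "tame_upto d X k f'" "tame_upto d X k g'"
      "\<forall>s. \<forall>x\<in>open_box d X. ((\<lambda>t. f s (x(j := t))) has_vector_derivative f' s x) (at (x j))"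
      "\<forall>s. \<forall>x\<in>open_box d X. ((\<lambda>t. g s (x(j := t))) has_vector_derivative g' s x) (at (x j))"
      using tame_upto_SucD[OF Suc.prems(1) j] tame_upto_SucD[OF Suc.prems(2) j] by blast
    have "((\<lambda>t. f s (x(j := t)) * g s (x(j := t))) has_vector_derivative f s x * g' s x + f' s x * g s x) (at (x j))"
      if "x \<in> open_box d X" for s x
      using has_vector_derivative_mult[OF 1(3)[rule_format, OF that] 1(4)[rule_format, OF that], of s s] by simp
    \<comment> \<open>The Leibniz rule leaves undifferentiated factors, which are needed at order
      \<open>k\<close> although they are given at order \<open>Suc k\<close>; hence
      \<open>tame_upto_decr\<close>.\<close>
    moreover have "tame_upto d X k (\<lambda>s x. f s x * g' s x + f' s x * g s x)"
      using Suc.prems 1 tame_upto_decr[OF Suc.prems(1)] tame_upto_decr[OF Suc.prems(2)]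
      by (intro tame_upto_add assms Suc.IH)
    ultimately show ?thesis by (intro exI[of _ "\<lambda>s x. f s x * g' s x + f' s x * g s x"] conjI allI ballI)
  qed
  moreover have "tame d X f" "tame d X g" using Suc.prems by simp_all
  ultimately show ?case by (intro tame_upto_SucI tame_mult assms)
qed (use tame_mult assms in auto)

lemma tame_smooth_const_hol: "X \<subseteq> {0..} \<Longrightarrow> holomorphic_multi c UNIV \<Longrightarrow> tame_smooth d X (\<lambda>s x. c s)"
  unfolding tame_smooth_def using tame_upto_const_hol by blast

lemma tame_smooth_const: "X \<subseteq> {0..} \<Longrightarrow> tame_smooth d X (\<lambda>s x. c)"
  by (intro tame_smooth_const_hol holomorphic_multi_const)

lemma tame_smooth_add:
  "X \<subseteq> {0..} \<Longrightarrow> tame_smooth d X f \<Longrightarrow> tame_smooth d X g \<Longrightarrow> tame_smooth d X (\<lambda>s x. f s x + g s x)"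
  unfolding tame_smooth_def using tame_upto_add by blast

lemma tame_smooth_mult:
  "X \<subseteq> {0..} \<Longrightarrow> tame_smooth d X f \<Longrightarrow> tame_smooth d X g \<Longrightarrow> tame_smooth d X (\<lambda>s x. f s x * g s x)"
  unfolding tame_smooth_def using tame_upto_mult by blast

lemma tame_smooth_sum:
  assumes "X \<subseteq> {0..}" "\<And>i. i \<in> I \<Longrightarrow> tame_smooth d X (f i)"
  shows "tame_smooth d X (\<lambda>s x. \<Sum>i\<in>I. f i s x)"
  using assms(2)
proof (induction I rule: infinite_finite_induct)
  case (insert i I)
  have "tame_smooth d X (\<lambda>s x. f i s x + (\<Sum>i\<in>I. f i s x))"
    by (rule tame_smooth_add[OF assms(1) insert.prems insert.IH]) (simp_all add: insert.prems)
  then show ?case unfolding sum.insert[OF insert.hyps] .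
qed (simp_all only: sum.infinite sum.empty tame_smooth_const[OF assms(1)] not_False_eq_True)

lemma tame_smooth_prod:
  assumes "X \<subseteq> {0..}" "\<And>i. i \<in> I \<Longrightarrow> tame_smooth d X (f i)"
  shows "tame_smooth d X (\<lambda>s x. \<Prod>i\<in>I. f i s x)"
  using assms(2)
proof (induction I rule: infinite_finite_induct)
  case (insert i I)
  have "tame_smooth d X (\<lambda>s x. f i s x * (\<Prod>i\<in>I. f i s x))"
    by (rule tame_smooth_mult[OF assms(1) insert.prems insert.IH]) (simp_all add: insert.prems)
  then show ?case unfolding prod.insert[OF insert.hyps] .
qed (simp_all only: prod.infinite prod.empty tame_smooth_const[OF assms(1)] not_False_eq_True)

lemma tame_smooth_power:
  assumes "X \<subseteq> {0..}" "tame_smooth d X f"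
  shows "tame_smooth d X (\<lambda>s x. f s x ^ m)"
proof (induction m)
  case 0
  show ?case unfolding power_0 by (rule tame_smooth_const[OF assms(1)])
next
  case (Suc m)
  show ?case unfolding power_Suc by (rule tame_smooth_mult[OF assms(1,2) Suc])
qed

section \<open>Coordinates, powers and holomorphic compositions\<close>

lemma continuous_on_nth: "continuous_on S (\<lambda>x::nat \<Rightarrow> real. x j)"
  by (rule continuous_on_subset[OF continuous_on_product_coordinates subset_UNIV])

lemma tame_coord:
  assumes "X \<subseteq> {0..}" "j \<in> {1..d}"
  shows "tame d X (\<lambda>s x. of_real (x j))"
  unfolding tame_def
proof (intro conjI ballI allI)
  have "norm (complex_of_real (x j)) \<le> 1 * (1 + x 1) ^ 1" if "x \<in> half_box d X" for x
  proof (cases "j = 1")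
    case True then show ?thesis using that assms by (auto simp: half_box_def)
  next
    case False
    then have "j \<in> {2..d}" using assms by auto
    then have "0 < x j" "x j \<le> 1/2" "x 1 \<ge> 0" using that assms by (auto simp: half_box_def)
    then show ?thesis by simp
  qed
  then show "\<exists>\<epsilon>>0. \<exists>C\<ge>0. \<exists>N. \<forall>s\<in>ball z \<epsilon>. \<forall>x\<in>half_box d X. norm (complex_of_real (x j)) \<le> C * (1 + x 1) ^ N" for z :: "complex ^ 'v"
    by (intro exI[of _ 1] exI[of _ "1::real"] conjI ballI) auto
qed (auto intro!: holomorphic_multi_const continuous_on_of_real continuous_on_nth)

lemma tame_smooth_coord:
  assumes "X \<subseteq> {0..}" "j \<in> {1..d}"
  shows "tame_smooth d X (\<lambda>s x. of_real (x j))"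
  unfolding tame_smooth_def
proof
  fix k show "tame_upto d X k (\<lambda>s x. of_real (x j))"
  proof (cases k)
    case (Suc m)
    have "\<exists>g. tame_upto d X m g \<and> (\<forall>s. \<forall>x\<in>open_box d X.
       ((\<lambda>t. complex_of_real ((x(i := t)) j)) has_vector_derivative g s x) (at (x i)))" for i
      by (intro exI[of _ "\<lambda>s x. if i = j then 1 else 0"] conjI tame_upto_const_hol assms holomorphic_multi_const)
         (auto intro!: derivative_eq_intros)
    then show ?thesis using tame_coord[OF assms] unfolding Suc by (intro tame_upto_SucI)
  qed (use tame_coord[OF assms] in simp)
qed

lemma of_real_powr_eq_exp: "0 < y \<Longrightarrow> complex_of_real y powr w = exp (w * of_real (ln y))"
  by (simp add: powr_def Ln_of_real)

lemma norm_of_real_powr: "0 \<le> y \<Longrightarrow> norm (complex_of_real y powr w) = y powr Re w"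
  by (subst norm_powr_real_powr) auto

text \<open>This is where the restriction to the half box pays off: for a base in [1/2, 1) the
  logarithm is at most \<open>ln 2\<close> in absolute value, so the power is bounded whatever the
  sign of \<open>Re w\<close>.\<close>

lemma norm_powr_le_half:
  assumes "1/2 \<le> y" "y < 1" "norm w \<le> C"
  shows "norm (complex_of_real y powr w) \<le> 2 powr C"
proof -
  have "norm (complex_of_real y powr w) = exp (Re w * ln y)"
    using assms by (simp add: norm_of_real_powr powr_def)
  also have "\<dots> \<le> exp (C * ln 2)"
  proof -
    have "ln (1/2) \<le> ln y" "ln y \<le> 0" using assms by (simp_all only: ln_le_cancel_iff ln_le_zero_iff)
    then have "\<bar>ln y\<bar> \<le> ln 2" by (simp add: ln_div)
    moreover have "\<bar>Re w\<bar> \<le> C" using assms(3) abs_Re_le_cmod[of w] by linarith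
    ultimately have "\<bar>Re w\<bar> * \<bar>ln y\<bar> \<le> C * ln 2" by (intro mult_mono) auto
    then show ?thesis unfolding exp_le_cancel_iff abs_mult[symmetric] by linarith
  qed
  also have "\<dots> = 2 powr C" by (simp add: powr_def)
  finally show ?thesis .
qed

text \<open>Differentiation in \<open>x j\<close> gives the power with exponent
  \<open>v s - 1\<close> times the holomorphic factor \<open>- v s\<close>. The induction on the
  order therefore runs over all entire exponents simultaneously.\<close>

lemma tame_smooth_powr:
  fixes v :: "complex ^ 'v::finite \<Rightarrow> complex"
  assumes X: "X \<subseteq> {0..}" and j: "j \<in> {2..d}" and v: "holomorphic_multi v UNIV"
  shows "tame_smooth d X (\<lambda>s x. of_real (1 - x j) powr v s)"
proof -
  have t: "tame d X (\<lambda>s x. of_real (1 - x j) powr v s)" if v: "holomorphic_multi v UNIV" for v :: "complex ^ 'v \<Rightarrow> complex"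
    unfolding tame_def
  proof (intro conjI ballI allI)
    fix x assume "x \<in> open_box d X"
    then have "0 < 1 - x j" using open_box_nth[OF _ j] by simp
    note eq = of_real_powr_eq_exp[OF this]
    show "holomorphic_multi (\<lambda>s. of_real (1 - x j) powr v s) UNIV"
      unfolding eq
      by (intro holomorphic_multi_compose[where f = exp and T = UNIV])
         (auto intro!: holomorphic_multi_mult v holomorphic_multi_const holomorphic_intros)
  next
    fix s
    have pos: "0 < 1 - x j" if "x \<in> open_box d X" for x using open_box_nth[OF that j] by simp
    then have "1 - x j \<noteq> 0" if "x \<in> open_box d X" for x using pos[OF that] by linarith
    have "continuous_on (open_box d X) (\<lambda>x. exp (v s * of_real (ln (1 - x j))))"
      by (intro continuous_on_exp continuous_on_mult continuous_on_const continuous_on_of_real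
            continuous_on_ln continuous_on_diff continuous_on_nth ballI) (rule \<open>\<And>x. x \<in> open_box d X \<Longrightarrow> 1 - x j \<noteq> 0\<close>)
    then show "continuous_on (open_box d X) (\<lambda>x. of_real (1 - x j) powr v s)"
      by (rule continuous_on_eq) (rule of_real_powr_eq_exp[OF pos, symmetric])
  next
    fix z
    \<comment> \<open>Local boundedness of \<open>v\<close> is read off from tameness over the
      auxiliary set \<open>{0}\<close>, where the growth factor \<open>(1 + x 1) ^ N\<close> is 1;
      the point with all other coordinates 1/2 witnesses the bound.\<close>
    obtain e C N where e: "e > 0" "C \<ge> 0" "\<And>s x. s \<in> ball z e \<Longrightarrow> x \<in> half_box d {0} \<Longrightarrow> norm (v s) \<le> C * (1 + x 1) ^ N"
    proof -
      have "tame d {0} (\<lambda>s x. v s)" by (rule tame_const_hol[OF v]) simp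
      then show ?thesis using that unfolding tame_def by blast
    qed
    have vb: "norm (v s) \<le> C" if "s \<in> ball z e" for s
      using e(3)[OF that, of "\<lambda>i. if i = 1 then 0 else 1/2"] by (simp add: half_box_def)
    have "norm (of_real (1 - x j) powr v s) \<le> 2 powr C * (1 + x 1) ^ 0"
      if s: "s \<in> ball z e" and x: "x \<in> half_box d X" for s x
    proof -
      have y: "1/2 \<le> 1 - x j" "1 - x j < 1"
        using half_box_nth[OF x j] by linarith+
      have "norm (of_real (1 - x j) powr v s) \<le> 2 powr C"
        by (rule norm_powr_le_half[OF y vb[OF s]])
      then show ?thesis by (simp only: power_0 mult_1_right)
    qed
    then show "\<exists>\<epsilon>>0. \<exists>C\<ge>0. \<exists>N. \<forall>s\<in>ball z \<epsilon>. \<forall>x\<in>half_box d X. norm (of_real (1 - x j) powr v s) \<le> C * (1 + x 1) ^ N"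
      using e(1) by (intro exI[of _ e] exI[of _ "2 powr C"] exI[of _ "0::nat"] conjI) auto
  qed
  have "tame_upto d X k (\<lambda>s x. of_real (1 - x j) powr v s)" for k
    using v
  proof (induction k arbitrary: v)
    case (Suc k)
    have "\<exists>g. tame_upto d X k g \<and> (\<forall>s. \<forall>x\<in>open_box d X.
       ((\<lambda>t. complex_of_real (1 - (x(i := t)) j) powr v s) has_vector_derivative g s x) (at (x i)))" for i
    proof (cases "i = j")
      case True
      have "((\<lambda>t. complex_of_real (1 - t) powr v s) has_vector_derivative (- v s) * of_real (1 - x j) powr (v s - 1)) (at (x j))"
        if "x \<in> open_box d X" for s x
      proof -
        have x: "x j < 1" using open_box_nth that j by blast
        have "((\<lambda>w. (1 - w) powr v s) has_field_derivative (- v s) * (1 - of_real (x j)) powr (v s - 1)) (at (of_real (x j)))"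
          using x by (auto intro!: derivative_eq_intros simp: complex_nonpos_Reals_iff)
        from has_vector_derivative_real_field[OF this] show ?thesis by simp
      qed
      moreover have "holomorphic_multi (\<lambda>s. - v s) UNIV"
        using holomorphic_multi_diff[OF holomorphic_multi_const[of 0] Suc.prems] by simp
      then have "tame_upto d X k (\<lambda>s x. (- v s) * of_real (1 - x j) powr (v s - 1))"
        by (intro tame_upto_mult[OF X] tame_upto_const_hol[OF X]
              Suc.IH[OF holomorphic_multi_diff[OF Suc.prems holomorphic_multi_const]])
      ultimately show ?thesis unfolding True fun_upd_same
        by (intro exI[of _ "\<lambda>s x. (- v s) * of_real (1 - x j) powr (v s - 1)"] conjI allI ballI)
    next
      case False
      then show ?thesis
        by (intro exI[of _ "\<lambda>s x. 0"] conjI tame_upto_const_hol[OF X holomorphic_multi_const]) simp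
    qed
    then show ?case using t[OF Suc.prems] by (intro tame_upto_SucI)
  qed (use t in auto)
  then show ?thesis by (simp add: tame_smooth_def)
qed

text \<open>By the chain rule the derivative of \<open>h\<close> at \<open>w x\<close> is a tame
  factor times the next derivative of \<open>h\<close> at \<open>w x\<close>, so the claim is proved
  for all \<open>(deriv ^^ r) h\<close> together, and bounds for all of them along the range of
  \<open>w\<close> are assumed.\<close>

lemma tame_smooth_compose:
  fixes h :: "complex \<Rightarrow> complex" and w :: "(nat \<Rightarrow> real) \<Rightarrow> real"
  assumes X: "X \<subseteq> {0..}"
    and w: "tame_smooth d X (\<lambda>(s :: complex ^ 'v::finite) x. of_real (w x))"
    and h: "h holomorphic_on S" "open S" "\<And>x. x \<in> open_box d X \<Longrightarrow> of_real (w x) \<in> S"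
    and b: "\<And>r. \<exists>C. \<forall>x\<in>half_box d X. norm ((deriv ^^ r) h (of_real (w x))) \<le> C"
  shows "tame_smooth d X (\<lambda>(s :: complex ^ 'v) x. h (of_real (w x)))"
proof -
  have hr: "(deriv ^^ r) h holomorphic_on S" for r by (intro holomorphic_higher_deriv h)
  have t: "tame d X (\<lambda>(s :: complex ^ 'v) x. (deriv ^^ r) h (of_real (w x)))" for r
    unfolding tame_def
  proof (intro conjI ballI allI)
    have "continuous_on (open_box d X) (\<lambda>x. complex_of_real (w x))"
    proof -
      have "tame_upto d X 0 (\<lambda>(s :: complex ^ 'v) x. of_real (w x))"
        using w unfolding tame_smooth_def by blast
      then show ?thesis unfolding tame_upto.simps tame_def by blast
    qed
    then show "continuous_on (open_box d X) (\<lambda>x. (deriv ^^ r) h (of_real (w x)))"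
      by (intro continuous_on_compose2[OF holomorphic_on_imp_continuous_on[OF hr]]) (use h(3) in auto)
    obtain C where C: "\<And>x. x \<in> half_box d X \<Longrightarrow> norm ((deriv ^^ r) h (of_real (w x))) \<le> C" using b[of r] by blast
    have "norm ((deriv ^^ r) h (of_real (w x))) \<le> \<bar>C\<bar> * (1 + x 1) ^ 0" if "x \<in> half_box d X" for x
      using C[OF that] by simp
    then show "\<exists>\<epsilon>>0. \<exists>C\<ge>0. \<exists>N. \<forall>s\<in>ball z \<epsilon>. \<forall>x\<in>half_box d X. norm ((deriv ^^ r) h (of_real (w x))) \<le> C * (1 + x 1) ^ N" for z :: "complex ^ 'v"
      by (intro exI[of _ 1] exI[of _ "\<bar>C\<bar>"] exI[of _ "0::nat"] conjI) auto
  qed (auto intro: holomorphic_multi_const)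
  have "tame_upto d X k (\<lambda>(s :: complex ^ 'v) x. (deriv ^^ r) h (of_real (w x)))" for k r
  proof (induction k arbitrary: r)
    case (Suc k)
    have "\<exists>g. tame_upto d X k g \<and> (\<forall>s :: complex ^ 'v. \<forall>x\<in>open_box d X.
       ((\<lambda>t. (deriv ^^ r) h (of_real (w (x(j := t))))) has_vector_derivative g s x) (at (x j)))" if j: "j \<in> {2..d}" for j
    proof -
      obtain w' :: "complex ^ 'v \<Rightarrow> (nat \<Rightarrow> real) \<Rightarrow> complex" where w': "tame_upto d X k w'"
        "\<forall>s. \<forall>x\<in>open_box d X. ((\<lambda>t. complex_of_real (w (x(j := t)))) has_vector_derivative w' s x) (at (x j))"
      proof -
        have "tame_upto d X (Suc k) (\<lambda>(s :: complex ^ 'v) x. of_real (w x))"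
          using w unfolding tame_smooth_def by blast
        from tame_upto_SucD[OF this j] show ?thesis using that by blast
      qed
      have "((\<lambda>t. (deriv ^^ r) h (of_real (w (x(j := t))))) has_vector_derivative w' s x * (deriv ^^ Suc r) h (of_real (w x))) (at (x j))"
        if x: "x \<in> open_box d X" for s x
      proof -
        have "((deriv ^^ r) h has_field_derivative (deriv ^^ Suc r) h (of_real (w x))) (at (of_real (w x)))"
          using holomorphic_derivI[OF hr h(2) h(3)[OF x]] by simp
        then have "((deriv ^^ r) h has_field_derivative (deriv ^^ Suc r) h (of_real (w x))) (at ((\<lambda>t. of_real (w (x(j := t)))) (x j)))"
          by simp
        from field_vector_diff_chain_at[OF w'(2)[rule_format, OF x] this]
        show ?thesis unfolding o_def .
      qed
      then show ?thesis using Suc.IH[of "Suc r"] w'(1)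
        by (intro exI[of _ "\<lambda>s x. w' s x * (deriv ^^ Suc r) h (of_real (w x))"] conjI tame_upto_mult X) auto
    qed
    then show ?case using t by (intro tame_upto_SucI)
  qed (use t in auto)
  from this[of _ 0] show ?thesis by (simp add: tame_smooth_def)
qed

section \<open>Mixed partial derivatives\<close>

text \<open>Schwarz's theorem by integration: \<open>F p q\<close> is \<open>F a q\<close> plus the
  integral of \<open>F1\<close> over \<open>{a..p}\<close>. Differentiating in \<open>q\<close>
  under the integral expresses \<open>F2 p q0\<close> through an integral of \<open>F12\<close>, and
  differentiating that in \<open>p\<close> gives \<open>F12\<close>. Continuity is assumed with
  \<open>q\<close> first because the differentiation rule takes the parameter as first
  component.\<close>

lemma mixed_partials_commute:
  fixes F :: "real \<Rightarrow> real \<Rightarrow> complex"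
  assumes F1: "\<And>p q. p \<in> {0<..<1} \<Longrightarrow> q \<in> {0<..<1} \<Longrightarrow> ((\<lambda>p. F p q) has_vector_derivative F1 p q) (at p)"
    and F2: "\<And>p q. p \<in> {0<..<1} \<Longrightarrow> q \<in> {0<..<1} \<Longrightarrow> ((\<lambda>q. F p q) has_vector_derivative F2 p q) (at q)"
    and F12: "\<And>p q. p \<in> {0<..<1} \<Longrightarrow> q \<in> {0<..<1} \<Longrightarrow> ((\<lambda>q. F1 p q) has_vector_derivative F12 p q) (at q)"
    and F21: "\<And>p q. p \<in> {0<..<1} \<Longrightarrow> q \<in> {0<..<1} \<Longrightarrow> ((\<lambda>p. F2 p q) has_vector_derivative F21 p q) (at p)"
    and c1: "continuous_on ({0<..<1} \<times> {0<..<1}) (\<lambda>(q, p). F1 p q)"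
    and c12: "continuous_on ({0<..<1} \<times> {0<..<1}) (\<lambda>(q, p). F12 p q)"
    and p0: "p0 \<in> {0<..<1}" and q0: "q0 \<in> {0<..<1}"
  shows "F12 p0 q0 = F21 p0 q0"
proof -
  define a b where "a = p0 / 2" and "b = (p0 + 1) / 2"
  have ab: "0 < a" "a < p0" "p0 < b" "b < 1" using p0 by (auto simp: a_def b_def)
  have cF1: "continuous_on {a..b} (\<lambda>p. F1 p q)" if "q \<in> {0<..<1}" for q
  proof -
    have "continuous_on {a..b} (\<lambda>p. (\<lambda>(q, p). F1 p q) (q, p))"
      by (rule continuous_on_compose2[OF c1 continuous_on_Pair[OF continuous_on_const continuous_on_id]])
         (use ab that in auto)
    then show ?thesis by simp
  qed
  have cF12: "continuous_on {a..b} (\<lambda>p. F12 p q0)"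
  proof -
    have "continuous_on {a..b} (\<lambda>p. (\<lambda>(q, p). F12 p q) (q0, p))"
      by (rule continuous_on_compose2[OF c12 continuous_on_Pair[OF continuous_on_const continuous_on_id]])
         (use ab q0 in auto)
    then show ?thesis by simp
  qed
  have eq: "F2 p q0 = F2 a q0 + integral {a..p} (\<lambda>p. F12 p q0)" if p: "p \<in> {a..b}" for p
  proof -
    have "((\<lambda>q. integral (cbox a p) (\<lambda>t. F1 t q)) has_vector_derivative integral (cbox a p) (\<lambda>t. F12 t q0)) (at q0 within {0<..<1})"
    proof (rule leibniz_rule_vector_derivative)
      show "((\<lambda>q. F1 t q) has_vector_derivative F12 t q) (at q within {0<..<1})"
        if "q \<in> {0<..<1}" "t \<in> cbox a p" for q t
        using F12[of t q] that p ab by (auto intro: has_vector_derivative_at_within)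
      show "(\<lambda>t. F1 t q) integrable_on cbox a p" if "q \<in> {0<..<1}" for q
        unfolding cbox_interval
        by (intro integrable_continuous_real continuous_on_subset[OF cF1[OF that]]) (use p in auto)
      show "continuous_on ({0<..<1} \<times> cbox a p) (\<lambda>(q, t). F12 t q)"
        by (rule continuous_on_subset[OF c12]) (use p ab in auto)
    qed (use q0 in auto)
    then have I: "((\<lambda>q. integral {a..p} (\<lambda>t. F1 t q)) has_vector_derivative integral {a..p} (\<lambda>t. F12 t q0)) (at q0)"
      using q0 at_within_open[of q0 "{0<..<1}"] by (simp add: cbox_interval)
    have ftc: "F p q = F a q + integral {a..p} (\<lambda>t. F1 t q)" if q: "q \<in> {0<..<1}" for q
    proof -
      have "((\<lambda>t. F1 t q) has_integral (F p q - F a q)) {a..p}"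
        using p ab q by (intro fundamental_theorem_of_calculus has_vector_derivative_at_within[OF F1]) auto
      then show ?thesis by (simp add: integral_unique)
    qed
    have "((\<lambda>q. F a q + integral {a..p} (\<lambda>t. F1 t q)) has_vector_derivative F2 a q0 + integral {a..p} (\<lambda>t. F12 t q0)) (at q0)"
      using ab q0 by (intro has_vector_derivative_add F2 I) auto
    then have "((\<lambda>q. F p q) has_vector_derivative F2 a q0 + integral {a..p} (\<lambda>t. F12 t q0)) (at q0)"
      by (rule has_vector_derivative_transform_within_open[of _ _ _ "{0<..<1}"]) (use q0 ftc in auto)
    moreover have "((\<lambda>q. F p q) has_vector_derivative F2 p q0) (at q0)" using p ab q0 by (intro F2) auto
    ultimately show ?thesis by (rule vector_derivative_unique_at[symmetric])
  qed
  have "((\<lambda>p. F2 a q0 + integral {a..p} (\<lambda>p. F12 p q0)) has_vector_derivative 0 + F12 p0 q0) (at p0 within {a..b})"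
    using ab cF12 by (intro has_vector_derivative_add has_vector_derivative_const integral_has_vector_derivative) auto
  then have "((\<lambda>p. F2 a q0 + integral {a..p} (\<lambda>p. F12 p q0)) has_vector_derivative F12 p0 q0) (at p0)"
    unfolding add_0_left at_within_Icc_at[OF ab(2,3)] .
  then have "((\<lambda>p. F2 p q0) has_vector_derivative F12 p0 q0) (at p0)"
    by (rule has_vector_derivative_transform_within_open[of _ _ _ "{a<..<b}"])
       (use ab in \<open>simp_all add: eq[symmetric]\<close>)
  then show ?thesis using F21[OF p0 q0] by (rule vector_derivative_unique_at)
qed

lemma tame_smooth_tame: "tame_smooth d X f \<Longrightarrow> tame d X f"
  unfolding tame_smooth_def using tame_upto_tame by blast

text \<open>\<open>vector_derivative\<close> is a description, so equality of values follows from
  both functions having the same set of derivatives at the point; this argument covers points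
  without a derivative as well.\<close>

lemma partial_deriv_cong:
  assumes "x \<in> open_box d X" "j \<in> {2..d}" "\<And>x. x \<in> open_box d X \<Longrightarrow> f' x = f x"
  shows "partial_deriv j f' x = partial_deriv j f x"
proof -
  have "((\<lambda>t. f' (x(j := t))) has_vector_derivative D) (at (x j)) \<longleftrightarrow>
        ((\<lambda>t. f (x(j := t))) has_vector_derivative D) (at (x j))" for D
    using partial_has_vector_derivative_cong[of f x j D d X f']
      partial_has_vector_derivative_cong[of f' x j D d X f] assms by auto
  then show ?thesis unfolding partial_deriv_def vector_derivative_def by simp
qed

text \<open>The families witnessing \<open>tame_upto\<close> may differ from order to order. On the
  box each of them equals \<open>partial_deriv\<close>, so one concrete function serves all
  orders.\<close>

lemma tame_smooth_partial_deriv: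
  assumes "tame_smooth d X f" "j \<in> {2..d}"
  shows "tame_smooth d X (\<lambda>s. partial_deriv j (f s))"
    and "x \<in> open_box d X \<Longrightarrow> ((\<lambda>t. f s (x(j := t))) has_vector_derivative partial_deriv j (f s) x) (at (x j))"
proof -
  have *: "tame_upto d X k (\<lambda>s. partial_deriv j (f s)) \<and>
     (\<forall>s. \<forall>x\<in>open_box d X. ((\<lambda>t. f s (x(j := t))) has_vector_derivative partial_deriv j (f s) x) (at (x j)))" for k
  proof -
    have "tame_upto d X (Suc k) f" using assms(1) by (simp only: tame_smooth_def)
    from tame_upto_SucD[OF this assms(2)] obtain g where g: "tame_upto d X k g"
      "\<And>s x. x \<in> open_box d X \<Longrightarrow> ((\<lambda>t. f s (x(j := t))) has_vector_derivative g s x) (at (x j))" by blast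
    have "partial_deriv j (f s) x = g s x" if "x \<in> open_box d X" for s x
      unfolding partial_deriv_def by (rule vector_derivative_at[OF g(2)[OF that]])
    then show ?thesis using g tame_upto_cong[OF g(1)] by simp
  qed
  show "tame_smooth d X (\<lambda>s. partial_deriv j (f s))" using * unfolding tame_smooth_def by blast
  show "((\<lambda>t. f s (x(j := t))) has_vector_derivative partial_deriv j (f s) x) (at (x j))" if "x \<in> open_box d X"
    using *[of 0] that by blast
qed

lemma continuous_on_two_coords:
  assumes "continuous_on (open_box d X) f" "x \<in> open_box d X" "i \<in> {2..d}" "j \<in> {2..d}"
  shows "continuous_on ({0<..<1} \<times> {0<..<1}) (\<lambda>(q, p). f (x(i := p, j := q)))"
proof -
  have "continuous_on ({0<..<1} \<times> {0<..<1}) (\<lambda>z::real \<times> real. x(i := snd z, j := fst z))"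
  proof (rule continuous_on_coordinatewise_then_product)
    show "continuous_on ({0<..<1} \<times> {0<..<1}) (\<lambda>z::real \<times> real. (x(i := snd z, j := fst z)) l)" for l
      by (cases "l = j"; cases "l = i") (auto intro!: continuous_intros)
  qed
  then show ?thesis
    unfolding case_prod_unfold
    by (rule continuous_on_compose2[OF assms(1)])
       (auto intro!: open_box_upd[OF open_box_upd] assms(2-4))
qed

lemma partial_deriv_commute:
  assumes f: "tame_smooth d X f" and ij: "i \<in> {2..d}" "j \<in> {2..d}" and x: "x \<in> open_box d X"
  shows "partial_deriv i (partial_deriv j (f s)) x = partial_deriv j (partial_deriv i (f s)) x"
proof (cases "i = j")
  case False
  define P where "P p q = x(i := p, j := q)" for p q
  have P: "P p q \<in> open_box d X" if "p \<in> {0<..<1}" "q \<in> {0<..<1}" for p q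
    using open_box_upd[OF open_box_upd] x ij that by (auto simp: P_def)
  have Pi: "(P p q)(i := t) = P t q" and Pj: "(P p q)(j := t) = P p t" and Pij: "P p q i = p" "P p q j = q" for p q t
    using False by (auto simp: P_def fun_eq_iff)
  have di: "((\<lambda>p. g s (P p q)) has_vector_derivative partial_deriv i (g s) (P p q)) (at p)"
    if "p \<in> {0<..<1}" "q \<in> {0<..<1}" "tame_smooth d X g" for p q g
    using tame_smooth_partial_deriv(2)[OF that(3) ij(1) P[OF that(1,2)], of s] by (simp add: Pi Pij)
  have dj: "((\<lambda>q. g s (P p q)) has_vector_derivative partial_deriv j (g s) (P p q)) (at q)"
    if "p \<in> {0<..<1}" "q \<in> {0<..<1}" "tame_smooth d X g" for p q g
    using tame_smooth_partial_deriv(2)[OF that(3) ij(2) P[OF that(1,2)], of s] by (simp add: Pj Pij)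
  have c: "continuous_on ({0<..<1} \<times> {0<..<1}) (\<lambda>(q, p). g s (P p q))" if "tame_smooth d X g" for g
  proof -
    have "continuous_on (open_box d X) (g s)" using tame_smooth_tame[OF that] by (simp add: tame_def)
    from continuous_on_two_coords[OF this x ij] show ?thesis unfolding P_def .
  qed
  note sm = tame_smooth_partial_deriv(1)[OF f ij(1)] tame_smooth_partial_deriv(1)[OF f ij(2)]
  have "partial_deriv j (partial_deriv i (f s)) (P (x i) (x j)) = partial_deriv i (partial_deriv j (f s)) (P (x i) (x j))"
    by (rule mixed_partials_commute[where F = "\<lambda>p q. f s (P p q)" and ?F1.0 = "\<lambda>p q. partial_deriv i (f s) (P p q)"
         and ?F2.0 = "\<lambda>p q. partial_deriv j (f s) (P p q)"
         and ?F12.0 = "\<lambda>p q. partial_deriv j (partial_deriv i (f s)) (P p q)"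
         and ?F21.0 = "\<lambda>p q. partial_deriv i (partial_deriv j (f s)) (P p q)",
         OF di[OF _ _ f] dj[OF _ _ f] dj[OF _ _ sm(1)] di[OF _ _ sm(2)] c[OF sm(1)]
          c[OF tame_smooth_partial_deriv(1)[OF sm(1) ij(2)]]])
       (simp_all only: greaterThanLessThan_iff open_box_nth[OF x ij(1)] open_box_nth[OF x ij(2)])
  moreover have "P (x i) (x j) = x" by (auto simp: P_def)
  ultimately show ?thesis by simp
qed simp

definition partial_derivs :: "nat list \<Rightarrow> ((nat \<Rightarrow> real) \<Rightarrow> complex) \<Rightarrow> (nat \<Rightarrow> real) \<Rightarrow> complex"
  where "partial_derivs js f = foldr partial_deriv js f"

lemma partial_derivs_Cons: "partial_derivs (j # js) f = partial_deriv j (partial_derivs js f)"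
  by (simp add: partial_derivs_def)

lemma tame_smooth_partial_derivs:
  "tame_smooth d X f \<Longrightarrow> set js \<subseteq> {2..d} \<Longrightarrow> tame_smooth d X (\<lambda>s. partial_derivs js (f s))"
proof (induction js)
  case (Cons j js)
  then have "tame_smooth d X (\<lambda>s. partial_derivs js (f s))" "j \<in> {2..d}" by auto
  then show ?case unfolding partial_derivs_Cons by (rule tame_smooth_partial_deriv(1))
qed (simp add: partial_derivs_def)

text \<open>One entry is carried to the front by exchanging neighbours. Each exchange happens under
  further derivatives and only on the box, which is why \<open>partial_deriv_cong\<close> has to
  accompany it.\<close>

lemma partial_derivs_move:
  assumes f: "tame_smooth d X f" and "x \<in> open_box d X" "set (ks @ j # ls) \<subseteq> {2..d}"
  shows "partial_derivs (ks @ j # ls) (f s) x = partial_derivs (j # ks @ ls) (f s) x"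
  using assms(2,3)
proof (induction ks arbitrary: x)
  case (Cons i ks)
  have i: "i \<in> {2..d}" and j: "j \<in> {2..d}" and k: "set (ks @ j # ls) \<subseteq> {2..d}" "set (ks @ ls) \<subseteq> {2..d}"
    using Cons.prems by auto
  have "partial_derivs ((i # ks) @ j # ls) (f s) x = partial_deriv i (partial_derivs (ks @ j # ls) (f s)) x"
    by (simp add: partial_derivs_Cons)
  also have "\<dots> = partial_deriv i (partial_derivs (j # ks @ ls) (f s)) x"
    by (rule partial_deriv_cong[OF Cons.prems(1) i Cons.IH]) (use k in auto)
  also have "\<dots> = partial_deriv j (partial_deriv i (partial_derivs (ks @ ls) (f s))) x"
    unfolding partial_derivs_Cons
    by (rule partial_deriv_commute[OF tame_smooth_partial_derivs[OF f k(2)] i j Cons.prems(1)])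
  finally show ?case by (simp add: partial_derivs_Cons)
qed simp

lemma partial_derivs_perm:
  assumes f: "tame_smooth d X f" and "mset js = mset ks" "set js \<subseteq> {2..d}" "x \<in> open_box d X"
  shows "partial_derivs js (f s) x = partial_derivs ks (f s) x"
  using assms(2-4)
proof (induction js arbitrary: ks x)
  case (Cons j js)
  then have "j \<in> set ks" by (metis list.set_intros(1) set_mset_mset)
  then obtain k1 k2 where ks: "ks = k1 @ j # k2" by (meson split_list)
  have m: "mset js = mset (k1 @ k2)" using Cons.prems(1) by (simp add: ks)
  have st: "set ks \<subseteq> {2..d}" using Cons.prems(1,2) by (metis set_mset_mset)
  have "partial_derivs (j # js) (f s) x = partial_derivs (j # k1 @ k2) (f s) x"
    unfolding partial_derivs_Cons
    by (rule partial_deriv_cong[OF Cons.prems(3) _ Cons.IH[OF m]]) (use Cons.prems in auto)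
  also have "\<dots> = partial_derivs ks (f s) x"
    unfolding ks by (rule partial_derivs_move[OF f Cons.prems(3), symmetric]) (use st ks in auto)
  finally show ?case .
qed simp

text \<open>A normal form for a multi-index \<open>r\<close>: differentiations sorted by variable.
  Any other order is compared with it through the multiset of the list.\<close>

definition mixed_deriv :: "nat \<Rightarrow> (nat \<Rightarrow> nat) \<Rightarrow> ((nat \<Rightarrow> real) \<Rightarrow> complex) \<Rightarrow> (nat \<Rightarrow> real) \<Rightarrow> complex"
  where "mixed_deriv d r f = partial_derivs (concat (map (\<lambda>j. replicate (r j) j) [2..<d+1])) f"

lemma mset_concat_replicate:
  "distinct js \<Longrightarrow> mset (concat (map (\<lambda>j. replicate (r j) j) js)) = (\<Sum>j\<in>set js. replicate_mset (r j) j)"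
  by (induction js) auto

lemma mixed_deriv_set: "set (concat (map (\<lambda>j. replicate (r j) j) [2..<d+1])) \<subseteq> {2..d}"
  by (auto split: if_splits)

lemma tame_smooth_mixed_deriv: "tame_smooth d X f \<Longrightarrow> tame_smooth d X (\<lambda>s. mixed_deriv d r (f s))"
  unfolding mixed_deriv_def by (intro tame_smooth_partial_derivs mixed_deriv_set)

lemma mixed_deriv_Suc:
  assumes f: "tame_smooth d X f" and j: "j \<in> {2..d}" and x: "x \<in> open_box d X"
  shows "((\<lambda>t. mixed_deriv d r (f s) (x(j := t))) has_vector_derivative mixed_deriv d (r(j := Suc (r j))) (f s) x) (at (x j))"
proof -
  let ?L = "\<lambda>r. concat (map (\<lambda>j. replicate (r j) j) [2..<d+1]) :: nat list"
  have "mset (?L (r(j := Suc (r j)))) = mset (j # ?L r)"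
  proof -
    have S: "set [2..<d+1] = insert j ({2..d} - {j})" using j by auto
    have "mset (?L (r(j := Suc (r j)))) = replicate_mset (Suc (r j)) j + (\<Sum>i\<in>{2..d} - {j}. replicate_mset (r i) i)"
      unfolding mset_concat_replicate[OF distinct_upt] S by (subst sum.insert) auto
    moreover have "mset (?L r) = replicate_mset (r j) j + (\<Sum>i\<in>{2..d} - {j}. replicate_mset (r i) i)"
      unfolding mset_concat_replicate[OF distinct_upt] S by (subst sum.insert) auto
    ultimately show ?thesis by simp
  qed
  from partial_derivs_perm[OF f this mixed_deriv_set x]
  have "mixed_deriv d (r(j := Suc (r j))) (f s) x = partial_deriv j (mixed_deriv d r (f s)) x"
    unfolding mixed_deriv_def partial_derivs_Cons .
  then show ?thesis
    using tame_smooth_partial_deriv(2)[OF tame_smooth_mixed_deriv[OF f] j x] by (simp only:)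
qed

text \<open>In \<open>ez_F\<close> the order of differentiation follows \<open>\<sigma>\<close>.
  Reindexing by the permutation shows that the list has the multiset of the normal form.\<close>

lemma foldr_partial_deriv_eq_mixed_deriv:
  assumes f: "tame_smooth d X f" and \<sigma>: "\<sigma> permutes {2..d}" and x: "x \<in> open_box d X"
    and N: "\<And>j. j \<in> {2..d} \<Longrightarrow> N j = r (\<sigma> j)"
  shows "foldr (\<lambda>j. partial_deriv (\<sigma> j) ^^ N j) [2..<d+1] (f s) x = mixed_deriv d r (f s) x"
proof -
  have 1: "foldr (\<lambda>j. partial_deriv (\<sigma> j) ^^ N j) js g = partial_derivs (concat (map (\<lambda>j. replicate (N j) (\<sigma> j)) js)) g" for js g
  proof (induction js)
    case (Cons j js)
    have "foldr partial_deriv (replicate m i) h = (partial_deriv i ^^ m) h" for m i h by (induction m) auto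
    then show ?case using Cons by (simp add: partial_derivs_def)
  qed (simp add: partial_derivs_def)
  have 2: "mset (concat (map (\<lambda>j. replicate (N j) (\<sigma> j)) js)) = (\<Sum>j\<in>set js. replicate_mset (N j) (\<sigma> j))"
    if "distinct js" for js using that by (induction js) auto
  have S: "set [2..<d+1] = {2..d}" by auto
  have "mset (concat (map (\<lambda>j. replicate (N j) (\<sigma> j)) [2..<d+1])) = (\<Sum>j\<in>{2..d}. replicate_mset (r (\<sigma> j)) (\<sigma> j))"
    unfolding 2[OF distinct_upt] S by (intro sum.cong) (simp_all add: N)
  also have "\<dots> = (\<Sum>j\<in>{2..d}. replicate_mset (r j) j)"
    by (rule sum.permute[OF \<sigma>, symmetric, unfolded o_def])
  also have "\<dots> = mset (concat (map (\<lambda>j. replicate (r j) j) [2..<d+1]))"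
    unfolding mset_concat_replicate[OF distinct_upt] S ..
  finally have m: "mset (concat (map (\<lambda>j. replicate (r j) j) [2..<d+1])) = mset (concat (map (\<lambda>j. replicate (N j) (\<sigma> j)) [2..<d+1]))"
    by simp
  show ?thesis unfolding 1 mixed_deriv_def by (rule partial_derivs_perm[OF f m mixed_deriv_set x, symmetric])
qed

section \<open>Iterated integration by parts\<close>

interpretation lborel_product: product_sigma_finite "\<lambda>_::nat. lborel :: real measure"
  by standard

text \<open>A power cut off to (0, 1/2], so that all inner integrals run over the full product
  space. The exponential makes holomorphy in \<open>c\<close> and measurability in \<open>t\<close>
  immediate.\<close>

definition half_powr :: "complex \<Rightarrow> real \<Rightarrow> complex"
  where "half_powr c t = (if 0 < t \<and> t \<le> 1/2 then exp (c * of_real (ln t)) else 0)"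

definition box_weight :: "nat set \<Rightarrow> (nat \<Rightarrow> complex) \<Rightarrow> (nat \<Rightarrow> real) \<Rightarrow> complex"
  where "box_weight B e y = (\<Prod>j\<in>B. half_powr (e j) (y j))"

text \<open>Points of \<open>Pi\<^sub>M B\<close> carry the value \<open>undefined\<close> outside
  \<open>B\<close>; the remaining coordinates, frozen or outer, are taken from
  \<open>z\<close>.\<close>

definition glue :: "nat set \<Rightarrow> (nat \<Rightarrow> real) \<Rightarrow> (nat \<Rightarrow> real) \<Rightarrow> nat \<Rightarrow> real"
  where "glue B y z = (\<lambda>i. if i \<in> B then y i else z i)"

lemma half_powr_measurable [measurable]: "half_powr c \<in> borel_measurable borel"
  unfolding half_powr_def by measurable

lemma norm_half_powr: "norm (half_powr c t) = (if 0 < t \<and> t \<le> 1/2 then t powr Re c else 0)"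
  by (simp add: half_powr_def powr_def)

lemma integrable_half_powr:
  assumes "a > -1"
  shows "integrable lborel (\<lambda>t. if 0 < t \<and> t \<le> 1/2 then t powr a else 0 :: real)"
proof -
  have "((\<lambda>t. t powr a) has_integral (1/2) powr (a+1) / (a+1)) {0..1/2}"
    by (rule has_integral_powr_from_0) (use assms in auto)
  then have "((\<lambda>t. if 0 < t \<and> t \<le> 1/2 then t powr a else 0) has_integral (1/2) powr (a+1) / (a+1)) {0..1/2}"
    by (rule has_integral_spike_finite[of "{0}", rotated 2]) auto
  then have "((\<lambda>t. if 0 < t \<and> t \<le> 1/2 then t powr a else 0) has_integral (1/2) powr (a+1) / (a+1)) UNIV"
    by (rule has_integral_on_superset) auto
  from nn_integral_has_integral_lborel[OF _ _ this]
  have "(\<integral>\<^sup>+ t. ennreal (if 0 < t \<and> t \<le> 1/2 then t powr a else 0) \<partial>lborel) = ennreal ((1/2) powr (a+1) / (a+1))"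
    by simp
  then show ?thesis by (intro integrableI_nonneg) (auto simp: less_top[symmetric])
qed

lemma box_weight_measurable [measurable]:
  assumes "finite B"
  shows "box_weight B e \<in> borel_measurable (Pi\<^sub>M B (\<lambda>_. lborel))"
  unfolding box_weight_def
  by (intro borel_measurable_prod measurable_compose[OF measurable_component_singleton]) auto

lemma integrable_norm_box_weight:
  assumes "finite B" "\<And>j. j \<in> B \<Longrightarrow> Re (e j) > -1"
  shows "integrable (Pi\<^sub>M B (\<lambda>_. lborel)) (\<lambda>y. norm (box_weight B e y))"
  unfolding box_weight_def prod_norm[symmetric] norm_half_powr
  by (intro lborel_product.product_integrable_prod assms integrable_half_powr)

lemma box_weight_eq_0: "finite B \<Longrightarrow> j \<in> B \<Longrightarrow> \<not> (0 < y j \<and> y j \<le> 1/2) \<Longrightarrow> box_weight B e y = 0"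
  unfolding box_weight_def by (rule prod_zero) (auto simp: half_powr_def intro!: bexI[of _ j])

text \<open>The closed box of \<open>ez_F\<close> contains points with a coordinate 0. There
  \<open>0 powr w = 0\<close> agrees with the cut-off power, so the equality holds at every point
  and not merely almost everywhere.\<close>

lemma indicator_powr_eq_box_weight:
  assumes "finite B" "y \<in> space (Pi\<^sub>M B (\<lambda>_. lborel :: real measure))"
  shows "indicator (Pi\<^sub>E B (\<lambda>_. {0..1/2})) y *\<^sub>R ((\<Prod>j\<in>B. of_real (y j) powr e j) * h)
       = box_weight B e y * h"
proof (cases "\<forall>j\<in>B. 0 < y j \<and> y j \<le> 1/2")
  case True
  have "y \<in> Pi\<^sub>E B (\<lambda>_. UNIV)" using assms(2) by (simp add: space_PiM)
  then have "y \<in> Pi\<^sub>E B (\<lambda>_. {0..1/2})"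
    by (intro PiE_I) (use True PiE_arb in \<open>simp_all add: less_imp_le\<close>)
  moreover have "(\<Prod>j\<in>B. of_real (y j) powr e j) = box_weight B e y"
    unfolding box_weight_def by (intro prod.cong refl) (use True in \<open>simp add: half_powr_def of_real_powr_eq_exp\<close>)
  ultimately show ?thesis by simp
next
  case False
  then obtain j where j: "j \<in> B" "\<not> (0 < y j \<and> y j \<le> 1/2)" by blast
  have z: "(\<Prod>j\<in>B. of_real (y j) powr e j) = 0" if "y \<in> Pi\<^sub>E B (\<lambda>_. {0..1/2})"
  proof (rule prod_zero[OF assms(1)], rule bexI[OF _ j(1)])
    have "y j \<in> {0..1/2}" using that j(1) by (rule PiE_mem)
    then have "y j = 0" using j(2) unfolding atLeastAtMost_iff by linarith
    then show "of_real (y j) powr e j = 0" by simp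
  qed
  have w: "box_weight B e y = 0" by (rule box_weight_eq_0[where y = y and j = j, OF assms(1) j])
  show ?thesis
  proof (cases "y \<in> Pi\<^sub>E B (\<lambda>_. {0..1/2})")
    case True show ?thesis unfolding z[OF True] w by simp
  next
    case False show ?thesis unfolding indicator_simps(2)[OF False] w by simp
  qed
qed

lemma open_box_borel:
  assumes "X \<in> sets borel"
  shows "open_box d X \<in> sets borel"
proof -
  have [measurable]: "(\<lambda>x::nat \<Rightarrow> real. x j) \<in> borel_measurable borel" for j
    by (intro borel_measurable_continuous_onI continuous_on_nth)
  have "open_box d X = {x\<in>space borel. x 1 \<in> X \<and> (\<forall>j\<in>{2..d}. 0 < x j \<and> x j < 1)}"
    by (simp add: open_box_def)
  also have "\<dots> \<in> sets borel" using assms by measurable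
  finally show ?thesis .
qed

text \<open>On real sequences the product sigma-algebra is the Borel algebra of the product
  topology, so a map can be tested coordinatewise and then composed with functions known only to be
  continuous on the box.\<close>

lemma measurable_into_sequences:
  assumes "\<And>i. (\<lambda>\<omega>. f \<omega> i) \<in> borel_measurable N"
  shows "f \<in> measurable N (borel :: (nat \<Rightarrow> real) measure)"
proof -
  have "f \<in> measurable N (Pi\<^sub>M UNIV (\<lambda>_. borel))"
    by (rule measurable_PiM_single') (use assms in \<open>auto simp: space_PiM\<close>)
  then show ?thesis using sets_PiM_equal_borel measurable_cong_sets by blast
qed

text \<open>\<open>g\<close> is continuous on the box and arbitrary elsewhere. The weight vanishes
  unless the glued point lies in the box, so \<open>g\<close> may be replaced by its extension by
  zero. The parameter space \<open>N\<close> allows joint measurability in the outer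
  variable.\<close>

lemma box_weight_glue_measurable:
  assumes X: "X \<in> sets borel" and g: "continuous_on (open_box d X) g" and B: "finite B"
    and Y: "Y \<in> measurable N (Pi\<^sub>M B (\<lambda>_. lborel))"
    and Z: "\<And>i. i \<notin> B \<Longrightarrow> (\<lambda>\<omega>. Z \<omega> i) \<in> borel_measurable N"
    and P: "\<And>\<omega>. \<omega> \<in> space N \<Longrightarrow> \<forall>j\<in>B. 0 < Y \<omega> j \<and> Y \<omega> j \<le> 1/2 \<Longrightarrow> glue B (Y \<omega>) (Z \<omega>) \<in> open_box d X"
  shows "(\<lambda>\<omega>. box_weight B e (Y \<omega>) * g (glue B (Y \<omega>) (Z \<omega>))) \<in> borel_measurable N"
proof -
  let ?h = "\<lambda>x. indicator (open_box d X) x *\<^sub>R g x"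
  have h: "?h \<in> borel_measurable borel"
    by (rule borel_measurable_continuous_on_indicator[OF open_box_borel[OF X] g])
  have T: "(\<lambda>\<omega>. glue B (Y \<omega>) (Z \<omega>)) \<in> measurable N borel"
  proof (rule measurable_into_sequences)
    fix i
    show "(\<lambda>\<omega>. glue B (Y \<omega>) (Z \<omega>) i) \<in> borel_measurable N"
    proof (cases "i \<in> B")
      case True
      have "(\<lambda>y. y i) \<in> measurable (Pi\<^sub>M B (\<lambda>_. lborel)) (lborel :: real measure)"
        by (rule measurable_component_singleton[OF True])
      from measurable_compose[OF Y this] show ?thesis using True by (simp add: glue_def)
    next
      case False then show ?thesis using Z[OF False] by (simp add: glue_def)
    qed
  qed
  have "(\<lambda>\<omega>. box_weight B e (Y \<omega>) * ?h (glue B (Y \<omega>) (Z \<omega>))) \<in> borel_measurable N"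
    by (intro borel_measurable_times measurable_compose[OF Y box_weight_measurable[OF B]] measurable_compose[OF T h])
  moreover have "box_weight B e (Y \<omega>) * ?h (glue B (Y \<omega>) (Z \<omega>)) = box_weight B e (Y \<omega>) * g (glue B (Y \<omega>) (Z \<omega>))"
    if "\<omega> \<in> space N" for \<omega>
  proof (cases "\<forall>j\<in>B. 0 < Y \<omega> j \<and> Y \<omega> j \<le> 1/2")
    case True then show ?thesis using P[OF that True] by simp
  next
    case False
    then obtain j where "j \<in> B" "\<not> (0 < Y \<omega> j \<and> Y \<omega> j \<le> 1/2)" by blast
    then have "box_weight B e (Y \<omega>) = 0" by (intro box_weight_eq_0[where y = "Y \<omega>" and j = j] B)
    then show ?thesis by simp
  qed
  ultimately show ?thesis using measurable_cong by (metis (no_types, lifting))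
qed

text \<open>Both integrands stay under one integral, being the derivative of
  \<open>t powr (c + 1) / (c + 1) * \<phi> t\<close>. This function tends to 0 at 0 because
  \<open>Re c > -1\<close> and \<open>\<phi>\<close> is bounded, so only the endpoint 1/2
  contributes.\<close>

lemma half_powr_by_parts:
  fixes \<phi> \<phi>' :: "real \<Rightarrow> complex"
  assumes c: "Re c > -1"
    and d: "\<And>t. 0 < t \<Longrightarrow> t < 1 \<Longrightarrow> (\<phi> has_vector_derivative \<phi>' t) (at t)"
    and cont: "continuous_on {0<..<1} \<phi>'"
    and b: "\<And>t. 0 < t \<Longrightarrow> t \<le> 1/2 \<Longrightarrow> norm (\<phi> t) \<le> C" "\<And>t. 0 < t \<Longrightarrow> t \<le> 1/2 \<Longrightarrow> norm (\<phi>' t) \<le> C"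
  shows "(LINT t|lborel. half_powr c t * \<phi> t + half_powr (c + 1) t * \<phi>' t / (c + 1))
         = (1/2) powr (c + 1) / (c + 1) * \<phi> (1/2)"
proof -
  have c1: "c + 1 \<noteq> 0" using c by (auto simp: complex_eq_iff)
  have C0: "C \<ge> 0" using b(1)[of "1/2"] norm_ge_zero[of "\<phi> (1/2)"] by linarith
  have cphi: "continuous_on {0<..<1} \<phi>"
    by (rule continuous_at_imp_continuous_on) (use d has_vector_derivative_continuous in force)
  have int: "integrable lborel (\<lambda>t. half_powr a t * f t)"
    if f: "continuous_on {0<..<1} f" and fb: "\<And>t. 0 < t \<Longrightarrow> t \<le> 1/2 \<Longrightarrow> norm (f t) \<le> C" and a: "Re a > -1" for a f
  proof (rule Bochner_Integration.integrable_bound)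
    show "integrable lborel (\<lambda>t. (if 0 < t \<and> t \<le> 1/2 then t powr Re a else 0) * C)"
      by (intro integrable_mult_left integrable_half_powr a)
    have "(\<lambda>t. half_powr a t * (indicator {0<..<1} t *\<^sub>R f t)) \<in> borel_measurable borel"
      by (intro borel_measurable_times borel_measurable_continuous_on_indicator half_powr_measurable f) auto
    moreover have "half_powr a t * (indicator {0<..<1} t *\<^sub>R f t) = half_powr a t * f t" for t
      by (simp add: half_powr_def indicator_def)
    ultimately show "(\<lambda>t. half_powr a t * f t) \<in> borel_measurable lborel" by simp
    show "AE t in lborel. norm (half_powr a t * f t) \<le> norm ((if 0 < t \<and> t \<le> 1/2 then t powr Re a else 0) * C)"
      using fb C0 by (intro AE_I2) (auto simp: norm_mult norm_half_powr intro!: mult_left_mono)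
  qed
  note i1 = int[OF cphi b(1) c] and i2 = int[OF cont b(2), of "c + 1"]
  have i2': "integrable lborel (\<lambda>t. half_powr (c + 1) t * \<phi>' t / (c + 1))"
    using i2 c by simp
  define F where "F t = of_real t powr (c + 1) / (c + 1) * \<phi> t" for t :: real
  have "((\<lambda>t. half_powr c t * \<phi> t + half_powr (c + 1) t * \<phi>' t / (c + 1)) has_integral F (1/2) - F 0) {0..1/2}"
  proof (rule fundamental_theorem_of_calculus_interior)
    show "(F has_vector_derivative half_powr c t * \<phi> t + half_powr (c + 1) t * \<phi>' t / (c + 1)) (at t)"
      if "t \<in> {0<..<1/2}" for t
    proof -
      have t: "0 < t" "t < 1/2" using that by auto
      have "((\<lambda>w. w powr (c + 1) / (c + 1)) has_field_derivative (c + 1) * of_real t powr (c + 1 - 1) / (c + 1)) (at (of_real t))"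
        using t c1 by (intro DERIV_cdivide has_field_derivative_powr) (auto simp: complex_nonpos_Reals_iff)
      then have "((\<lambda>w. w powr (c + 1) / (c + 1)) has_field_derivative of_real t powr c) (at (of_real t))"
        using c1 by simp
      from has_vector_derivative_mult[OF has_vector_derivative_real_field[OF this] d[of t]] t
      have "(F has_vector_derivative of_real t powr (c + 1) / (c + 1) * \<phi>' t + of_real t powr c * \<phi> t) (at t)"
        unfolding F_def by simp
      moreover have h: "half_powr a t = of_real t powr a" for a
        using t by (simp add: half_powr_def of_real_powr_eq_exp)
      have "half_powr c t * \<phi> t + half_powr (c + 1) t * \<phi>' t / (c + 1)
          = of_real t powr (c + 1) / (c + 1) * \<phi>' t + of_real t powr c * \<phi> t"
        unfolding h by simp
      ultimately show ?thesis by (rule ssubst[rotated])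
    qed
    have "continuous (at t within {0..1/2}) F" if t: "t \<in> {0..1/2}" for t
    proof (cases "t = 0")
      case True
      have "((\<lambda>t::real. t powr (Re c + 1)) \<longlongrightarrow> 0) (at 0 within {0..1/2})"
        by (rule tendsto_zero_powrI[OF tendsto_ident_at tendsto_const])
           (use c in \<open>auto simp: eventually_at_filter\<close>)
      from tendsto_mult_left_zero[OF this, of "C / norm (c + 1)"]
      have l: "((\<lambda>t::real. t powr (Re c + 1) / norm (c + 1) * C) \<longlongrightarrow> 0) (at 0 within {0..1/2})"
        by (simp add: mult.commute)
      have "\<forall>\<^sub>F t in at 0 within {0..1/2}. norm (F t) \<le> t powr (Re c + 1) / norm (c + 1) * C"
        unfolding eventually_at_filter
      proof (rule always_eventually, intro allI impI)
        fix t :: real assume "t \<noteq> 0" "t \<in> {0..1/2}"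
        then have t: "0 < t" "t \<le> 1/2" by auto
        then show "norm (F t) \<le> t powr (Re c + 1) / norm (c + 1) * C"
          unfolding F_def norm_mult norm_divide
          by (intro mult_mono b(1)) (simp_all add: norm_of_real_powr divide_right_mono)
      qed
      from Lim_null_comparison[OF this l] have "(F \<longlongrightarrow> 0) (at 0 within {0..1/2})" .
      moreover have "F 0 = 0" by (simp add: F_def)
      ultimately show ?thesis using True by (simp add: continuous_within)
    next
      case False
      then have t: "0 < t" "t < 1" using t by auto
      have "isCont \<phi> t" using d[OF t] has_vector_derivative_continuous by blast
      moreover have "isCont (\<lambda>t. of_real t powr (c + 1) / (c + 1)) t"
        using t c1 by (intro continuous_intros) (auto simp: complex_nonpos_Reals_iff)
      ultimately have "isCont F t" unfolding F_def by (intro continuous_mult)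
      then show ?thesis by (rule continuous_at_imp_continuous_at_within)
    qed
    then show "continuous_on {0..1/2} F" by (simp add: continuous_on_eq_continuous_within)
  qed simp
  then have "((\<lambda>t. half_powr c t * \<phi> t + half_powr (c + 1) t * \<phi>' t / (c + 1)) has_integral F (1/2) - F 0) UNIV"
    by (rule has_integral_on_superset) (auto simp: half_powr_def)
  moreover have "integrable lborel (\<lambda>t. half_powr c t * \<phi> t + half_powr (c + 1) t * \<phi>' t / (c + 1))"
    by (intro Bochner_Integration.integrable_add i1 i2')
  ultimately have "(LINT t|lborel. half_powr c t * \<phi> t + half_powr (c + 1) t * \<phi>' t / (c + 1)) = F (1/2) - F 0"
    using has_integral_integral_lborel has_integral_unique by blast
  then show ?thesis by (simp add: F_def)
qed

section \<open>Integration by parts in several variables\<close>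

lemma box_weight_insert:
  "finite B \<Longrightarrow> j \<notin> B \<Longrightarrow> box_weight (insert j B) e (y(j := t)) = half_powr (e j) t * box_weight B e y"
  unfolding box_weight_def by (subst prod.insert) (auto intro!: prod.cong)

lemma box_weight_cong: "(\<And>j. j \<in> B \<Longrightarrow> e j = e' j) \<Longrightarrow> box_weight B e = box_weight B e'"
  unfolding box_weight_def by (intro ext prod.cong) auto

lemma sum_PiE_insert:
  assumes "finite B" "j \<notin> B"
  shows "(\<Sum>q\<in>Pi\<^sub>E (insert j B) F. T q) = (\<Sum>k\<in>F j. \<Sum>q\<in>Pi\<^sub>E B F. T (q(j := k)) :: 'a::comm_monoid_add)"
proof -
  have "(\<Sum>q\<in>Pi\<^sub>E (insert j B) F. T q) = (\<Sum>p\<in>F j \<times> Pi\<^sub>E B F. T ((\<lambda>(k, q). q(j := k)) p))"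
    unfolding PiE_insert_eq by (rule sum.reindex[OF inj_combinator[OF assms(2)], unfolded o_def])
  then show ?thesis by (simp add: sum.cartesian_product case_prod_unfold)
qed

text \<open>
  The case \<open>q \<le> n\<close> is the boundary term at \<open>1/2\<close> after \<open>q\<close> steps, the other case (only \<open>q = n + 1\<close>
  occurs) the factor in front of the remaining integral.
\<close>
definition bdry_coeff :: "complex \<Rightarrow> nat \<Rightarrow> nat \<Rightarrow> complex"
  where "bdry_coeff u n q =
    (if q \<le> n then (-1) ^ q * inverse (pochhammer (u + 1) (q + 1)) * (1/2) powr (u + of_nat q + 1)
     else (-1) ^ (n + 1) * inverse (pochhammer (u + 1) (n + 1)))"

lemma by_parts_algebra:
  fixes u p b K A D :: complex
  shows "u * inverse p * (K / b * A - 1 / b * D) = u * inverse (p * b) * K * A + (- 1) * u * inverse (p * b) * D"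
  by (simp add: divide_inverse algebra_simps)

text \<open>\<open>G r\<close> stands for the mixed derivative of order \<open>r\<close> of one
  function. With the first coordinate frozen at \<open>x1\<close>, the polynomial growth in it
  becomes a constant, so the bound carries no growth factor.\<close>

locale box_family =
  fixes d :: nat and X :: "real set" and x1 :: real and G :: "(nat \<Rightarrow> nat) \<Rightarrow> (nat \<Rightarrow> real) \<Rightarrow> complex"
  assumes X: "X \<in> sets borel"
    and cont: "\<And>r. continuous_on (open_box d X) (G r)"
    and bound: "\<And>r. \<exists>C. \<forall>x\<in>half_box d X. x 1 = x1 \<longrightarrow> norm (G r x) \<le> C"
    and deriv: "\<And>r j x. j \<in> {2..d} \<Longrightarrow> x \<in> open_box d X \<Longrightarrow>
      ((\<lambda>t. G r (x(j := t))) has_vector_derivative G (r(j := Suc (r j))) x) (at (x j))"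
begin

definition base :: "nat set \<Rightarrow> (nat \<Rightarrow> real) \<Rightarrow> bool"
  where "base B z \<longleftrightarrow> z 1 = x1 \<and> x1 \<in> X \<and> (\<forall>j\<in>{2..d} - B. 0 < z j \<and> z j \<le> 1/2)"

lemma glue_half_box:
  assumes "base B z" "B \<subseteq> {2..d}" "\<forall>j\<in>B. 0 < y j \<and> y j \<le> 1/2"
  shows "glue B y z \<in> half_box d X" "glue B y z 1 = x1"
proof -
  have "1 \<notin> B" using assms(2) by auto
  then show "glue B y z 1 = x1" using assms(1) by (simp add: glue_def base_def)
  then show "glue B y z \<in> half_box d X"
    unfolding half_box_def using assms(1,3) by (simp add: glue_def base_def)
qed

lemma integrable_box:
  assumes B: "B \<subseteq> {2..d}" and z: "base B z" and e: "\<And>j. j \<in> B \<Longrightarrow> Re (e j) > -1"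
  shows "integrable (Pi\<^sub>M B (\<lambda>_. lborel)) (\<lambda>y. box_weight B e y * G r (glue B y z))"
proof -
  have fin: "finite B" using B finite_subset by blast
  obtain C where C: "\<And>x. x \<in> half_box d X \<Longrightarrow> x 1 = x1 \<Longrightarrow> norm (G r x) \<le> C" using bound by blast
  show ?thesis
  proof (rule Bochner_Integration.integrable_bound)
    show "integrable (Pi\<^sub>M B (\<lambda>_. lborel)) (\<lambda>y. norm (box_weight B e y) * \<bar>C\<bar>)"
      by (intro integrable_mult_left integrable_norm_box_weight fin e)
    show "(\<lambda>y. box_weight B e y * G r (glue B y z)) \<in> borel_measurable (Pi\<^sub>M B (\<lambda>_. lborel))"
    proof (rule box_weight_glue_measurable[OF X cont fin])
      show "glue B y z \<in> open_box d X" if "\<forall>j\<in>B. 0 < y j \<and> y j \<le> 1/2" for y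
        using glue_half_box(1)[OF z B that] half_box_subset by blast
    qed auto
    show "AE y in Pi\<^sub>M B (\<lambda>_. lborel). norm (box_weight B e y * G r (glue B y z)) \<le> norm (norm (box_weight B e y) * \<bar>C\<bar>)"
    proof (rule AE_I2)
      fix y
      show "norm (box_weight B e y * G r (glue B y z)) \<le> norm (norm (box_weight B e y) * \<bar>C\<bar>)"
      proof (cases "\<forall>j\<in>B. 0 < y j \<and> y j \<le> 1/2")
        case True
        have "norm (G r (glue B y z)) \<le> \<bar>C\<bar>" using C[OF glue_half_box[OF z B True]] by simp
        then show ?thesis by (simp add: norm_mult mult_left_mono)
      next
        case False
        then obtain j where "j \<in> B" "\<not> (0 < y j \<and> y j \<le> 1/2)" by blast
        then have "box_weight B e y = 0" by (intro box_weight_eq_0[where y = y and j = j] fin)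
        then show ?thesis by simp
      qed
    qed
  qed
qed

text \<open>Fubini puts variable \<open>j\<close> innermost, where the one-dimensional formula
  applies to the sum of the two integrands. Where the weight of the other coordinates vanishes, the
  glued point may leave the box, and the identity reads 0 = 0.\<close>

lemma by_parts_step:
  assumes B: "B \<subseteq> {2..d}" and j: "j \<in> {2..d}" "j \<notin> B" and z: "base (insert j B) z"
    and e: "\<And>i. i \<in> insert j B \<Longrightarrow> Re (e i) > -1"
  shows "(LINT y|Pi\<^sub>M (insert j B) (\<lambda>_. lborel). box_weight (insert j B) e y * G r (glue (insert j B) y z))
    = (1/2) powr (e j + 1) / (e j + 1) *
        (LINT y|Pi\<^sub>M B (\<lambda>_. lborel). box_weight B e y * G r (glue B y (z(j := 1/2))))
      - 1 / (e j + 1) * (LINT y|Pi\<^sub>M (insert j B) (\<lambda>_. lborel).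
          box_weight (insert j B) (e(j := e j + 1)) y * G (r(j := Suc (r j))) (glue (insert j B) y z))"
proof -
  let ?c = "e j" and ?r = "r(j := Suc (r j))" and ?e = "e(j := e j + 1)" and ?J = "insert j B"
  have fin: "finite B" using B finite_subset by blast
  have JB: "?J \<subseteq> {2..d}" using B j by auto
  have c: "Re ?c > -1" using e by auto
  have c1: "?c + 1 \<noteq> 0" using c by (auto simp: complex_eq_iff)
  define f1 where "f1 y = box_weight ?J e y * G r (glue ?J y z)" for y
  define f2 where "f2 y = box_weight ?J ?e y * G ?r (glue ?J y z)" for y
  have i1: "integrable (Pi\<^sub>M ?J (\<lambda>_. lborel)) f1"
    unfolding f1_def by (rule integrable_box[OF JB z e])
  have e2: "Re (?e i) > -1" if "i \<in> ?J" for i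
    using e[OF that] c by (cases "i = j") simp_all
  have i2: "integrable (Pi\<^sub>M ?J (\<lambda>_. lborel)) f2"
    unfolding f2_def by (rule integrable_box[OF JB z e2])
  have z': "base B (z(j := 1/2))" using z j unfolding base_def by auto
  have we: "box_weight B ?e = box_weight B e" by (rule box_weight_cong) (use j in auto)
  have inner: "(LINT t|lborel. f1 (y(j := t)) + f2 (y(j := t)) / (?c + 1))
      = (1/2) powr (?c + 1) / (?c + 1) * (box_weight B e y * G r (glue B y (z(j := 1/2))))" for y
  proof (cases "\<forall>i\<in>B. 0 < y i \<and> y i \<le> 1/2")
    case True
    define x where "x = glue B y (z(j := 1/2))"
    have x: "x \<in> half_box d X" "x 1 = x1" using glue_half_box[OF z' B True] by (simp_all add: x_def)
    have xo: "x \<in> open_box d X" using x half_box_subset by blast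
    have g: "glue ?J (y(j := t)) z = x(j := t)" for t using j by (auto simp: x_def glue_def)
    have xj: "x(j := 1/2) = x" using j by (auto simp: x_def glue_def)
    have xt: "x(j := t) \<in> half_box d X" "(x(j := t)) 1 = x1" if "0 < t" "t \<le> 1/2" for t
      using x that j by (auto simp: half_box_def)
    obtain C1 where C1: "\<And>x. x \<in> half_box d X \<Longrightarrow> x 1 = x1 \<Longrightarrow> norm (G r x) \<le> C1" using bound by blast
    obtain C2 where C2: "\<And>x. x \<in> half_box d X \<Longrightarrow> x 1 = x1 \<Longrightarrow> norm (G ?r x) \<le> C2" using bound by blast
    have "f1 (y(j := t)) + f2 (y(j := t)) / (?c + 1)
        = box_weight B e y * (half_powr ?c t * G r (x(j := t)) + half_powr (?c + 1) t * G ?r (x(j := t)) / (?c + 1))" for t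
      unfolding f1_def f2_def g box_weight_insert[OF fin j(2)] we by (simp add: field_simps)
    moreover have "(LINT t|lborel. half_powr ?c t * G r (x(j := t)) + half_powr (?c + 1) t * G ?r (x(j := t)) / (?c + 1))
        = (1/2) powr (?c + 1) / (?c + 1) * G r (x(j := 1/2))"
    proof (rule half_powr_by_parts[OF c, where C = "max C1 C2"])
      show "((\<lambda>t. G r (x(j := t))) has_vector_derivative G ?r (x(j := t))) (at t)" if "0 < t" "t < 1" for t
        using deriv[OF j(1) open_box_upd[OF xo j(1) that], of r] by simp
      have "continuous_on {0<..<1} (\<lambda>t. x(j := t))"
      proof (rule continuous_on_coordinatewise_then_product)
        show "continuous_on {0<..<1} (\<lambda>t. (x(j := t)) i)" for i
          by (cases "i = j") (simp_all add: continuous_on_id)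
      qed
      then show "continuous_on {0<..<1} (\<lambda>t. G ?r (x(j := t)))"
        by (rule continuous_on_compose2[OF cont]) (rule image_subsetI, rule open_box_upd[OF xo j(1)], simp_all)
      show "norm (G r (x(j := t))) \<le> max C1 C2" if "0 < t" "t \<le> 1/2" for t
        by (rule order.trans[OF C1[OF xt[OF that]] max.cobounded1])
      show "norm (G ?r (x(j := t))) \<le> max C1 C2" if "0 < t" "t \<le> 1/2" for t
        by (rule order.trans[OF C2[OF xt[OF that]] max.cobounded2])
    qed
    ultimately show ?thesis unfolding xj by (simp add: x_def)
  next
    case False
    then obtain i where i: "i \<in> B" "\<not> (0 < y i \<and> y i \<le> 1/2)" by blast
    then have "box_weight B e y = 0" by (intro box_weight_eq_0[where y = y and j = i] fin)
    then show ?thesis unfolding f1_def f2_def box_weight_insert[OF fin j(2)] we by simp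
  qed
  have "(LINT y|Pi\<^sub>M ?J (\<lambda>_. lborel). f1 y + f2 y / (?c + 1))
      = (LINT y|Pi\<^sub>M B (\<lambda>_. lborel). LINT t|lborel. f1 (y(j := t)) + f2 (y(j := t)) / (?c + 1))"
    by (rule lborel_product.product_integral_insert[OF fin j(2)])
       (intro Bochner_Integration.integrable_add i1 integrable_divide i2)
  also have "\<dots> = (1/2) powr (?c + 1) / (?c + 1) *
        (LINT y|Pi\<^sub>M B (\<lambda>_. lborel). box_weight B e y * G r (glue B y (z(j := 1/2))))"
    unfolding inner by simp
  finally have "(LINT y|Pi\<^sub>M ?J (\<lambda>_. lborel). f1 y) + (LINT y|Pi\<^sub>M ?J (\<lambda>_. lborel). f2 y) / (?c + 1) = \<dots>"
    using i1 i2 by (subst (asm) Bochner_Integration.integral_add) simp_all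
  then show ?thesis unfolding f1_def f2_def by (simp add: eq_diff_eq)
qed

text \<open>The denominators \<open>e j + 1\<close>, \<open>e j + 2\<close>, ... of successive steps
  accumulate to the Pochhammer symbol, and each step contributes a sign.\<close>

lemma by_parts:
  assumes B: "B \<subseteq> {2..d}" and j: "j \<in> {2..d}" "j \<notin> B" and z: "base (insert j B) z"
    and e: "\<And>i. i \<in> insert j B \<Longrightarrow> Re (e i) > -1"
  shows "(LINT y|Pi\<^sub>M (insert j B) (\<lambda>_. lborel). box_weight (insert j B) e y * G r (glue (insert j B) y z))
    = (\<Sum>k<N. (-1) ^ k * inverse (pochhammer (e j + 1) (k + 1)) * (1/2) powr (e j + of_nat k + 1) *
        (LINT y|Pi\<^sub>M B (\<lambda>_. lborel). box_weight B e y * G (r(j := r j + k)) (glue B y (z(j := 1/2)))))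
      + (-1) ^ N * inverse (pochhammer (e j + 1) N) * (LINT y|Pi\<^sub>M (insert j B) (\<lambda>_. lborel).
          box_weight (insert j B) (e(j := e j + of_nat N)) y * G (r(j := r j + N)) (glue (insert j B) y z))"
proof (induction N)
  case (Suc N)
  let ?e = "e(j := e j + of_nat N)" and ?r = "r(j := r j + N)"
  have e2: "Re (?e i) > -1" if "i \<in> insert j B" for i
    using e[OF that] by (cases "i = j") simp_all
  have w: "box_weight B ?e = box_weight B e" by (intro box_weight_cong fun_upd_other) (use j in blast)
  have eN: "e j + of_nat (Suc N) = e j + of_nat N + 1" "r j + Suc N = Suc (r j + N)"
    by (simp_all only: of_nat_Suc add.assoc add.commute[of 1] add_Suc_right)
  define A where "A = (LINT y|Pi\<^sub>M B (\<lambda>_. lborel). box_weight B e y * G ?r (glue B y (z(j := 1/2))))"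
  define D where "D = (LINT y|Pi\<^sub>M (insert j B) (\<lambda>_. lborel).
          box_weight (insert j B) (e(j := e j + of_nat N + 1)) y * G (r(j := Suc (r j + N))) (glue (insert j B) y z))"
  have step: "(LINT y|Pi\<^sub>M (insert j B) (\<lambda>_. lborel). box_weight (insert j B) ?e y * G ?r (glue (insert j B) y z))
     = (1/2) powr (e j + of_nat N + 1) / (e j + of_nat N + 1) * A - 1 / (e j + of_nat N + 1) * D"
    using by_parts_step[where e = ?e and r = ?r, OF B j z e2] unfolding fun_upd_same fun_upd_upd w A_def D_def .
  have p: "pochhammer (e j + 1) (N + 1) = pochhammer (e j + 1) N * (e j + of_nat N + 1)"
    "pochhammer (e j + 1) (Suc N) = pochhammer (e j + 1) N * (e j + of_nat N + 1)"
    unfolding Suc_eq_plus1[symmetric] pochhammer_Suc by (simp_all only: add.assoc add.commute[of 1])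
  have "(-1) ^ N * inverse (pochhammer (e j + 1) N) * ((1/2) powr (e j + of_nat N + 1) / (e j + of_nat N + 1) * A - 1 / (e j + of_nat N + 1) * D)
      = (-1) ^ N * inverse (pochhammer (e j + 1) (N + 1)) * (1/2) powr (e j + of_nat N + 1) * A
        + (-1) ^ Suc N * inverse (pochhammer (e j + 1) (Suc N)) * D"
    unfolding p power_Suc by (rule by_parts_algebra)
  then show ?case
    unfolding Suc.IH step sum.lessThan_Suc eN A_def[symmetric] D_def[symmetric] by (simp only: add.assoc)
qed simp

text \<open>\<open>B\<close> contains the variables still to be expanded and \<open>C\<close> those
  whose integral has already been kept. Expanding \<open>j\<close> either freezes it at 1/2 or
  transfers it to \<open>C\<close> with raised exponent and order; the induction therefore varies
  \<open>C\<close>, \<open>r\<close>, \<open>z\<close> and \<open>e\<close> together.\<close>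

lemma expansion:
  fixes n :: "nat \<Rightarrow> nat"
  defines "tp \<equiv> \<lambda>B q. {j\<in>B. q j = n j + 1}"
  assumes "finite B" "B \<subseteq> {2..d}" "C \<subseteq> {2..d}" "B \<inter> C = {}" "base (B \<union> C) z"
    and "\<And>i. i \<in> B \<union> C \<Longrightarrow> Re (e i) > -1"
  shows "(LINT y|Pi\<^sub>M (B \<union> C) (\<lambda>_. lborel). box_weight (B \<union> C) e y * G r (glue (B \<union> C) y z))
    = (\<Sum>q\<in>Pi\<^sub>E B (\<lambda>j. {0..n j + 1}). (\<Prod>j\<in>B. bdry_coeff (e j) (n j) (q j)) *
        (LINT y|Pi\<^sub>M (tp B q \<union> C) (\<lambda>_. lborel).
           box_weight (tp B q \<union> C) (\<lambda>i. if i \<in> B then e i + of_nat (n i) + 1 else e i) y *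
           G (\<lambda>i. if i \<in> B then r i + q i else r i)
             (glue (tp B q \<union> C) y (\<lambda>i. if i \<in> B - tp B q then 1/2 else z i))))"
  using assms(2-)
proof (induction B arbitrary: C r z e rule: finite_induct)
  case empty
  then show ?case by (simp add: tp_def)
next
  case (insert j B)
  let ?B = "insert j B" and ?F = "\<lambda>j. {0..n j + 1}"
  define T where "T q = (\<Prod>j\<in>?B. bdry_coeff (e j) (n j) (q j)) *
        (LINT y|Pi\<^sub>M (tp ?B q \<union> C) (\<lambda>_. lborel).
           box_weight (tp ?B q \<union> C) (\<lambda>i. if i \<in> ?B then e i + of_nat (n i) + 1 else e i) y *
           G (\<lambda>i. if i \<in> ?B then r i + q i else r i)
             (glue (tp ?B q \<union> C) y (\<lambda>i. if i \<in> ?B - tp ?B q then 1/2 else z i)))" for q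
  have j: "j \<in> {2..d}" "j \<notin> B \<union> C" and BC: "B \<union> C \<subseteq> {2..d}" using insert by auto
  have U: "?B \<union> C = insert j (B \<union> C)" "B \<union> insert j C = insert j (B \<union> C)" by auto
  have z: "base (insert j (B \<union> C)) z" using insert.prems(4) by (simp add: U)
  have e: "Re (e i) > -1" if "i \<in> insert j (B \<union> C)" for i using insert.prems(5) that by auto
  have prodB: "(\<Prod>i\<in>?B. bdry_coeff (e i) (n i) ((q(j := k)) i)) = bdry_coeff (e j) (n j) k * (\<Prod>i\<in>B. bdry_coeff (e i) (n i) (q i))" for q k
    using insert.hyps by (subst prod.insert) (auto intro!: prod.cong)
  \<comment> \<open>Boundary terms: after \<open>k\<close> steps the variable leaves the integral,
    so 1/2 is written into the base point and \<open>k\<close> into the order of the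
    derivative.\<close>
  have low: "(-1) ^ k * inverse (pochhammer (e j + 1) (k + 1)) * (1/2) powr (e j + of_nat k + 1) *
        (LINT y|Pi\<^sub>M (B \<union> C) (\<lambda>_. lborel). box_weight (B \<union> C) e y * G (r(j := r j + k)) (glue (B \<union> C) y (z(j := 1/2))))
      = (\<Sum>q\<in>Pi\<^sub>E B ?F. T (q(j := k)))" if k: "k \<le> n j" for k
  proof -
    have z': "base (B \<union> C) (z(j := 1/2))" using z j unfolding base_def by auto
    have bc: "bdry_coeff (e j) (n j) k = (-1) ^ k * inverse (pochhammer (e j + 1) (k + 1)) * (1/2) powr (e j + of_nat k + 1)"
      using k by (simp add: bdry_coeff_def)
    have IH: "(LINT y|Pi\<^sub>M (B \<union> C) (\<lambda>_. lborel). box_weight (B \<union> C) e y * G (r(j := r j + k)) (glue (B \<union> C) y (z(j := 1/2))))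
     = (\<Sum>q\<in>Pi\<^sub>E B ?F. (\<Prod>j\<in>B. bdry_coeff (e j) (n j) (q j)) *
        (LINT y|Pi\<^sub>M (tp B q \<union> C) (\<lambda>_. lborel).
           box_weight (tp B q \<union> C) (\<lambda>i. if i \<in> B then e i + of_nat (n i) + 1 else e i) y *
           G (\<lambda>i. if i \<in> B then (r(j := r j + k)) i + q i else (r(j := r j + k)) i)
             (glue (tp B q \<union> C) y (\<lambda>i. if i \<in> B - tp B q then 1/2 else (z(j := 1/2)) i))))"
      using insert.prems e by (intro insert.IH z') auto
    have "T (q(j := k)) = bdry_coeff (e j) (n j) k * ((\<Prod>j\<in>B. bdry_coeff (e j) (n j) (q j)) *
        (LINT y|Pi\<^sub>M (tp B q \<union> C) (\<lambda>_. lborel).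
           box_weight (tp B q \<union> C) (\<lambda>i. if i \<in> B then e i + of_nat (n i) + 1 else e i) y *
           G (\<lambda>i. if i \<in> B then (r(j := r j + k)) i + q i else (r(j := r j + k)) i)
             (glue (tp B q \<union> C) y (\<lambda>i. if i \<in> B - tp B q then 1/2 else (z(j := 1/2)) i))))" for q
    proof -
      have t: "tp ?B (q(j := k)) = tp B q" using k insert.hyps by (auto simp: tp_def)
      have w: "box_weight (tp B q \<union> C) (\<lambda>i. if i \<in> ?B then e i + of_nat (n i) + 1 else e i)
             = box_weight (tp B q \<union> C) (\<lambda>i. if i \<in> B then e i + of_nat (n i) + 1 else e i)"
        by (rule box_weight_cong) (use j in \<open>auto simp: tp_def\<close>)
      have g: "(\<lambda>i. if i \<in> ?B then r i + (q(j := k)) i else r i) = (\<lambda>i. if i \<in> B then (r(j := r j + k)) i + q i else (r(j := r j + k)) i)"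
        using insert.hyps by (auto simp: fun_eq_iff)
      have zz: "(\<lambda>i. if i \<in> ?B - tp B q then 1/2 else z i) = (\<lambda>i. if i \<in> B - tp B q then 1/2 else (z(j := 1/2)) i)"
        using insert.hyps by (auto simp: fun_eq_iff tp_def)
      show ?thesis unfolding T_def t w g zz prodB by (simp only: mult.assoc)
    qed
    then show ?thesis unfolding IH bc[symmetric] sum_distrib_left by simp
  qed
  \<comment> \<open>The surviving integral after \<open>n j + 1\<close> steps: \<open>j\<close>
    joins \<open>C\<close> with exponent and order already updated, and the induction hypothesis for
    \<open>B\<close> leaves both alone.\<close>
  have high: "(-1) ^ (n j + 1) * inverse (pochhammer (e j + 1) (n j + 1)) * (LINT y|Pi\<^sub>M (insert j (B \<union> C)) (\<lambda>_. lborel).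
          box_weight (insert j (B \<union> C)) (e(j := e j + of_nat (n j + 1))) y * G (r(j := r j + (n j + 1))) (glue (insert j (B \<union> C)) y z))
      = (\<Sum>q\<in>Pi\<^sub>E B ?F. T (q(j := n j + 1)))"
  proof -
    let ?e = "e(j := e j + of_nat (n j + 1))" and ?r = "r(j := r j + (n j + 1))"
    have bc: "bdry_coeff (e j) (n j) (n j + 1) = (-1) ^ (n j + 1) * inverse (pochhammer (e j + 1) (n j + 1))"
      by (simp add: bdry_coeff_def)
    have e2: "Re (?e i) > -1" if "i \<in> insert j (B \<union> C)" for i
      using e[OF that] by (cases "i = j") simp_all
    have IH: "(LINT y|Pi\<^sub>M (B \<union> insert j C) (\<lambda>_. lborel). box_weight (B \<union> insert j C) ?e y * G ?r (glue (B \<union> insert j C) y z))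
     = (\<Sum>q\<in>Pi\<^sub>E B ?F. (\<Prod>j\<in>B. bdry_coeff (?e j) (n j) (q j)) *
        (LINT y|Pi\<^sub>M (tp B q \<union> insert j C) (\<lambda>_. lborel).
           box_weight (tp B q \<union> insert j C) (\<lambda>i. if i \<in> B then ?e i + of_nat (n i) + 1 else ?e i) y *
           G (\<lambda>i. if i \<in> B then ?r i + q i else ?r i)
             (glue (tp B q \<union> insert j C) y (\<lambda>i. if i \<in> B - tp B q then 1/2 else z i))))"
    proof (rule insert.IH)
      show "base (B \<union> insert j C) z" unfolding U by (rule z)
      show "Re (?e i) > -1" if "i \<in> B \<union> insert j C" for i using e2 that by blast
    qed (use insert.prems insert.hyps j in auto)
    have "T (q(j := n j + 1)) = bdry_coeff (e j) (n j) (n j + 1) * ((\<Prod>j\<in>B. bdry_coeff (?e j) (n j) (q j)) *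
        (LINT y|Pi\<^sub>M (tp B q \<union> insert j C) (\<lambda>_. lborel).
           box_weight (tp B q \<union> insert j C) (\<lambda>i. if i \<in> B then ?e i + of_nat (n i) + 1 else ?e i) y *
           G (\<lambda>i. if i \<in> B then ?r i + q i else ?r i)
             (glue (tp B q \<union> insert j C) y (\<lambda>i. if i \<in> B - tp B q then 1/2 else z i))))" for q
    proof -
      have t: "tp ?B (q(j := n j + 1)) \<union> C = tp B q \<union> insert j C" using insert.hyps by (auto simp: tp_def)
      have w: "box_weight (tp B q \<union> insert j C) (\<lambda>i. if i \<in> ?B then e i + of_nat (n i) + 1 else e i)
             = box_weight (tp B q \<union> insert j C) (\<lambda>i. if i \<in> B then ?e i + of_nat (n i) + 1 else ?e i)"
        by (rule box_weight_cong) (use j insert.hyps in \<open>auto simp: tp_def add_ac\<close>)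
      have g: "(\<lambda>i. if i \<in> ?B then r i + (q(j := n j + 1)) i else r i) = (\<lambda>i. if i \<in> B then ?r i + q i else ?r i)"
        using insert.hyps by (auto simp: fun_eq_iff)
      have zz: "(\<lambda>i. if i \<in> ?B - tp ?B (q(j := n j + 1)) then 1/2 else z i) = (\<lambda>i. if i \<in> B - tp B q then 1/2 else z i)"
        using insert.hyps by (auto simp: fun_eq_iff tp_def)
      have pe: "(\<Prod>j\<in>B. bdry_coeff (?e j) (n j) (q j)) = (\<Prod>j\<in>B. bdry_coeff (e j) (n j) (q j))"
        by (rule prod.cong) (use insert.hyps in auto)
      show ?thesis unfolding T_def t w g zz prodB pe by (simp only: mult.assoc)
    qed
    then show ?thesis unfolding IH[unfolded U] bc[symmetric] sum_distrib_left by simp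
  qed
  have "(LINT y|Pi\<^sub>M (?B \<union> C) (\<lambda>_. lborel). box_weight (?B \<union> C) e y * G r (glue (?B \<union> C) y z))
     = (\<Sum>k<n j + 1. \<Sum>q\<in>Pi\<^sub>E B ?F. T (q(j := k))) + (\<Sum>q\<in>Pi\<^sub>E B ?F. T (q(j := n j + 1)))"
  proof -
    have S: "(\<Sum>k<n j + 1. \<Sum>q\<in>Pi\<^sub>E B ?F. T (q(j := k))) = (\<Sum>k<n j + 1.
        (-1) ^ k * inverse (pochhammer (e j + 1) (k + 1)) * (1/2) powr (e j + of_nat k + 1) *
        (LINT y|Pi\<^sub>M (B \<union> C) (\<lambda>_. lborel). box_weight (B \<union> C) e y * G (r(j := r j + k)) (glue (B \<union> C) y (z(j := 1/2)))))"
      by (rule sum.cong[OF refl low[symmetric]]) simp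
    show ?thesis unfolding U high[symmetric] S
      by (rule by_parts[where e = e and r = r and N = "n j + 1", OF BC j z e])
  qed
  also have "\<dots> = (\<Sum>k\<in>?F j. \<Sum>q\<in>Pi\<^sub>E B ?F. T (q(j := k)))"
  proof -
    have "?F j = insert (n j + 1) {..<n j + 1}" by auto
    then show ?thesis by (simp add: add.commute)
  qed
  also have "\<dots> = (\<Sum>q\<in>Pi\<^sub>E ?B ?F. T q)"
    by (rule sum_PiE_insert[OF insert.hyps, symmetric])
  finally show ?case unfolding T_def .
qed

end

section \<open>The finite sum over shuffles\<close>

text \<open>A shuffle is determined by the image of \<open>{2..m}\<close>, and every subset of \<open>{2..d}\<close> is such an image.\<close>
definition shuffles_upto :: "nat \<Rightarrow> nat \<Rightarrow> (nat \<Rightarrow> nat) set"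
  where "shuffles_upto d m = {\<sigma>. \<sigma> permutes {2..d} \<and> strict_mono_on {2..m} \<sigma> \<and> strict_mono_on {m+1..d} \<sigma>}"

text \<open>Both maps list the same finite set in increasing order.\<close>

lemma strict_mono_on_image_unique:
  fixes \<sigma> \<tau> :: "nat \<Rightarrow> nat"
  assumes "strict_mono_on {a..b} \<sigma>" "strict_mono_on {a..b} \<tau>" "\<sigma> ` {a..b} = \<tau> ` {a..b}" "i \<in> {a..b}"
  shows "\<sigma> i = \<tau> i"
proof -
  have s: "sorted_wrt (<) (map f [a..<b+1])" if "strict_mono_on {a..b} f" for f :: "nat \<Rightarrow> nat"
    unfolding sorted_wrt_map
    by (rule sorted_wrt_mono_rel[OF _ sorted_wrt_upt]) (use that in \<open>auto simp: strict_mono_on_def\<close>)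
  have S: "set [a..<b+1] = {a..b}" unfolding set_upt by auto
  have "map \<sigma> [a..<b+1] = map \<tau> [a..<b+1]"
    by (intro strict_sorted_equal s assms(1,2)) (simp only: set_map S assms(3))
  then show ?thesis using assms(4) unfolding map_eq_conv S by blast
qed

lemma shuffles_unique:
  assumes "\<sigma> \<in> shuffles_upto d m" "\<tau> \<in> shuffles_upto d m" "m \<in> {1..d}" "\<sigma> ` {2..m} = \<tau> ` {2..m}"
  shows "\<sigma> = \<tau>"
proof
  fix i
  have s: "\<sigma> permutes {2..d}" "strict_mono_on {2..m} \<sigma>" "strict_mono_on {m+1..d} \<sigma>"
    and t: "\<tau> permutes {2..d}" "strict_mono_on {2..m} \<tau>" "strict_mono_on {m+1..d} \<tau>"
    using assms(1,2) by (auto simp: shuffles_upto_def)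
  have J: "{m+1..d} = {2..d} - {2..m}" using assms(3) by auto
  have "\<sigma> ` {m+1..d} = {2..d} - \<sigma> ` {2..m}" "\<tau> ` {m+1..d} = {2..d} - \<tau> ` {2..m}"
    unfolding J using s(1) t(1) by (simp_all add: image_set_diff permutes_inj permutes_image)
  then have "\<sigma> ` {m+1..d} = \<tau> ` {m+1..d}" using assms(4) by simp
  then show "\<sigma> i = \<tau> i"
    using strict_mono_on_image_unique[OF s(2) t(2) assms(4), of i] strict_mono_on_image_unique[OF s(3) t(3), of i]
      permutes_not_in[OF s(1), of i] permutes_not_in[OF t(1), of i] by (cases "i \<in> {2..d}"; cases "i \<le> m") auto
qed

text \<open>The increasing list of \<open>A\<close> followed by the increasing list of its
  complement is the required shuffle, with \<open>m - 1\<close> the size of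
  \<open>A\<close>.\<close>

lemma shuffle_exists:
  assumes "A \<subseteq> {2..d}" "d \<ge> 1"
  shows "\<exists>m\<in>{1..d}. \<exists>\<sigma>\<in>shuffles_upto d m. \<sigma> ` {2..m} = A"
proof -
  define m where "m = card A + 1"
  define xs where "xs = sorted_list_of_set A"
  define ys where "ys = sorted_list_of_set ({2..d} - A)"
  define zs where "zs = xs @ ys"
  \<comment> \<open>Variables start at 2 and lists at 0, hence \<open>i - 2\<close>. Outside
    \<open>{2..d}\<close> the identity is forced by \<open>permutes\<close>.\<close>
  define \<sigma> where "\<sigma> i = (if i \<in> {2..d} then zs ! (i - 2) else i)" for i
  have fin: "finite A" using assms(1) finite_subset by blast
  have cA: "card A \<le> d - 1" using card_mono[OF _ assms(1)] by simp
  have lx: "length xs = m - 1" and sx: "set xs = A" using fin by (simp_all add: xs_def m_def)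
  have ly: "length ys = d - m" and sy: "set ys = {2..d} - A"
    using fin assms by (simp_all add: ys_def m_def card_Diff_subset)
  have m: "m \<in> {1..d}" using cA assms(2) by (auto simp: m_def)
  have lz: "length zs = d - 1" using lx ly m by (auto simp: zs_def)
  have sz: "set zs = {2..d}" using sx sy assms(1) by (auto simp: zs_def)
  have dz: "distinct zs" unfolding zs_def using sx sy by (auto simp: xs_def ys_def)
  have "bij_betw (\<lambda>i. i - 2) {2..d} {..<d - 1}"
    by (rule bij_betw_byWitness[where f' = "\<lambda>i. i + 2"]) auto
  from bij_betw_trans[OF this bij_betw_nth[OF dz]] have "bij_betw (\<lambda>i. zs ! (i - 2)) {2..d} {2..d}"
    using lz sz by (auto simp: o_def)
  then have "bij_betw \<sigma> {2..d} {2..d}" by (rule bij_betw_cong[THEN iffD1, rotated]) (simp add: \<sigma>_def)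
  then have p: "\<sigma> permutes {2..d}" by (rule bij_imp_permutes) (auto simp: \<sigma>_def)
  have s1: "\<sigma> i = xs ! (i - 2)" if "i \<in> {2..m}" for i
    using that m lx by (auto simp: \<sigma>_def zs_def nth_append)
  have s2: "\<sigma> i = ys ! (i - m - 1)" if "i \<in> {m+1..d}" for i
  proof -
    have "i - 2 - (m - 1) = i - m - 1" using that m by auto
    then show ?thesis using that m lx by (auto simp: \<sigma>_def zs_def nth_append)
  qed
  have "strict_mono_on {2..m} \<sigma>"
  proof (rule strict_mono_onI)
    fix i j assume ij: "i \<in> {2..m}" "j \<in> {2..m}" "i < j"
    have "sorted_wrt (<) xs" by (simp add: xs_def)
    then have "xs ! (i - 2) < xs ! (j - 2)" by (rule sorted_wrt_nth_less) (use ij lx in auto)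
    then show "\<sigma> i < \<sigma> j" using s1 ij by simp
  qed
  moreover have "strict_mono_on {m+1..d} \<sigma>"
  proof (rule strict_mono_onI)
    fix i j assume ij: "i \<in> {m+1..d}" "j \<in> {m+1..d}" "i < j"
    have "sorted_wrt (<) ys" by (simp add: ys_def)
    then have "ys ! (i - m - 1) < ys ! (j - m - 1)" by (rule sorted_wrt_nth_less) (use ij ly in auto)
    then show "\<sigma> i < \<sigma> j" using s2 ij by simp
  qed
  moreover have "\<sigma> ` {2..m} = A"
  proof -
    have "\<sigma> ` {2..m} = (\<lambda>i. xs ! (i - 2)) ` {2..m}" by (rule image_cong[OF refl s1])
    also have "\<dots> = (\<lambda>k. xs ! k) ` ((\<lambda>i. i - 2) ` {2..m})" by (simp add: image_image)
    also have "(\<lambda>i. i - 2) ` {2..m} = {..<length xs}"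
    proof (intro equalityI subsetI)
      fix k assume "k \<in> {..<length xs}"
      then show "k \<in> (\<lambda>i. i - 2) ` {2..m}" using lx by (intro image_eqI[of _ _ "k + 2"]) auto
    qed (use lx in auto)
    finally show ?thesis using sx by (auto simp: set_conv_nth)
  qed
  ultimately show ?thesis using m p by (auto simp: shuffles_upto_def)
qed

lemma sum_shuffles:
  fixes H :: "nat set \<Rightarrow> 'a::comm_monoid_add"
  assumes "d \<ge> 1"
  shows "(\<Sum>m=1..d. \<Sum>\<sigma>\<in>shuffles_upto d m. H (\<sigma> ` {2..m})) = (\<Sum>A\<in>Pow {2..d}. H A)"
proof -
  have fin: "finite (shuffles_upto d m)" for m
    by (rule finite_subset[OF _ finite_permutations[of "{2..d}"]]) (auto simp: shuffles_upto_def)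
  have card: "card (\<sigma> ` {2..m}) = m - 1" if "\<sigma> \<in> shuffles_upto d m" for \<sigma> m
    using that permutes_inj[of \<sigma>] by (subst card_image) (auto simp: shuffles_upto_def intro: inj_on_subset)
  have "bij_betw (\<lambda>(m, \<sigma>). \<sigma> ` {2..m}) (Sigma {1..d} (shuffles_upto d)) (Pow {2..d})"
  proof (rule bij_betw_imageI)
    show "inj_on (\<lambda>(m, \<sigma>). \<sigma> ` {2..m}) (Sigma {1..d} (shuffles_upto d))"
    proof (rule inj_onI, clarify)
      fix m1 \<sigma>1 m2 \<sigma>2
      assume 1: "m1 \<in> {1..d}" "\<sigma>1 \<in> shuffles_upto d m1" and 2: "m2 \<in> {1..d}" "\<sigma>2 \<in> shuffles_upto d m2"
        and eq: "\<sigma>1 ` {2..m1} = \<sigma>2 ` {2..m2}"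
      have "m1 - 1 = m2 - 1" using card[OF 1(2)] card[OF 2(2)] eq by simp
      then have m: "m1 = m2" using 1(1) 2(1) by auto
      then show "m1 = m2 \<and> \<sigma>1 = \<sigma>2" using shuffles_unique[OF 1(2)] 2 1(1) eq by simp
    qed
    have sub: "\<sigma> ` {2..m} \<subseteq> {2..d}" if "\<sigma> \<in> shuffles_upto d m" "m \<in> {1..d}" for \<sigma> m
    proof -
      have "\<sigma> ` {2..m} \<subseteq> \<sigma> ` {2..d}" using that(2) by (intro image_mono) auto
      then show ?thesis using that(1) permutes_image[of \<sigma> "{2..d}"] by (simp add: shuffles_upto_def)
    qed
    show "(\<lambda>(m, \<sigma>). \<sigma> ` {2..m}) ` Sigma {1..d} (shuffles_upto d) = Pow {2..d}"
    proof (intro equalityI subsetI)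
      fix A assume "A \<in> Pow {2..d}"
      then obtain m \<sigma> where "m \<in> {1..d}" "\<sigma> \<in> shuffles_upto d m" "\<sigma> ` {2..m} = A"
        using shuffle_exists[OF _ assms, of A] by auto
      then show "A \<in> (\<lambda>(m, \<sigma>). \<sigma> ` {2..m}) ` Sigma {1..d} (shuffles_upto d)"
        by (intro image_eqI[of _ _ "(m, \<sigma>)"]) auto
    qed (use sub in fastforce)
  qed
  from sum.reindex_bij_betw[OF this, of H] show ?thesis
    by (subst sum.Sigma) (use fin in \<open>auto simp: case_prod_unfold\<close>)
qed

text \<open>A set \<open>A\<close> with exponents on it is one function \<open>q\<close> on
  \<open>J\<close>: the value \<open>n j + 1\<close>, just beyond the admissible exponents, encodes
  that \<open>j\<close> lies outside \<open>A\<close>.\<close>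

lemma sum_Pow_PiE:
  fixes n :: "nat \<Rightarrow> nat" and T :: "nat set \<Rightarrow> (nat \<Rightarrow> nat) \<Rightarrow> 'a::comm_monoid_add"
  assumes "finite J"
  shows "(\<Sum>A\<in>Pow J. \<Sum>k\<in>Pi\<^sub>E A (\<lambda>j. {0..n j}). T A k)
       = (\<Sum>q\<in>Pi\<^sub>E J (\<lambda>j. {0..n j + 1}). T {j\<in>J. q j \<le> n j} (restrict q {j\<in>J. q j \<le> n j}))"
proof -
  have "(\<Sum>A\<in>Pow J. \<Sum>k\<in>Pi\<^sub>E A (\<lambda>j. {0..n j}). T A k) = (\<Sum>(A, k)\<in>Sigma (Pow J) (\<lambda>A. Pi\<^sub>E A (\<lambda>j. {0..n j})). T A k)"
    using assms by (intro sum.Sigma) (auto intro!: finite_PiE dest: finite_subset)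
  also have "\<dots> = (\<Sum>q\<in>Pi\<^sub>E J (\<lambda>j. {0..n j + 1}). T {j\<in>J. q j \<le> n j} (restrict q {j\<in>J. q j \<le> n j}))"
  proof (rule sum.reindex_bij_witness[where i = "\<lambda>q. ({j\<in>J. q j \<le> n j}, restrict q {j\<in>J. q j \<le> n j})"
       and j = "\<lambda>(A, k). (\<lambda>j\<in>J. if j \<in> A then k j else n j + 1)"])
    fix p assume p: "p \<in> Sigma (Pow J) (\<lambda>A. Pi\<^sub>E A (\<lambda>j. {0..n j}))"
    obtain A k where Ak: "p = (A, k)" "A \<subseteq> J" "k \<in> Pi\<^sub>E A (\<lambda>j. {0..n j})" using p by auto
    have kn: "k j \<le> n j" if "j \<in> A" for j using PiE_mem[OF Ak(3) that] by simp
    define q where "q = (\<lambda>j\<in>J. if j \<in> A then k j else n j + 1)"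
    have A: "{j\<in>J. q j \<le> n j} = A" using Ak(2) kn by (auto simp: q_def split: if_splits)
    have r: "restrict q A = k" using Ak(2) PiE_arb[OF Ak(3)] by (auto simp: q_def restrict_def fun_eq_iff)
    show "(case p of (A, k) \<Rightarrow> \<lambda>j\<in>J. if j \<in> A then k j else n j + 1) \<in> Pi\<^sub>E J (\<lambda>j. {0..n j + 1})"
      unfolding Ak(1) using kn by (auto intro!: le_SucI)
    show "({j\<in>J. (case p of (A, k) \<Rightarrow> \<lambda>j\<in>J. if j \<in> A then k j else n j + 1) j \<le> n j},
        restrict (case p of (A, k) \<Rightarrow> \<lambda>j\<in>J. if j \<in> A then k j else n j + 1)
          {j\<in>J. (case p of (A, k) \<Rightarrow> \<lambda>j\<in>J. if j \<in> A then k j else n j + 1) j \<le> n j}) = p"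
      unfolding Ak(1) prod.case q_def[symmetric] A r ..
    show "T {j\<in>J. (case p of (A, k) \<Rightarrow> \<lambda>j\<in>J. if j \<in> A then k j else n j + 1) j \<le> n j}
        (restrict (case p of (A, k) \<Rightarrow> \<lambda>j\<in>J. if j \<in> A then k j else n j + 1)
          {j\<in>J. (case p of (A, k) \<Rightarrow> \<lambda>j\<in>J. if j \<in> A then k j else n j + 1) j \<le> n j}) = (case p of (A, k) \<Rightarrow> T A k)"
      unfolding Ak(1) prod.case q_def[symmetric] A r ..
  next
    fix q assume q: "q \<in> Pi\<^sub>E J (\<lambda>j. {0..n j + 1})"
    show "({j\<in>J. q j \<le> n j}, restrict q {j\<in>J. q j \<le> n j}) \<in> Sigma (Pow J) (\<lambda>A. Pi\<^sub>E A (\<lambda>j. {0..n j}))"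
      by auto
    have "(\<lambda>j\<in>J. if j \<in> {j\<in>J. q j \<le> n j} then restrict q {j\<in>J. q j \<le> n j} j else n j + 1) j = q j" for j
    proof (cases "j \<in> J")
      case True
      then have "q j \<le> n j + 1" using PiE_mem[OF q True] by simp
      then show ?thesis using True by auto
    next
      case False then show ?thesis using PiE_arb[OF q False] by simp
    qed
    then show "(case ({j\<in>J. q j \<le> n j}, restrict q {j\<in>J. q j \<le> n j}) of (A, k) \<Rightarrow> \<lambda>j\<in>J. if j \<in> A then k j else n j + 1) = q"
      unfolding prod.case by (rule ext)
  qed
  finally show ?thesis .
qed

section \<open>Normal form of \<open>ez_F\<close>\<close>

definition top_indices :: "nat \<Rightarrow> (nat \<Rightarrow> nat) \<Rightarrow> (nat \<Rightarrow> nat) \<Rightarrow> nat set"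
  where "top_indices d n q = {j\<in>{2..d}. q j = n j + 1}"

text \<open>The default \<open>undefined\<close> is the value an extensional point takes outside its
  index set; with it the glued point is literally the argument occurring in
  \<open>ez_F\<close>.\<close>

definition eval_point :: "real \<Rightarrow> nat set \<Rightarrow> nat \<Rightarrow> real"
  where "eval_point x1 A = (\<lambda>i. if i = 1 then x1 else if i \<in> A then 1/2 else undefined)"

definition F_term :: "nat \<Rightarrow> (nat \<Rightarrow> nat) \<Rightarrow> (nat \<Rightarrow> complex) \<Rightarrow> ((nat \<Rightarrow> real) \<Rightarrow> complex) \<Rightarrow> (nat \<Rightarrow> nat) \<Rightarrow> real \<Rightarrow> complex"
  where "F_term d n u g q x1 = (LINT y|Pi\<^sub>M (top_indices d n q) (\<lambda>_. lborel).
     box_weight (top_indices d n q) (\<lambda>j. u j + of_nat (n j) + 1) y *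
     mixed_deriv d q g (glue (top_indices d n q) y (eval_point x1 ({2..d} - top_indices d n q))))"

lemma mixed_deriv_cong: "(\<And>j. j \<in> {2..d} \<Longrightarrow> r j = r' j) \<Longrightarrow> mixed_deriv d r g = mixed_deriv d r' g"
proof -
  assume "\<And>j. j \<in> {2..d} \<Longrightarrow> r j = r' j"
  then have "map (\<lambda>j. replicate (r j) j) [2..<d+1] = map (\<lambda>j. replicate (r' j) j) [2..<d+1]"
    by (intro map_cong) auto
  then show ?thesis by (simp only: mixed_deriv_def)
qed

text \<open>After the reordering of derivatives the summand depends on \<open>\<sigma>\<close> only
  through the image of \<open>{2..m}\<close>. \<open>sum_shuffles\<close> and
  \<open>sum_Pow_PiE\<close> then turn the sums over \<open>m\<close>, \<open>\<sigma>\<close> and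
  \<open>k\<close> into a single sum over \<open>q\<close>.\<close>

lemma ez_F_eq_sum:
  assumes "d \<ge> 1" and f: "\<And>a. tame_smooth d X (\<Phi> a)" and fz: "\<And>a. f a = \<Phi> a z" and x1: "x1 \<in> X"
  shows "ez_F d n s f x1 = (\<Sum>a\<in>{2..d} \<rightarrow>\<^sub>E {0, 1}. \<Sum>q\<in>Pi\<^sub>E {2..d} (\<lambda>j. {0..n j + 1}).
     (\<Prod>j\<in>{2..d}. bdry_coeff (u_exp d s a j) (n j) (q j)) * F_term d n (u_exp d s a) (f a) q x1)"
  unfolding ez_F_def
proof (rule sum.cong[OF refl])
  fix a
  let ?J = "{2..d}" and ?u = "u_exp d s a"
  define T where "T A k = (\<Prod>i\<in>A. (-1) ^ k i * inverse (pochhammer (?u i + 1) (k i + 1)) * (1/2) powr (?u i + of_nat (k i) + 1)) *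
       (\<Prod>i\<in>?J - A. (-1) ^ (n i + 1) * inverse (pochhammer (?u i + 1) (n i + 1))) *
       (LINT y|Pi\<^sub>M (?J - A) (\<lambda>_. lborel). box_weight (?J - A) (\<lambda>i. ?u i + of_nat (n i) + 1) y *
          mixed_deriv d (\<lambda>i. if i \<in> A then k i else n i + 1) (f a) (glue (?J - A) y (eval_point x1 A)))" for A k
  have main: "(\<Prod>j=2..m. (-1) ^ k (\<sigma> j) * inverse (pochhammer (?u (\<sigma> j) + 1) (k (\<sigma> j) + 1))
                   * (1/2) powr (?u (\<sigma> j) + of_nat (k (\<sigma> j)) + 1)) *
       (\<Prod>j=m+1..d. (-1) ^ (n (\<sigma> j) + 1) * inverse (pochhammer (?u (\<sigma> j) + 1) (n (\<sigma> j) + 1))) *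
       (LINT y : Pi\<^sub>E (\<sigma> ` {m+1..d}) (\<lambda>_. {0..1/2}) | Pi\<^sub>M (\<sigma> ` {m+1..d}) (\<lambda>_. lborel).
          (\<Prod>j=m+1..d. of_real (y (\<sigma> j)) powr (?u (\<sigma> j) + of_nat (n (\<sigma> j)) + 1)) *
          foldr (\<lambda>j. partial_deriv (\<sigma> j) ^^ (if j \<le> m then k (\<sigma> j) else n (\<sigma> j) + 1)) [2..<d+1] (f a)
            (\<lambda>i. if i = 1 then x1 else if i \<in> \<sigma> ` {2..m} then 1/2 else y i)) = T (\<sigma> ` {2..m}) k"
    if m: "m \<in> {1..d}" and \<sigma>: "\<sigma> \<in> shuffles_upto d m" for m \<sigma> k
  proof -
    let ?A = "\<sigma> ` {2..m}" and ?B = "\<sigma> ` {m+1..d}"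
    have p: "\<sigma> permutes ?J" using \<sigma> by (simp add: shuffles_upto_def)
    have inj: "inj_on \<sigma> S" for S by (rule inj_on_subset[OF permutes_inj[OF p]]) simp
    have D: "{m+1..d} = ?J - {2..m}" using m by auto
    have B: "?B = ?J - ?A"
      unfolding D using permutes_inj[OF p] permutes_image[OF p] by (simp add: image_set_diff)
    have finB: "finite ?B" by simp
    have P1: "(\<Prod>j=2..m. g (\<sigma> j)) = (\<Prod>i\<in>?A. g i)" and P2: "(\<Prod>j=m+1..d. g (\<sigma> j)) = (\<Prod>i\<in>?B. g i)" for g :: "nat \<Rightarrow> complex"
      by (simp_all add: prod.reindex[OF inj])
    define r where "r i = (if i \<in> ?A then k i else n i + 1)" for i
    have "(LINT y : Pi\<^sub>E ?B (\<lambda>_. {0..1/2}) | Pi\<^sub>M ?B (\<lambda>_. lborel).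
          (\<Prod>j=m+1..d. of_real (y (\<sigma> j)) powr (?u (\<sigma> j) + of_nat (n (\<sigma> j)) + 1)) *
          foldr (\<lambda>j. partial_deriv (\<sigma> j) ^^ (if j \<le> m then k (\<sigma> j) else n (\<sigma> j) + 1)) [2..<d+1] (f a)
            (\<lambda>i. if i = 1 then x1 else if i \<in> ?A then 1/2 else y i))
       = (LINT y|Pi\<^sub>M ?B (\<lambda>_. lborel). box_weight ?B (\<lambda>i. ?u i + of_nat (n i) + 1) y *
            mixed_deriv d r (f a) (glue ?B y (eval_point x1 ?A)))"
      unfolding set_lebesgue_integral_def
    proof (rule Bochner_Integration.integral_cong[OF refl])
      fix y assume y: "y \<in> space (Pi\<^sub>M ?B (\<lambda>_. lborel :: real measure))"
      let ?x = "\<lambda>i. if i = 1 then x1 else if i \<in> ?A then 1/2 else y i"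
      let ?h = "foldr (\<lambda>j. partial_deriv (\<sigma> j) ^^ (if j \<le> m then k (\<sigma> j) else n (\<sigma> j) + 1)) [2..<d+1] (f a)"
      have pr: "(\<Prod>j=m+1..d. of_real (y (\<sigma> j)) powr (?u (\<sigma> j) + of_nat (n (\<sigma> j)) + 1)) = (\<Prod>i\<in>?B. of_real (y i) powr (?u i + of_nat (n i) + 1))"
        by (rule P2)
      have "y \<in> Pi\<^sub>E ?B (\<lambda>_. UNIV)" using y by (simp add: space_PiM)
      then have yarb: "y i = undefined" if "i \<notin> ?B" for i using PiE_arb that by metis
      have x: "?x = glue ?B y (eval_point x1 ?A)"
      proof
        fix i show "?x i = glue ?B y (eval_point x1 ?A) i"
        proof (cases "i \<in> ?B")
          case True
          then have "i \<noteq> 1" "i \<notin> ?A" unfolding B by auto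
          then show ?thesis using True by (simp add: glue_def)
        next
          case False then show ?thesis using yarb[OF False] by (simp add: glue_def eval_point_def)
        qed
      qed
      \<comment> \<open>Derivatives may be reordered only inside the box; elsewhere the weight is 0
        and both sides vanish.\<close>
      have "box_weight ?B e y * ?h ?x = box_weight ?B e y * mixed_deriv d r (f a) (glue ?B y (eval_point x1 ?A))" for e
      proof (cases "\<forall>j\<in>?B. 0 < y j \<and> y j \<le> 1/2")
        case True
        have xo: "?x \<in> open_box d X"
          unfolding open_box_def
        proof (intro CollectI conjI ballI)
          show "?x 1 \<in> X" using x1 by simp
          fix j assume j: "j \<in> ?J"
          then have "j \<noteq> 1" by auto
          show "0 < ?x j" "?x j < 1"
            using \<open>j \<noteq> 1\<close> j True unfolding B by (cases "j \<in> ?A"; force)+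
        qed
        have "foldr (\<lambda>j. partial_deriv (\<sigma> j) ^^ (if j \<le> m then k (\<sigma> j) else n (\<sigma> j) + 1)) [2..<d+1] (\<Phi> a z) ?x = mixed_deriv d r (\<Phi> a z) ?x"
        proof (rule foldr_partial_deriv_eq_mixed_deriv[OF f p xo])
          fix j assume j: "j \<in> ?J"
          have "\<sigma> j \<in> ?A \<longleftrightarrow> j \<in> {2..m}" by (rule inj_image_mem_iff[OF permutes_inj[OF p]])
          then show "(if j \<le> m then k (\<sigma> j) else n (\<sigma> j) + 1) = r (\<sigma> j)" using j by (auto simp: r_def)
        qed
        then show ?thesis unfolding fz x by simp
      next
        case False
        then obtain j where "j \<in> ?B" "\<not> (0 < y j \<and> y j \<le> 1/2)" by blast
        then have "box_weight ?B e y = 0" by (intro box_weight_eq_0[where y = y and j = j] finB)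
        then show ?thesis by simp
      qed
      then show "indicator (Pi\<^sub>E ?B (\<lambda>_. {0..1/2})) y *\<^sub>R
         ((\<Prod>j=m+1..d. of_real (y (\<sigma> j)) powr (?u (\<sigma> j) + of_nat (n (\<sigma> j)) + 1)) * ?h ?x) =
         box_weight ?B (\<lambda>i. ?u i + of_nat (n i) + 1) y * mixed_deriv d r (f a) (glue ?B y (eval_point x1 ?A))"
        unfolding pr indicator_powr_eq_box_weight[OF finB y] .
    qed
    note L = this
    have Q1: "(\<Prod>j=2..m. (-1) ^ k (\<sigma> j) * inverse (pochhammer (?u (\<sigma> j) + 1) (k (\<sigma> j) + 1)) * (1/2) powr (?u (\<sigma> j) + of_nat (k (\<sigma> j)) + 1))
        = (\<Prod>i\<in>?A. (-1) ^ k i * inverse (pochhammer (?u i + 1) (k i + 1)) * (1/2) powr (?u i + of_nat (k i) + 1))"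
      by (rule P1)
    have Q2: "(\<Prod>j=m+1..d. (-1) ^ (n (\<sigma> j) + 1) * inverse (pochhammer (?u (\<sigma> j) + 1) (n (\<sigma> j) + 1)))
        = (\<Prod>i\<in>?B. (-1) ^ (n i + 1) * inverse (pochhammer (?u i + 1) (n i + 1)))"
      by (rule P2)
    have r: "r = (\<lambda>i. if i \<in> ?A then k i else n i + 1)" by (rule ext) (rule r_def)
    show ?thesis unfolding T_def Q1 Q2 L B[symmetric] r ..
  qed
  have fA: "T {j\<in>?J. q j \<le> n j} (restrict q {j\<in>?J. q j \<le> n j})
      = (\<Prod>j\<in>?J. bdry_coeff (?u j) (n j) (q j)) * F_term d n ?u (f a) q x1"
    if q: "q \<in> Pi\<^sub>E ?J (\<lambda>j. {0..n j + 1})" for q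
  proof -
    let ?A = "{j\<in>?J. q j \<le> n j}"
    have B: "?J - ?A = top_indices d n q"
    proof -
      have "q j \<le> n j + 1" if "j \<in> ?J" for j using PiE_mem[OF q that] by simp
      then show ?thesis unfolding top_indices_def by force
    qed
    have A: "?J - top_indices d n q = ?A" unfolding B[symmetric] by auto
    have md: "mixed_deriv d (\<lambda>i. if i \<in> ?A then restrict q ?A i else n i + 1) (f a) = mixed_deriv d q (f a)"
    proof (rule mixed_deriv_cong)
      fix j assume j: "j \<in> ?J"
      have "q j \<le> n j + 1" using PiE_mem[OF q j] by simp
      then show "(if j \<in> ?A then restrict q ?A j else n j + 1) = q j" using j by auto
    qed
    have "(\<Prod>j\<in>?J. bdry_coeff (?u j) (n j) (q j)) = (\<Prod>j\<in>?A. bdry_coeff (?u j) (n j) (q j)) * (\<Prod>j\<in>?J - ?A. bdry_coeff (?u j) (n j) (q j))"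
      by (subst mult.commute, rule prod.subset_diff) auto
    also have "(\<Prod>j\<in>?A. bdry_coeff (?u j) (n j) (q j)) = (\<Prod>i\<in>?A. (-1) ^ restrict q ?A i * inverse (pochhammer (?u i + 1) (restrict q ?A i + 1)) * (1/2) powr (?u i + of_nat (restrict q ?A i) + 1))"
      by (rule prod.cong[OF refl]) (simp add: bdry_coeff_def)
    also have "(\<Prod>j\<in>?J - ?A. bdry_coeff (?u j) (n j) (q j)) = (\<Prod>i\<in>?J - ?A. (-1) ^ (n i + 1) * inverse (pochhammer (?u i + 1) (n i + 1)))"
      by (rule prod.cong[OF refl]) (auto simp: bdry_coeff_def)
    finally show ?thesis unfolding T_def md F_term_def A B by (simp only:)
  qed
  have "(\<Sum>m=1..d. \<Sum>\<sigma>\<in>{\<sigma>. \<sigma> permutes {2..d} \<and> strict_mono_on {2..m} \<sigma> \<and> strict_mono_on {m+1..d} \<sigma>}.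
     \<Sum>k\<in>Pi\<^sub>E (\<sigma> ` {2..m}) (\<lambda>j. {0..n j}).
       (\<Prod>j=2..m. (-1) ^ k (\<sigma> j) * inverse (pochhammer (?u (\<sigma> j) + 1) (k (\<sigma> j) + 1))
                   * (1/2) powr (?u (\<sigma> j) + of_nat (k (\<sigma> j)) + 1)) *
       (\<Prod>j=m+1..d. (-1) ^ (n (\<sigma> j) + 1) * inverse (pochhammer (?u (\<sigma> j) + 1) (n (\<sigma> j) + 1))) *
       (LINT y : Pi\<^sub>E (\<sigma> ` {m+1..d}) (\<lambda>_. {0..1/2}) | Pi\<^sub>M (\<sigma> ` {m+1..d}) (\<lambda>_. lborel).
          (\<Prod>j=m+1..d. of_real (y (\<sigma> j)) powr (?u (\<sigma> j) + of_nat (n (\<sigma> j)) + 1)) *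
          foldr (\<lambda>j. partial_deriv (\<sigma> j) ^^ (if j \<le> m then k (\<sigma> j) else n (\<sigma> j) + 1)) [2..<d+1] (f a)
            (\<lambda>i. if i = 1 then x1 else if i \<in> \<sigma> ` {2..m} then 1/2 else y i)))
     = (\<Sum>m=1..d. \<Sum>\<sigma>\<in>shuffles_upto d m. \<Sum>k\<in>Pi\<^sub>E (\<sigma> ` {2..m}) (\<lambda>j. {0..n j}). T (\<sigma> ` {2..m}) k)"
    by (intro sum.cong refl main) (auto simp: shuffles_upto_def)
  also have "\<dots> = (\<Sum>A\<in>Pow ?J. \<Sum>k\<in>Pi\<^sub>E A (\<lambda>j. {0..n j}). T A k)"
    by (rule sum_shuffles[OF assms(1), of "\<lambda>A. \<Sum>k\<in>Pi\<^sub>E A (\<lambda>j. {0..n j}). T A k"])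
  also have "\<dots> = (\<Sum>q\<in>Pi\<^sub>E ?J (\<lambda>j. {0..n j + 1}). (\<Prod>j\<in>?J. bdry_coeff (?u j) (n j) (q j)) * F_term d n ?u (f a) q x1)"
    unfolding sum_Pow_PiE[OF finite_atLeastAtMost] by (rule sum.cong[OF refl fA])
  finally show "(\<Sum>m=1..d. \<Sum>\<sigma>\<in>{\<sigma>. \<sigma> permutes {2..d} \<and> strict_mono_on {2..m} \<sigma> \<and> strict_mono_on {m+1..d} \<sigma>}.
     \<Sum>k\<in>Pi\<^sub>E (\<sigma> ` {2..m}) (\<lambda>j. {0..n j}).
       (\<Prod>j=2..m. (-1) ^ k (\<sigma> j) * inverse (pochhammer (?u (\<sigma> j) + 1) (k (\<sigma> j) + 1))
                   * (1/2) powr (?u (\<sigma> j) + of_nat (k (\<sigma> j)) + 1)) *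
       (\<Prod>j=m+1..d. (-1) ^ (n (\<sigma> j) + 1) * inverse (pochhammer (?u (\<sigma> j) + 1) (n (\<sigma> j) + 1))) *
       (LINT y : Pi\<^sub>E (\<sigma> ` {m+1..d}) (\<lambda>_. {0..1/2}) | Pi\<^sub>M (\<sigma> ` {m+1..d}) (\<lambda>_. lborel).
          (\<Prod>j=m+1..d. of_real (y (\<sigma> j)) powr (?u (\<sigma> j) + of_nat (n (\<sigma> j)) + 1)) *
          foldr (\<lambda>j. partial_deriv (\<sigma> j) ^^ (if j \<le> m then k (\<sigma> j) else n (\<sigma> j) + 1)) [2..<d+1] (f a)
            (\<lambda>i. if i = 1 then x1 else if i \<in> \<sigma> ` {2..m} then 1/2 else y i)))
     = (\<Sum>q\<in>Pi\<^sub>E ?J (\<lambda>j. {0..n j + 1}). (\<Prod>j\<in>?J. bdry_coeff (?u j) (n j) (q j)) * F_term d n ?u (f a) q x1)" .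
qed

lemma box_family_mixed_deriv:
  assumes "X \<in> sets borel" "tame_smooth d X \<Phi>"
  shows "box_family d X x1 (\<lambda>r. mixed_deriv d r (\<Phi> z))"
proof
  fix r
  have t: "tame d X (\<lambda>s. mixed_deriv d r (\<Phi> s))" by (intro tame_smooth_tame tame_smooth_mixed_deriv assms)
  show "continuous_on (open_box d X) (mixed_deriv d r (\<Phi> z))" using t unfolding tame_def by blast
  obtain e C N where "e > 0" "\<forall>s\<in>ball z e. \<forall>x\<in>half_box d X. norm (mixed_deriv d r (\<Phi> s) x) \<le> C * (1 + x 1) ^ N"
    using t unfolding tame_def by meson
  then show "\<exists>C. \<forall>x\<in>half_box d X. x 1 = x1 \<longrightarrow> norm (mixed_deriv d r (\<Phi> z) x) \<le> C"
    by (intro exI[of _ "C * (1 + x1) ^ N"]) auto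
  show "((\<lambda>t. mixed_deriv d r (\<Phi> z) (x(j := t))) has_vector_derivative mixed_deriv d (r(j := Suc (r j))) (\<Phi> z) x) (at (x j))"
    if "j \<in> {2..d}" "x \<in> open_box d X" for j x
    by (rule mixed_deriv_Suc[OF assms(2) that])
qed (rule assms(1))

text \<open>The expansion read backwards. If all exponents exceed -1 in real part, the integral
  before any integration by parts converges and equals the sum; this is the form needed at large
  real points.\<close>

lemma sum_F_term_eq_integral:
  assumes X: "X \<in> sets borel" and f: "tame_smooth d X \<Phi>" and x1: "x1 \<in> X"
    and u: "\<And>j. j \<in> {2..d} \<Longrightarrow> Re (u j) > -1"
  shows "(\<Sum>q\<in>Pi\<^sub>E {2..d} (\<lambda>j. {0..n j + 1}). (\<Prod>j\<in>{2..d}. bdry_coeff (u j) (n j) (q j)) * F_term d n u (\<Phi> z) q x1)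
    = (LINT y|Pi\<^sub>M {2..d} (\<lambda>_. lborel). box_weight {2..d} u y * \<Phi> z (glue {2..d} y (eval_point x1 {})))"
proof -
  interpret box_family d X x1 "\<lambda>r. mixed_deriv d r (\<Phi> z)" by (rule box_family_mixed_deriv[OF X f])
  have b: "base ({2..d} \<union> {}) (eval_point x1 {})" using x1 by (simp add: base_def eval_point_def)
  have 0: "mixed_deriv d (\<lambda>_. 0) g = g" for g
  proof -
    have "concat (map (\<lambda>j. replicate 0 j) xs) = []" for xs :: "nat list" by (induction xs) auto
    then show ?thesis by (simp only: mixed_deriv_def partial_derivs_def foldr_Nil id_apply)
  qed
  have "(LINT y|Pi\<^sub>M ({2..d} \<union> {}) (\<lambda>_. lborel). box_weight ({2..d} \<union> {}) u y * mixed_deriv d (\<lambda>_. 0) (\<Phi> z) (glue ({2..d} \<union> {}) y (eval_point x1 {})))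
    = (\<Sum>q\<in>Pi\<^sub>E {2..d} (\<lambda>j. {0..n j + 1}). (\<Prod>j\<in>{2..d}. bdry_coeff (u j) (n j) (q j)) *
        (LINT y|Pi\<^sub>M ({j\<in>{2..d}. q j = n j + 1} \<union> {}) (\<lambda>_. lborel).
           box_weight ({j\<in>{2..d}. q j = n j + 1} \<union> {}) (\<lambda>i. if i \<in> {2..d} then u i + of_nat (n i) + 1 else u i) y *
           mixed_deriv d (\<lambda>i. if i \<in> {2..d} then 0 + q i else 0) (\<Phi> z)
             (glue ({j\<in>{2..d}. q j = n j + 1} \<union> {}) y (\<lambda>i. if i \<in> {2..d} - {j\<in>{2..d}. q j = n j + 1} then 1/2 else eval_point x1 {} i))))"
    by (rule expansion[OF _ _ _ _ b]) (use u in auto)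
  also have "\<dots> = (\<Sum>q\<in>Pi\<^sub>E {2..d} (\<lambda>j. {0..n j + 1}). (\<Prod>j\<in>{2..d}. bdry_coeff (u j) (n j) (q j)) * F_term d n u (\<Phi> z) q x1)"
  proof (rule sum.cong[OF refl])
    fix q
    let ?T = "top_indices d n q"
    have 1: "{j\<in>{2..d}. q j = n j + 1} = ?T" by (simp add: top_indices_def)
    have 2: "box_weight ?T (\<lambda>i. if i \<in> {2..d} then u i + of_nat (n i) + 1 else u i) = box_weight ?T (\<lambda>i. u i + of_nat (n i) + 1)"
      by (rule box_weight_cong) (auto simp: top_indices_def)
    have 3: "mixed_deriv d (\<lambda>i. if i \<in> {2..d} then 0 + q i else 0) (\<Phi> z) = mixed_deriv d q (\<Phi> z)"
      by (rule mixed_deriv_cong) simp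
    have 4: "(\<lambda>i. if i \<in> {2..d} - ?T then 1/2 else eval_point x1 {} i) = eval_point x1 ({2..d} - ?T)"
      by (auto simp: eval_point_def fun_eq_iff)
    show "(\<Prod>j\<in>{2..d}. bdry_coeff (u j) (n j) (q j)) *
        (LINT y|Pi\<^sub>M ({j\<in>{2..d}. q j = n j + 1} \<union> {}) (\<lambda>_. lborel).
           box_weight ({j\<in>{2..d}. q j = n j + 1} \<union> {}) (\<lambda>i. if i \<in> {2..d} then u i + of_nat (n i) + 1 else u i) y *
           mixed_deriv d (\<lambda>i. if i \<in> {2..d} then 0 + q i else 0) (\<Phi> z)
             (glue ({j\<in>{2..d}. q j = n j + 1} \<union> {}) y (\<lambda>i. if i \<in> {2..d} - {j\<in>{2..d}. q j = n j + 1} then 1/2 else eval_point x1 {} i)))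
       = (\<Prod>j\<in>{2..d}. bdry_coeff (u j) (n j) (q j)) * F_term d n u (\<Phi> z) q x1"
      unfolding Un_empty_right 1 2 3 4 F_term_def ..
  qed
  finally show ?thesis unfolding 0 Un_empty_right by (rule sym)
qed

section \<open>Bernoulli series\<close>

unbundle fps_syntax
no_notation vec_nth (infixl "$" 90)

definition cbern :: "complex \<Rightarrow> complex"
  where "cbern z = (if z = 0 then 1 else z / (exp z - 1))"

definition expm1_quot :: "complex \<Rightarrow> complex"
  where "expm1_quot z = (if z = 0 then 1 else (exp z - 1) / z)"

text \<open>The zeros of \<open>exp z - 1\<close> are the integer multiples of
  \<open>2 * pi * \<i>\<close>, so this is the widest open horizontal strip about the real axis in
  which 0 is the only one.\<close>

definition bern_strip :: "complex set"
  where "bern_strip = {z. \<bar>Im z\<bar> < 2 * pi}"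

lemma open_bern_strip: "open bern_strip"
  unfolding bern_strip_def by (intro open_Collect_less continuous_intros)

lemma expm1_quot_holomorphic: "expm1_quot holomorphic_on UNIV"
proof -
  have "(\<lambda>z. if z = 0 then deriv exp 0 else (exp z - exp 0) / (z - 0)) holomorphic_on (UNIV :: complex set)"
    by (rule pole_lemma) (auto intro!: holomorphic_intros)
  moreover have "deriv exp 0 = (1 :: complex)" using DERIV_imp_deriv[OF DERIV_exp, of "0 :: complex"] by simp
  ultimately show ?thesis unfolding expm1_quot_def by (simp cong: if_cong)
qed

lemma exp_eq_1_strip:
  assumes "z \<in> bern_strip" "exp z = 1"
  shows "z = 0"
proof -
  obtain k :: int where k: "Im z = of_int (2 * k) * pi" and "Re z = 0"
    using assms(2) exp_eq_1 by auto
  have "\<bar>of_int k * (2 * pi)\<bar> < 1 * (2 * pi)"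
    using assms(1) unfolding bern_strip_def mem_Collect_eq k by (simp add: mult_ac)
  then have "\<bar>real_of_int k\<bar> < 1" by (simp add: abs_mult)
  then have "k = 0" by linarith
  then show ?thesis using k \<open>Re z = 0\<close> by (simp add: complex_eq_iff)
qed

lemma expm1_quot_nonzero: "z \<in> bern_strip \<Longrightarrow> expm1_quot z \<noteq> 0"
  using exp_eq_1_strip unfolding expm1_quot_def by auto

lemma cbern_eq: "cbern z = inverse (expm1_quot z)"
  unfolding cbern_def expm1_quot_def by simp

lemma cbern_holomorphic: "cbern holomorphic_on bern_strip"
  unfolding cbern_eq[abs_def]
  by (intro holomorphic_on_inverse holomorphic_on_subset[OF expm1_quot_holomorphic]) (auto simp: expm1_quot_nonzero)

lemma cbern_of_real: "cbern (of_real y) = of_real (bern_gen y)"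
  unfolding cbern_def bern_gen_def by (simp flip: exp_of_real)

definition bern_fps :: "complex fps"
  where "bern_fps = fps_X / (fps_exp 1 - 1)"

lemma bernoulli_eq: "bernoulli m / fact m = bern_fps $ m"
  by (simp add: bernoulli_def bern_fps_def)

lemma cbern_has_fps_expansion: "cbern has_fps_expansion bern_fps"
proof -
  let ?F = "fps_exp 1 - 1 :: complex fps"
  have e1: "(\<lambda>z. exp (1 * z) - 1) has_fps_expansion ?F"
    by (intro fps_expansion_intros)
  have nz: "?F $ 1 \<noteq> 0" "?F $ 0 = 0" by simp_all
  then have sd: "1 \<le> subdegree ?F"
    by (intro subdegree_geI) auto
  have c: "(1::complex) = ?F $ 1" by simp
  have "(\<lambda>x. if x = 0 then 1 else (exp (1 * x) - 1) / x ^ 1) has_fps_expansion fps_shift 1 ?F"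
    by (rule has_fps_expansion_shift[OF e1 sd c])
  moreover have "(\<lambda>x. if x = 0 then 1 else (exp (1 * x) - 1) / x ^ 1) = expm1_quot"
    by (auto simp: expm1_quot_def fun_eq_iff)
  ultimately have "expm1_quot has_fps_expansion fps_shift 1 ?F" by (simp only:)
  then have "(\<lambda>x. inverse (expm1_quot x)) has_fps_expansion inverse (fps_shift 1 ?F)"
    by (rule has_fps_expansion_inverse) simp
  \<comment> \<open>The denominator \<open>fps_exp 1 - 1\<close> has no constant term. Cancelling
    one factor \<open>fps_X\<close> turns the quotient into the inverse of a unit.\<close>
  moreover have "inverse (fps_shift 1 ?F) = bern_fps"
  proof -
    have F: "?F = fps_shift 1 ?F * fps_X" using fps_shift_times_fps_X_power[OF sd] by simp
    have "fps_shift 1 ?F $ 0 \<noteq> 0" by simp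
    then have "fps_shift 1 ?F \<noteq> 0" by (metis fps_zero_nth)
    then have "bern_fps = 1 / fps_shift 1 ?F"
      unfolding bern_fps_def by (subst F) (metis div_mult_mult2 fps_X_neq_zero mult.commute mult_1)
    then show ?thesis using \<open>fps_shift 1 ?F $ 0 \<noteq> 0\<close> by (simp add: fps_divide_unit)
  qed
  ultimately show ?thesis unfolding cbern_eq[abs_def] by simp
qed

lemma ball_bern_strip: "ball 0 (2 * pi) \<subseteq> bern_strip"
proof
  fix z :: complex assume "z \<in> ball 0 (2 * pi)"
  then show "z \<in> bern_strip" using abs_Im_le_cmod[of z] by (simp add: bern_strip_def)
qed

lemma cbern_sums:
  assumes "norm z < 2 * pi"
  shows "(\<lambda>n. bern_fps $ n * z ^ n) sums cbern z"
proof (rule has_fps_expansion_imp_sums_complex[OF cbern_has_fps_expansion, where r = "ereal (2 * pi)"])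
  show "cbern holomorphic_on eball 0 (ereal (2 * pi))"
    using holomorphic_on_subset[OF cbern_holomorphic ball_bern_strip] by (simp add: eball_ereal)
qed (use assms in simp)

lemma cbern_abs_summable:
  assumes "norm z < 2 * pi"
  shows "(\<lambda>n. norm (bern_fps $ n * z ^ n)) summable_on UNIV"
proof -
  obtain r where r: "norm z < r" "r < 2 * pi" using assms dense by blast
  then have r0: "r > 0" using norm_ge_zero[of z] by linarith
  have "summable (\<lambda>n. bern_fps $ n * (of_real r) ^ n)"
    using cbern_sums[of "of_real r"] r r0 by (auto simp: sums_iff)
  then have "summable (\<lambda>n. norm (bern_fps $ n * z ^ n))"
    by (rule powser_insidea) (use r r0 in simp)
  then show ?thesis by (rule summable_nonneg_imp_summable_on) simp
qed

lemma cbern_infsum: "norm z < 2 * pi \<Longrightarrow> (\<Sum>\<^sub>\<infinity>n. bern_fps $ n * z ^ n) = cbern z"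
  using norm_summable_imp_has_sum[OF _ cbern_sums] cbern_abs_summable
  by (metis (no_types, lifting) infsumI summable_on_UNIV_nonneg_real_iff norm_ge_zero)

text \<open>Cauchy's estimate on unit discs about nonnegative reals. These discs lie in the
  half-strip with imaginary part at most 1 in absolute value and real part at least -1, where
  \<open>cbern\<close> is bounded: by compactness up to real part 1, and beyond by
  \<open>norm (exp z - 1) \<ge> Re z\<close>. Uniformity in \<open>y\<close> is what makes psi tame
  for unbounded \<open>x 1\<close>.\<close>

lemma cbern_deriv_bounded: "\<exists>C. \<forall>y\<ge>0. norm ((deriv ^^ r) cbern (of_real y)) \<le> C"
proof -
  let ?K = "cbox (Complex (-1) (-1)) (Complex 1 1)"
  have "?K \<subseteq> bern_strip"
  proof
    fix z assume "z \<in> ?K"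
    then have "\<bar>Im z\<bar> \<le> 1" by (auto simp: in_cbox_complex_iff)
    then show "z \<in> bern_strip" using pi_gt3 by (simp add: bern_strip_def)
  qed
  then have "compact (cbern ` ?K)"
    by (intro compact_continuous_image holomorphic_on_imp_continuous_on holomorphic_on_subset[OF cbern_holomorphic]) auto
  then have "bounded (cbern ` ?K)" by (rule compact_imp_bounded)
  then obtain B where "\<forall>w\<in>cbern ` ?K. norm w \<le> B" unfolding bounded_iff by blast
  then have B: "norm (cbern z) \<le> B" if "z \<in> ?K" for z using that by blast
  have bd: "norm (cbern z) \<le> max B 2" if z: "\<bar>Im z\<bar> \<le> 1" "Re z \<ge> -1" for z
  proof (cases "Re z \<le> 1")
    case True
    then have "z \<in> ?K" using z by (auto simp: in_cbox_complex_iff)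
    then show ?thesis using B by fastforce
  next
    case False
    then have x: "Re z > 1" by simp
    have "norm z \<le> Re z + 1" using cmod_le[of z] z x by linarith
    moreover have "Re z \<le> norm (exp z - 1)"
    proof -
      have "1 + Re z \<le> exp (Re z)" by (rule exp_ge_add_one_self)
      moreover have "norm (exp z) - norm (1::complex) \<le> norm (exp z - 1)" by (rule norm_triangle_ineq2)
      ultimately show ?thesis unfolding norm_exp_eq_Re norm_one by linarith
    qed
    ultimately have "norm z / norm (exp z - 1) \<le> (Re z + 1) / Re z"
      using x by (intro frac_le) auto
    also have "\<dots> \<le> 2" using x by (simp add: field_simps)
    finally show ?thesis using x unfolding cbern_def by (auto simp: norm_divide)
  qed
  have "norm ((deriv ^^ r) cbern (of_real y)) \<le> fact r * max B 2 / 1 ^ r" if y: "y \<ge> 0" for y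
  proof (rule Cauchy_inequality)
    have in1: "\<bar>Im z\<bar> \<le> 1 \<and> Re z \<ge> -1" if "norm (of_real y - z) \<le> 1" for z
      using that y abs_Im_le_cmod[of "of_real y - z"] abs_Re_le_cmod[of "of_real y - z"] by auto
    then have sub: "cball (of_real y) 1 \<subseteq> bern_strip"
      using pi_gt3 by (force simp: bern_strip_def dist_norm)
    show "cbern holomorphic_on ball (of_real y) 1"
      using holomorphic_on_subset[OF cbern_holomorphic] sub ball_subset_cball by blast
    show "continuous_on (cball (of_real y) 1) cbern"
      using holomorphic_on_imp_continuous_on[OF holomorphic_on_subset[OF cbern_holomorphic sub]] .
    show "norm (cbern x) \<le> max B 2" if "norm (of_real y - x) = 1" for x
      using bd[of x] in1[of x] that by simp
  qed simp
  then show ?thesis by blast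
qed

text \<open>The Taylor remainder divided by \<open>z ^ Suc N\<close> has a removable singularity at
  0, where the shifted power series supplies the value.\<close>

lemma fps_remainder_holomorphic:
  assumes "f holomorphic_on S" "open S" "0 \<in> S" "f has_fps_expansion F"
  shows "\<exists>R. R holomorphic_on S \<and> (\<forall>z\<in>S. f z = (\<Sum>p\<le>N. F $ p * z ^ p) + z ^ Suc N * R z)"
proof -
  define P where "P z = (\<Sum>p\<le>N. F $ p * z ^ p)" for z :: complex
  define H where "H = F - (\<Sum>p\<le>N. fps_const (F $ p) * fps_X ^ p)"
  define R where "R z = (if z = 0 then H $ Suc N else (f z - P z) / z ^ Suc N)" for z
  have "(\<lambda>z. f z - P z) has_fps_expansion H"
    unfolding H_def P_def by (intro fps_expansion_intros assms(4))
  \<comment> \<open>The zero series has subdegree 0, so the case that \<open>f\<close> coincides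
    near 0 with its Taylor polynomial has to be treated apart.\<close>
  then have "R has_fps_expansion fps_shift (Suc N) H"
  proof (cases "H = 0")
    case False
    assume e: "(\<lambda>z. f z - P z) has_fps_expansion H"
    have "H $ i = 0" if "i \<le> N" for i
      using that unfolding H_def by (simp add: fps_sum_nth fps_X_power_nth if_distrib[of "\<lambda>x. _ * x"] cong: if_cong)
    then have "Suc N \<le> subdegree H" by (intro subdegree_geI False) auto
    then show ?thesis unfolding R_def[abs_def] by (intro has_fps_expansion_shift[OF e]) auto
  next
    case True
    assume "(\<lambda>z. f z - P z) has_fps_expansion H"
    then have "eventually (\<lambda>z. f z - P z = 0) (nhds 0)" unfolding True has_fps_expansion_0_iff .
    then have "eventually (\<lambda>z. R z = 0) (nhds 0)" by eventually_elim (simp add: R_def True)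
    then show ?thesis unfolding True by (simp add: has_fps_expansion_0_iff)
  qed
  then have R0: "R analytic_on {0}" by (rule has_fps_expansion_imp_analytic_0)
  have "R holomorphic_on S"
  proof -
    have "(\<lambda>z. (f z - P z) / z ^ Suc N) holomorphic_on S - {0}"
      unfolding P_def by (intro holomorphic_intros holomorphic_on_subset[OF assms(1)]) auto
    then have "R holomorphic_on S - {0}"
      by (rule holomorphic_transform) (auto simp: R_def)
    then have "R analytic_on S - {0}" using assms(2) by (simp add: analytic_on_open open_delete)
    then have "R analytic_on (S - {0}) \<union> {0}" unfolding analytic_on_Un using R0 by blast
    then show ?thesis by (rule holomorphic_on_subset[OF analytic_imp_holomorphic]) auto
  qed
  moreover have "f z = P z + z ^ Suc N * R z" if "z \<in> S" for z
  proof (cases "z = 0")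
    case True
    have "f 0 = F $ 0" using has_fps_expansion_imp_0_eq_fps_nth_0[OF assms(4)] by simp
    then show ?thesis using True by (simp add: P_def power_0_left if_distrib[of "\<lambda>x. _ * x"] cong: if_cong)
  qed (simp add: R_def)
  ultimately show ?thesis unfolding P_def by blast
qed

section \<open>Smoothness of the integrand psi\<close>

lemma holomorphic_multi_coords: "holomorphic_multi (\<lambda>z. coords e z j) S"
  unfolding coords_def by (rule holomorphic_multi_nth)

lemma holomorphic_multi_tail_sum: "holomorphic_multi (\<lambda>z. tail_sum d (coords e z) j) S"
  unfolding tail_sum_def by (intro holomorphic_multi_sum holomorphic_multi_coords)

lemma holomorphic_multi_v_exp: "holomorphic_multi (\<lambda>z. v_exp d (coords e z) a j) S"
  unfolding v_exp_def
  by (cases "a j = 0") (simp_all add: holomorphic_multi_diff holomorphic_multi_add holomorphic_multi_const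
      holomorphic_multi_coords holomorphic_multi_tail_sum)

lemma holomorphic_multi_u_exp: "holomorphic_multi (\<lambda>z. u_exp d (coords e z) a j) S"
  unfolding u_exp_def
  by (cases "a j = 0") (simp_all add: holomorphic_multi_diff holomorphic_multi_add holomorphic_multi_const
      holomorphic_multi_coords holomorphic_multi_tail_sum)

text \<open>For \<open>j = 1\<close> the product is empty and the value is \<open>x 1\<close>. That
  factor does not occur in \<open>ez_psi\<close>; it comes from the outer kernel and completes the
  product of \<open>d\<close> Bernoulli generating functions.\<close>

definition chain_arg :: "(nat \<Rightarrow> nat) \<Rightarrow> nat \<Rightarrow> (nat \<Rightarrow> real) \<Rightarrow> real"
  where "chain_arg a j x = x 1 * (\<Prod>i=2..j. t_var a x i)"

lemma t_var_open: "x \<in> open_box d X \<Longrightarrow> j \<in> {2..d} \<Longrightarrow> 0 < t_var a x j \<and> t_var a x j < 1"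
  using open_box_nth[of x d X j] by (simp add: t_var_def)

lemma chain_arg_bounds:
  assumes "x \<in> open_box d X" "X \<subseteq> {0..}" "j \<le> d"
  shows "0 \<le> chain_arg a j x" "chain_arg a j x \<le> x 1"
proof -
  have x1: "x 1 \<ge> 0" using assms(1,2) unfolding open_box_def by auto
  have t: "0 \<le> t_var a x i \<and> t_var a x i \<le> 1" if "i \<in> {2..j}" for i
    using t_var_open[OF assms(1), of i a] that assms(3) by auto
  have "0 \<le> (\<Prod>i=2..j. t_var a x i)" using t by (intro prod_nonneg) auto
  then show "0 \<le> chain_arg a j x" unfolding chain_arg_def using x1 by simp
  have "(\<Prod>i=2..j. t_var a x i) \<le> 1" by (intro prod_le_1) (use t in auto)
  from mult_left_mono[OF this x1] show "chain_arg a j x \<le> x 1" unfolding chain_arg_def by simp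
qed

lemma tame_smooth_t_var:
  assumes "X \<subseteq> {0..}" "j \<in> {2..d}"
  shows "tame_smooth d X (\<lambda>(s :: complex ^ 'v::finite) x. of_real (t_var a x j))"
proof -
  have j: "j \<in> {1..d}" using assms(2) by auto
  show ?thesis
  proof (cases "a j = 0")
    case True
    then show ?thesis using tame_smooth_coord[OF assms(1) j] by (simp add: t_var_def)
  next
    case False
    have "tame_smooth d X (\<lambda>(s :: complex ^ 'v) x. 1 + (-1) * of_real (x j))"
      by (intro tame_smooth_add tame_smooth_mult tame_smooth_const tame_smooth_coord assms(1) j)
    then show ?thesis using False by (simp add: t_var_def)
  qed
qed

lemma tame_smooth_prod_t_var:
  assumes "X \<subseteq> {0..}" "j \<in> {1..d}"
  shows "tame_smooth d X (\<lambda>(s :: complex ^ 'v::finite) x. of_real (\<Prod>i=2..j. t_var a x i))"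
  unfolding of_real_prod by (intro tame_smooth_prod tame_smooth_t_var assms(1)) (use assms(2) in auto)

lemma tame_smooth_chain_arg:
  assumes "X \<subseteq> {0..}" "j \<in> {1..d}"
  shows "tame_smooth d X (\<lambda>(s :: complex ^ 'v::finite) x. of_real (chain_arg a j x))"
  unfolding chain_arg_def of_real_mult
  by (intro tame_smooth_mult tame_smooth_coord tame_smooth_prod_t_var assms) (use assms(2) in auto)

lemma of_real_bern_strip: "of_real y \<in> bern_strip"
  by (simp add: bern_strip_def)

lemma tame_smooth_cbern_chain_arg:
  assumes "X \<subseteq> {0..}" "j \<in> {1..d}"
  shows "tame_smooth d X (\<lambda>(s :: complex ^ 'v::finite) x. cbern (of_real (chain_arg a j x)))"
proof (rule tame_smooth_compose[OF assms(1) tame_smooth_chain_arg[OF assms] cbern_holomorphic open_bern_strip of_real_bern_strip])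
  fix r
  obtain C where C: "\<And>y. y \<ge> 0 \<Longrightarrow> norm ((deriv ^^ r) cbern (of_real y)) \<le> C"
    using cbern_deriv_bounded by blast
  have "norm ((deriv ^^ r) cbern (of_real (chain_arg a j x))) \<le> C" if "x \<in> half_box d X" for x
    using chain_arg_bounds(1)[of x d X j a] half_box_subset[of d X] that assms by (intro C) auto
  then show "\<exists>C. \<forall>x\<in>half_box d X. norm ((deriv ^^ r) cbern (of_real (chain_arg a j x))) \<le> C" by blast
qed

lemma ez_psi_eq: "ez_psi d s a x = (\<Prod>j=2..d. of_real (1 - x j) powr v_exp d s a j) * (\<Prod>j=2..d. cbern (of_real (chain_arg a j x)))"
  unfolding ez_psi_def cbern_of_real chain_arg_def prod.distrib ..

lemma tame_smooth_weight:
  assumes "X \<subseteq> {0..}"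
  shows "tame_smooth d X (\<lambda>z x. \<Prod>j=2..d. of_real (1 - x j) powr v_exp d (coords e z) a j)"
  by (intro tame_smooth_prod tame_smooth_powr holomorphic_multi_v_exp assms)

lemma tame_smooth_ez_psi:
  assumes "X \<subseteq> {0..}"
  shows "tame_smooth d X (\<lambda>z. ez_psi d (coords e z) a)"
  unfolding ez_psi_eq[abs_def]
  by (intro tame_smooth_mult tame_smooth_weight tame_smooth_prod tame_smooth_cbern_chain_arg assms) auto

text \<open>\<open>T i\<close> divides the factors with index \<open>j \<ge> i\<close>, so
  exchanging the two products gives it the exponent \<open>p i + ... + p d\<close>. This is the
  origin of the tail sums of \<open>p\<close> in phi and in the beta factors.\<close>

lemma prod_chain_monomial:
  fixes c :: "'a::comm_semiring_1" and T :: "nat \<Rightarrow> 'a"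
  shows "(\<Prod>j=1..d. (c * (\<Prod>i=2..j. T i)) ^ p j) = c ^ (\<Sum>i=1..d. p i) * (\<Prod>j=2..d. T j ^ tail_sum d p j)"
proof -
  have "(\<Prod>j=1..d. (\<Prod>i=2..j. T i) ^ p j) = (\<Prod>j\<in>{1..d}. \<Prod>i | i \<in> {2..d} \<and> i \<le> j. T i ^ p j)"
    unfolding prod_power_distrib by (intro prod.cong refl) auto
  also have "\<dots> = (\<Prod>i\<in>{2..d}. \<Prod>j | j \<in> {1..d} \<and> i \<le> j. T i ^ p j)"
    by (rule prod.swap_restrict) auto
  also have "\<dots> = (\<Prod>i=2..d. T i ^ tail_sum d p i)"
    unfolding tail_sum_def power_sum by (intro prod.cong refl) auto
  finally show ?thesis by (simp add: power_mult_distrib prod.distrib power_sum)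
qed

definition mono_term :: "nat \<Rightarrow> (nat \<Rightarrow> nat) \<Rightarrow> (nat \<Rightarrow> nat) \<Rightarrow> (nat \<Rightarrow> real) \<Rightarrow> complex"
  where "mono_term d a p x = bern_coeff d p * (\<Prod>j=2..d. of_real (t_var a x j) ^ tail_sum d p j)"

lemma prod_chain_terms:
  "(\<Prod>j=1..d. bern_fps $ p j * of_real (chain_arg a j x) ^ p j) = of_real (x 1) ^ (\<Sum>i=1..d. p i) * mono_term d a p x"
proof -
  have "(\<Prod>j=1..d. complex_of_real (chain_arg a j x) ^ p j) =
      of_real (x 1) ^ (\<Sum>i=1..d. p i) * (\<Prod>j=2..d. of_real (t_var a x j) ^ tail_sum d p j)"
    using prod_chain_monomial[of "of_real (x 1)" "\<lambda>i. complex_of_real (t_var a x i)" p d]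
    by (simp add: chain_arg_def)
  then show ?thesis unfolding prod.distrib mono_term_def bern_coeff_def bernoulli_eq by simp
qed

section \<open>Taylor remainders of the Bernoulli product\<close>

lemma finite_compositions: "finite (compositions d k)"
proof (rule finite_subset)
  show "compositions d k \<subseteq> {1..d} \<rightarrow>\<^sub>E {..k}"
  proof
    fix p assume p: "p \<in> compositions d k"
    then have pe: "p \<in> {1..d} \<rightarrow>\<^sub>E UNIV" and s: "(\<Sum>i=1..d. p i) = k" by (auto simp: compositions_def)
    have "p i \<le> k" if "i \<in> {1..d}" for i unfolding s[symmetric] using that by (intro member_le_sum) auto
    then show "p \<in> {1..d} \<rightarrow>\<^sub>E {..k}" using pe by (auto simp: PiE_def Pi_def)
  qed
qed (intro finite_PiE; simp)

text \<open>Congruence modulo \<open>x 1 ^ M\<close> with a tame quotient is compatible with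
  products, exactly as for congruence modulo an ideal.\<close>

lemma prod_cong_remainder:
  fixes F H :: "nat \<Rightarrow> (nat \<Rightarrow> real) \<Rightarrow> complex"
  assumes X: "X \<subseteq> {0..}" and "finite I"
    and F: "\<And>j. j \<in> I \<Longrightarrow> tame_smooth d X (\<lambda>(s :: complex ^ 'v::finite) x. F j x)"
    and H: "\<And>j. j \<in> I \<Longrightarrow> tame_smooth d X (\<lambda>(s :: complex ^ 'v) x. H j x)"
    and R: "\<And>j. j \<in> I \<Longrightarrow> \<exists>\<Phi>. tame_smooth d X (\<lambda>(s :: complex ^ 'v) x. \<Phi> x) \<and>
              (\<forall>x\<in>open_box d X. F j x = H j x + of_real (x 1) ^ M * \<Phi> x)"
  shows "\<exists>\<Phi>. tame_smooth d X (\<lambda>(s :: complex ^ 'v) x. \<Phi> x) \<and>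
            (\<forall>x\<in>open_box d X. (\<Prod>j\<in>I. F j x) = (\<Prod>j\<in>I. H j x) + of_real (x 1) ^ M * \<Phi> x)"
  using assms(2-)
proof (induction I rule: finite_induct)
  case empty
  show ?case by (intro exI[of _ "\<lambda>_. 0"] conjI ballI tame_smooth_const[OF X]) simp
next
  case (insert i I)
  obtain \<Phi> where \<Phi>: "tame_smooth d X (\<lambda>(s :: complex ^ 'v) x. \<Phi> x)"
    "\<And>x. x \<in> open_box d X \<Longrightarrow> (\<Prod>j\<in>I. F j x) = (\<Prod>j\<in>I. H j x) + of_real (x 1) ^ M * \<Phi> x"
    using insert.IH[OF insert.prems(1)[OF insertI2] insert.prems(2)[OF insertI2] insert.prems(3)[OF insertI2]] by blast
  obtain \<Psi> where \<Psi>: "tame_smooth d X (\<lambda>(s :: complex ^ 'v) x. \<Psi> x)"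
    "\<And>x. x \<in> open_box d X \<Longrightarrow> F i x = H i x + of_real (x 1) ^ M * \<Psi> x"
    using insert.prems(3)[OF insertI1] by blast
  have eq: "(\<Prod>j\<in>insert i I. F j x) = (\<Prod>j\<in>insert i I. H j x) + of_real (x 1) ^ M * (F i x * \<Phi> x + \<Psi> x * (\<Prod>j\<in>I. H j x))"
    if x: "x \<in> open_box d X" for x
  proof -
    have "F i x * (P + m * f) = H i x * P + m * (F i x * f + \<Psi> x * P)" if "F i x = H i x + m * \<Psi> x" for P m f
      using that by (simp add: algebra_simps)
    from this[OF \<Psi>(2)[OF x]] show ?thesis
      unfolding prod.insert[OF insert.hyps] \<Phi>(2)[OF x] .
  qed
  have "tame_smooth d X (\<lambda>(s :: complex ^ 'v) x. F i x * \<Phi> x + \<Psi> x * (\<Prod>j\<in>I. H j x))"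
    by (rule tame_smooth_add[OF X tame_smooth_mult[OF X insert.prems(1)[OF insertI1] \<Phi>(1)]
          tame_smooth_mult[OF X \<Psi>(1) tame_smooth_prod[OF X insert.prems(2)[OF insertI2]]]])
  with eq show ?case by (intro exI[of _ "\<lambda>x. F i x * \<Phi> x + \<Psi> x * (\<Prod>j\<in>I. H j x)"] conjI ballI)
qed

text \<open>The power of the chain argument splits into the power of \<open>x 1\<close> that is
  wanted and a tame power of the remaining variables. The bound \<open>x 1 \<le> 1\<close> keeps the
  argument in [0, 1], where the derivatives of \<open>R\<close> are bounded by compactness.\<close>

lemma cbern_chain_remainder:
  assumes X: "X \<subseteq> {0..1}" and j: "j \<in> {1..d}"
  shows "\<exists>\<Phi>. tame_smooth d X (\<lambda>(s :: complex ^ 'v::finite) x. \<Phi> x) \<and>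
     (\<forall>x\<in>open_box d X. cbern (of_real (chain_arg a j x)) =
        (\<Sum>p\<le>N. bern_fps $ p * of_real (chain_arg a j x) ^ p) + of_real (x 1) ^ Suc N * \<Phi> x)"
proof -
  have X0: "X \<subseteq> {0..}" using X by auto
  have "0 \<in> bern_strip" by (simp add: bern_strip_def)
  from fps_remainder_holomorphic[OF cbern_holomorphic open_bern_strip this cbern_has_fps_expansion]
  obtain R where R: "R holomorphic_on bern_strip"
    "\<And>z. z \<in> bern_strip \<Longrightarrow> cbern z = (\<Sum>p\<le>N. bern_fps $ p * z ^ p) + z ^ Suc N * R z" by blast
  have "tame_smooth d X (\<lambda>(s :: complex ^ 'v) x. R (of_real (chain_arg a j x)))"
  proof (rule tame_smooth_compose[OF X0 tame_smooth_chain_arg[OF X0 j] R(1) open_bern_strip of_real_bern_strip])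
    fix r
    have "(deriv ^^ r) R holomorphic_on bern_strip" by (intro holomorphic_higher_deriv R open_bern_strip)
    then have "continuous_on (of_real ` {0..1}) ((deriv ^^ r) R)"
      by (intro holomorphic_on_imp_continuous_on) (auto elim!: holomorphic_on_subset simp: of_real_bern_strip)
    then have "compact ((deriv ^^ r) R ` (of_real ` {0..1}))"
      by (intro compact_continuous_image) (auto intro!: compact_continuous_image continuous_intros)
    then have "bounded ((deriv ^^ r) R ` (of_real ` {0..1}))" by (rule compact_imp_bounded)
    then obtain C where "\<forall>w\<in>(deriv ^^ r) R ` (of_real ` {0..1}). norm w \<le> C" unfolding bounded_iff by blast
    then have C: "norm ((deriv ^^ r) R (of_real y)) \<le> C" if "y \<in> {0..1}" for y :: real using that by blast
    have "norm ((deriv ^^ r) R (of_real (chain_arg a j x))) \<le> C" if x: "x \<in> half_box d X" for x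
    proof (rule C)
      have o: "x \<in> open_box d X" using x half_box_subset by blast
      have "x 1 \<le> 1" using x X unfolding half_box_def by auto
      then show "chain_arg a j x \<in> {0..1}"
        using chain_arg_bounds[OF o X0, of j a] j by auto
    qed
    then show "\<exists>C. \<forall>x\<in>half_box d X. norm ((deriv ^^ r) R (of_real (chain_arg a j x))) \<le> C" by blast
  qed
  then have "tame_smooth d X (\<lambda>(s :: complex ^ 'v) x. of_real (\<Prod>i=2..j. t_var a x i) ^ Suc N * R (of_real (chain_arg a j x)))"
    by (intro tame_smooth_mult tame_smooth_power tame_smooth_prod_t_var X0 j)
  moreover have "cbern (of_real (chain_arg a j x)) = (\<Sum>p\<le>N. bern_fps $ p * of_real (chain_arg a j x) ^ p)
     + of_real (x 1) ^ Suc N * (of_real (\<Prod>i=2..j. t_var a x i) ^ Suc N * R (of_real (chain_arg a j x)))" for x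
  proof -
    have "of_real (chain_arg a j x) ^ Suc N = (of_real (x 1) ^ Suc N * of_real (\<Prod>i=2..j. t_var a x i) ^ Suc N :: complex)"
      unfolding chain_arg_def of_real_mult power_mult_distrib ..
    then show ?thesis using R(2)[OF of_real_bern_strip[of "chain_arg a j x"]] by (simp only: mult.assoc)
  qed
  ultimately show ?thesis
    by (intro exI[of _ "\<lambda>x. of_real (\<Prod>i=2..j. t_var a x i) ^ Suc N * R (of_real (chain_arg a j x))"] conjI ballI)
qed

lemma tame_smooth_mono_term:
  assumes "X \<subseteq> {0..}"
  shows "tame_smooth d X (\<lambda>(s :: complex ^ 'v::finite) x. mono_term d a p x)"
  unfolding mono_term_def
  by (intro tame_smooth_mult tame_smooth_const tame_smooth_prod tame_smooth_power tame_smooth_t_var assms)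

text \<open>Multiplying out polynomials of degree \<open>N\<close> in each factor also produces
  total degrees above \<open>N\<close>; each such monomial contains \<open>x 1 ^ Suc N\<close>, so
  these finitely many terms go into the remainder.\<close>

lemma low_product_remainder:
  assumes X: "X \<subseteq> {0..}" and d: "d \<ge> 1"
  shows "\<exists>\<Phi>. tame_smooth d X (\<lambda>(s :: complex ^ 'v::finite) x. \<Phi> x) \<and>
     (\<forall>x\<in>open_box d X. (\<Prod>j=1..d. \<Sum>p\<le>N. bern_fps $ p * of_real (chain_arg a j x) ^ p) =
        (\<Sum>k=0..N. \<Sum>p\<in>compositions d k. of_real (x 1) ^ k * mono_term d a p x) + of_real (x 1) ^ Suc N * \<Phi> x)"
proof -
  let ?P = "{1..d} \<rightarrow>\<^sub>E {..N}" and ?s = "\<lambda>p. \<Sum>i=1..d. p i :: nat"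
  define Q where "Q = {p\<in>?P. ?s p > N}"
  define \<Phi> where "\<Phi> x = (\<Sum>p\<in>Q. of_real (x 1) ^ (?s p - Suc N) * mono_term d a p x)" for x
  have finP: "finite ?P" by (intro finite_PiE) auto
  have "tame_smooth d X (\<lambda>(s :: complex ^ 'v) x. \<Phi> x)"
    unfolding \<Phi>_def
    by (intro tame_smooth_sum tame_smooth_mult tame_smooth_power tame_smooth_coord tame_smooth_mono_term X) (use d in auto)
  moreover have "(\<Prod>j=1..d. \<Sum>p\<le>N. bern_fps $ p * of_real (chain_arg a j x) ^ p) =
        (\<Sum>k=0..N. \<Sum>p\<in>compositions d k. of_real (x 1) ^ k * mono_term d a p x) + of_real (x 1) ^ Suc N * \<Phi> x" for x
  proof -
    have "(\<Prod>j=1..d. \<Sum>p\<le>N. bern_fps $ p * of_real (chain_arg a j x) ^ p) =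
        (\<Sum>p\<in>?P. \<Prod>j=1..d. bern_fps $ p j * of_real (chain_arg a j x) ^ p j)"
      by (rule prod_sum_PiE) auto
    also have "\<dots> = (\<Sum>p\<in>?P. of_real (x 1) ^ ?s p * mono_term d a p x)"
      unfolding prod_chain_terms ..
    also have "\<dots> = (\<Sum>p\<in>?P - Q. of_real (x 1) ^ ?s p * mono_term d a p x) + (\<Sum>p\<in>Q. of_real (x 1) ^ ?s p * mono_term d a p x)"
      by (rule sum.subset_diff) (use finP in \<open>auto simp: Q_def\<close>)
    also have "(\<Sum>p\<in>Q. of_real (x 1) ^ ?s p * mono_term d a p x) = of_real (x 1) ^ Suc N * \<Phi> x"
      unfolding \<Phi>_def sum_distrib_left
    proof (rule sum.cong[OF refl])
      fix p assume "p \<in> Q"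
      then have "?s p = Suc N + (?s p - Suc N)" by (simp add: Q_def)
      then have "complex_of_real (x 1) ^ ?s p = of_real (x 1) ^ Suc N * of_real (x 1) ^ (?s p - Suc N)"
        by (metis power_add)
      then show "of_real (x 1) ^ ?s p * mono_term d a p x = of_real (x 1) ^ Suc N * (of_real (x 1) ^ (?s p - Suc N) * mono_term d a p x)"
        by (simp only: mult.assoc)
    qed
    \<comment> \<open>A composition of some \<open>k \<le> N\<close> has all parts at most
      \<open>N\<close>, so every composition of total degree up to \<open>N\<close> is
      present.\<close>
    also have "?P - Q = (\<Union>k\<in>{0..N}. compositions d k)"
    proof (intro equalityI subsetI)
      fix p assume "p \<in> ?P - Q"
      then show "p \<in> (\<Union>k\<in>{0..N}. compositions d k)"
        by (intro UN_I[of "?s p"]) (auto simp: Q_def compositions_def PiE_def)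
    next
      fix p assume "p \<in> (\<Union>k\<in>{0..N}. compositions d k)"
      then have pe: "p \<in> {1..d} \<rightarrow>\<^sub>E UNIV" and s: "?s p \<le> N" by (auto simp: compositions_def)
      have "p i \<le> N" if "i \<in> {1..d}" for i
        using member_le_sum[of i "{1..d}" p] that s by auto
      then have "p \<in> ?P" using pe by (auto simp: PiE_def Pi_def)
      then show "p \<in> ?P - Q" using s by (simp add: Q_def)
    qed
    also have "(\<Sum>p\<in>(\<Union>k\<in>{0..N}. compositions d k). of_real (x 1) ^ ?s p * mono_term d a p x)
        = (\<Sum>k=0..N. \<Sum>p\<in>compositions d k. of_real (x 1) ^ ?s p * mono_term d a p x)"
      by (rule sum.UNION_disjoint) (simp, simp add: finite_compositions, force simp: compositions_def)
    also have "\<dots> = (\<Sum>k=0..N. \<Sum>p\<in>compositions d k. of_real (x 1) ^ k * mono_term d a p x)"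
      by (intro sum.cong refl) (simp add: compositions_def)
    finally show ?thesis .
  qed
  ultimately show ?thesis by blast
qed

lemma bernoulli_product_remainder:
  assumes X: "X \<subseteq> {0..1}" and d: "d \<ge> 1"
  shows "\<exists>\<Phi>. tame_smooth d X (\<lambda>(s :: complex ^ 'v::finite) x. \<Phi> x) \<and>
     (\<forall>x\<in>open_box d X. (\<Prod>j=1..d. cbern (of_real (chain_arg a j x))) =
        (\<Sum>k=0..N. \<Sum>p\<in>compositions d k. of_real (x 1) ^ k * mono_term d a p x) + of_real (x 1) ^ Suc N * \<Phi> x)"
proof -
  have X0: "X \<subseteq> {0..}" using X by auto
  obtain \<Phi> where \<Phi>: "tame_smooth d X (\<lambda>(s :: complex ^ 'v) x. \<Phi> x)"
     "\<And>x. x \<in> open_box d X \<Longrightarrow> (\<Prod>j=1..d. \<Sum>p\<le>N. bern_fps $ p * of_real (chain_arg a j x) ^ p) =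
        (\<Sum>k=0..N. \<Sum>p\<in>compositions d k. of_real (x 1) ^ k * mono_term d a p x) + of_real (x 1) ^ Suc N * \<Phi> x"
    using low_product_remainder[OF X0 d] by blast
  have "\<exists>\<Phi>. tame_smooth d X (\<lambda>(s :: complex ^ 'v) x. \<Phi> x) \<and>
     (\<forall>x\<in>open_box d X. (\<Prod>j=1..d. cbern (of_real (chain_arg a j x))) =
        (\<Prod>j=1..d. \<Sum>p\<le>N. bern_fps $ p * of_real (chain_arg a j x) ^ p) + of_real (x 1) ^ Suc N * \<Phi> x)"
    by (rule prod_cong_remainder[OF X0 _ tame_smooth_cbern_chain_arg[OF X0] _ cbern_chain_remainder[OF X]])
       (auto intro!: tame_smooth_sum tame_smooth_mult tame_smooth_const tame_smooth_power tame_smooth_chain_arg X0)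
  then obtain \<Psi> where \<Psi>: "tame_smooth d X (\<lambda>(s :: complex ^ 'v) x. \<Psi> x)"
     "\<And>x. x \<in> open_box d X \<Longrightarrow> (\<Prod>j=1..d. cbern (of_real (chain_arg a j x))) =
        (\<Prod>j=1..d. \<Sum>p\<le>N. bern_fps $ p * of_real (chain_arg a j x) ^ p) + of_real (x 1) ^ Suc N * \<Psi> x"
    by blast
  have "tame_smooth d X (\<lambda>(s :: complex ^ 'v) x. \<Phi> x + \<Psi> x)"
    by (intro tame_smooth_add X0 \<Phi>(1) \<Psi>(1))
  moreover have "(\<Prod>j=1..d. cbern (of_real (chain_arg a j x))) =
        (\<Sum>k=0..N. \<Sum>p\<in>compositions d k. of_real (x 1) ^ k * mono_term d a p x) + of_real (x 1) ^ Suc N * (\<Phi> x + \<Psi> x)"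
    if "x \<in> open_box d X" for x
    unfolding \<Psi>(2)[OF that] \<Phi>(2)[OF that] by (simp only: distrib_left add.assoc)
  ultimately show ?thesis by blast
qed

definition phi_series :: "nat \<Rightarrow> nat \<Rightarrow> (nat \<Rightarrow> nat) \<Rightarrow> (nat \<Rightarrow> real) \<Rightarrow> complex"
  where "phi_series d N a x = (\<Sum>\<^sub>\<infinity>k\<in>{N + 1..}. \<Sum>p\<in>compositions d k. of_real (x 1) ^ (k - N - 1) * mono_term d a p x)"

text \<open>Since \<open>x 1 \<le> 1\<close>, every chain argument is below \<open>2 * pi\<close>
  and each factor converges absolutely. The product series over all multi-indices may then be
  regrouped by total degree.\<close>

lemma bernoulli_product_series:
  assumes X: "X \<subseteq> {0<..1}" and x: "x \<in> open_box d X"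
  shows "(\<Prod>j=1..d. cbern (of_real (chain_arg a j x))) =
        (\<Sum>k=0..N. \<Sum>p\<in>compositions d k. of_real (x 1) ^ k * mono_term d a p x) + of_real (x 1) ^ Suc N * phi_series d N a x"
proof -
  let ?P = "{1..d} \<rightarrow>\<^sub>E (UNIV :: nat set)" and ?s = "\<lambda>p. \<Sum>i=1..d. p i :: nat"
  define h where "h p = of_real (x 1) ^ ?s p * mono_term d a p x" for p
  have x1: "x 1 \<le> 1" using x X unfolding open_box_def by auto
  have X0: "X \<subseteq> {0..}" using X by auto
  have w: "norm (complex_of_real (chain_arg a j x)) < 2 * pi" if "j \<in> {1..d}" for j
    using chain_arg_bounds[OF x X0, of j a] that x1 pi_gt3 by auto
  have hp: "h = (\<lambda>p. \<Prod>j=1..d. bern_fps $ p j * of_real (chain_arg a j x) ^ p j)"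
    unfolding h_def prod_chain_terms ..
  have sm: "Infinite_Sum.abs_summable_on (\<lambda>n. bern_fps $ n * of_real (chain_arg a j x) ^ n) UNIV" if "j \<in> {1..d}" for j
    by (rule cbern_abs_summable[OF w[OF that]])
  have tot: "infsum h ?P = (\<Prod>j=1..d. cbern (of_real (chain_arg a j x)))"
    unfolding hp by (subst infsum_prod_PiE_abs) (auto intro!: sm prod.cong cbern_infsum w)
  have "Infinite_Sum.abs_summable_on h ?P"
    unfolding hp abs_summable_equivalent
    by (rule abs_summable_on_prod_PiE) (use sm in \<open>auto simp: abs_summable_equivalent\<close>)
  then have hs: "h summable_on ?P" by (rule abs_summable_summable)
  let ?L = "\<Union>k\<in>{0..N}. compositions d k"
  have L: "?L \<subseteq> ?P" "finite ?L"
    by (auto simp: compositions_def)[1] (intro finite_UN_I finite_atLeastAtMost finite_compositions)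
  have "infsum h ?P = infsum h ?L + infsum h (?P - ?L)"
    using infsum_Un_disjoint[of h ?L "?P - ?L"] summable_on_subset_banach[OF hs L(1)] summable_on_subset_banach[OF hs, of "?P - ?L"] L(1)
    by (simp add: Un_absorb1)
  also have "infsum h ?L = (\<Sum>k=0..N. \<Sum>p\<in>compositions d k. of_real (x 1) ^ k * mono_term d a p x)"
  proof -
    have "infsum h ?L = (\<Sum>k=0..N. \<Sum>p\<in>compositions d k. h p)"
      unfolding infsum_finite[OF L(2)] by (rule sum.UNION_disjoint) (simp, simp add: finite_compositions, force simp: compositions_def)
    also have "\<dots> = (\<Sum>k=0..N. \<Sum>p\<in>compositions d k. of_real (x 1) ^ k * mono_term d a p x)"
      by (intro sum.cong refl) (simp add: h_def compositions_def)
    finally show ?thesis .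
  qed
  also have "infsum h (?P - ?L) = (\<Sum>\<^sub>\<infinity>k\<in>{N + 1..}. \<Sum>\<^sub>\<infinity>p\<in>compositions d k. h p)"
  proof -
    define P where "P = ?P"
    define S where "S = ?s"
    have c: "compositions d k = {p\<in>P. S p = k}" for k by (simp add: compositions_def P_def S_def)
    have M: "?P - ?L = {p\<in>P. N + 1 \<le> S p}" unfolding c P_def[symmetric] by auto
    let ?M = "{p\<in>P. N + 1 \<le> S p}" and ?C = "\<lambda>k. {p\<in>P. S p = k}"
    \<comment> \<open>The multi-indices of degree above \<open>N\<close> are fibred over their
      degree, so that an infinite sum over pairs can be iterated.\<close>
    have b: "bij_betw snd (Sigma {N + 1..} ?C) ?M"
      by (rule bij_betw_byWitness[where f' = "\<lambda>p. (S p, p)"]) auto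
    have "h summable_on ?M" unfolding M[symmetric] by (rule summable_on_subset_banach[OF hs]) simp
    then have "(\<lambda>z. h (snd z)) summable_on Sigma {N + 1..} ?C"
      unfolding summable_on_reindex_bij_betw[OF b] .
    then have "(\<lambda>(k, p). h p) summable_on Sigma {N + 1..} ?C" by (simp add: case_prod_unfold)
    then have "(\<Sum>\<^sub>\<infinity>k\<in>{N + 1..}. \<Sum>\<^sub>\<infinity>p\<in>?C k. h p) = infsum (\<lambda>(k, p). h p) (Sigma {N + 1..} ?C)"
      by (rule infsum_Sigma'_banach)
    also have "\<dots> = infsum (\<lambda>z. h (snd z)) (Sigma {N + 1..} ?C)" by (simp add: case_prod_unfold)
    also have "\<dots> = infsum h ?M" by (rule infsum_reindex_bij_betw[OF b])
    finally show ?thesis unfolding M unfolding c by (rule sym)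
  qed
  also have "\<dots> = (\<Sum>\<^sub>\<infinity>k\<in>{N + 1..}. of_real (x 1) ^ Suc N * (\<Sum>p\<in>compositions d k. of_real (x 1) ^ (k - N - 1) * mono_term d a p x))"
  proof (rule infsum_cong)
    fix k assume "k \<in> {N + 1..}"
    then have "k = Suc N + (k - N - 1)" by simp
    then have k: "complex_of_real (x 1) ^ k = of_real (x 1) ^ Suc N * of_real (x 1) ^ (k - N - 1)" by (metis power_add)
    have "(\<Sum>\<^sub>\<infinity>p\<in>compositions d k. h p) = (\<Sum>p\<in>compositions d k. of_real (x 1) ^ k * mono_term d a p x)"
      unfolding infsum_finite[OF finite_compositions] by (rule sum.cong) (simp_all add: h_def compositions_def)
    then show "(\<Sum>\<^sub>\<infinity>p\<in>compositions d k. h p) = of_real (x 1) ^ Suc N * (\<Sum>p\<in>compositions d k. of_real (x 1) ^ (k - N - 1) * mono_term d a p x)"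
      unfolding k sum_distrib_left by (simp only: mult.assoc)
  qed
  also have "\<dots> = of_real (x 1) ^ Suc N * phi_series d N a x"
    unfolding phi_series_def by (rule infsum_cmult_right')
  finally show ?thesis unfolding tot .
qed

lemma ez_phi_eq: "ez_phi d n s a x = (\<Prod>j=2..d. of_real (1 - x j) powr v_exp d s a j) * phi_series d (n 1) a x"
  unfolding ez_phi_def phi_series_def mono_term_def
proof (rule arg_cong2[of _ _ _ _ times, OF refl])
  show "(\<Sum>\<^sub>\<infinity>k\<in>{n 1 + 1..}. \<Sum>p\<in>compositions d k. bern_coeff d p * of_real (x 1) ^ (k - n 1 - 1) *
          (\<Prod>j=2..d. of_real (t_var a x j) ^ tail_sum d p j))
      = (\<Sum>\<^sub>\<infinity>k\<in>{n 1 + 1..}. \<Sum>p\<in>compositions d k. of_real (x 1) ^ (k - n 1 - 1) *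
          (bern_coeff d p * (\<Prod>j=2..d. of_real (t_var a x j) ^ tail_sum d p j)))"
    by (rule infsum_cong, rule sum.cong[OF refl]) (simp only: mult_ac)
qed

text \<open>The series is not differentiated term by term. It and the tame remainder
  \<open>\<Phi>\<close> complete the same Taylor polynomial to the same product, so they agree after
  cancelling the power of \<open>x 1\<close>; this is why 0 is excluded from the range of
  \<open>x 1\<close>.\<close>

lemma tame_smooth_ez_phi:
  assumes d: "d \<ge> 1"
  shows "tame_smooth d {0<..1} (\<lambda>z. ez_phi d n (coords (e :: nat \<Rightarrow> 'v::finite) z) a)"
proof -
  have X: "{0<..1} \<subseteq> {0..1::real}" and X0: "{0<..1} \<subseteq> {0..(1::real)}" "{0<..1} \<subseteq> {0::real..}" by auto
  obtain \<Phi> where \<Phi>: "tame_smooth d {0<..1} (\<lambda>(s :: complex ^ 'v) x. \<Phi> x)"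
     "\<And>x. x \<in> open_box d {0<..1} \<Longrightarrow> (\<Prod>j=1..d. cbern (of_real (chain_arg a j x))) =
        (\<Sum>k=0..n 1. \<Sum>p\<in>compositions d k. of_real (x 1) ^ k * mono_term d a p x) + of_real (x 1) ^ Suc (n 1) * \<Phi> x"
    using bernoulli_product_remainder[OF X d] by blast
  have ser: "phi_series d (n 1) a x = \<Phi> x" if x: "x \<in> open_box d {0<..1}" for x
  proof -
    have "of_real (x 1) ^ Suc (n 1) * phi_series d (n 1) a x = of_real (x 1) ^ Suc (n 1) * \<Phi> x"
      using trans[OF bernoulli_product_series[OF order_refl x, of a "n 1", symmetric] \<Phi>(2)[OF x]]
      by (simp only: add_left_cancel)
    moreover have "complex_of_real (x 1) \<noteq> 0" using x by (auto simp: open_box_def)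
    ultimately show ?thesis by simp
  qed
  have "tame_smooth d {0<..1} (\<lambda>z x. (\<Prod>j=2..d. of_real (1 - x j) powr v_exp d (coords e z) a j) * \<Phi> x)"
    by (intro tame_smooth_mult tame_smooth_weight X0(2) \<Phi>(1))
  then show ?thesis by (rule tame_smooth_cong) (simp only: ez_phi_eq ser)
qed

section \<open>Iterated Laplace integrals at real points\<close>

text \<open>The numbers \<open>y * x (j+1) * ... * x i\<close> form a decreasing chain starting at
  \<open>y\<close>. Powers of the differences of consecutive members contribute the factors
  \<open>1 - x i\<close>; together with the Jacobian they give \<open>x i\<close> the exponent
  \<open>tail_sum d r i - 1\<close>.\<close>

definition chain_density :: "nat \<Rightarrow> (nat \<Rightarrow> real) \<Rightarrow> nat \<Rightarrow> real \<Rightarrow> (nat \<Rightarrow> real) \<Rightarrow> ennreal"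
  where "chain_density d r j y x = (\<Prod>i\<in>{j<..d}.
     ennreal (indicator {0<..<1} (x i) * (x i powr (tail_sum d r i - 1) * (1 - x i) powr (r (i - 1) - 1)
       / (exp (y * (\<Prod>l\<in>{j<..i}. x l)) - 1))))"

text \<open>
  Integrating \<open>chain_measure d r j\<close> against \<open>exp (- c * y)\<close> gives the partial zeta sum over the indices
  \<open>j, \<dots>, d\<close> shifted by \<open>c\<close>; the values are extended nonnegative so that Tonelli applies
  without any integrability.
\<close>
definition chain_measure :: "nat \<Rightarrow> (nat \<Rightarrow> real) \<Rightarrow> nat \<Rightarrow> real \<Rightarrow> ennreal"
  where "chain_measure d r j y = ennreal (indicator {0<..} y * (y powr (tail_sum d r j - 1) / (exp y - 1))) *
     (\<integral>\<^sup>+ x. chain_density d r j y x \<partial>Pi\<^sub>M {j<..d} (\<lambda>_. lborel))"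

lemma measurable_PiM_lborel_component:
  "i \<in> I \<Longrightarrow> (\<lambda>x. x i) \<in> borel_measurable (Pi\<^sub>M I (\<lambda>_. lborel :: real measure))"
  using measurable_component_singleton[of i I "\<lambda>_. lborel :: real measure"] by simp

lemma chain_density_measurable:
  "(\<lambda>(y, x). chain_density d r j y x) \<in> borel_measurable (borel \<Otimes>\<^sub>M Pi\<^sub>M {j<..d} (\<lambda>_. lborel))"
proof -
  have c: "(\<lambda>z. snd z i) \<in> borel_measurable (borel \<Otimes>\<^sub>M Pi\<^sub>M {j<..d} (\<lambda>_. lborel :: real measure))" if "i \<in> {j<..d}" for i
    by (rule measurable_compose[OF measurable_snd measurable_PiM_lborel_component[OF that]])
  have p: "(\<lambda>z. \<Prod>l\<in>{j<..i}. snd z l) \<in> borel_measurable (borel \<Otimes>\<^sub>M Pi\<^sub>M {j<..d} (\<lambda>_. lborel :: real measure))" if "i \<in> {j<..d}" for i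
    using that by (intro borel_measurable_prod c) auto
  show ?thesis
    unfolding chain_density_def case_prod_unfold
  proof (rule borel_measurable_prod_ennreal)
    fix i assume i: "i \<in> {j<..d}"
    note [measurable] = c[OF i] p[OF i]
    show "(\<lambda>z. ennreal (indicator {0<..<1} (snd z i) * (snd z i powr (tail_sum d r i - 1) * (1 - snd z i) powr (r (i - 1) - 1)
       / (exp (fst z * (\<Prod>l\<in>{j<..i}. snd z l)) - 1)))) \<in> borel_measurable (borel \<Otimes>\<^sub>M Pi\<^sub>M {j<..d} (\<lambda>_. lborel))"
      by measurable
  qed
qed

lemma chain_measure_measurable [measurable]: "chain_measure d r j \<in> borel_measurable borel"
proof -
  interpret sigma_finite_measure "Pi\<^sub>M {j<..d} (\<lambda>_. lborel :: real measure)"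
    by (rule lborel_product.sigma_finite) simp
  have "(\<lambda>y. \<integral>\<^sup>+ x. chain_density d r j y x \<partial>Pi\<^sub>M {j<..d} (\<lambda>_. lborel)) \<in> borel_measurable borel"
    by (rule borel_measurable_nn_integral[OF chain_density_measurable])
  then show ?thesis unfolding chain_measure_def[abs_def] by measurable
qed

lemma chain_density_step:
  assumes "j < d"
  shows "chain_density d r j y (x(Suc j := t)) =
    ennreal (indicator {0<..<1} t * (t powr (tail_sum d r (Suc j) - 1) * (1 - t) powr (r j - 1) / (exp (y * t) - 1)))
    * chain_density d r (Suc j) (y * t) x"
proof -
  have S: "{j<..d} = insert (Suc j) {Suc j<..d}" using assms by auto
  have P: "(\<Prod>l\<in>{j<..i}. (x(Suc j := t)) l) = t * (\<Prod>l\<in>{Suc j<..i}. x l)" if "i \<in> {Suc j<..d}" for i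
  proof -
    have "{j<..i} = insert (Suc j) {Suc j<..i}" using that by auto
    then show ?thesis by (auto intro!: prod.cong)
  qed
  have "{j<..Suc j} = {Suc j}" by auto
  then have 1: "(\<Prod>l\<in>{j<..Suc j}. (x(Suc j := t)) l) = t" by simp
  have rest: "(\<Prod>i\<in>{Suc j<..d}. ennreal (indicator {0<..<1} ((x(Suc j := t)) i) * ((x(Suc j := t)) i powr (tail_sum d r i - 1) *
       (1 - (x(Suc j := t)) i) powr (r (i - 1) - 1) / (exp (y * (\<Prod>l\<in>{j<..i}. (x(Suc j := t)) l)) - 1))))
     = chain_density d r (Suc j) (y * t) x"
    unfolding chain_density_def
  proof (rule prod.cong[OF refl])
    fix i assume i: "i \<in> {Suc j<..d}"
    then have xi: "(x(Suc j := t)) i = x i" by simp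
    show "ennreal (indicator {0<..<1} ((x(Suc j := t)) i) * ((x(Suc j := t)) i powr (tail_sum d r i - 1) *
       (1 - (x(Suc j := t)) i) powr (r (i - 1) - 1) / (exp (y * (\<Prod>l\<in>{j<..i}. (x(Suc j := t)) l)) - 1)))
      = ennreal (indicator {0<..<1} (x i) * (x i powr (tail_sum d r i - 1) *
       (1 - x i) powr (r (i - 1) - 1) / (exp (y * t * (\<Prod>l\<in>{Suc j<..i}. x l)) - 1)))"
      unfolding P[OF i] xi mult.assoc[of y t] ..
  qed
  have "chain_density d r j y (x(Suc j := t)) = ennreal (indicator {0<..<1} t * (t powr (tail_sum d r (Suc j) - 1) *
       (1 - t) powr (r j - 1) / (exp (y * t) - 1))) * (\<Prod>i\<in>{Suc j<..d}. ennreal (indicator {0<..<1} ((x(Suc j := t)) i) * ((x(Suc j := t)) i powr (tail_sum d r i - 1) *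
       (1 - (x(Suc j := t)) i) powr (r (i - 1) - 1) / (exp (y * (\<Prod>l\<in>{j<..i}. (x(Suc j := t)) l)) - 1))))"
    unfolding chain_density_def S
    by (subst prod.insert) (simp_all only: finite_greaterThanAtMost greaterThanAtMost_iff less_irrefl 1 fun_upd_same diff_Suc_1 simp_thms)
  then show ?thesis unfolding rest .
qed

lemma chain_density_measurable_snd:
  "chain_density d r j y \<in> borel_measurable (Pi\<^sub>M {j<..d} (\<lambda>_. lborel))"
proof -
  have "Pair y \<in> measurable (Pi\<^sub>M {j<..d} (\<lambda>_. lborel :: real measure)) (borel \<Otimes>\<^sub>M Pi\<^sub>M {j<..d} (\<lambda>_. lborel :: real measure))"
    by (rule measurable_Pair1') simp
  from measurable_compose[OF this chain_density_measurable] show ?thesis by simp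
qed

text \<open>The substitution \<open>z = y * t\<close> makes \<open>t\<close> the new coordinate
  \<open>x (Suc j)\<close>. The powers of \<open>y\<close> add up as
  \<open>1 + (r j - 1) + (tail_sum d r (Suc j) - 1)\<close>, the 1 coming from the Jacobian. So the
  change to chain variables is a convolution, one variable at a time.\<close>

lemma chain_measure_step:
  assumes j: "1 \<le> j" "j < d" and y: "y > 0" and r: "tail_sum d r j = r j + tail_sum d r (Suc j)"
  shows "chain_measure d r j y = ennreal (1 / (exp y - 1)) *
     (\<integral>\<^sup>+ z. ennreal (indicator {0<..} (y - z) * (y - z) powr (r j - 1)) * chain_measure d r (Suc j) z \<partial>lborel)"
proof -
  let ?s = "tail_sum d r (Suc j)"
  have S: "{j<..d} = insert (Suc j) {Suc j<..d}" using j by auto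
  have m2: "(\<lambda>x. chain_density d r j y x) \<in> borel_measurable (Pi\<^sub>M {j<..d} (\<lambda>_. lborel))"
    by (rule chain_density_measurable_snd)
  have m3: "(\<lambda>x. chain_density d r (Suc j) y x) \<in> borel_measurable (Pi\<^sub>M {Suc j<..d} (\<lambda>_. lborel))" for y
    by (rule chain_density_measurable_snd)
  define A where "A t = ennreal (indicator {0<..<1} t * (t powr (?s - 1) * (1 - t) powr (r j - 1) / (exp (y * t) - 1)))" for t
  have "(\<integral>\<^sup>+ x. chain_density d r j y x \<partial>Pi\<^sub>M {j<..d} (\<lambda>_. lborel))
      = (\<integral>\<^sup>+ t. (\<integral>\<^sup>+ x. chain_density d r j y (x(Suc j := t)) \<partial>Pi\<^sub>M {Suc j<..d} (\<lambda>_. lborel)) \<partial>lborel)"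
    using m2 unfolding S by (intro lborel_product.product_nn_integral_insert_rev) auto
  also have "\<dots> = (\<integral>\<^sup>+ t. A t * (\<integral>\<^sup>+ x. chain_density d r (Suc j) (y * t) x \<partial>Pi\<^sub>M {Suc j<..d} (\<lambda>_. lborel)) \<partial>lborel)"
    unfolding chain_density_step[OF j(2)] A_def by (simp add: nn_integral_cmult m3)
  finally have L: "(\<integral>\<^sup>+ x. chain_density d r j y x \<partial>Pi\<^sub>M {j<..d} (\<lambda>_. lborel))
      = (\<integral>\<^sup>+ t. A t * (\<integral>\<^sup>+ x. chain_density d r (Suc j) (y * t) x \<partial>Pi\<^sub>M {Suc j<..d} (\<lambda>_. lborel)) \<partial>lborel)" .
  have "(\<integral>\<^sup>+ z. ennreal (indicator {0<..} (y - z) * (y - z) powr (r j - 1)) * chain_measure d r (Suc j) z \<partial>lborel)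
      = ennreal \<bar>y\<bar> * (\<integral>\<^sup>+ t. ennreal (indicator {0<..} (y - (0 + y * t)) * (y - (0 + y * t)) powr (r j - 1)) * chain_measure d r (Suc j) (0 + y * t) \<partial>lborel)"
    by (rule nn_integral_real_affine) (use y in \<open>auto\<close>)
  also have "\<dots> = (\<integral>\<^sup>+ t. ennreal y * (ennreal (indicator {0<..} (y - (0 + y * t)) * (y - (0 + y * t)) powr (r j - 1)) * chain_measure d r (Suc j) (0 + y * t)) \<partial>lborel)"
    using y by (subst nn_integral_cmult[symmetric]) auto
  also have "\<dots> = (\<integral>\<^sup>+ t. ennreal (y powr (tail_sum d r j - 1)) * (A t * (\<integral>\<^sup>+ x. chain_density d r (Suc j) (y * t) x \<partial>Pi\<^sub>M {Suc j<..d} (\<lambda>_. lborel))) \<partial>lborel)"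
  proof (rule nn_integral_cong)
    fix t :: real
    have "ennreal y * (ennreal (indicator {0<..} (y - y * t) * (y - y * t) powr (r j - 1)) *
        ennreal (indicator {0<..} (y * t) * ((y * t) powr (?s - 1) / (exp (y * t) - 1))))
       = ennreal (y powr (tail_sum d r j - 1)) * A t"
    proof (cases "0 < t \<and> t < 1")
      case True
      then have t: "0 < t" "t < 1" by auto
      have e: "y * (y * (1 - t)) powr (r j - 1) * (y * t) powr (?s - 1) = y powr (tail_sum d r j - 1) * (t powr (?s - 1) * (1 - t) powr (r j - 1))"
      proof -
        have "y * (y powr (r j - 1) * y powr (?s - 1)) = y powr (1 + (r j - 1) + (?s - 1))"
          unfolding powr_add using y by simp
        also have "1 + (r j - 1) + (?s - 1) = tail_sum d r j - 1" using r by simp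
        finally show ?thesis using y t by (simp add: powr_mult mult_ac)
      qed
      have yt: "y - y * t = y * (1 - t)" by (simp add: algebra_simps)
      have pos: "0 < y * (1 - t)" "0 < y * t" using y t by simp_all
      have "ennreal y * (ennreal ((y * (1 - t)) powr (r j - 1)) * ennreal ((y * t) powr (?s - 1) / (exp (y * t) - 1)))
          = ennreal (y * (y * (1 - t)) powr (r j - 1) * (y * t) powr (?s - 1) / (exp (y * t) - 1))"
        using y pos by (simp add: ennreal_mult[symmetric] mult.assoc)
      also have "\<dots> = ennreal (y powr (tail_sum d r j - 1) * (t powr (?s - 1) * (1 - t) powr (r j - 1) / (exp (y * t) - 1)))"
        unfolding e by simp
      also have "\<dots> = ennreal (y powr (tail_sum d r j - 1)) * ennreal (t powr (?s - 1) * (1 - t) powr (r j - 1) / (exp (y * t) - 1))"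
        using pos by (intro ennreal_mult) auto
      finally show ?thesis unfolding A_def yt using pos t by (simp del: times_divide_eq_right)
    next
      case False
      then have "\<not> (0 < y * t) \<or> \<not> (0 < y - y * t)"
        using y by (auto simp: zero_less_mult_iff not_less)
      then show ?thesis using False unfolding A_def by (auto simp: indicator_def)
    qed
    then show "ennreal y * (ennreal (indicator {0<..} (y - (0 + y * t)) * (y - (0 + y * t)) powr (r j - 1)) * chain_measure d r (Suc j) (0 + y * t))
       = ennreal (y powr (tail_sum d r j - 1)) * (A t * (\<integral>\<^sup>+ x. chain_density d r (Suc j) (y * t) x \<partial>Pi\<^sub>M {Suc j<..d} (\<lambda>_. lborel)))"
      unfolding chain_measure_def add_0_left by (simp only: mult.assoc[symmetric])
  qed
  also have "\<dots> = ennreal (y powr (tail_sum d r j - 1)) * (\<integral>\<^sup>+ x. chain_density d r j y x \<partial>Pi\<^sub>M {j<..d} (\<lambda>_. lborel))"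
  proof -
    have "(\<lambda>t. \<integral>\<^sup>+ x. chain_density d r (Suc j) (y * t) x \<partial>Pi\<^sub>M {Suc j<..d} (\<lambda>_. lborel)) \<in> borel_measurable borel"
    proof -
      interpret sigma_finite_measure "Pi\<^sub>M {Suc j<..d} (\<lambda>_. lborel :: real measure)"
        by (rule lborel_product.sigma_finite) simp
      have "(\<lambda>y. \<integral>\<^sup>+ x. chain_density d r (Suc j) y x \<partial>Pi\<^sub>M {Suc j<..d} (\<lambda>_. lborel)) \<in> borel_measurable borel"
        by (rule borel_measurable_nn_integral[OF chain_density_measurable])
      then show ?thesis by (rule measurable_compose[rotated]) measurable
    qed
    moreover have "A \<in> borel_measurable borel" unfolding A_def by measurable
    ultimately show ?thesis unfolding L by (subst nn_integral_cmult) auto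
  qed
  finally have R: "(\<integral>\<^sup>+ z. ennreal (indicator {0<..} (y - z) * (y - z) powr (r j - 1)) * chain_measure d r (Suc j) z \<partial>lborel)
      = ennreal (y powr (tail_sum d r j - 1)) * (\<integral>\<^sup>+ x. chain_density d r j y x \<partial>Pi\<^sub>M {j<..d} (\<lambda>_. lborel))" .
  show ?thesis
  proof -
    have "chain_measure d r j y = ennreal (1 / (exp y - 1) * y powr (tail_sum d r j - 1)) * (\<integral>\<^sup>+ x. chain_density d r j y x \<partial>Pi\<^sub>M {j<..d} (\<lambda>_. lborel))"
      using y by (simp add: chain_measure_def)
    also have "ennreal (1 / (exp y - 1) * y powr (tail_sum d r j - 1)) = ennreal (1 / (exp y - 1)) * ennreal (y powr (tail_sum d r j - 1))"
      using y by (intro ennreal_mult) auto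
    finally show ?thesis unfolding R by (simp only: mult.assoc)
  qed
qed

section \<open>Laplace transforms and the zeta sum\<close>

lemma Gamma_Laplace:
  assumes "s > 0" "b > 0"
  shows "ennreal (Gamma s * b powr (- s)) = (\<integral>\<^sup>+ t. ennreal (indicator {0<..} t * t powr (s - 1) * exp (- b * t)) \<partial>lborel)"
proof -
  have "(\<integral>\<^sup>+ t. ennreal (indicator {0..} t * t powr (s - 1) / exp t) \<partial>lborel)
     = ennreal \<bar>b\<bar> * (\<integral>\<^sup>+ t. ennreal (indicator {0..} (0 + b * t) * (0 + b * t) powr (s - 1) / exp (0 + b * t)) \<partial>lborel)"
    by (rule nn_integral_real_affine) (use assms in auto)
  also have "\<dots> = (\<integral>\<^sup>+ t. ennreal b * ennreal (indicator {0..} (0 + b * t) * (0 + b * t) powr (s - 1) / exp (0 + b * t)) \<partial>lborel)"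
    using assms by (subst nn_integral_cmult[symmetric]) auto
  also have "\<dots> = (\<integral>\<^sup>+ t. ennreal (b powr s) * ennreal (indicator {0<..} t * t powr (s - 1) * exp (- b * t)) \<partial>lborel)"
  proof (rule nn_integral_cong)
    fix t :: real
    have "b * (indicator {0..} (b * t) * (b * t) powr (s - 1) / exp (b * t)) = b powr s * (indicator {0<..} t * t powr (s - 1) * exp (- b * t))"
    proof (cases "t > 0")
      case True
      have "b * b powr (s - 1) = b powr s" using assms by (simp add: powr_diff)
      then have "b * (b * t) powr (s - 1) = b powr s * t powr (s - 1)"
        using assms True by (simp add: powr_mult mult.assoc[symmetric])
      then show ?thesis using assms True by (simp add: exp_minus field_simps)
    next
      case False
      then show ?thesis using assms by (cases "t = 0") (auto simp: indicator_def zero_le_mult_iff)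
    qed
    then show "ennreal b * ennreal (indicator {0..} (0 + b * t) * (0 + b * t) powr (s - 1) / exp (0 + b * t))
       = ennreal (b powr s) * ennreal (indicator {0<..} t * t powr (s - 1) * exp (- b * t))"
      using assms by (simp add: ennreal_mult[symmetric] indicator_def)
  qed
  also have "\<dots> = ennreal (b powr s) * (\<integral>\<^sup>+ t. ennreal (indicator {0<..} t * t powr (s - 1) * exp (- b * t)) \<partial>lborel)"
    by (rule nn_integral_cmult) measurable
  finally have "ennreal (Gamma s) = ennreal (b powr s) * (\<integral>\<^sup>+ t. ennreal (indicator {0<..} t * t powr (s - 1) * exp (- b * t)) \<partial>lborel)"
    unfolding Gamma_conv_nn_integral_real[OF assms(1)] .
  then have "ennreal (b powr (- s)) * ennreal (Gamma s) =
      (ennreal (b powr (- s)) * ennreal (b powr s)) * (\<integral>\<^sup>+ t. ennreal (indicator {0<..} t * t powr (s - 1) * exp (- b * t)) \<partial>lborel)"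
    by (simp only: mult.assoc)
  moreover have "ennreal (b powr (- s)) * ennreal (b powr s) = 1"
    using assms by (simp add: ennreal_mult[symmetric] powr_minus)
  ultimately show ?thesis
    using Gamma_real_pos[OF assms(1)] by (simp add: ennreal_mult[symmetric] mult.commute)
qed

lemma geometric_exp_suminf:
  assumes "y > 0"
  shows "(\<Sum>m. ennreal (exp (- (c + real (Suc m)) * y))) = ennreal (exp (- c * y) / (exp y - 1))"
proof -
  have "(\<lambda>m. exp (- y) ^ m) sums (1 / (1 - exp (- y)))" by (rule geometric_sums) (use assms in simp)
  then have "(\<lambda>m. exp (- (c + 1) * y) * exp (- y) ^ m) sums (exp (- (c + 1) * y) * (1 / (1 - exp (- y))))"
    by (rule sums_mult)
  moreover have "exp (- (c + 1) * y) * exp (- y) ^ m = exp (- (c + real (Suc m)) * y)" for m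
    by (simp add: exp_of_nat_mult[symmetric] exp_add[symmetric] algebra_simps)
  moreover have "exp (- (c + 1) * y) * (1 / (1 - exp (- y))) = exp (- c * y) / (exp y - 1)"
  proof -
    have "exp (- (c + 1) * y) = exp (- c * y) * exp (- y)" by (simp add: exp_add[symmetric] algebra_simps)
    moreover have "exp (- y) * (exp y - 1) = 1 - exp (- y)" by (simp add: right_diff_distrib exp_add[symmetric])
    moreover have "exp y - 1 \<noteq> 0" "1 - exp (- y) \<noteq> 0" using assms by simp_all
    ultimately show ?thesis by (simp add: field_simps)
  qed
  ultimately have "(\<lambda>m. exp (- (c + real (Suc m)) * y)) sums (exp (- c * y) / (exp y - 1))" by simp
  then show ?thesis by (intro suminf_ennreal_eq) auto
qed


text \<open>Sums over tuples are peeled off one coordinate at a time; \<open>Suc k\<close> turns the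
  positive entry into an index of \<open>suminf\<close>.\<close>

lemma nn_integral_count_space_PiE_insert:
  fixes T :: "(nat \<Rightarrow> nat) \<Rightarrow> ennreal"
  assumes "j \<notin> B"
  shows "(\<integral>\<^sup>+ m. T m \<partial>count_space (Pi\<^sub>E (insert j B) (\<lambda>_. {1..}))) =
    (\<Sum>k. \<integral>\<^sup>+ m. T (m(j := Suc k)) \<partial>count_space (Pi\<^sub>E B (\<lambda>_. {1..})))"
proof -
  let ?P = "Pi\<^sub>E B (\<lambda>_. {1::nat..})"
  have b: "bij_betw (\<lambda>(k, m). m(j := Suc k)) (UNIV \<times> ?P) (Pi\<^sub>E (insert j B) (\<lambda>_. {1..}))"
  proof (rule bij_betw_imageI)
    show "inj_on (\<lambda>(k, m). m(j := Suc k)) (UNIV \<times> ?P)"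
    proof (rule inj_onI, clarify)
      fix k1 m1 k2 m2 assume 1: "m1 \<in> ?P" "m2 \<in> ?P" and eq: "m1(j := Suc k1) = m2(j := Suc k2)"
      have "Suc k1 = Suc k2" using fun_cong[OF eq, of j] by simp
      moreover have "m1 = m2"
      proof
        fix i show "m1 i = m2 i"
          using fun_cong[OF eq, of i] PiE_arb[OF 1(1), of i] PiE_arb[OF 1(2), of i] assms by (cases "i = j") auto
      qed
      ultimately show "k1 = k2 \<and> m1 = m2" by simp
    qed
    show "(\<lambda>(k, m). m(j := Suc k)) ` (UNIV \<times> ?P) = Pi\<^sub>E (insert j B) (\<lambda>_. {1..})"
      unfolding PiE_insert_eq
    proof (intro equalityI subsetI)
      fix f assume "f \<in> (\<lambda>(k, m). m(j := Suc k)) ` (UNIV \<times> ?P)"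
      then obtain k m where "m \<in> ?P" "f = m(j := Suc k)" by auto
      then show "f \<in> (\<lambda>(y, g). g(j := y)) ` ({1..} \<times> ?P)" by (intro image_eqI[of _ _ "(Suc k, m)"]) auto
    next
      fix f assume "f \<in> (\<lambda>(y, g). g(j := y)) ` ({1..} \<times> ?P)"
      then obtain y g where "y \<ge> 1" "g \<in> ?P" "f = g(j := y)" by auto
      then show "f \<in> (\<lambda>(k, m). m(j := Suc k)) ` (UNIV \<times> ?P)" by (intro image_eqI[of _ _ "(y - 1, g)"]) auto
    qed
  qed
  have "(\<integral>\<^sup>+ m. T m \<partial>count_space (Pi\<^sub>E (insert j B) (\<lambda>_. {1..}))) = (\<integral>\<^sup>+ p. T ((\<lambda>(k, m). m(j := Suc k)) p) \<partial>count_space (UNIV \<times> ?P))"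
    by (rule nn_integral_bij_count_space[OF b, symmetric])
  also have "\<dots> = (\<integral>\<^sup>+ p. T ((\<lambda>(k, m). m(j := Suc k)) p) * indicator (UNIV \<times> ?P) p \<partial>count_space UNIV)"
    by (rule nn_integral_count_space_indicator) simp
  also have "\<dots> = (\<integral>\<^sup>+ k. \<integral>\<^sup>+ m. T (m(j := Suc k)) * indicator ?P m \<partial>count_space UNIV \<partial>count_space UNIV)"
    by (subst nn_integral_fst_count_space[symmetric]) (simp add: indicator_times)
  also have "\<dots> = (\<integral>\<^sup>+ k. \<integral>\<^sup>+ m. T (m(j := Suc k)) \<partial>count_space ?P \<partial>count_space UNIV)"
    by (simp add: nn_integral_count_space_indicator)
  also have "\<dots> = (\<Sum>k. \<integral>\<^sup>+ m. T (m(j := Suc k)) \<partial>count_space ?P)"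
    by (rule nn_integral_count_space_nat)
  finally show ?thesis .
qed

text \<open>The zeta sum with its gamma factors, with the first \<open>j - 1\<close> indices fixed:
  \<open>c\<close> stands for their sum.\<close>

definition laplace_sum :: "nat \<Rightarrow> (nat \<Rightarrow> real) \<Rightarrow> nat \<Rightarrow> real \<Rightarrow> ennreal"
  where "laplace_sum d r j c = (\<integral>\<^sup>+ m. (\<Prod>i\<in>{j..d}. ennreal (Gamma (r i) * (c + real (\<Sum>l=j..i. m l)) powr (- r i)))
     \<partial>count_space (Pi\<^sub>E {j..d} (\<lambda>_. {1..})))"

lemma laplace_sum_step:
  assumes "j \<le> d"
  shows "laplace_sum d r j c = (\<Sum>k. ennreal (Gamma (r j) * (c + real (Suc k)) powr (- r j)) * laplace_sum d r (Suc j) (c + real (Suc k)))"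
proof -
  have S: "{j..d} = insert j {Suc j..d}" using assms by auto
  have nj: "j \<notin> {Suc j..d}" by simp
  have "(\<Prod>i\<in>insert j {Suc j..d}. ennreal (Gamma (r i) * (c + real (\<Sum>l=j..i. (m(j := Suc k)) l)) powr (- r i)))
     = ennreal (Gamma (r j) * (c + real (Suc k)) powr (- r j)) *
       (\<Prod>i\<in>{Suc j..d}. ennreal (Gamma (r i) * ((c + real (Suc k)) + real (\<Sum>l=Suc j..i. m l)) powr (- r i)))" for m k
  proof -
    have 1: "(\<Sum>l=j..j. (m(j := Suc k)) l) = Suc k" by simp
    have 2: "(\<Prod>i\<in>{Suc j..d}. ennreal (Gamma (r i) * (c + real (\<Sum>l=j..i. (m(j := Suc k)) l)) powr (- r i)))
      = (\<Prod>i\<in>{Suc j..d}. ennreal (Gamma (r i) * ((c + real (Suc k)) + real (\<Sum>l=Suc j..i. m l)) powr (- r i)))"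
    proof (rule prod.cong[OF refl])
      fix i assume i: "i \<in> {Suc j..d}"
      have "(\<Sum>l=j..i. (m(j := Suc k)) l) = Suc k + (\<Sum>l=Suc j..i. (m(j := Suc k)) l)"
        using i by (subst sum.atLeast_Suc_atMost) auto
      also have "(\<Sum>l=Suc j..i. (m(j := Suc k)) l) = (\<Sum>l=Suc j..i. m l)" by (intro sum.cong) auto
      finally have e: "c + real (\<Sum>l=j..i. (m(j := Suc k)) l) = (c + real (Suc k)) + real (\<Sum>l=Suc j..i. m l)"
        by (simp only: of_nat_add add.assoc)
      show "ennreal (Gamma (r i) * (c + real (\<Sum>l=j..i. (m(j := Suc k)) l)) powr (- r i))
        = ennreal (Gamma (r i) * ((c + real (Suc k)) + real (\<Sum>l=Suc j..i. m l)) powr (- r i))"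
        unfolding e ..
    qed
    show ?thesis
      unfolding prod.insert[OF finite_atLeastAtMost nj] 1 2 ..
  qed
  note P = this
  show ?thesis
    unfolding laplace_sum_def S
    by (subst nn_integral_count_space_PiE_insert[OF nj]) (simp only: P nn_integral_cmult borel_measurable_count_space)
qed

lemma chain_measure_nonpos: "z \<le> 0 \<Longrightarrow> chain_measure d r j z = 0"
  by (simp add: chain_measure_def)

text \<open>Induction from \<open>d\<close> downwards. With \<open>b = c + m j\<close>, both
  \<open>Gamma (r j) * b powr (- r j)\<close> and the remaining sum are Laplace transforms at
  \<open>b\<close>, so their product is the transform of a convolution. Summing
  \<open>exp (- b * y)\<close> over \<open>m j \<ge> 1\<close> produces
  \<open>1 / (exp y - 1)\<close>, which is the outer factor in \<open>chain_measure\<close>.\<close>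

lemma laplace_sum_eq:
  assumes r: "\<And>i. i \<in> {1..d} \<Longrightarrow> r i > 0" and "j \<le> d" "1 \<le> j" "c \<ge> 0"
  shows "laplace_sum d r j c = (\<integral>\<^sup>+ y. ennreal (exp (- c * y)) * chain_measure d r j y \<partial>lborel)"
  using assms(2-)
proof (induction j arbitrary: c rule: inc_induct)
  case (base c)
  then have rd: "r d > 0" using r by auto
  have e: "laplace_sum d r (Suc d) c' = 1" for c'
    by (simp add: laplace_sum_def nn_integral_count_space_finite)
  have "laplace_sum d r d c = (\<Sum>k. ennreal (Gamma (r d) * (c + real (Suc k)) powr (- r d)))"
    by (subst laplace_sum_step) (simp_all only: e mult_1_right order_refl)
  also have "\<dots> = (\<Sum>k. \<integral>\<^sup>+ t. ennreal (indicator {0<..} t * t powr (r d - 1) * exp (- (c + real (Suc k)) * t)) \<partial>lborel)"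
    using base rd by (intro arg_cong[where f = suminf] ext Gamma_Laplace) auto
  also have "\<dots> = (\<integral>\<^sup>+ t. (\<Sum>k. ennreal (indicator {0<..} t * t powr (r d - 1) * exp (- (c + real (Suc k)) * t))) \<partial>lborel)"
    by (rule nn_integral_suminf[symmetric]) measurable
  also have "\<dots> = (\<integral>\<^sup>+ y. ennreal (exp (- c * y)) * chain_measure d r d y \<partial>lborel)"
  proof (rule nn_integral_cong)
    fix t :: real
    show "(\<Sum>k. ennreal (indicator {0<..} t * t powr (r d - 1) * exp (- (c + real (Suc k)) * t))) = ennreal (exp (- c * t)) * chain_measure d r d t"
    proof (cases "t > 0")
      case True
      have "chain_measure d r d t = ennreal (t powr (r d - 1) / (exp t - 1))"
        using True by (simp add: chain_measure_def chain_density_def tail_sum_def PiM_empty nn_integral_count_space_finite)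
      moreover have "(\<Sum>k. ennreal (indicator {0<..} t * t powr (r d - 1) * exp (- (c + real (Suc k)) * t)))
          = ennreal (t powr (r d - 1)) * ennreal (exp (- c * t) / (exp t - 1))"
        unfolding geometric_exp_suminf[OF True, symmetric] ennreal_suminf_cmult[symmetric]
        using True by (intro arg_cong[where f = suminf] ext) (simp add: ennreal_mult)
      ultimately show ?thesis using True by (simp add: ennreal_mult[symmetric] mult.commute)
    qed (simp add: chain_measure_nonpos)
  qed
  finally show ?case .
next
  case (step j c)
  have rj: "r j > 0" using r step by auto
  let ?P = "chain_measure d r (Suc j)"
  define g where "g t = ennreal (indicator {0<..} t * t powr (r j - 1))" for t :: real
  have gm [measurable]: "g \<in> borel_measurable borel" unfolding g_def by measurable
  have ts: "tail_sum d r j = r j + tail_sum d r (Suc j)"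
    unfolding tail_sum_def using step.hyps by (subst sum.atLeast_Suc_atMost) auto
  have Gamma_term: "ennreal (Gamma (r j) * b powr (- r j)) * laplace_sum d r (Suc j) b
      = (\<integral>\<^sup>+ z. \<integral>\<^sup>+ y. g (y - z) * ennreal (exp (- b * y)) * ?P z \<partial>lborel \<partial>lborel)" if b: "b > 0" for b
  proof -
    have "(\<integral>\<^sup>+ y. g (y - z) * ennreal (exp (- b * y)) * ?P z \<partial>lborel) = ennreal (Gamma (r j) * b powr (- r j)) * (ennreal (exp (- b * z)) * ?P z)" for z
    proof -
      have e: "exp (- b * (z + 1 * t)) = exp (- b * t) * exp (- b * z)" for t
        by (simp add: exp_add[symmetric] algebra_simps)
      have "(\<integral>\<^sup>+ y. g (y - z) * ennreal (exp (- b * y)) * ?P z \<partial>lborel) = (\<integral>\<^sup>+ y. g (y - z) * ennreal (exp (- b * y)) \<partial>lborel) * ?P z"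
        by (rule nn_integral_multc) measurable
      also have "(\<integral>\<^sup>+ y. g (y - z) * ennreal (exp (- b * y)) \<partial>lborel) = ennreal \<bar>1\<bar> * (\<integral>\<^sup>+ t. g ((z + 1 * t) - z) * ennreal (exp (- b * (z + 1 * t))) \<partial>lborel)"
        by (rule nn_integral_real_affine) auto
      also have "\<dots> = (\<integral>\<^sup>+ t. ennreal (indicator {0<..} t * t powr (r j - 1) * exp (- b * t)) * ennreal (exp (- b * z)) \<partial>lborel)"
        unfolding e by (simp add: g_def ennreal_mult[symmetric] mult_ac)
      also have "\<dots> = ennreal (Gamma (r j) * b powr (- r j)) * ennreal (exp (- b * z))"
        unfolding Gamma_Laplace[OF rj b] by (rule nn_integral_multc) measurable
      finally show ?thesis by (simp only: mult.assoc)
    qed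
    then have "(\<integral>\<^sup>+ z. \<integral>\<^sup>+ y. g (y - z) * ennreal (exp (- b * y)) * ?P z \<partial>lborel \<partial>lborel)
       = ennreal (Gamma (r j) * b powr (- r j)) * (\<integral>\<^sup>+ z. ennreal (exp (- b * z)) * ?P z \<partial>lborel)"
      by (simp add: nn_integral_cmult)
    also have "(\<integral>\<^sup>+ z. ennreal (exp (- b * z)) * ?P z \<partial>lborel) = laplace_sum d r (Suc j) b"
      using step.IH[of b] b by simp
    finally show ?thesis by (rule sym)
  qed
  have "laplace_sum d r j c = (\<Sum>k. \<integral>\<^sup>+ z. \<integral>\<^sup>+ y. g (y - z) * ennreal (exp (- (c + real (Suc k)) * y)) * ?P z \<partial>lborel \<partial>lborel)"
  proof -
    have jd: "j \<le> d" using step.hyps by simp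
    have ck: "c + real (Suc k) > 0" for k using step.prems by simp
    show ?thesis
      unfolding laplace_sum_step[OF jd] by (rule arg_cong[where f = suminf], rule ext, rule Gamma_term, rule ck)
  qed
  also have "\<dots> = (\<integral>\<^sup>+ z. (\<Sum>k. \<integral>\<^sup>+ y. g (y - z) * ennreal (exp (- (c + real (Suc k)) * y)) * ?P z \<partial>lborel) \<partial>lborel)"
    by (rule nn_integral_suminf[symmetric]) measurable
  also have "\<dots> = (\<integral>\<^sup>+ z. \<integral>\<^sup>+ y. (\<Sum>k. g (y - z) * ennreal (exp (- (c + real (Suc k)) * y)) * ?P z) \<partial>lborel \<partial>lborel)"
    by (rule nn_integral_cong, rule nn_integral_suminf[symmetric]) measurable
  also have "\<dots> = (\<integral>\<^sup>+ z. \<integral>\<^sup>+ y. g (y - z) * ennreal (indicator {0<..} y * (exp (- c * y) / (exp y - 1))) * ?P z \<partial>lborel \<partial>lborel)"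
  proof (intro nn_integral_cong)
    fix z y :: real
    show "(\<Sum>k. g (y - z) * ennreal (exp (- (c + real (Suc k)) * y)) * ?P z) = g (y - z) * ennreal (indicator {0<..} y * (exp (- c * y) / (exp y - 1))) * ?P z"
    proof (cases "y > 0")
      case True
      then show ?thesis
        using geometric_exp_suminf[OF True, of c] by (simp add: ennreal_suminf_multc ennreal_suminf_cmult)
    next
      case False
      \<comment> \<open>For \<open>y \<le> 0\<close> the geometric series diverges, but the term
        carries a zero factor: \<open>g\<close> is supported on positive arguments and
        \<open>chain_measure\<close> vanishes at nonpositive ones.\<close>
      have "g (y - z) = 0 \<or> ?P z = 0"
        using False by (cases "z > 0") (auto simp: g_def chain_measure_nonpos)
      then show ?thesis by auto
    qed
  qed
  also have "\<dots> = (\<integral>\<^sup>+ y. \<integral>\<^sup>+ z. g (y - z) * ennreal (indicator {0<..} y * (exp (- c * y) / (exp y - 1))) * ?P z \<partial>lborel \<partial>lborel)"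
    by (rule lborel_pair.Fubini') measurable
  also have "\<dots> = (\<integral>\<^sup>+ y. ennreal (exp (- c * y)) * chain_measure d r j y \<partial>lborel)"
  proof (rule nn_integral_cong)
    fix y :: real
    show "(\<integral>\<^sup>+ z. g (y - z) * ennreal (indicator {0<..} y * (exp (- c * y) / (exp y - 1))) * ?P z \<partial>lborel) = ennreal (exp (- c * y)) * chain_measure d r j y"
    proof (cases "y > 0")
      case True
      have "(\<integral>\<^sup>+ z. g (y - z) * ennreal (indicator {0<..} y * (exp (- c * y) / (exp y - 1))) * ?P z \<partial>lborel)
         = (\<integral>\<^sup>+ z. ennreal (exp (- c * y) / (exp y - 1)) * (g (y - z) * ?P z) \<partial>lborel)"
        using True by (simp add: mult_ac)
      also have "\<dots> = ennreal (exp (- c * y) / (exp y - 1)) * (\<integral>\<^sup>+ z. g (y - z) * ?P z \<partial>lborel)"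
        by (rule nn_integral_cmult) measurable
      also have "ennreal (exp (- c * y) / (exp y - 1)) = ennreal (exp (- c * y)) * ennreal (1 / (exp y - 1))"
        using True by (subst ennreal_mult[symmetric]) auto
      finally show ?thesis
        unfolding g_def chain_measure_step[OF step.prems(1) step.hyps(2) True ts] by (simp only: mult.assoc)
    qed (simp add: chain_measure_nonpos)
  qed
  finally show ?case .
qed

lemma of_nat_powr_of_real: "of_nat n powr - complex_of_real x = of_real (real n powr (- x))"
  using powr_of_real[of "real n" "- x"] by simp

lemma ez_term_of_real:
  assumes "m \<in> ez_index d"
  shows "ez_term d (\<lambda>j. of_real (r j)) m = of_real (\<Prod>j=1..d. real (\<Sum>i=1..j. m i) powr (- r j))"
  unfolding ez_term_def of_real_prod
proof (rule prod.cong[OF refl])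
  fix j assume "j \<in> {1..d}"
  show "of_nat (\<Sum>i=1..j. m i) powr - complex_of_real (r j) = of_real (real (\<Sum>i=1..j. m i) powr (- r j))"
    by (rule of_nat_powr_of_real)
qed

text \<open>\<open>infsum\<close> takes a default value on families that are not summable, so
  convergence is what identifies \<open>ez_zeta\<close> with the integral over the counting measure.
  The identity in \<open>ennreal\<close> also records that the right-hand integral is
  finite.\<close>

lemma ez_zeta_real_integral:
  assumes r: "\<And>i. i \<in> {1..d} \<Longrightarrow> r i > 0" and d: "d \<ge> 1" and conv: "ez_converges d (\<lambda>j. of_real (r j))"
  shows "\<exists>Z\<ge>0. ez_zeta d (\<lambda>j. of_real (r j)) = of_real Z \<and>
     ennreal ((\<Prod>i=1..d. Gamma (r i)) * Z) = (\<integral>\<^sup>+ y. chain_measure d r 1 y \<partial>lborel)"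
proof -
  define T where "T m = (\<Prod>j=1..d. real (\<Sum>i=1..j. m i) powr (- r j))" for m
  have T0: "T m \<ge> 0" for m unfolding T_def by (intro prod_nonneg) simp
  have Tn: "norm (ez_term d (\<lambda>j. of_real (r j)) m) = T m" if "m \<in> ez_index d" for m
    unfolding ez_term_of_real[OF that] T_def[symmetric] using T0 by simp
  have sT: "T summable_on ez_index d"
    using conv unfolding ez_converges_def by (rule summable_on_cong[THEN iffD1, rotated]) (rule Tn)
  define Z where "Z = infsum T (ez_index d)"
  have "(T has_sum Z) (ez_index d)" unfolding Z_def using sT by (rule has_sum_infsum)
  then have "((\<lambda>m. complex_of_real (T m)) has_sum of_real Z) (ez_index d)" by (rule has_sum_of_real)
  then have "infsum (\<lambda>m. complex_of_real (T m)) (ez_index d) = of_real Z" by (rule infsumI)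
  moreover have "ez_zeta d (\<lambda>j. of_real (r j)) = infsum (\<lambda>m. complex_of_real (T m)) (ez_index d)"
    unfolding ez_zeta_def T_def by (rule infsum_cong) (rule ez_term_of_real)
  ultimately have zeta: "ez_zeta d (\<lambda>j. of_real (r j)) = of_real Z" by simp
  have "Infinite_Sum.abs_summable_on T (ez_index d)" using sT T0 by simp
  then have aT: "Infinite_Set_Sum.abs_summable_on T (ez_index d)" unfolding abs_summable_equivalent .
  then have "integrable (count_space (ez_index d)) T" unfolding Infinite_Set_Sum.abs_summable_on_def .
  then have "(\<integral>\<^sup>+ m. ennreal (T m) \<partial>count_space (ez_index d)) = ennreal (lebesgue_integral (count_space (ez_index d)) T)"
    by (rule nn_integral_eq_integral) (use T0 in simp)
  also have "lebesgue_integral (count_space (ez_index d)) T = Z"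
    using infsetsum_infsum[OF aT] unfolding infsetsum_def Z_def .
  finally have nT: "(\<integral>\<^sup>+ m. ennreal (T m) \<partial>count_space (ez_index d)) = ennreal Z" .
  have Z0: "Z \<ge> 0" unfolding Z_def by (rule infsum_nonneg) (rule T0)
  have G0: "(\<Prod>i=1..d. Gamma (r i)) \<ge> 0" using r by (intro prod_nonneg) (simp add: Gamma_real_pos less_imp_le)
  have "laplace_sum d r 1 0 = (\<integral>\<^sup>+ m. ennreal (\<Prod>i=1..d. Gamma (r i)) * ennreal (T m) \<partial>count_space (ez_index d))"
    unfolding laplace_sum_def ez_index_def
  proof (rule nn_integral_cong)
    fix m
    have "(\<Prod>i\<in>{1..d}. ennreal (Gamma (r i) * (0 + real (\<Sum>l=1..i. m l)) powr (- r i)))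
       = ennreal (\<Prod>i\<in>{1..d}. Gamma (r i) * (0 + real (\<Sum>l=1..i. m l)) powr (- r i))"
      by (rule prod_ennreal) (use r in \<open>auto intro!: mult_nonneg_nonneg simp: Gamma_real_pos less_imp_le\<close>)
    also have "(\<Prod>i\<in>{1..d}. Gamma (r i) * (0 + real (\<Sum>l=1..i. m l)) powr (- r i)) = (\<Prod>i=1..d. Gamma (r i)) * T m"
      unfolding T_def prod.distrib by simp
    finally show "(\<Prod>i\<in>{1..d}. ennreal (Gamma (r i) * (0 + real (\<Sum>l=1..i. m l)) powr (- r i)))
       = ennreal (\<Prod>i=1..d. Gamma (r i)) * ennreal (T m)"
      using G0 T0 by (simp add: ennreal_mult)
  qed
  also have "\<dots> = ennreal ((\<Prod>i=1..d. Gamma (r i)) * Z)"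
    by (simp only: nn_integral_cmult borel_measurable_count_space nT ennreal_mult[OF G0 Z0])
  finally have "ennreal ((\<Prod>i=1..d. Gamma (r i)) * Z) = (\<integral>\<^sup>+ y. ennreal (exp (- 0 * y)) * chain_measure d r 1 y \<partial>lborel)"
    using laplace_sum_eq[OF r d order_refl order_refl] by simp
  then show ?thesis using zeta Z0 by (intro exI[of _ Z]) simp
qed

section \<open>The representation formula at large real points\<close>

text \<open>The reflection \<open>x \<mapsto> 1 - x\<close> in the coordinates with
  \<open>a j \<noteq> 0\<close>; for 0-1 vectors \<open>a\<close> it carries the half cube onto the
  piece of the unit cube selected by \<open>a\<close>, up to a null set.\<close>

definition flip :: "nat set \<Rightarrow> (nat \<Rightarrow> nat) \<Rightarrow> (nat \<Rightarrow> real) \<Rightarrow> nat \<Rightarrow> real"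
  where "flip J a y = (\<lambda>j\<in>J. t_var a y j)"

lemma flip_measurable [measurable]: "flip J a \<in> measurable (Pi\<^sub>M J (\<lambda>_. lborel)) (Pi\<^sub>M J (\<lambda>_. lborel))"
  unfolding flip_def[abs_def]
proof (rule measurable_restrict)
  fix j assume j: "j \<in> J"
  note [measurable] = measurable_PiM_lborel_component[OF j]
  have "(\<lambda>y. t_var a y j) \<in> borel_measurable (Pi\<^sub>M J (\<lambda>_. lborel))"
    unfolding t_var_def by (cases "a j = 0") auto
  then show "(\<lambda>y. t_var a y j) \<in> measurable (Pi\<^sub>M J (\<lambda>_. lborel)) lborel" by simp
qed

lemma nn_integral_unit_split:
  fixes h :: "real \<Rightarrow> ennreal"
  assumes [measurable]: "h \<in> borel_measurable borel"
  shows "(\<integral>\<^sup>+ t. indicator {0<..<1} t * h t \<partial>lborel)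
       = (\<integral>\<^sup>+ t. indicator {0<..1/2} t * h t \<partial>lborel) + (\<integral>\<^sup>+ t. indicator {0<..1/2} t * h (1 - t) \<partial>lborel)"
proof -
  have "(\<integral>\<^sup>+ t. indicator {0<..<1} t * h t \<partial>lborel) = (\<integral>\<^sup>+ t. indicator {0<..1/2} t * h t + indicator {1/2<..<1} t * h t \<partial>lborel)"
    by (rule nn_integral_cong) (auto simp: indicator_def)
  also have "\<dots> = (\<integral>\<^sup>+ t. indicator {0<..1/2} t * h t \<partial>lborel) + (\<integral>\<^sup>+ t. indicator {1/2<..<1} t * h t \<partial>lborel)"
    by (rule nn_integral_add) measurable
  also have "(\<integral>\<^sup>+ t. indicator {1/2<..<1} t * h t \<partial>lborel) = ennreal \<bar>- 1\<bar> * (\<integral>\<^sup>+ t. indicator {1/2<..<1} (1 + - 1 * t) * h (1 + - 1 * t) \<partial>lborel)"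
    by (rule nn_integral_real_affine) auto
  also have "\<dots> = (\<integral>\<^sup>+ t. indicator {1/2<..<1} (1 - t) * h (1 - t) \<partial>lborel)" by simp
  also have "\<dots> = (\<integral>\<^sup>+ t. indicator {0<..1/2} t * h (1 - t) \<partial>lborel)"
  \<comment> \<open>Reflecting the open upper half omits the point 1/2, a null set.\<close>
  proof (rule nn_integral_cong_AE)
    have "AE t in lborel. t \<noteq> (1/2 :: real)" by (rule AE_lborel_singleton)
    then show "AE t in lborel. indicator {1/2<..<1} (1 - t) * h (1 - t) = indicator {0<..1/2} t * h (1 - t)"
      by eventually_elim (auto simp: indicator_def)
  qed
  finally show ?thesis .
qed

lemma nn_integral_cube_split:
  fixes f :: "(nat \<Rightarrow> real) \<Rightarrow> ennreal"
  assumes "finite J" "f \<in> borel_measurable (Pi\<^sub>M J (\<lambda>_. lborel))"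
  shows "(\<integral>\<^sup>+ x. (\<Prod>j\<in>J. indicator {0<..<1} (x j)) * f x \<partial>Pi\<^sub>M J (\<lambda>_. lborel))
    = (\<Sum>a\<in>Pi\<^sub>E J (\<lambda>_. {0, 1}). \<integral>\<^sup>+ y. (\<Prod>j\<in>J. indicator {0<..1/2} (y j)) * f (flip J a y) \<partial>Pi\<^sub>M J (\<lambda>_. lborel))"
  using assms
proof (induction J arbitrary: f rule: finite_induct)
  case empty
  have "flip {} a y = y" if "y \<in> space (Pi\<^sub>M {} (\<lambda>_. lborel :: real measure))" for a y
    using that by (auto simp: flip_def space_PiM)
  then show ?case by (auto intro!: nn_integral_cong)
next
  case (insert j J)
  note fm = insert.prems
  \<comment> \<open>\<open>F 0\<close> integrates coordinate \<open>j\<close> over the lower half,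
    \<open>F 1\<close> over the reflected upper half; the induction hypothesis is applied to
    each.\<close>
  define F where "F b x = (\<integral>\<^sup>+ t. indicator {0<..1/2} t * f (x(j := (if b = (0::nat) then t else 1 - t))) \<partial>lborel)" for b x
  have upd: "(\<lambda>(x, t). f (x(j := g t))) \<in> borel_measurable (Pi\<^sub>M J (\<lambda>_. lborel) \<Otimes>\<^sub>M lborel)"
    if g: "g \<in> borel_measurable borel" for g :: "real \<Rightarrow> real"
  proof -
    have 1: "(\<lambda>z. (fst z, g (snd z))) \<in> measurable (Pi\<^sub>M J (\<lambda>_. lborel) \<Otimes>\<^sub>M lborel) (Pi\<^sub>M J (\<lambda>_. lborel :: real measure) \<Otimes>\<^sub>M lborel)"
      using g by simp
    have "(\<lambda>z. f ((\<lambda>(f, y). f(j := y)) (fst z, g (snd z)))) \<in> borel_measurable (Pi\<^sub>M J (\<lambda>_. lborel) \<Otimes>\<^sub>M lborel)"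
      by (rule measurable_compose[OF measurable_compose[OF 1 measurable_add_dim] fm])
    then show ?thesis by (simp add: case_prod_unfold)
  qed
  have Fm: "F b \<in> borel_measurable (Pi\<^sub>M J (\<lambda>_. lborel))" for b
  proof -
    have "(\<lambda>(x, t). indicator {0<..1/2} t * f (x(j := (if b = 0 then t else 1 - t)))) \<in> borel_measurable (Pi\<^sub>M J (\<lambda>_. lborel) \<Otimes>\<^sub>M lborel)"
      using upd[of "\<lambda>t. if b = 0 then t else 1 - t"] unfolding case_prod_unfold
      by (intro borel_measurable_times_ennreal) auto
    from lborel.borel_measurable_nn_integral[OF this] show ?thesis unfolding F_def .
  qed
  have inner: "(\<integral>\<^sup>+ t. indicator {0<..<1} t * f (x(j := t)) \<partial>lborel) = F 0 x + F 1 x" if "x \<in> space (Pi\<^sub>M J (\<lambda>_. lborel :: real measure))" for x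
  proof -
    have "(\<lambda>t. f (x(j := t))) \<in> borel_measurable borel"
      using measurable_compose[OF measurable_Pair1'[OF that] upd[of "\<lambda>t. t"]] by simp
    from nn_integral_unit_split[OF this] show ?thesis by (simp add: F_def)
  qed
  have pj: "(\<Prod>i\<in>insert j J. indicator S ((x(j := t)) i)) = indicator S t * (\<Prod>i\<in>J. indicator S (x i) :: ennreal)" for S :: "real set" and x t
  proof -
    have "(\<Prod>i\<in>J. indicator S ((x(j := t)) i)) = (\<Prod>i\<in>J. indicator S (x i) :: ennreal)"
      by (rule prod.cong) (use insert.hyps in auto)
    then show ?thesis unfolding prod.insert[OF insert.hyps] by simp
  qed
  have Im: "(\<lambda>x. \<Prod>i\<in>K. indicator S (x i) :: ennreal) \<in> borel_measurable (Pi\<^sub>M K (\<lambda>_. lborel))" if "S \<in> sets borel" for S :: "real set" and K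
    by (intro borel_measurable_prod_ennreal measurable_compose[OF measurable_PiM_lborel_component]) (use that in auto)
  have "(\<integral>\<^sup>+ x. (\<Prod>i\<in>insert j J. indicator {0<..<1} (x i)) * f x \<partial>Pi\<^sub>M (insert j J) (\<lambda>_. lborel))
      = (\<integral>\<^sup>+ x. \<integral>\<^sup>+ t. (\<Prod>i\<in>insert j J. indicator {0<..<1} ((x(j := t)) i)) * f (x(j := t)) \<partial>lborel \<partial>Pi\<^sub>M J (\<lambda>_. lborel))"
    by (rule lborel_product.product_nn_integral_insert) (auto intro!: insert.hyps borel_measurable_times_ennreal fm Im)
  also have "\<dots> = (\<integral>\<^sup>+ x. (\<Prod>i\<in>J. indicator {0<..<1} (x i)) * (F 0 x + F 1 x) \<partial>Pi\<^sub>M J (\<lambda>_. lborel))"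
  proof (rule nn_integral_cong)
    fix x assume x: "x \<in> space (Pi\<^sub>M J (\<lambda>_. lborel :: real measure))"
    have m: "(\<lambda>t. indicator {0<..<1} t * f (x(j := t))) \<in> borel_measurable lborel"
      using measurable_compose[OF measurable_Pair1'[OF x] upd[of "\<lambda>t. t"]] by simp
    have "(\<integral>\<^sup>+ t. (\<Prod>i\<in>insert j J. indicator {0<..<1} ((x(j := t)) i)) * f (x(j := t)) \<partial>lborel)
        = (\<integral>\<^sup>+ t. (\<Prod>i\<in>J. indicator {0<..<1} (x i)) * (indicator {0<..<1} t * f (x(j := t))) \<partial>lborel)"
      unfolding pj by (simp only: mult_ac)
    also have "\<dots> = (\<Prod>i\<in>J. indicator {0<..<1} (x i)) * (F 0 x + F 1 x)"
      unfolding nn_integral_cmult[OF m] inner[OF x] ..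
    finally show "(\<integral>\<^sup>+ t. (\<Prod>i\<in>insert j J. indicator {0<..<1} ((x(j := t)) i)) * f (x(j := t)) \<partial>lborel)
        = (\<Prod>i\<in>J. indicator {0<..<1} (x i)) * (F 0 x + F 1 x)" .
  qed
  also have "\<dots> = (\<Sum>b\<in>{0, 1}. \<integral>\<^sup>+ x. (\<Prod>i\<in>J. indicator {0<..<1} (x i)) * F b x \<partial>Pi\<^sub>M J (\<lambda>_. lborel))"
    unfolding distrib_left
    by (subst nn_integral_add) (auto intro!: borel_measurable_times_ennreal Im Fm)
  also have "\<dots> = (\<Sum>b\<in>{0, 1}. \<Sum>a\<in>Pi\<^sub>E J (\<lambda>_. {0, 1}). \<integral>\<^sup>+ y. (\<Prod>i\<in>J. indicator {0<..1/2} (y i)) * F b (flip J a y) \<partial>Pi\<^sub>M J (\<lambda>_. lborel))"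
    by (intro sum.cong refl insert.IH Fm)
  also have "\<dots> = (\<Sum>b\<in>{0, 1}. \<Sum>a\<in>Pi\<^sub>E J (\<lambda>_. {0, 1}). \<integral>\<^sup>+ y. (\<Prod>i\<in>insert j J. indicator {0<..1/2} (y i)) * f (flip (insert j J) (a(j := b)) y) \<partial>Pi\<^sub>M (insert j J) (\<lambda>_. lborel))"
  proof (intro sum.cong refl)
    fix b :: nat and a :: "nat \<Rightarrow> nat"
    assume b: "b \<in> {0, 1}"
    have fl: "flip (insert j J) (a(j := b)) (y(j := t)) = (flip J a y)(j := (if b = 0 then t else 1 - t))" for y t
      using insert.hyps by (auto simp: flip_def t_var_def fun_eq_iff)
    have "(\<integral>\<^sup>+ y. (\<Prod>i\<in>insert j J. indicator {0<..1/2} (y i)) * f (flip (insert j J) (a(j := b)) y) \<partial>Pi\<^sub>M (insert j J) (\<lambda>_. lborel))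
      = (\<integral>\<^sup>+ y. \<integral>\<^sup>+ t. (\<Prod>i\<in>insert j J. indicator {0<..1/2} ((y(j := t)) i)) * f (flip (insert j J) (a(j := b)) (y(j := t))) \<partial>lborel \<partial>Pi\<^sub>M J (\<lambda>_. lborel))"
      by (rule lborel_product.product_nn_integral_insert)
         (auto intro!: insert.hyps borel_measurable_times_ennreal measurable_compose[OF flip_measurable fm] Im)
    also have "\<dots> = (\<integral>\<^sup>+ y. (\<Prod>i\<in>J. indicator {0<..1/2} (y i)) * F b (flip J a y) \<partial>Pi\<^sub>M J (\<lambda>_. lborel))"
    proof (rule nn_integral_cong)
      fix y assume y: "y \<in> space (Pi\<^sub>M J (\<lambda>_. lborel :: real measure))"
      have fy: "flip J a y \<in> space (Pi\<^sub>M J (\<lambda>_. lborel :: real measure))" by (rule measurable_space[OF flip_measurable y])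
      have m: "(\<lambda>t. indicator {0<..1/2} t * f ((flip J a y)(j := (if b = 0 then t else 1 - t)))) \<in> borel_measurable lborel"
        using measurable_compose[OF measurable_Pair1'[OF fy] upd[of "\<lambda>t. if b = 0 then t else 1 - t"]] by simp
      show "(\<integral>\<^sup>+ t. (\<Prod>i\<in>insert j J. indicator {0<..1/2} ((y(j := t)) i)) * f (flip (insert j J) (a(j := b)) (y(j := t))) \<partial>lborel)
        = (\<Prod>i\<in>J. indicator {0<..1/2} (y i)) * F b (flip J a y)"
        unfolding pj fl F_def nn_integral_cmult[OF m, symmetric] by (simp only: mult_ac)
    qed
    finally show "(\<integral>\<^sup>+ y. (\<Prod>i\<in>J. indicator {0<..1/2} (y i)) * F b (flip J a y) \<partial>Pi\<^sub>M J (\<lambda>_. lborel))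
      = (\<integral>\<^sup>+ y. (\<Prod>i\<in>insert j J. indicator {0<..1/2} (y i)) * f (flip (insert j J) (a(j := b)) y) \<partial>Pi\<^sub>M (insert j J) (\<lambda>_. lborel))" by (rule sym)
  qed
  also have "\<dots> = (\<Sum>a\<in>Pi\<^sub>E (insert j J) (\<lambda>_. {0, 1}). \<integral>\<^sup>+ y. (\<Prod>i\<in>insert j J. indicator {0<..1/2} (y i)) * f (flip (insert j J) a y) \<partial>Pi\<^sub>M (insert j J) (\<lambda>_. lborel))"
    by (rule sum_PiE_insert[OF insert.hyps, symmetric])
  finally show ?case .
qed

lemma nn_integral_Beta:
  assumes "a > -1" "b > -1"
  shows "(\<integral>\<^sup>+ t. ennreal (indicator {0<..<1} t * (t powr a * (1 - t) powr b)) \<partial>lborel) = ennreal (Beta (a + 1) (b + 1))"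
proof -
  have "((\<lambda>t. t powr a * (1 - t) powr b) has_integral Beta (a + 1) (b + 1)) {0..1}"
    using has_integral_Beta_real[of "a + 1" "b + 1"] assms by simp
  then have "((\<lambda>t. indicator {0<..<1} t * (t powr a * (1 - t) powr b)) has_integral Beta (a + 1) (b + 1)) {0..1}"
    by (rule has_integral_spike_finite[of "{0, 1}", rotated 2]) auto
  then have "((\<lambda>t. indicator {0<..<1} t * (t powr a * (1 - t) powr b)) has_integral Beta (a + 1) (b + 1)) UNIV"
    by (rule has_integral_on_superset) auto
  from nn_integral_has_integral_lborel[OF _ _ this] show ?thesis by simp
qed

lemma integrable_tame:
  assumes X: "X \<in> sets borel" and f: "tame_smooth d X \<Phi>" and x1: "x1 \<in> X"
    and u: "\<And>j. j \<in> {2..d} \<Longrightarrow> Re (u j) > -1"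
  shows "integrable (Pi\<^sub>M {2..d} (\<lambda>_. lborel)) (\<lambda>y. box_weight {2..d} u y * \<Phi> z (glue {2..d} y (eval_point x1 {})))"
proof -
  interpret box_family d X x1 "\<lambda>r. mixed_deriv d r (\<Phi> z)" by (rule box_family_mixed_deriv[OF X f])
  have b: "base {2..d} (eval_point x1 {})" using x1 by (simp add: base_def eval_point_def)
  have 0: "mixed_deriv d (\<lambda>_. 0) g = g" for g
  proof -
    have "concat (map (\<lambda>j. replicate 0 j) xs) = []" for xs :: "nat list" by (induction xs) auto
    then show ?thesis by (simp only: mixed_deriv_def partial_derivs_def foldr_Nil id_apply)
  qed
  show ?thesis using integrable_box[where B = "{2..d}" and e = u and r = "\<lambda>_. 0", OF order_refl b u] unfolding 0 .
qed

text \<open>The bridge between the complex integrals in \<open>ez_F\<close> and the extended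
  nonnegative integrals from Tonelli. Integrability on the complex side makes the passage back from
  \<open>ennreal\<close> faithful.\<close>

lemma integral_of_real_nonneg:
  fixes g :: "'a \<Rightarrow> complex" and h :: "'a \<Rightarrow> real"
  assumes "integrable M g" "\<And>y. y \<in> space M \<Longrightarrow> g y = of_real (h y)" "\<And>y. y \<in> space M \<Longrightarrow> h y \<ge> 0"
  shows "(\<integral>\<^sup>+ y. ennreal (h y) \<partial>M) = ennreal (Re (integral\<^sup>L M g))" "integral\<^sup>L M g = of_real (Re (integral\<^sup>L M g))"
    "Re (integral\<^sup>L M g) \<ge> 0"
proof -
  have "integrable M (\<lambda>y. Re (g y))" using assms(1) by simp
  then have h: "integrable M h" by (rule Bochner_Integration.integrable_cong[THEN iffD1, rotated 2]) (simp_all add: assms(2))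
  have e: "integral\<^sup>L M g = of_real (integral\<^sup>L M h)"
    unfolding integral_complex_of_real[symmetric] by (rule Bochner_Integration.integral_cong) (simp_all add: assms(2))
  show "(\<integral>\<^sup>+ y. ennreal (h y) \<partial>M) = ennreal (Re (integral\<^sup>L M g))"
    unfolding e Re_complex_of_real by (rule nn_integral_eq_integral[OF h]) (use assms(3) in auto)
  show "integral\<^sup>L M g = of_real (Re (integral\<^sup>L M g))" by (simp add: e)
  show "Re (integral\<^sup>L M g) \<ge> 0" unfolding e Re_complex_of_real by (rule integral_nonneg_AE) (use assms(3) in auto)
qed


text \<open>The bound \<open>real d + 1\<close> makes all exponents \<open>u0\<close> and
  \<open>v0\<close> positive and \<open>tail_sum d r 1 - real d\<close> larger than 1, so every
  integral occurring here converges before any integration by parts.\<close>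

locale real_point =
  fixes d :: nat and n :: "nat \<Rightarrow> nat" and e :: "nat \<Rightarrow> 'v::finite" and z :: "complex ^ 'v" and r :: "nat \<Rightarrow> real"
  assumes d: "d \<ge> 1" and s: "coords e z = (\<lambda>j. of_real (r j))" and big: "\<And>j. j \<in> {1..d} \<Longrightarrow> r j > real d + 1"
begin

abbreviation "S \<equiv> coords e z"

text \<open>The exponents of \<open>x j\<close> and \<open>1 - x j\<close> on the unit cube; a
  reflected coordinate exchanges them, which is what \<open>ur\<close> and \<open>vr\<close>
  record.\<close>

definition "u0 j = tail_sum d r j - real d + real j - 2"
definition "v0 j = r (j - 1) - 1"
definition "ur a j = (if a j = (0::nat) then u0 j else v0 j)"
definition "vr a j = (if a j = (0::nat) then v0 j else u0 j)"

lemma tail_of_real: "tail_sum d S j = of_real (tail_sum d r j)"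
  unfolding tail_sum_def s by simp

lemma u_eq: "u_exp d S a j = of_real (ur a j)" and v_eq: "v_exp d S a j = of_real (vr a j)"
  unfolding u_exp_def v_exp_def ur_def vr_def u0_def v0_def tail_of_real by (simp_all add: s)

lemma tail_big: "j \<in> {1..d} \<Longrightarrow> tail_sum d r j > real d + 1"
proof -
  assume j: "j \<in> {1..d}"
  have "r j \<le> (\<Sum>i=j..d. r i)" using j big by (intro member_le_sum) (auto simp: less_imp_le intro: order.trans[OF _ less_imp_le[OF big]])
  then show ?thesis using big[OF j] unfolding tail_sum_def by linarith
qed

lemma u0_pos: "j \<in> {2..d} \<Longrightarrow> u0 j > 0" and v0_pos: "j \<in> {2..d} \<Longrightarrow> v0 j > 0"
proof -
  assume j: "j \<in> {2..d}"
  then have "j \<in> {1..d}" "j - 1 \<in> {1..d}" by auto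
  then show "u0 j > 0" "v0 j > 0" using tail_big[of j] big[of "j - 1"] j unfolding u0_def v0_def by auto
qed

lemma ur_pos: "j \<in> {2..d} \<Longrightarrow> ur a j > 0" and vr_pos: "j \<in> {2..d} \<Longrightarrow> vr a j > 0"
  using u0_pos v0_pos by (auto simp: ur_def vr_def)

definition weight_r :: "(nat \<Rightarrow> nat) \<Rightarrow> (nat \<Rightarrow> real) \<Rightarrow> real"
  where "weight_r a y = (\<Prod>j\<in>{2..d}. indicator {0<..1/2} (y j) * (y j powr ur a j * (1 - y j) powr vr a j))"

lemma box_weight_real:
  "box_weight {2..d} (u_exp d S a) y * (\<Prod>j=2..d. of_real (1 - y j) powr v_exp d S a j) = of_real (weight_r a y)"
  unfolding box_weight_def prod.distrib[symmetric] weight_r_def of_real_prod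
proof (rule prod.cong[OF refl])
  fix j assume "j \<in> {2..d}"
  show "half_powr (u_exp d S a j) (y j) * of_real (1 - y j) powr v_exp d S a j
    = of_real (indicator {0<..1/2} (y j) * (y j powr ur a j * (1 - y j) powr vr a j))"
  proof (cases "0 < y j \<and> y j \<le> 1/2")
    case True
    then have "half_powr (u_exp d S a j) (y j) = of_real (y j powr ur a j)"
      unfolding u_eq half_powr_def powr_def by (simp flip: exp_of_real)
    moreover have "complex_of_real (1 - y j) powr of_real (vr a j) = of_real ((1 - y j) powr vr a j)"
      using True by (intro powr_of_real) auto
    ultimately show ?thesis unfolding v_eq using True by simp
  qed (auto simp: half_powr_def indicator_def)
qed

lemma weight_r_flip:
  "ennreal (weight_r a y) = (\<Prod>j\<in>{2..d}. indicator {0<..1/2} (y j)) *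
     (\<Prod>j\<in>{2..d}. ennreal (flip {2..d} a y j powr u0 j * (1 - flip {2..d} a y j) powr v0 j))"
  unfolding prod.distrib[symmetric] weight_r_def
proof (subst prod_ennreal[symmetric])
  show "(\<Prod>j\<in>{2..d}. ennreal (indicator {0<..1/2} (y j) * (y j powr ur a j * (1 - y j) powr vr a j)))
    = (\<Prod>j\<in>{2..d}. indicator {0<..1/2} (y j) * ennreal (flip {2..d} a y j powr u0 j * (1 - flip {2..d} a y j) powr v0 j))"
    by (intro prod.cong refl) (auto simp: indicator_def flip_def t_var_def ur_def vr_def mult.commute)
qed simp

definition cube_integral :: "((nat \<Rightarrow> real) \<Rightarrow> real) \<Rightarrow> ennreal"
  where "cube_integral K = (\<integral>\<^sup>+ x. (\<Prod>j\<in>{2..d}. indicator {0<..<1} (x j)) *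
     ((\<Prod>j\<in>{2..d}. ennreal (x j powr u0 j * (1 - x j) powr v0 j)) * ennreal (K x)) \<partial>Pi\<^sub>M {2..d} (\<lambda>_. lborel))"

text \<open>Nonnegativity lets the sum over \<open>a\<close> be formed in \<open>ennreal\<close> and
  then transferred to complex numbers, which also shows that it is real. The set \<open>{1}\<close>
  is a placeholder for the first coordinate, which \<open>K\<close> does not see after
  \<open>restrict\<close>.\<close>

lemma cube_integral_split:
  assumes [measurable]: "K \<in> borel_measurable (Pi\<^sub>M {2..d} (\<lambda>_. lborel))"
    and K0: "\<forall>x\<in>open_box d {1}. K (restrict x {2..d}) \<ge> 0"
    and int: "\<And>a. integrable (Pi\<^sub>M {2..d} (\<lambda>_. lborel)) (\<lambda>y. of_real (weight_r a y) * of_real (K (flip {2..d} a y)) :: complex)"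
  shows "cube_integral K = ennreal (Re (\<Sum>a\<in>{2..d} \<rightarrow>\<^sub>E {0, 1}. LINT y|Pi\<^sub>M {2..d} (\<lambda>_. lborel). of_real (weight_r a y) * of_real (K (flip {2..d} a y))))"
    "(\<Sum>a\<in>{2..d} \<rightarrow>\<^sub>E {0, 1}. LINT y|Pi\<^sub>M {2..d} (\<lambda>_. lborel). of_real (weight_r a y) * of_real (K (flip {2..d} a y)))
       = complex_of_real (Re (\<Sum>a\<in>{2..d} \<rightarrow>\<^sub>E {0, 1}. LINT y|Pi\<^sub>M {2..d} (\<lambda>_. lborel). of_real (weight_r a y) * of_real (K (flip {2..d} a y))))"
    "Re (\<Sum>a\<in>{2..d} \<rightarrow>\<^sub>E {0, 1}. LINT y|Pi\<^sub>M {2..d} (\<lambda>_. lborel). of_real (weight_r a y) * of_real (K (flip {2..d} a y)) :: complex) \<ge> 0"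
proof -
  let ?C = "\<lambda>a. LINT y|Pi\<^sub>M {2..d} (\<lambda>_. lborel). of_real (weight_r a y) * complex_of_real (K (flip {2..d} a y))"
  have w0: "weight_r a y \<ge> 0" for a y unfolding weight_r_def by (intro prod_nonneg) simp
  have nn: "weight_r a y * K (flip {2..d} a y) \<ge> 0" for a y
  proof (cases "\<forall>j\<in>{2..d}. 0 < y j \<and> y j \<le> 1/2")
    case True
    define x where "x i = (if i = 1 then 1 else t_var a y i)" for i
    have "x \<in> open_box d {1}"
      unfolding open_box_def x_def t_var_def using True by auto
    moreover have "restrict x {2..d} = flip {2..d} a y" by (auto simp: x_def flip_def fun_eq_iff)
    ultimately have "K (flip {2..d} a y) \<ge> 0" using K0 by force
    then show ?thesis using w0 by simp
  next
    case False
    then obtain j where j: "j \<in> {2..d}" "\<not> (0 < y j \<and> y j \<le> 1/2)" by blast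
    have "weight_r a y = 0" unfolding weight_r_def by (rule prod_zero) (use j in \<open>auto intro!: bexI[of _ j]\<close>)
    then show ?thesis by simp
  qed
  have eq: "complex_of_real (weight_r a y) * of_real (K (flip {2..d} a y)) = of_real (weight_r a y * K (flip {2..d} a y))" for a y by simp
  note I = integral_of_real_nonneg[OF int eq nn]
  have m: "(\<lambda>x. (\<Prod>j\<in>{2..d}. ennreal (x j powr u0 j * (1 - x j) powr v0 j)) * ennreal (K x)) \<in> borel_measurable (Pi\<^sub>M {2..d} (\<lambda>_. lborel))"
  proof (intro borel_measurable_times_ennreal borel_measurable_prod_ennreal)
    fix j assume "j \<in> {2..d}"
    note [measurable] = measurable_PiM_lborel_component[OF this]
    show "(\<lambda>x. ennreal (x j powr u0 j * (1 - x j) powr v0 j)) \<in> borel_measurable (Pi\<^sub>M {2..d} (\<lambda>_. lborel))" by measurable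
  qed measurable
  have "cube_integral K = (\<Sum>a\<in>{2..d} \<rightarrow>\<^sub>E {0, 1}. \<integral>\<^sup>+ y. (\<Prod>j\<in>{2..d}. indicator {0<..1/2} (y j)) *
     ((\<Prod>j\<in>{2..d}. ennreal (flip {2..d} a y j powr u0 j * (1 - flip {2..d} a y j) powr v0 j)) * ennreal (K (flip {2..d} a y))) \<partial>Pi\<^sub>M {2..d} (\<lambda>_. lborel))"
    unfolding cube_integral_def by (rule nn_integral_cube_split[OF _ m]) simp
  also have "\<dots> = (\<Sum>a\<in>{2..d} \<rightarrow>\<^sub>E {0, 1}. \<integral>\<^sup>+ y. ennreal (weight_r a y * K (flip {2..d} a y)) \<partial>Pi\<^sub>M {2..d} (\<lambda>_. lborel))"
  proof (intro sum.cong refl nn_integral_cong)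
    fix a y
    show "(\<Prod>j\<in>{2..d}. indicator {0<..1/2} (y j)) * ((\<Prod>j\<in>{2..d}. ennreal (flip {2..d} a y j powr u0 j * (1 - flip {2..d} a y j) powr v0 j)) * ennreal (K (flip {2..d} a y)))
       = ennreal (weight_r a y * K (flip {2..d} a y))"
      unfolding ennreal_mult'[OF w0] weight_r_flip by (simp only: mult.assoc)
  qed
  also have "\<dots> = (\<Sum>a\<in>{2..d} \<rightarrow>\<^sub>E {0, 1}. ennreal (Re (?C a)))" unfolding I(1) ..
  also have "\<dots> = ennreal (\<Sum>a\<in>{2..d} \<rightarrow>\<^sub>E {0, 1}. Re (?C a))" by (rule sum_ennreal) (rule I(3))
  finally show "cube_integral K = ennreal (Re (\<Sum>a\<in>{2..d} \<rightarrow>\<^sub>E {0, 1}. ?C a))" by simp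
  show "Re (\<Sum>a\<in>{2..d} \<rightarrow>\<^sub>E {0, 1}. ?C a) \<ge> 0" by (simp add: sum_nonneg I(3))
  have "(\<Sum>a\<in>{2..d} \<rightarrow>\<^sub>E {0, 1}. ?C a) = (\<Sum>a\<in>{2..d} \<rightarrow>\<^sub>E {0, 1}. of_real (Re (?C a)))"
    by (intro sum.cong refl I(2))
  then show "(\<Sum>a\<in>{2..d} \<rightarrow>\<^sub>E {0, 1}. ?C a) = complex_of_real (Re (\<Sum>a\<in>{2..d} \<rightarrow>\<^sub>E {0, 1}. ?C a))"
    unfolding Re_sum of_real_sum .
qed

lemma glue_nth:
  "j \<in> {2..d} \<Longrightarrow> glue {2..d} y (eval_point x1 {}) j = y j" "glue {2..d} y (eval_point x1 {}) 1 = x1"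
  by (simp_all add: glue_def eval_point_def)

lemma t_var_glue: "j \<in> {2..d} \<Longrightarrow> t_var a (glue {2..d} y (eval_point x1 {})) j = flip {2..d} a y j"
  by (simp add: t_var_def flip_def glue_nth)

lemma weight_glue: "(\<Prod>j=2..d. complex_of_real (1 - glue {2..d} y (eval_point x1 {}) j) powr v_exp d S a j)
     = (\<Prod>j=2..d. of_real (1 - y j) powr v_exp d S a j)"
  by (intro prod.cong refl) (simp add: glue_nth)

definition psi_kernel :: "real \<Rightarrow> (nat \<Rightarrow> real) \<Rightarrow> real"
  where "psi_kernel y x = (\<Prod>j\<in>{2..d}. bern_gen (y * (\<Prod>i\<in>{2..j}. x i)))"

lemma chain_arg_glue: "j \<in> {1..d} \<Longrightarrow> chain_arg a j (glue {2..d} y (eval_point x1 {})) = x1 * (\<Prod>i\<in>{2..j}. flip {2..d} a y i)"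
  unfolding chain_arg_def glue_nth by (intro arg_cong2[of _ _ _ _ times] prod.cong refl t_var_glue) auto

lemma psi_integrand:
  "box_weight {2..d} (u_exp d S a) y * ez_psi d S a (glue {2..d} y (eval_point x1 {})) = of_real (weight_r a y) * of_real (psi_kernel x1 (flip {2..d} a y))"
proof -
  have "(\<Prod>j=2..d. cbern (of_real (chain_arg a j (glue {2..d} y (eval_point x1 {}))))) = of_real (psi_kernel x1 (flip {2..d} a y))"
    unfolding psi_kernel_def of_real_prod cbern_of_real by (intro prod.cong refl) (simp add: chain_arg_glue)
  then show ?thesis unfolding ez_psi_eq weight_glue box_weight_real[symmetric] by (simp only: mult.assoc)
qed

lemma mono_integrand:
  "box_weight {2..d} (u_exp d S a) y * ((\<Prod>j=2..d. of_real (1 - glue {2..d} y (eval_point x1 {}) j) powr v_exp d S a j) * mono_term d a p (glue {2..d} y (eval_point x1 {})))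
   = bern_coeff d p * (of_real (weight_r a y) * of_real (\<Prod>j\<in>{2..d}. flip {2..d} a y j ^ tail_sum d p j))"
proof -
  have "(\<Prod>j=2..d. complex_of_real (t_var a (glue {2..d} y (eval_point x1 {})) j) ^ tail_sum d p j) = of_real (\<Prod>j\<in>{2..d}. flip {2..d} a y j ^ tail_sum d p j)"
    unfolding of_real_prod by (intro prod.cong refl) (simp add: t_var_glue)
  then show ?thesis unfolding mono_term_def weight_glue box_weight_real[symmetric] by (simp only: mult_ac)
qed

lemma Re_u: "j \<in> {2..d} \<Longrightarrow> Re (u_exp d S a j) > -1"
  using ur_pos[of j a] by (simp add: u_eq)

lemma ez_F_psi_eq:
  assumes "y \<ge> 0"
  shows "ez_F d n S (ez_psi d S) y = (\<Sum>a\<in>{2..d} \<rightarrow>\<^sub>E {0, 1}. LINT x|Pi\<^sub>M {2..d} (\<lambda>_. lborel). of_real (weight_r a x) * of_real (psi_kernel y (flip {2..d} a x)))"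
proof -
  have y: "y \<in> {0..}" using assms by simp
  have "ez_F d n S (ez_psi d S) y = (\<Sum>a\<in>{2..d} \<rightarrow>\<^sub>E {0, 1}. \<Sum>q\<in>Pi\<^sub>E {2..d} (\<lambda>j. {0..n j + 1}).
     (\<Prod>j\<in>{2..d}. bdry_coeff (u_exp d S a j) (n j) (q j)) * F_term d n (u_exp d S a) (ez_psi d S a) q y)"
    by (rule ez_F_eq_sum[where \<Phi> = "\<lambda>a z. ez_psi d (coords e z) a" and z = z and X = "{0..}", OF d tame_smooth_ez_psi _ y]) auto
  also have "\<dots> = (\<Sum>a\<in>{2..d} \<rightarrow>\<^sub>E {0, 1}. LINT x|Pi\<^sub>M {2..d} (\<lambda>_. lborel). box_weight {2..d} (u_exp d S a) x * ez_psi d S a (glue {2..d} x (eval_point y {})))"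
    by (intro sum.cong refl sum_F_term_eq_integral[where \<Phi> = "\<lambda>z. ez_psi d (coords e z) _", OF _ tame_smooth_ez_psi y Re_u]) auto
  finally show ?thesis unfolding psi_integrand .
qed

lemma ez_F_phi_eq:
  assumes "0 < y" "y \<le> 1"
  shows "ez_F d n S (ez_phi d n S) y = (\<Sum>a\<in>{2..d} \<rightarrow>\<^sub>E {0, 1}. LINT x|Pi\<^sub>M {2..d} (\<lambda>_. lborel). box_weight {2..d} (u_exp d S a) x * ez_phi d n S a (glue {2..d} x (eval_point y {})))"
proof -
  have y: "y \<in> {0<..1}" using assms by simp
  have "ez_F d n S (ez_phi d n S) y = (\<Sum>a\<in>{2..d} \<rightarrow>\<^sub>E {0, 1}. \<Sum>q\<in>Pi\<^sub>E {2..d} (\<lambda>j. {0..n j + 1}).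
     (\<Prod>j\<in>{2..d}. bdry_coeff (u_exp d S a j) (n j) (q j)) * F_term d n (u_exp d S a) (ez_phi d n S a) q y)"
    by (rule ez_F_eq_sum[where \<Phi> = "\<lambda>a z. ez_phi d n (coords e z) a" and z = z and X = "{0<..1}", OF d tame_smooth_ez_phi[OF d] _ y]) auto
  also have "\<dots> = (\<Sum>a\<in>{2..d} \<rightarrow>\<^sub>E {0, 1}. LINT x|Pi\<^sub>M {2..d} (\<lambda>_. lborel). box_weight {2..d} (u_exp d S a) x * ez_phi d n S a (glue {2..d} x (eval_point y {})))"
    by (intro sum.cong refl sum_F_term_eq_integral[where \<Phi> = "\<lambda>z. ez_phi d n (coords e z) _", OF _ tame_smooth_ez_phi[OF d] y Re_u]) auto
  finally show ?thesis .
qed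


lemma bern_gen_nonneg: "bern_gen y \<ge> 0"
  unfolding bern_gen_def by (cases "y > 0") (auto intro: divide_nonneg_nonneg divide_nonpos_nonpos)

lemma psi_kernel_nonneg: "psi_kernel y x \<ge> 0"
  unfolding psi_kernel_def by (intro prod_nonneg) (simp add: bern_gen_nonneg)

lemma psi_kernel_measurable [measurable]: "psi_kernel y \<in> borel_measurable (Pi\<^sub>M {2..d} (\<lambda>_. lborel))"
  unfolding psi_kernel_def[abs_def]
proof (rule borel_measurable_prod)
  fix j assume j: "j \<in> {2..d}"
  have [measurable]: "bern_gen \<in> borel_measurable borel" unfolding bern_gen_def[abs_def] by measurable
  have [measurable]: "(\<lambda>x. \<Prod>i\<in>{2..j}. x i) \<in> borel_measurable (Pi\<^sub>M {2..d} (\<lambda>_. lborel :: real measure))"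
    by (intro borel_measurable_prod measurable_PiM_lborel_component) (use j in auto)
  show "(\<lambda>x. bern_gen (y * (\<Prod>i\<in>{2..j}. x i))) \<in> borel_measurable (Pi\<^sub>M {2..d} (\<lambda>_. lborel))" by measurable
qed

lemma prod_chain_args:
  fixes y :: real
  shows "(\<Prod>j\<in>{2..d}. y * (\<Prod>i\<in>{2..j}. x i)) = y ^ (d - 1) * (\<Prod>j\<in>{2..d}. x j ^ (d + 1 - j))"
proof -
  \<comment> \<open>Exponent 0 at \<open>j = 1\<close> removes the factor \<open>y\<close> belonging
    to the outer variable from \<open>prod_chain_monomial\<close>; the tail sums of this
    \<open>p\<close> count the factors \<open>j, ..., d\<close>.\<close>
  define p :: "nat \<Rightarrow> nat" where "p j = (if j = 1 then 0 else 1)" for j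
  have I: "{1..d} = insert 1 {2..d}" using d by auto
  have 1: "(\<Prod>j=1..d. (y * (\<Prod>i=2..j. x i)) ^ p j) = (\<Prod>j\<in>{2..d}. y * (\<Prod>i\<in>{2..j}. x i))"
    unfolding I by (subst prod.insert) (auto simp: p_def intro!: prod.cong)
  have 2: "(\<Sum>i=1..d. p i) = d - 1" unfolding I by (subst sum.insert) (auto simp: p_def)
  have 3: "tail_sum d p j = d + 1 - j" if "j \<in> {2..d}" for j
    using that by (simp add: tail_sum_def p_def)
  have 4: "(\<Prod>j=2..d. x j ^ tail_sum d p j) = (\<Prod>j\<in>{2..d}. x j ^ (d + 1 - j))"
    by (rule prod.cong[OF refl]) (simp only: 3)
  show ?thesis
    using prod_chain_monomial[of y x p d] unfolding 1 2 4 .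
qed

lemma divide_expm1_eq: "w > 0 \<Longrightarrow> A / (exp w - 1) = A * bern_gen w / w"
  by (simp add: bern_gen_def)

text \<open>Each \<open>1 / (exp w - 1)\<close> becomes \<open>bern_gen w / w\<close>. The product
  of the denominators \<open>w\<close> is a monomial in \<open>y\<close> and the \<open>x j\<close>;
  it accounts for \<open>y powr (1 - real d)\<close> and lowers the exponent
  \<open>tail_sum d r j - 1\<close> to \<open>u0 j\<close>.\<close>

lemma chain_density_one:
  assumes y: "y > 0"
  shows "chain_density d r 1 y x = ennreal (y powr (1 - real d)) * ((\<Prod>j\<in>{2..d}. indicator {0<..<1} (x j)) *
     ((\<Prod>j\<in>{2..d}. ennreal (x j powr u0 j * (1 - x j) powr v0 j)) * ennreal (psi_kernel y x)))"
proof -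
  have I: "{1<..i} = {2..i}" for i :: nat by auto
  show ?thesis
  proof (cases "\<forall>j\<in>{2..d}. 0 < x j \<and> x j < 1")
    case True
    let ?w = "\<lambda>j. y * (\<Prod>i\<in>{2..j}. x i)"
    have w: "?w j > 0" if "j \<in> {2..d}" for j
      using y True that by (intro mult_pos_pos prod_pos) auto
    have "(\<Prod>i\<in>{2..d}. x i powr (tail_sum d r i - 1) * (1 - x i) powr (r (i - 1) - 1) / (exp (?w i) - 1))
      = (\<Prod>i\<in>{2..d}. (x i powr (tail_sum d r i - 1) * (1 - x i) powr v0 i * bern_gen (?w i)) / ?w i)"
      unfolding v0_def by (intro prod.cong refl divide_expm1_eq w)
    also have "\<dots> = (\<Prod>i\<in>{2..d}. x i powr (tail_sum d r i - 1)) * (\<Prod>i\<in>{2..d}. (1 - x i) powr v0 i) * psi_kernel y x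
        / (y ^ (d - 1) * (\<Prod>j\<in>{2..d}. x j ^ (d + 1 - j)))"
      unfolding prod_dividef prod.distrib psi_kernel_def prod_chain_args[unfolded prod.distrib] ..
    also have "\<dots> = y powr (1 - real d) * ((\<Prod>i\<in>{2..d}. x i powr (tail_sum d r i - 1) / x i ^ (d + 1 - i)) * (\<Prod>i\<in>{2..d}. (1 - x i) powr v0 i) * psi_kernel y x)"
    proof -
      have "y powr (1 - real d) = 1 / y ^ (d - 1)"
        using y d by (simp add: powr_realpow[symmetric] powr_minus_divide[symmetric] of_nat_diff)
      then show ?thesis by (simp add: prod_dividef)
    qed
    also have "(\<Prod>i\<in>{2..d}. x i powr (tail_sum d r i - 1) / x i ^ (d + 1 - i)) = (\<Prod>i\<in>{2..d}. x i powr u0 i)"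
    proof (rule prod.cong[OF refl])
      fix i assume i: "i \<in> {2..d}"
      have xi: "x i > 0" using True i by auto
      have "x i powr (tail_sum d r i - 1) / x i ^ (d + 1 - i) = x i powr (tail_sum d r i - 1 - real (d + 1 - i))"
        unfolding powr_diff powr_realpow[OF xi] ..
      also have "tail_sum d r i - 1 - real (d + 1 - i) = u0 i"
        using i by (simp add: u0_def of_nat_diff)
      finally show "x i powr (tail_sum d r i - 1) / x i ^ (d + 1 - i) = x i powr u0 i" .
    qed
    finally have main: "(\<Prod>i\<in>{2..d}. x i powr (tail_sum d r i - 1) * (1 - x i) powr (r (i - 1) - 1) / (exp (?w i) - 1))
       = y powr (1 - real d) * ((\<Prod>i\<in>{2..d}. x i powr u0 i * (1 - x i) powr v0 i) * psi_kernel y x)"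
      by (simp add: prod.distrib)
    have ind: "(\<Prod>j\<in>{2..d}. indicator {0<..<1} (x j)) = (1 :: ennreal)" by (rule prod.neutral) (use True in auto)
    have "chain_density d r 1 y x = (\<Prod>i\<in>{2..d}. ennreal (x i powr (tail_sum d r i - 1) * (1 - x i) powr (r (i - 1) - 1) / (exp (?w i) - 1)))"
      unfolding chain_density_def I by (intro prod.cong refl) (use True in auto)
    also have "\<dots> = ennreal (\<Prod>i\<in>{2..d}. x i powr (tail_sum d r i - 1) * (1 - x i) powr (r (i - 1) - 1) / (exp (?w i) - 1))"
      by (rule prod_ennreal) (use w in \<open>fastforce intro!: divide_nonneg_nonneg mult_nonneg_nonneg\<close>)
    also have "\<dots> = ennreal (y powr (1 - real d)) * (ennreal (\<Prod>i\<in>{2..d}. x i powr u0 i * (1 - x i) powr v0 i) * ennreal (psi_kernel y x))"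
      unfolding main by (simp add: ennreal_mult prod_nonneg psi_kernel_nonneg)
    also have "ennreal (\<Prod>i\<in>{2..d}. x i powr u0 i * (1 - x i) powr v0 i) = (\<Prod>i\<in>{2..d}. ennreal (x i powr u0 i * (1 - x i) powr v0 i))"
      by (rule prod_ennreal[symmetric]) simp
    finally show ?thesis unfolding ind mult_1 .
  next
    case False
    then obtain j where j: "j \<in> {2..d}" "\<not> (0 < x j \<and> x j < 1)" by blast
    have "(\<Prod>j\<in>{2..d}. indicator {0<..<1} (x j)) = (0 :: ennreal)"
      by (rule prod_zero) (use j in \<open>auto intro!: bexI[of _ j]\<close>)
    moreover have "chain_density d r 1 y x = 0"
      unfolding chain_density_def I by (rule prod_zero) (use j in \<open>auto intro!: bexI[of _ j]\<close>)
    ultimately show ?thesis by simp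
  qed
qed

lemma psi_integrable:
  assumes "y \<ge> 0"
  shows "integrable (Pi\<^sub>M {2..d} (\<lambda>_. lborel)) (\<lambda>x. of_real (weight_r a x) * of_real (psi_kernel y (flip {2..d} a x)) :: complex)"
  using integrable_tame[where \<Phi> = "\<lambda>z. ez_psi d (coords e z) a" and z = z and X = "{0..}" and ?x1.0 = y and u = "u_exp d S a" and d = d,
      OF _ tame_smooth_ez_psi _ Re_u] assms
  unfolding psi_integrand by simp

text \<open>The exponents \<open>tail_sum d r 1 - 1\<close> and \<open>1 - real d\<close> combine to
  that of the psi integral in the formula, so its integrand is the density whose total mass is the
  zeta value times the gamma factors.\<close>

lemma chain_measure_one:
  assumes y: "y > 0"
  shows "chain_measure d r 1 y = ennreal (y powr (tail_sum d r 1 - real d) / (exp y - 1) * Re (ez_F d n S (ez_psi d S) y))"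
    and "Re (ez_F d n S (ez_psi d S) y) \<ge> 0" and "ez_F d n S (ez_psi d S) y = of_real (Re (ez_F d n S (ez_psi d S) y))"
proof -
  have I: "{1<..d} = {2..d}" by auto
  note sp = cube_integral_split[OF psi_kernel_measurable ballI[OF psi_kernel_nonneg] psi_integrable[OF less_imp_le[OF y]], folded ez_F_psi_eq[OF less_imp_le[OF y]]]
  show "Re (ez_F d n S (ez_psi d S) y) \<ge> 0" "ez_F d n S (ez_psi d S) y = of_real (Re (ez_F d n S (ez_psi d S) y))"
    by (rule sp(3), rule sp(2))
  have m: "(\<lambda>x. (\<Prod>j\<in>{2..d}. indicator {0<..<1} (x j)) * ((\<Prod>j\<in>{2..d}. ennreal (x j powr u0 j * (1 - x j) powr v0 j)) * ennreal (psi_kernel y x)))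
      \<in> borel_measurable (Pi\<^sub>M {2..d} (\<lambda>_. lborel))"
  proof (intro borel_measurable_times_ennreal borel_measurable_prod_ennreal)
    fix j assume j: "j \<in> {2..d}"
    note [measurable] = measurable_PiM_lborel_component[OF this]
    show "(\<lambda>x. ennreal (x j powr u0 j * (1 - x j) powr v0 j)) \<in> borel_measurable (Pi\<^sub>M {2..d} (\<lambda>_. lborel))" by measurable
  next
    fix j assume j: "j \<in> {2..d}"
    have "(indicator {0<..<1} :: real \<Rightarrow> ennreal) \<in> borel_measurable borel" by simp
    from measurable_compose[OF measurable_PiM_lborel_component[OF j] this]
    show "(\<lambda>x :: nat \<Rightarrow> real. indicator {0<..<1} (x j) :: ennreal) \<in> borel_measurable (Pi\<^sub>M {2..d} (\<lambda>_. lborel))" .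
  qed measurable
  have "(\<integral>\<^sup>+ x. chain_density d r 1 y x \<partial>Pi\<^sub>M {1<..d} (\<lambda>_. lborel)) = ennreal (y powr (1 - real d)) * cube_integral (psi_kernel y)"
    unfolding I cube_integral_def chain_density_one[OF y] by (rule nn_integral_cmult[OF m])
  then have "chain_measure d r 1 y = ennreal (y powr (tail_sum d r 1 - 1) / (exp y - 1)) * (ennreal (y powr (1 - real d)) * ennreal (Re (ez_F d n S (ez_psi d S) y)))"
    unfolding chain_measure_def sp(1) using y by simp
  also have "\<dots> = ennreal (y powr (tail_sum d r 1 - 1) / (exp y - 1) * (y powr (1 - real d) * Re (ez_F d n S (ez_psi d S) y)))"
    using ennreal_mult[of "y powr (tail_sum d r 1 - 1) / (exp y - 1)" "y powr (1 - real d) * Re (ez_F d n S (ez_psi d S) y)"]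
      ennreal_mult[of "y powr (1 - real d)" "Re (ez_F d n S (ez_psi d S) y)"] y sp(3)
    by (metis divide_nonneg_pos exp_gt_one diff_gt_0_iff_gt mult_nonneg_nonneg powr_ge_zero)
  also have "y powr (tail_sum d r 1 - 1) / (exp y - 1) * (y powr (1 - real d) * Re (ez_F d n S (ez_psi d S) y))
      = (y powr (tail_sum d r 1 - 1) * y powr (1 - real d)) / (exp y - 1) * Re (ez_F d n S (ez_psi d S) y)" by simp
  also have "y powr (tail_sum d r 1 - 1) * y powr (1 - real d) = y powr (tail_sum d r 1 - real d)"
    using y by (simp add: powr_add[symmetric])
  finally show "chain_measure d r 1 y = ennreal (y powr (tail_sum d r 1 - real d) / (exp y - 1) * Re (ez_F d n S (ez_psi d S) y))" .
qed

definition mono_kernel :: "(nat \<Rightarrow> nat) \<Rightarrow> (nat \<Rightarrow> real) \<Rightarrow> real"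
  where "mono_kernel p x = (\<Prod>j\<in>{2..d}. x j ^ tail_sum d p j)"

lemma mono_integrable:
  "integrable (Pi\<^sub>M {2..d} (\<lambda>_. lborel)) (\<lambda>x. of_real (weight_r a x) * of_real (mono_kernel p (flip {2..d} a x)) :: complex)"
proof -
  have t: "tame_smooth d {0..} (\<lambda>z x. (\<Prod>j=2..d. of_real (1 - x j) powr v_exp d (coords e z) a j) * (\<Prod>j=2..d. of_real (t_var a x j) ^ tail_sum d p j))"
    by (intro tame_smooth_mult tame_smooth_weight tame_smooth_prod tame_smooth_power tame_smooth_t_var) auto
  have eq: "box_weight {2..d} (u_exp d S a) y * ((\<Prod>j=2..d. of_real (1 - glue {2..d} y (eval_point 0 {}) j) powr v_exp d S a j) * (\<Prod>j=2..d. of_real (t_var a (glue {2..d} y (eval_point 0 {})) j) ^ tail_sum d p j))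
     = of_real (weight_r a y) * of_real (mono_kernel p (flip {2..d} a y))" for y
  proof -
    have "(\<Prod>j=2..d. complex_of_real (t_var a (glue {2..d} y (eval_point 0 {})) j) ^ tail_sum d p j) = of_real (mono_kernel p (flip {2..d} a y))"
      unfolding mono_kernel_def of_real_prod by (intro prod.cong refl) (simp add: t_var_glue)
    then show ?thesis unfolding weight_glue box_weight_real[symmetric] by (simp only: mult.assoc)
  qed
  show ?thesis
    using integrable_tame[where z = z and ?x1.0 = 0 and u = "u_exp d S a" and d = d, OF _ t _ Re_u] unfolding eq by simp
qed

text \<open>Summing over \<open>a\<close> reassembles the integral over the whole cube, where a
  monomial kernel leaves a product of one-dimensional beta integrals.\<close>

lemma mono_integral:
  "(\<Sum>a\<in>{2..d} \<rightarrow>\<^sub>E {0, 1}. LINT x|Pi\<^sub>M {2..d} (\<lambda>_. lborel). of_real (weight_r a x) * of_real (mono_kernel p (flip {2..d} a x)))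
    = (\<Prod>j=2..d. Beta (tail_sum d S j - of_nat d + of_nat j + of_nat (tail_sum d p j) - 1) (S (j - 1)))"
proof -
  let ?B = "\<lambda>j. Beta (u0 j + real (tail_sum d p j) + 1) (v0 j + 1)"
  have mk: "mono_kernel p \<in> borel_measurable (Pi\<^sub>M {2..d} (\<lambda>_. lborel))"
    unfolding mono_kernel_def[abs_def]
    by (intro borel_measurable_prod borel_measurable_power measurable_PiM_lborel_component)
  have k0: "\<forall>x\<in>open_box d {1}. mono_kernel p (restrict x {2..d}) \<ge> 0"
  proof
    fix x assume x: "x \<in> open_box d {1}"
    show "mono_kernel p (restrict x {2..d}) \<ge> 0"
      unfolding mono_kernel_def by (intro prod_nonneg zero_le_power) (use open_box_nth[OF x] in \<open>simp add: less_imp_le\<close>)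
  qed
  note sp = cube_integral_split[OF mk k0 mono_integrable]
  have "cube_integral (mono_kernel p) = (\<integral>\<^sup>+ x. (\<Prod>j\<in>{2..d}. ennreal (indicator {0<..<1} (x j) * (x j powr (u0 j + real (tail_sum d p j)) * (1 - x j) powr v0 j))) \<partial>Pi\<^sub>M {2..d} (\<lambda>_. lborel))"
    unfolding cube_integral_def
  proof (rule nn_integral_cong)
    fix x
    show "(\<Prod>j\<in>{2..d}. indicator {0<..<1} (x j)) * ((\<Prod>j\<in>{2..d}. ennreal (x j powr u0 j * (1 - x j) powr v0 j)) * ennreal (mono_kernel p x))
       = (\<Prod>j\<in>{2..d}. ennreal (indicator {0<..<1} (x j) * (x j powr (u0 j + real (tail_sum d p j)) * (1 - x j) powr v0 j)))"
    proof (cases "\<forall>j\<in>{2..d}. 0 < x j \<and> x j < 1")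
      case True
      have "ennreal (mono_kernel p x) = (\<Prod>j\<in>{2..d}. ennreal (x j ^ tail_sum d p j))"
        unfolding mono_kernel_def by (rule prod_ennreal[symmetric]) (use True in \<open>simp add: less_imp_le\<close>)
      then have "(\<Prod>j\<in>{2..d}. indicator {0<..<1} (x j)) * ((\<Prod>j\<in>{2..d}. ennreal (x j powr u0 j * (1 - x j) powr v0 j)) * ennreal (mono_kernel p x))
        = (\<Prod>j\<in>{2..d}. indicator {0<..<1} (x j) * (ennreal (x j powr u0 j * (1 - x j) powr v0 j) * ennreal (x j ^ tail_sum d p j)))"
        unfolding prod.distrib by simp
      also have "\<dots> = (\<Prod>j\<in>{2..d}. ennreal (indicator {0<..<1} (x j) * (x j powr (u0 j + real (tail_sum d p j)) * (1 - x j) powr v0 j)))"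
      proof (rule prod.cong[OF refl])
        fix j assume "j \<in> {2..d}"
        then have xj: "0 < x j" "x j < 1" using True by auto
        then show "indicator {0<..<1} (x j) * (ennreal (x j powr u0 j * (1 - x j) powr v0 j) * ennreal (x j ^ tail_sum d p j))
          = ennreal (indicator {0<..<1} (x j) * (x j powr (u0 j + real (tail_sum d p j)) * (1 - x j) powr v0 j))"
          by (simp add: ennreal_mult[symmetric] powr_add powr_realpow mult_ac)
      qed
      finally show ?thesis .
    next
      case False
      then obtain j where j: "j \<in> {2..d}" "\<not> (0 < x j \<and> x j < 1)" by blast
      have "(\<Prod>j\<in>{2..d}. indicator {0<..<1} (x j)) = (0 :: ennreal)"
        by (rule prod_zero) (use j in \<open>auto intro!: bexI[of _ j]\<close>)
      moreover have "(\<Prod>j\<in>{2..d}. ennreal (indicator {0<..<1} (x j) * (x j powr (u0 j + real (tail_sum d p j)) * (1 - x j) powr v0 j))) = 0"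
        by (rule prod_zero) (use j in \<open>auto intro!: bexI[of _ j]\<close>)
      ultimately show ?thesis by (simp only: mult_zero_left)
    qed
  qed
  also have "\<dots> = (\<Prod>j\<in>{2..d}. \<integral>\<^sup>+ t. ennreal (indicator {0<..<1} t * (t powr (u0 j + real (tail_sum d p j)) * (1 - t) powr v0 j)) \<partial>lborel)"
    by (rule lborel_product.product_nn_integral_prod) auto
  also have "\<dots> = (\<Prod>j\<in>{2..d}. ennreal (?B j))"
  proof (intro prod.cong refl nn_integral_Beta)
    fix j assume "j \<in> {2..d}"
    then show "- 1 < u0 j + real (tail_sum d p j)" "- 1 < v0 j" using u0_pos[of j] v0_pos[of j] by linarith+
  qed
  also have "\<dots> = ennreal (\<Prod>j\<in>{2..d}. ?B j)"
  proof (rule prod_ennreal)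
    fix j assume "j \<in> {2..d}"
    then have "u0 j + real (tail_sum d p j) + 1 > 0" "v0 j + 1 > 0" using u0_pos[of j] v0_pos[of j] by linarith+
    then show "?B j \<ge> 0" unfolding Beta_def by (simp add: Gamma_real_pos less_imp_le)
  qed
  finally have "ennreal (Re (\<Sum>a\<in>{2..d} \<rightarrow>\<^sub>E {0, 1}. LINT x|Pi\<^sub>M {2..d} (\<lambda>_. lborel). of_real (weight_r a x) * of_real (mono_kernel p (flip {2..d} a x))))
     = ennreal (\<Prod>j\<in>{2..d}. ?B j)" unfolding sp(1) .
  moreover have "(\<Prod>j\<in>{2..d}. ?B j) \<ge> 0"
  proof (rule prod_nonneg)
    fix j assume "j \<in> {2..d}"
    then have "u0 j + real (tail_sum d p j) + 1 > 0" "v0 j + 1 > 0" using u0_pos[of j] v0_pos[of j] by linarith+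
    then show "?B j \<ge> 0" unfolding Beta_def by (simp add: Gamma_real_pos less_imp_le)
  qed
  ultimately have "Re (\<Sum>a\<in>{2..d} \<rightarrow>\<^sub>E {0, 1}. LINT x|Pi\<^sub>M {2..d} (\<lambda>_. lborel). of_real (weight_r a x) * of_real (mono_kernel p (flip {2..d} a x))) = (\<Prod>j\<in>{2..d}. ?B j)"
    using sp(3) by (simp only: ennreal_inj)
  then have "(\<Sum>a\<in>{2..d} \<rightarrow>\<^sub>E {0, 1}. LINT x|Pi\<^sub>M {2..d} (\<lambda>_. lborel). of_real (weight_r a x) * of_real (mono_kernel p (flip {2..d} a x))) = complex_of_real (\<Prod>j\<in>{2..d}. ?B j)"
    using sp(2) by (simp only:)
  also have "\<dots> = (\<Prod>j=2..d. Beta (tail_sum d S j - of_nat d + of_nat j + of_nat (tail_sum d p j) - 1) (S (j - 1)))"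
    unfolding of_real_prod
  proof (rule prod.cong[OF refl])
    fix j assume "j \<in> {2..d}"
    have a: "tail_sum d S j - of_nat d + of_nat j + of_nat (tail_sum d p j) - 1 = complex_of_real (u0 j + real (tail_sum d p j) + 1)"
      unfolding tail_of_real u0_def by simp
    have b: "S (j - 1) = complex_of_real (v0 j + 1)" unfolding s v0_def by simp
    show "complex_of_real (?B j) = Beta (tail_sum d S j - of_nat d + of_nat j + of_nat (tail_sum d p j) - 1) (S (j - 1))"
      unfolding a b Beta_def of_real_divide of_real_mult Gamma_complex_of_real[symmetric] of_real_add[symmetric] ..
  qed
  finally show ?thesis .
qed

end

section \<open>The outer integral at real points\<close>

lemma has_integral_powr_unit:
  assumes "\<alpha> > -1"
  shows "integrable lborel (\<lambda>x. indicator {0<..1} x * x powr \<alpha> :: real)" "(LINT x|lborel. indicator {0<..1} x * x powr \<alpha> :: real) = 1 / (\<alpha> + 1)"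
proof -
  have "((\<lambda>x. x powr \<alpha>) has_integral 1 powr (\<alpha> + 1) / (\<alpha> + 1)) {0..1::real}"
    by (rule has_integral_powr_from_0) (use assms in auto)
  then have "((\<lambda>x. indicator {0<..1} x * x powr \<alpha>) has_integral 1 / (\<alpha> + 1)) {0..1::real}"
    unfolding powr_one_eq_one by (rule has_integral_spike_finite[of "{0}", rotated 2]) auto
  then have hi: "((\<lambda>x. indicator {0<..1} x * x powr \<alpha>) has_integral 1 / (\<alpha> + 1)) (UNIV :: real set)"
    by (rule has_integral_on_superset) auto
  from nn_integral_has_integral_lborel[OF _ _ hi]
  have nn: "(\<integral>\<^sup>+ x. ennreal (indicator {0<..1} x * x powr \<alpha>) \<partial>lborel) = ennreal (1 / (\<alpha> + 1))" by simp
  show i: "integrable lborel (\<lambda>x. indicator {0<..1} x * x powr \<alpha> :: real)"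
    by (rule integrableI_nonneg) (auto simp: nn)
  show "(LINT x|lborel. indicator {0<..1} x * x powr \<alpha> :: real) = 1 / (\<alpha> + 1)"
    using has_integral_integral_lborel[OF i] hi has_integral_unique by blast
qed

context real_point begin

lemma box_weight_outside:
  "\<not> (\<forall>j\<in>{2..d}. 0 < x j \<and> x j \<le> 1/2) \<Longrightarrow> box_weight {2..d} u x = 0"
  using box_weight_eq_0[of "{2..d}" _ x u] by blast

text \<open>\<open>bern_gen y\<close> is the factor for \<open>j = 1\<close> absent from psi. With
  it the product is the full Bernoulli product, whose splitting at degree \<open>n 1\<close>
  consists of the Taylor monomials and \<open>y ^ Suc (n 1)\<close> times phi.\<close>

lemma psi_phi_pointwise:
  assumes y: "0 < y" "y \<le> 1"
  defines "G \<equiv> \<lambda>x. glue {2..d} x (eval_point y {})"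
  shows "of_real (bern_gen y) * (box_weight {2..d} (u_exp d S a) x * ez_psi d S a (G x))
    = (\<Sum>k=0..n 1. \<Sum>p\<in>compositions d k. of_real y ^ k * (bern_coeff d p * (of_real (weight_r a x) * of_real (mono_kernel p (flip {2..d} a x)))))
      + of_real y ^ Suc (n 1) * (box_weight {2..d} (u_exp d S a) x * ez_phi d n S a (G x))"
proof (cases "\<forall>j\<in>{2..d}. 0 < x j \<and> x j \<le> 1/2")
  case False
  have "complex_of_real (weight_r a x) = 0" unfolding box_weight_real[symmetric] box_weight_outside[OF False] by simp
  then show ?thesis unfolding box_weight_outside[OF False] by simp
next
  case True
  let ?b = "box_weight {2..d} (u_exp d S a) x" and ?W = "\<Prod>j=2..d. complex_of_real (1 - G x j) powr v_exp d S a j"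
  have G1: "G x 1 = y" unfolding G_def by (rule glue_nth)
  have xo: "G x \<in> open_box d {0<..1}"
    unfolding open_box_def using y True by (auto simp: G1 G_def glue_def eval_point_def)
  have I: "{1..d} = insert 1 {2..d}" using d by auto
  have "chain_arg a 1 (G x) = y" by (simp add: chain_arg_def G1[simplified])
  then have c: "(\<Prod>j=1..d. cbern (of_real (chain_arg a j (G x)))) = of_real (bern_gen y) * (\<Prod>j=2..d. cbern (of_real (chain_arg a j (G x))))"
    unfolding I by (subst prod.insert) (simp_all add: cbern_of_real)
  have "of_real (bern_gen y) * (?b * ez_psi d S a (G x)) = ?b * (?W * (\<Prod>j=1..d. cbern (of_real (chain_arg a j (G x)))))"
    unfolding ez_psi_eq c by (simp only: mult_ac)
  also have "\<dots> = ?b * (?W * ((\<Sum>k=0..n 1. \<Sum>p\<in>compositions d k. of_real y ^ k * mono_term d a p (G x)) + of_real y ^ Suc (n 1) * phi_series d (n 1) a (G x)))"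
    using bernoulli_product_series[OF order_refl xo, of a "n 1"] unfolding G1 by simp
  also have "\<dots> = (\<Sum>k=0..n 1. \<Sum>p\<in>compositions d k. of_real y ^ k * (?b * (?W * mono_term d a p (G x)))) + of_real y ^ Suc (n 1) * (?b * (?W * phi_series d (n 1) a (G x)))"
    unfolding distrib_left sum_distrib_left by (simp only: mult_ac)
  also have "(\<lambda>p. ?b * (?W * mono_term d a p (G x))) = (\<lambda>p. bern_coeff d p * (of_real (weight_r a x) * of_real (mono_kernel p (flip {2..d} a x))))"
    unfolding G_def mono_integrand mono_kernel_def ..
  finally show ?thesis unfolding ez_phi_eq .
qed

definition beta_prod :: "(nat \<Rightarrow> nat) \<Rightarrow> complex"
  where "beta_prod p = (\<Prod>j=2..d. Beta (tail_sum d S j - of_nat d + of_nat j + of_nat (tail_sum d p j) - 1) (S (j - 1)))"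

text \<open>Integration of the pointwise splitting over the half boxes and summation over
  \<open>a\<close>; the monomials integrate to the beta products. It explains the exponent of
  \<open>x\<close> in the phi integral: the kernel loses one power of \<open>y\<close> to
  \<open>bern_gen\<close>, and phi returns \<open>Suc (n 1)\<close> powers.\<close>

lemma key_identity:
  assumes y: "0 < y" "y \<le> 1"
  shows "of_real (bern_gen y) * ez_F d n S (ez_psi d S) y
    = (\<Sum>k=0..n 1. \<Sum>p\<in>compositions d k. of_real y ^ k * (bern_coeff d p * beta_prod p))
      + of_real y ^ Suc (n 1) * ez_F d n S (ez_phi d n S) y"
proof -
  let ?M = "Pi\<^sub>M {2..d} (\<lambda>_. lborel :: real measure)" and ?G = "\<lambda>x. glue {2..d} x (eval_point y {})"
  let ?A = "{2..d} \<rightarrow>\<^sub>E {0::nat, 1}"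
  define m where "m a p x = complex_of_real (weight_r a x) * of_real (mono_kernel p (flip {2..d} a x))" for a p x
  define h where "h a x = box_weight {2..d} (u_exp d S a) x * ez_phi d n S a (?G x)" for a x
  have mi: "integrable ?M (m a p)" for a p unfolding m_def by (rule mono_integrable)
  have hi: "integrable ?M (h a)" for a
    unfolding h_def
    by (rule integrable_tame[where \<Phi> = "\<lambda>z. ez_phi d n (coords e z) a" and X = "{0<..1}" and u = "u_exp d S a" and d = d, OF _ tame_smooth_ez_phi[OF d] _ Re_u])
       (use y in auto)
  have a: "of_real (bern_gen y) * (LINT x|?M. of_real (weight_r a x) * of_real (psi_kernel y (flip {2..d} a x)))
     = (\<Sum>k=0..n 1. \<Sum>p\<in>compositions d k. of_real y ^ k * (bern_coeff d p * (LINT x|?M. m a p x))) + of_real y ^ Suc (n 1) * (LINT x|?M. h a x)" for a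
  proof -
    have "complex_of_real (bern_gen y) * (LINT x|?M. of_real (weight_r a x) * of_real (psi_kernel y (flip {2..d} a x)))
      = (LINT x|?M. of_real (bern_gen y) * (of_real (weight_r a x) * of_real (psi_kernel y (flip {2..d} a x))))"
      by (rule integral_mult_right_zero[symmetric])
    also have "\<dots> = (LINT x|?M. (\<Sum>k=0..n 1. \<Sum>p\<in>compositions d k. of_real y ^ k * (bern_coeff d p * m a p x)) + of_real y ^ Suc (n 1) * h a x)"
      unfolding psi_integrand[symmetric, of _ _ y] psi_phi_pointwise[OF y] m_def h_def ..
    also have "\<dots> = (LINT x|?M. (\<Sum>k=0..n 1. \<Sum>p\<in>compositions d k. of_real y ^ k * (bern_coeff d p * m a p x))) + (LINT x|?M. of_real y ^ Suc (n 1) * h a x)"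
      by (intro Bochner_Integration.integral_add Bochner_Integration.integrable_sum integrable_mult_right mi hi)
    also have "\<dots> = (\<Sum>k=0..n 1. \<Sum>p\<in>compositions d k. of_real y ^ k * (bern_coeff d p * (LINT x|?M. m a p x))) + of_real y ^ Suc (n 1) * (LINT x|?M. h a x)"
      by (simp add: Bochner_Integration.integral_sum mi del: power_Suc)
    finally show ?thesis .
  qed
  have "of_real (bern_gen y) * ez_F d n S (ez_psi d S) y
     = (\<Sum>a\<in>?A. (\<Sum>k=0..n 1. \<Sum>p\<in>compositions d k. of_real y ^ k * (bern_coeff d p * (LINT x|?M. m a p x))) + of_real y ^ Suc (n 1) * (LINT x|?M. h a x))"
    unfolding ez_F_psi_eq[OF less_imp_le[OF y(1)]] sum_distrib_left a ..
  also have "\<dots> = (\<Sum>a\<in>?A. \<Sum>k=0..n 1. \<Sum>p\<in>compositions d k. of_real y ^ k * (bern_coeff d p * (LINT x|?M. m a p x))) + of_real y ^ Suc (n 1) * ez_F d n S (ez_phi d n S) y"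
    unfolding sum.distrib ez_F_phi_eq[OF y] sum_distrib_left h_def ..
  also have "(\<Sum>a\<in>?A. \<Sum>k=0..n 1. \<Sum>p\<in>compositions d k. of_real y ^ k * (bern_coeff d p * (LINT x|?M. m a p x)))
     = (\<Sum>k=0..n 1. \<Sum>p\<in>compositions d k. of_real y ^ k * (bern_coeff d p * (\<Sum>a\<in>?A. LINT x|?M. m a p x)))"
    unfolding sum_distrib_left
    by (subst sum.swap, rule sum.cong[OF refl], rule sum.swap)
  finally show ?thesis unfolding m_def mono_integral beta_prod_def .
qed

theorem formula_real:
  assumes conv: "ez_converges d S"
  shows "ez_formula d n S = ez_zeta d S"
proof -
  let ?t = "tail_sum d r 1" and ?Fpsi = "ez_F d n S (ez_psi d S)" and ?Fphi = "ez_F d n S (ez_phi d n S)"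
  have r0: "r i > 0" if "i \<in> {1..d}" for i using big[OF that] by linarith
  obtain Z where Z: "Z \<ge> 0" "ez_zeta d S = of_real Z"
     "ennreal ((\<Prod>i=1..d. Gamma (r i)) * Z) = (\<integral>\<^sup>+ y. chain_measure d r 1 y \<partial>lborel)"
    using ez_zeta_real_integral[OF r0 d conv[unfolded s]] unfolding s by blast
  let ?P = "\<Prod>i=1..d. Gamma (r i)"
  have P0: "?P > 0" using r0 by (intro prod_pos) (simp add: Gamma_real_pos)
  \<comment> \<open>The complete outer integrand as a real function. Its total integral is finite by
    the convergence of the zeta sum, and this integrability justifies cutting at 1 and subtracting
    the Taylor part on (0, 1].\<close>
  define h where "h y = enn2real (chain_measure d r 1 y)" for y
  have hpos: "h y = y powr (?t - real d) / (exp y - 1) * Re (?Fpsi y)" if "y > 0" for y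
    unfolding h_def chain_measure_one(1)[OF that] by (rule enn2real_ennreal) (use that chain_measure_one(2)[OF that] in auto)
  have h0: "h y = 0" if "\<not> y > 0" for y using that by (simp add: h_def chain_measure_nonpos)
  have hm: "h \<in> borel_measurable borel" unfolding h_def[abs_def] by measurable
  have hc: "ennreal (h y) = chain_measure d r 1 y" for y
  proof (cases "y > 0")
    case True show ?thesis unfolding hpos[OF True] chain_measure_one(1)[OF True] ..
  next
    case False then show ?thesis using h0[OF False] by (simp add: chain_measure_nonpos)
  qed
  have nn: "(\<integral>\<^sup>+ y. ennreal (h y) \<partial>lborel) = ennreal (?P * Z)" unfolding hc Z(3) ..
  have hnn: "h y \<ge> 0" for y by (simp add: h_def)
  have hi: "integrable lborel h" by (rule integrableI_nonneg) (use hm hnn nn in auto)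
  have hI: "(LINT y|lborel. h y) = ?P * Z"
    by (rule integral_eq_nn_integral[THEN trans]) (use hm hnn nn P0 Z(1) in auto)
  have hcx: "complex_of_real (h y) = of_real y powr (tail_sum d S 1 - of_nat d) / of_real (exp y - 1) * ?Fpsi y" if "y > 0" for y
  proof -
    have "complex_of_real y powr (tail_sum d S 1 - of_nat d) = of_real (y powr (?t - real d))"
      unfolding tail_of_real using powr_of_real[of y "?t - real d"] that by simp
    then show ?thesis unfolding hpos[OF that] by (subst chain_measure_one(3)[OF that]) simp
  qed
  have hi1: "integrable lborel (\<lambda>y. indicator A y *\<^sub>R complex_of_real (h y))" if "A \<in> sets borel" for A :: "real set"
    by (rule integrable_mult_indicator) (use that hi in auto)
  have term3: "(LINT x:{1..}|lborel. of_real x powr (tail_sum d S 1 - of_nat d) / of_real (exp x - 1) * ?Fpsi x)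
     = (LINT y|lborel. indicator {1<..} y *\<^sub>R complex_of_real (h y))"
  proof -
    have "(LINT x:{1..}|lborel. of_real x powr (tail_sum d S 1 - of_nat d) / of_real (exp x - 1) * ?Fpsi x)
       = (LINT y|lborel. indicator {1..} y *\<^sub>R complex_of_real (h y))"
      unfolding set_lebesgue_integral_def
    proof (rule Bochner_Integration.integral_cong[OF refl])
      fix y :: real
      show "indicator {1..} y *\<^sub>R (of_real y powr (tail_sum d S 1 - of_nat d) / of_real (exp y - 1) * ?Fpsi y) = indicator {1..} y *\<^sub>R complex_of_real (h y)"
        using hcx[of y] by (cases "y \<ge> 1") (auto simp: indicator_def)
    qed
    also have "\<dots> = (LINT y|lborel. indicator {1<..} y *\<^sub>R complex_of_real (h y))"
    proof (rule integral_cong_AE)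
      have "AE y in lborel. y \<noteq> (1 :: real)" by (rule AE_lborel_singleton)
      then show "AE y in lborel. indicator {1..} y *\<^sub>R complex_of_real (h y) = indicator {1<..} y *\<^sub>R complex_of_real (h y)"
        by eventually_elim (auto simp: indicator_def)
    qed (use hm in measurable)
    finally show ?thesis .
  qed
  let ?c = "\<lambda>k p. bern_coeff d p * beta_prod p"
  \<comment> \<open>The worst case is \<open>k = 0\<close>, where the exponent
    \<open>tail_sum d r 1 - real d - 1\<close> must exceed -1.\<close>
  have tk: "?t - real d - 1 + real k > -1" for k using tail_big[of 1] d by auto
  have term2: "(LINT x:{0..1}|lborel. of_real x powr (tail_sum d S 1 - of_nat d + of_nat (n 1)) * ?Fphi x)
     = (LINT y|lborel. indicator {0<..1} y *\<^sub>R complex_of_real (h y)) - (\<Sum>k=0..n 1. \<Sum>p\<in>compositions d k. ?c k p * (1 / (tail_sum d S 1 - of_nat d + of_nat k)))"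
  proof -
    define w where "w k y = complex_of_real (indicator {0<..1} y * y powr (?t - real d - 1 + real k))" for k y
    have wi: "integrable lborel (w k)" for k unfolding w_def by (rule integrable_of_real, rule has_integral_powr_unit(1)[OF tk])
    have wI: "(LINT y|lborel. w k y) = 1 / (tail_sum d S 1 - of_nat d + of_nat k)" for k
      unfolding w_def integral_complex_of_real has_integral_powr_unit(2)[OF tk] tail_of_real by simp
    have "indicator {0..1} y *\<^sub>R (of_real y powr (tail_sum d S 1 - of_nat d + of_nat (n 1)) * ?Fphi y)
       = indicator {0<..1} y *\<^sub>R complex_of_real (h y) - (\<Sum>k=0..n 1. \<Sum>p\<in>compositions d k. ?c k p * w k y)" for y :: real
    proof (cases "0 < y \<and> y \<le> 1")
      case True
      then have y: "0 < y" "y \<le> 1" by auto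
      \<comment> \<open>Since \<open>1 / (exp y - 1)\<close> is \<open>bern_gen y / y\<close>, one
        power of \<open>y\<close> is moved out of the kernel; \<open>b\<close> is what remains and
        is common to all terms.\<close>
      define b where "b = complex_of_real (y powr (?t - real d - 1))"
      have e1: "complex_of_real y powr (tail_sum d S 1 - of_nat d) / of_real (exp y - 1) = b * of_real (bern_gen y)"
      proof -
        have "complex_of_real y powr (tail_sum d S 1 - of_nat d) = of_real (y powr (?t - real d))"
          unfolding tail_of_real using powr_of_real[of y "?t - real d"] y by simp
        moreover have "y powr (?t - real d) = y powr (?t - real d - 1) * y" using y by (simp add: powr_diff)
        ultimately show ?thesis using y by (simp add: b_def bern_gen_def)
      qed
      have e2: "complex_of_real y powr (tail_sum d S 1 - of_nat d + of_nat (n 1)) = b * of_real y ^ Suc (n 1)"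
      proof -
        have "complex_of_real y powr (tail_sum d S 1 - of_nat d + of_nat (n 1)) = of_real (y powr (?t - real d + real (n 1)))"
          unfolding tail_of_real using powr_of_real[of y "?t - real d + real (n 1)"] y by simp
        also have "?t - real d + real (n 1) = (?t - real d - 1) + real (Suc (n 1))" by simp
        finally show ?thesis using y unfolding powr_add powr_realpow[OF y(1)] b_def by simp
      qed
      have e3: "w k y = b * of_real y ^ k" for k
        using y unfolding w_def b_def by (simp add: powr_add powr_realpow)
      have "complex_of_real (h y) = b * ((\<Sum>k=0..n 1. \<Sum>p\<in>compositions d k. of_real y ^ k * ?c k p) + of_real y ^ Suc (n 1) * ?Fphi y)"
        unfolding hcx[OF y(1)] e1 mult.assoc key_identity[OF y] ..
      also have "\<dots> = (\<Sum>k=0..n 1. \<Sum>p\<in>compositions d k. ?c k p * w k y) + b * of_real y ^ Suc (n 1) * ?Fphi y"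
        unfolding e3 distrib_left sum_distrib_left by (simp only: mult_ac)
      finally show ?thesis unfolding e2 using y by simp
    next
      case False
      \<comment> \<open>The formula integrates over the closed interval; at 0 its integrand vanishes
        because \<open>0 powr w = 0\<close>.\<close>
      then have "indicator {0..1} y *\<^sub>R (of_real y powr (tail_sum d S 1 - of_nat d + of_nat (n 1)) * ?Fphi y) = 0"
        by (cases "y = 0") (auto simp: indicator_def)
      moreover have "w k y = 0" for k using False by (simp add: w_def indicator_def)
      moreover have "indicator {0<..1} y = (0 :: real)" using False by (simp add: indicator_def)
      ultimately show ?thesis by simp
    qed
    then have "(LINT x:{0..1}|lborel. of_real x powr (tail_sum d S 1 - of_nat d + of_nat (n 1)) * ?Fphi x)
       = (LINT y|lborel. indicator {0<..1} y *\<^sub>R complex_of_real (h y) - (\<Sum>k=0..n 1. \<Sum>p\<in>compositions d k. ?c k p * w k y))"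
      unfolding set_lebesgue_integral_def by simp
    also have "\<dots> = (LINT y|lborel. indicator {0<..1} y *\<^sub>R complex_of_real (h y)) - (LINT y|lborel. (\<Sum>k=0..n 1. \<Sum>p\<in>compositions d k. ?c k p * w k y))"
      by (intro Bochner_Integration.integral_diff hi1 Bochner_Integration.integrable_sum integrable_mult_right wi) simp
    also have "(LINT y|lborel. (\<Sum>k=0..n 1. \<Sum>p\<in>compositions d k. ?c k p * w k y)) = (\<Sum>k=0..n 1. \<Sum>p\<in>compositions d k. ?c k p * (1 / (tail_sum d S 1 - of_nat d + of_nat k)))"
      unfolding wI[symmetric] by (simp add: Bochner_Integration.integral_sum wi)
    finally show ?thesis .
  qed
  have "complex_of_real (?P * Z) = (LINT y|lborel. complex_of_real (h y))" unfolding integral_complex_of_real hI ..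
  also have "\<dots> = (LINT y|lborel. indicator {0<..1} y *\<^sub>R complex_of_real (h y) + indicator {1<..} y *\<^sub>R complex_of_real (h y))"
    by (rule Bochner_Integration.integral_cong) (auto simp: indicator_def h0)
  also have "\<dots> = (LINT y|lborel. indicator {0<..1} y *\<^sub>R complex_of_real (h y)) + (LINT y|lborel. indicator {1<..} y *\<^sub>R complex_of_real (h y))"
    by (intro Bochner_Integration.integral_add hi1) auto
  finally have tot: "complex_of_real (?P * Z) = \<dots>" .
  have G: "(\<Prod>j=1..d. Gamma (S j)) = complex_of_real ?P" unfolding s Gamma_complex_of_real of_real_prod ..
  have t1: "(\<Sum>k=0..n 1. \<Sum>p\<in>compositions d k. bern_coeff d p * (1 / (tail_sum d S 1 - of_nat d + of_nat k)) * (\<Prod>j=2..d. Beta (tail_sum d S j - of_nat d + of_nat j + of_nat (tail_sum d p j) - 1) (S (j - 1))))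
      = (\<Sum>k=0..n 1. \<Sum>p\<in>compositions d k. ?c k p * (1 / (tail_sum d S 1 - of_nat d + of_nat k)))"
    unfolding beta_prod_def by (simp only: mult_ac)
  have "ez_formula d n S = 1 / complex_of_real ?P * of_real (?P * Z)"
    unfolding ez_formula_def G t1 term2 term3 tot by (simp add: algebra_simps)
  also have "\<dots> = of_real Z"
    using P0 unfolding of_real_mult by (metis nonzero_mult_div_cancel_left less_irrefl mult_1 of_real_eq_0_iff times_divide_eq_left)
  finally show ?thesis unfolding Z(2) .
qed

end

section \<open>Holomorphy of the outer integrals\<close>

definition strip_domain :: "nat \<Rightarrow> (nat \<Rightarrow> nat) \<Rightarrow> (nat \<Rightarrow> 'v::finite) \<Rightarrow> (complex ^ 'v) set"
  where "strip_domain d n e = {z. coords e z \<in> ez_domain d n}"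

lemma continuous_on_holomorphic: "holomorphic_multi f UNIV \<Longrightarrow> continuous_on S f"
  by (rule continuous_on_subset[OF holomorphic_multi_continuous_on]) auto

lemma open_Re_greater:
  assumes "\<And>j. j \<in> B \<Longrightarrow> holomorphic_multi (w j) UNIV" "finite B"
  shows "open {z. \<forall>j\<in>B. Re (w j z) > m j}"
proof -
  have "{z. \<forall>j\<in>B. Re (w j z) > m j} = (\<Inter>j\<in>B. {z. m j < Re (w j z)})" by auto
  moreover have "open (\<Inter>j\<in>B. {z. m j < Re (w j z)})"
    using assms by (intro open_INT ballI open_Collect_less continuous_intros continuous_on_holomorphic) auto
  ultimately show ?thesis by simp
qed

lemma open_strip_domain: "open (strip_domain d n e)"
proof -
  have "strip_domain d n e = {z. \<forall>j\<in>{1..d}. Re (tail_sum d (coords e z) j) > real d - real j - real (n j)}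
      \<inter> {z. \<forall>j\<in>{2..d}. Re (coords e z (j - 1)) > - real (n j) - 1}"
    by (auto simp: strip_domain_def ez_domain_def)
  moreover have "open \<dots>"
    by (intro open_Int open_Re_greater holomorphic_multi_tail_sum holomorphic_multi_coords) auto
  ultimately show ?thesis by simp
qed

text \<open>For \<open>j \<ge> 2\<close> the two inequalities defining \<open>D\<close> say exactly
  this: after \<open>n j + 1\<close> integrations by parts the exponents for \<open>a j = 0\<close>
  and for \<open>a j = 1\<close> are integrable at 0.\<close>

lemma Re_u_strip:
  assumes "z \<in> strip_domain d n e" "j \<in> {2..d}"
  shows "Re (u_exp d (coords e z) a j + of_nat (n j) + 1) > -1"
proof -
  have 1: "Re (tail_sum d (coords e z) j) > real d - real j - real (n j)" "Re (coords e z (j - 1)) > - real (n j) - 1"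
    using assms by (auto simp: strip_domain_def ez_domain_def)
  show ?thesis
  proof (cases "a j = 0")
    case True then show ?thesis using 1(1) unfolding u_exp_def by simp
  next
    case False then show ?thesis using 1(2) unfolding u_exp_def by simp
  qed
qed

lemma box_weight_mono:
  assumes "\<And>j. j \<in> B \<Longrightarrow> m j \<le> Re (w j)"
  shows "norm (box_weight B w y) \<le> norm (box_weight B (\<lambda>j. of_real (m j)) y)"
  unfolding box_weight_def prod_norm[symmetric] norm_half_powr
proof (rule prod_mono)
  fix j assume j: "j \<in> B"
  have "y j powr Re (w j) \<le> y j powr m j" if "0 < y j" "y j \<le> 1/2"
    by (rule powr_mono') (use that assms[OF j] in auto)
  then show "0 \<le> (if 0 < y j \<and> y j \<le> 1/2 then y j powr Re (w j) else 0) \<and>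
    (if 0 < y j \<and> y j \<le> 1/2 then y j powr Re (w j) else 0) \<le> (if 0 < y j \<and> y j \<le> 1/2 then y j powr Re (complex_of_real (m j)) else 0)"
    by simp
qed

text \<open>One summand of the expansion, for fixed \<open>a\<close> and \<open>q\<close>; its inner
  integral is studied as a function of the complex point \<open>z\<close> and the outer
  variable.\<close>

locale inner_integral =
  fixes d :: nat and n :: "nat \<Rightarrow> nat" and e :: "nat \<Rightarrow> 'v::finite" and X :: "real set"
    and \<Phi> :: "complex ^ 'v \<Rightarrow> (nat \<Rightarrow> real) \<Rightarrow> complex" and a q :: "nat \<Rightarrow> nat"
  assumes X: "X \<in> sets borel" "X \<subseteq> {0..}" and tame: "tame_smooth d X \<Phi>"
begin

abbreviation "B \<equiv> top_indices d n q"
abbreviation "D \<equiv> strip_domain d n e"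

definition "w z j = u_exp d (coords e z) a j + of_nat (n j) + 1"
definition "g z x y = box_weight B (w z) y * mixed_deriv d q (\<Phi> z) (glue B y (eval_point x ({2..d} - B)))"
definition "FT z x = F_term d n (u_exp d (coords e z) a) (\<Phi> z) q x"

lemma B: "B \<subseteq> {2..d}" "finite B" by (auto simp: top_indices_def)

lemma FT_eq: "FT z x = (LINT y|Pi\<^sub>M B (\<lambda>_. lborel). g z x y)"
  unfolding FT_def F_term_def g_def w_def ..

lemma hol_w: "holomorphic_multi (\<lambda>z. w z j) UNIV"
  unfolding w_def by (intro holomorphic_multi_add holomorphic_multi_u_exp holomorphic_multi_const)

lemma tame_md: "tame d X (\<lambda>z. mixed_deriv d q (\<Phi> z))"
  by (intro tame_smooth_tame tame_smooth_mixed_deriv tame)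

lemma glue_half:
  assumes "x \<in> X" "\<forall>j\<in>B. 0 < y j \<and> y j \<le> 1/2"
  shows "glue B y (eval_point x ({2..d} - B)) \<in> half_box d X" "glue B y (eval_point x ({2..d} - B)) 1 = x"
proof -
  have "1 \<notin> B" using B by auto
  then show "glue B y (eval_point x ({2..d} - B)) 1 = x" by (simp add: glue_def eval_point_def)
  then show "glue B y (eval_point x ({2..d} - B)) \<in> half_box d X"
    unfolding half_box_def using assms by (auto simp: glue_def eval_point_def)
qed

lemma g_zero: "\<not> (\<forall>j\<in>B. 0 < y j \<and> y j \<le> 1/2) \<Longrightarrow> g z x y = 0"
  using box_weight_eq_0[of B _ y "w z"] B unfolding g_def by auto

lemma g_bound:
  assumes z: "z \<in> D"
  shows "\<exists>\<epsilon>>0. \<exists>C\<ge>0. \<exists>N m. (\<forall>j\<in>B. m j > -1) \<and> (\<forall>s\<in>ball z \<epsilon>. \<forall>x\<in>X. \<forall>y. norm (g s x y) \<le> C * (1 + x) ^ N * norm (box_weight B (\<lambda>j. of_real (m j)) y))"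
proof -
  obtain \<epsilon>1 C N where 1: "\<epsilon>1 > 0" "C \<ge> 0"
    "\<And>s x. s \<in> ball z \<epsilon>1 \<Longrightarrow> x \<in> half_box d X \<Longrightarrow> norm (mixed_deriv d q (\<Phi> s) x) \<le> C * (1 + x 1) ^ N"
    using tame_md unfolding tame_def by meson
  \<comment> \<open>The midpoint between -1 and the real part of the exponent. On (0, 1/2] powers
    decrease in the exponent, so the power \<open>m j\<close> dominates for all nearby points and is
    still integrable.\<close>
  define m where "m j = (Re (w z j) - 1) / 2" for j
  have wz: "Re (w z j) > -1" if "j \<in> B" for j
    unfolding w_def by (rule Re_u_strip[OF z]) (use that B in auto)
  have "open {s. \<forall>j\<in>B. Re (w s j) > m j}" by (intro open_Re_greater hol_w B)
  moreover have "z \<in> {s. \<forall>j\<in>B. Re (w s j) > m j}" using wz by (fastforce simp: m_def)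
  ultimately obtain \<epsilon>2 where 2: "\<epsilon>2 > 0" "ball z \<epsilon>2 \<subseteq> {s. \<forall>j\<in>B. Re (w s j) > m j}" by (meson openE)
  have "norm (g s x y) \<le> C * (1 + x) ^ N * norm (box_weight B (\<lambda>j. of_real (m j)) y)"
    if s: "s \<in> ball z (min \<epsilon>1 \<epsilon>2)" and x: "x \<in> X" for s x y
  proof (cases "\<forall>j\<in>B. 0 < y j \<and> y j \<le> 1/2")
    case True
    have "norm (mixed_deriv d q (\<Phi> s) (glue B y (eval_point x ({2..d} - B)))) \<le> C * (1 + x) ^ N"
      using 1(3)[of s, OF _ glue_half(1)[OF x True]] s unfolding glue_half(2)[OF x True] by auto
    moreover have "norm (box_weight B (w s) y) \<le> norm (box_weight B (\<lambda>j. of_real (m j)) y)"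
      by (rule box_weight_mono) (use 2(2) s in \<open>fastforce intro: less_imp_le\<close>)
    ultimately have "norm (g s x y) \<le> norm (box_weight B (\<lambda>j. of_real (m j)) y) * (C * (1 + x) ^ N)"
      unfolding g_def norm_mult by (intro mult_mono) auto
    then show ?thesis by (simp only: mult.commute)
  next
    case False
    have "x \<ge> 0" using x X by auto
    then show ?thesis unfolding g_zero[OF False] using 1(2) by simp
  qed
  moreover have "\<forall>j\<in>B. m j > -1" using wz by (fastforce simp: m_def)
  ultimately show ?thesis using 1 2 by (intro exI[of _ "min \<epsilon>1 \<epsilon>2"] exI[of _ C] exI[of _ N] exI[of _ m] conjI) (auto simp del: mem_ball)
qed

lemma g_measurable:
  assumes "x \<in> X"
  shows "g z x \<in> borel_measurable (Pi\<^sub>M B (\<lambda>_. lborel))"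
  unfolding g_def[abs_def]
proof (rule box_weight_glue_measurable[OF X(1) _ B(2)])
  show "continuous_on (open_box d X) (mixed_deriv d q (\<Phi> z))" using tame_md unfolding tame_def by blast
  show "glue B y (eval_point x ({2..d} - B)) \<in> open_box d X" if "\<forall>j\<in>B. 0 < y j \<and> y j \<le> 1/2" for y
    using glue_half(1)[OF assms that] half_box_subset by blast
qed auto

lemma FT_holomorphic:
  assumes x: "x \<in> X"
  shows "holomorphic_multi (\<lambda>z. FT z x) D"
  unfolding FT_eq
proof (rule holomorphic_multi_integral[OF open_strip_domain])
  fix y assume "y \<in> space (Pi\<^sub>M B (\<lambda>_. lborel :: real measure))"
  show "holomorphic_multi (\<lambda>z. g z x y) D"
  proof (cases "\<forall>j\<in>B. 0 < y j \<and> y j \<le> 1/2")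
    case True
    have "glue B y (eval_point x ({2..d} - B)) \<in> open_box d X" using glue_half(1)[OF x True] half_box_subset by blast
    then have 1: "holomorphic_multi (\<lambda>z. mixed_deriv d q (\<Phi> z) (glue B y (eval_point x ({2..d} - B)))) UNIV"
      using tame_md unfolding tame_def by blast
    have 2: "holomorphic_multi (\<lambda>z. half_powr (w z j) (y j)) UNIV" if "j \<in> B" for j
    proof -
      have "holomorphic_multi (\<lambda>z. exp (w z j * of_real (ln (y j)))) UNIV"
        by (rule holomorphic_multi_compose[where f = exp and T = UNIV])
           (auto intro!: holomorphic_multi_mult hol_w holomorphic_multi_const holomorphic_intros)
      then show ?thesis using True that by (simp add: half_powr_def)
    qed
    have "holomorphic_multi (\<lambda>z. g z x y) UNIV"
      unfolding g_def box_weight_def by (intro holomorphic_multi_mult holomorphic_multi_prod 1 2)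
    then show ?thesis by (rule holomorphic_multi_subset) simp
  next
    case False
    show ?thesis unfolding g_zero[OF False] by (rule holomorphic_multi_const)
  qed
next
  show "g z x \<in> borel_measurable (Pi\<^sub>M B (\<lambda>_. lborel))" for z by (rule g_measurable[OF x])
next
  fix z assume "z \<in> D"
  from g_bound[OF this] obtain \<epsilon> C N m where 1: "\<epsilon> > 0" "\<forall>j\<in>B. m j > -1"
    "\<forall>s\<in>ball z \<epsilon>. \<forall>x\<in>X. \<forall>y. norm (g s x y) \<le> C * (1 + x) ^ N * norm (box_weight B (\<lambda>j. of_real (m j)) y)"
    by blast
  have "integrable (Pi\<^sub>M B (\<lambda>_. lborel)) (\<lambda>y. C * (1 + x) ^ N * norm (box_weight B (\<lambda>j. of_real (m j)) y))"
    by (intro integrable_mult_right integrable_norm_box_weight B(2)) (use 1(2) in auto)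
  then show "\<exists>r>0. \<exists>Bd. integrable (Pi\<^sub>M B (\<lambda>_. lborel)) Bd \<and> (\<forall>s\<in>ball z r \<inter> D. \<forall>y\<in>space (Pi\<^sub>M B (\<lambda>_. lborel)). norm (g s x y) \<le> Bd y)"
    using 1(1,3) x by (intro exI[of _ \<epsilon>] conjI exI[of _ "\<lambda>y. C * (1 + x) ^ N * norm (box_weight B (\<lambda>j. of_real (m j)) y)"]) blast+
qed

lemma FT_bound:
  assumes z: "z \<in> D"
  shows "\<exists>\<epsilon>>0. \<exists>C\<ge>0. \<exists>N. \<forall>s\<in>ball z \<epsilon>. \<forall>x\<in>X. norm (FT s x) \<le> C * (1 + x) ^ N"
proof -
  from g_bound[OF z] obtain \<epsilon> C N m where 1: "\<epsilon> > 0" "C \<ge> 0" "\<forall>j\<in>B. m j > -1"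
    "\<forall>s\<in>ball z \<epsilon>. \<forall>x\<in>X. \<forall>y. norm (g s x y) \<le> C * (1 + x) ^ N * norm (box_weight B (\<lambda>j. of_real (m j)) y)"
    by blast
  let ?I = "LINT y|Pi\<^sub>M B (\<lambda>_. lborel). norm (box_weight B (\<lambda>j. of_real (m j)) y)"
  have wi: "integrable (Pi\<^sub>M B (\<lambda>_. lborel)) (\<lambda>y. norm (box_weight B (\<lambda>j. of_real (m j)) y))"
    by (intro integrable_norm_box_weight B(2)) (use 1(3) in auto)
  have "norm (FT s x) \<le> (C * ?I) * (1 + x) ^ N" if s: "s \<in> ball z \<epsilon>" and x: "x \<in> X" for s x
  proof -
    have b: "norm (g s x y) \<le> C * (1 + x) ^ N * norm (box_weight B (\<lambda>j. of_real (m j)) y)" for y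
      using 1(4) s x by blast
    have gi: "integrable (Pi\<^sub>M B (\<lambda>_. lborel)) (g s x)"
      by (rule Bochner_Integration.integrable_bound[OF integrable_mult_right[OF wi, of "C * (1 + x) ^ N"] g_measurable[OF x]])
         (use b in \<open>auto intro!: AE_I2 order.trans[OF b]\<close>)
    have "norm (FT s x) \<le> (LINT y|Pi\<^sub>M B (\<lambda>_. lborel). norm (g s x y))" unfolding FT_eq by (rule integral_norm_bound)
    also have "\<dots> \<le> (LINT y|Pi\<^sub>M B (\<lambda>_. lborel). C * (1 + x) ^ N * norm (box_weight B (\<lambda>j. of_real (m j)) y))"
      by (intro integral_mono integrable_norm gi integrable_mult_right wi b)
    also have "\<dots> = (C * ?I) * (1 + x) ^ N" by simp
    finally show ?thesis .
  qed
  moreover have "C * ?I \<ge> 0" using 1(2) by simp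
  ultimately show ?thesis using 1(1) by blast
qed

text \<open>The glued point lies in the box only for \<open>x\<close> in \<open>X\<close>, so joint
  measurability is proved on the restricted space and carried over to the line by extension with
  0.\<close>

lemma FT_measurable: "(\<lambda>x. indicator X x *\<^sub>R FT z x) \<in> borel_measurable borel"
proof -
  let ?N = "borel \<Otimes>\<^sub>M Pi\<^sub>M B (\<lambda>_. lborel :: real measure)"
  let ?R = "restrict_space borel X \<Otimes>\<^sub>M Pi\<^sub>M B (\<lambda>_. lborel :: real measure)"
  have sp: "space (restrict_space borel X) = X" by (simp add: space_restrict_space)
  interpret sigma_finite_measure "Pi\<^sub>M B (\<lambda>_. lborel :: real measure)"
    by (rule lborel_product.sigma_finite) (rule B(2))
  have "(\<lambda>p. box_weight B (w z) (snd p) * mixed_deriv d q (\<Phi> z) (glue B (snd p) (eval_point (fst p) ({2..d} - B)))) \<in> borel_measurable ?R"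
  proof (rule box_weight_glue_measurable[OF X(1) _ B(2)])
    show "continuous_on (open_box d X) (mixed_deriv d q (\<Phi> z))" using tame_md unfolding tame_def by blast
    have "fst \<in> measurable ?R borel"
      by (rule measurable_compose[OF measurable_fst]) (simp add: measurable_restrict_space1)
    then show "(\<lambda>p. eval_point (fst p) ({2..d} - B) i) \<in> borel_measurable ?R" for i
      unfolding eval_point_def by (cases "i = 1") auto
    fix p assume p: "p \<in> space ?R" and y: "\<forall>j\<in>B. 0 < snd p j \<and> snd p j \<le> 1/2"
    then have "fst p \<in> X" by (auto simp: space_pair_measure sp)
    from glue_half(1)[OF this y] show "glue B (snd p) (eval_point (fst p) ({2..d} - B)) \<in> open_box d X"
      using half_box_subset by blast
  qed simp
  then have "(\<lambda>(x, y). g z x y) \<in> borel_measurable ?R" by (simp add: g_def case_prod_unfold)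
  from borel_measurable_lebesgue_integral[OF this]
  have "FT z \<in> borel_measurable (restrict_space borel X)" unfolding FT_eq[abs_def] by simp
  then show ?thesis
    using borel_measurable_restrict_space_iff[of X borel "FT z"] X(1) by simp
qed

text \<open>Near any point of \<open>D\<close> the inner integral grows at most polynomially in the
  outer variable, uniformly in \<open>s\<close>. A kernel is therefore admissible if its product
  with every power of \<open>1 + x\<close> has a locally uniform integrable bound.\<close>

theorem outer_integral:
  fixes kern :: "complex ^ 'v \<Rightarrow> real \<Rightarrow> complex"
  assumes kh: "\<And>x. x \<in> X \<Longrightarrow> holomorphic_multi (\<lambda>z. kern z x) UNIV"
    and km: "\<And>z. kern z \<in> borel_measurable borel"
    and kd: "\<And>z N. z \<in> D \<Longrightarrow> \<exists>\<epsilon>>0. \<exists>Bd. integrable lborel Bd \<and> (\<forall>s\<in>ball z \<epsilon>. \<forall>x\<in>X. norm (kern s x) * (1 + x) ^ N \<le> Bd x)"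
  shows "holomorphic_multi (\<lambda>z. LINT x|lborel. indicator X x *\<^sub>R (kern z x * FT z x)) D"
    and "\<And>z. z \<in> D \<Longrightarrow> integrable lborel (\<lambda>x. indicator X x *\<^sub>R (kern z x * FT z x))"
proof -
  have meas: "(\<lambda>x. indicator X x *\<^sub>R (kern z x * FT z x)) \<in> borel_measurable lborel" for z
  proof -
    have "(\<lambda>x. kern z x * (indicator X x *\<^sub>R FT z x)) \<in> borel_measurable borel"
      by (intro borel_measurable_times km FT_measurable)
    moreover have "(\<lambda>x. kern z x * (indicator X x *\<^sub>R FT z x)) = (\<lambda>x. indicator X x *\<^sub>R (kern z x * FT z x))" by auto
    ultimately show ?thesis by simp
  qed
  have dom: "\<exists>r>0. \<exists>Bd. integrable lborel Bd \<and> (\<forall>s\<in>ball z r \<inter> D. \<forall>x\<in>space lborel. norm (indicator X x *\<^sub>R (kern s x * FT s x)) \<le> Bd x)"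
    if z: "z \<in> D" for z
  proof -
    obtain \<epsilon>1 C N where 1: "\<epsilon>1 > 0" "C \<ge> 0" "\<And>s x. s \<in> ball z \<epsilon>1 \<Longrightarrow> x \<in> X \<Longrightarrow> norm (FT s x) \<le> C * (1 + x) ^ N"
      using FT_bound[OF z] by blast
    obtain \<epsilon>2 Bd where 2: "\<epsilon>2 > 0" "integrable lborel Bd" "\<And>s x. s \<in> ball z \<epsilon>2 \<Longrightarrow> x \<in> X \<Longrightarrow> norm (kern s x) * (1 + x) ^ N \<le> Bd x"
      using kd[OF z] by blast
    have "norm (indicator X x *\<^sub>R (kern s x * FT s x)) \<le> C * \<bar>Bd x\<bar>" if s: "s \<in> ball z (min \<epsilon>1 \<epsilon>2)" for s x
    proof (cases "x \<in> X")
      case True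
      have sb: "s \<in> ball z \<epsilon>1" "s \<in> ball z \<epsilon>2" using s by auto
      have "norm (kern s x * FT s x) \<le> norm (kern s x) * (C * (1 + x) ^ N)"
        unfolding norm_mult by (intro mult_left_mono 1(3)[OF sb(1) True]) simp
      also have "\<dots> = C * (norm (kern s x) * (1 + x) ^ N)" by (simp only: mult_ac)
      also have "\<dots> \<le> C * \<bar>Bd x\<bar>" using 2(3)[OF sb(2) True] 1(2) by (intro mult_left_mono) linarith+
      finally show ?thesis using True by simp
    qed (use 1(2) in simp)
    then show ?thesis using 1(1) 2(1,2)
      by (intro exI[of _ "min \<epsilon>1 \<epsilon>2"] conjI exI[of _ "\<lambda>x. C * \<bar>Bd x\<bar>"] integrable_mult_right integrable_abs) auto
  qed
  show "holomorphic_multi (\<lambda>z. LINT x|lborel. indicator X x *\<^sub>R (kern z x * FT z x)) D"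
  proof (rule holomorphic_multi_integral[OF open_strip_domain _ meas dom])
    fix x :: real
    show "holomorphic_multi (\<lambda>z. indicator X x *\<^sub>R (kern z x * FT z x)) D"
    proof (cases "x \<in> X")
      case True
      then show ?thesis using holomorphic_multi_mult[OF holomorphic_multi_subset[OF kh[OF True]] FT_holomorphic[OF True]] by simp
    next
      case False
      then show ?thesis using holomorphic_multi_const[of 0] by simp
    qed
  qed
  fix z assume z: "z \<in> D"
  obtain r Bd where 3: "r > 0" "integrable lborel Bd" "\<forall>s\<in>ball z r \<inter> D. \<forall>x\<in>space lborel. norm (indicator X x *\<^sub>R (kern s x * FT s x)) \<le> Bd x"
    using dom[OF z] by blast
  have b: "norm (indicator X x *\<^sub>R (kern z x * FT z x)) \<le> Bd x" for x using 3(1,3) z by simp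
  show "integrable lborel (\<lambda>x. indicator X x *\<^sub>R (kern z x * FT z x))"
    by (rule Bochner_Integration.integrable_bound[OF 3(2) meas]) (rule AE_I2, rule order.trans[OF b], simp)
qed

end

section \<open>Clearing the poles\<close>

lemma holomorphic_multi_rGamma:
  assumes "holomorphic_multi f S"
  shows "holomorphic_multi (\<lambda>z. rGamma (f z)) S"
  by (rule holomorphic_multi_compose[OF assms, where T = UNIV]) (auto intro!: holomorphic_rGamma)

lemma holomorphic_multi_pochhammer:
  assumes "holomorphic_multi f S"
  shows "holomorphic_multi (\<lambda>z. pochhammer (f z) m) S"
  unfolding pochhammer_prod
  by (intro holomorphic_multi_prod holomorphic_multi_add assms holomorphic_multi_const)

text \<open>
  Each \<open>u\<^sub>j + 1\<close> and \<open>v\<^sub>j + 1\<close> is either \<open>pole_arg d s j\<close> or \<open>s (j - 1)\<close>, so the reciprocal gamma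
  factors at these two values cancel every pole for all \<open>a\<close> at once.
\<close>
definition pole_arg :: "nat \<Rightarrow> (nat \<Rightarrow> complex) \<Rightarrow> nat \<Rightarrow> complex"
  where "pole_arg d s j = tail_sum d s j - of_nat d + of_nat j - 1"

text \<open>The pairs for \<open>j \<ge> 2\<close> clear the Pochhammer and beta factors, and
  \<open>pole_arg d s 1\<close> clears the fractions
  \<open>1 / (tail_sum d s 1 - of_nat d + of_nat k)\<close>. With \<open>rGamma (s d)\<close> the
  zero set becomes exactly \<open>ez_singular d\<close>.\<close>

definition sing_factor :: "nat \<Rightarrow> (nat \<Rightarrow> complex) \<Rightarrow> complex"
  where "sing_factor d s = rGamma (pole_arg d s 1) * rGamma (s d) * (\<Prod>j\<in>{2..d}. rGamma (pole_arg d s j) * rGamma (s (j - 1)))"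

lemma holomorphic_multi_pole_arg: "holomorphic_multi (\<lambda>z. pole_arg d (coords e z) j) S"
  unfolding pole_arg_def
  by (intro holomorphic_multi_add holomorphic_multi_diff holomorphic_multi_tail_sum holomorphic_multi_const)

lemma holomorphic_multi_sing_factor: "holomorphic_multi (\<lambda>z. sing_factor d (coords e z)) S"
  unfolding sing_factor_def
  by (intro holomorphic_multi_mult holomorphic_multi_prod holomorphic_multi_rGamma holomorphic_multi_pole_arg holomorphic_multi_coords)

lemma rGamma_eq_0_iff_int: "rGamma w = 0 \<longleftrightarrow> (\<exists>z::int. z \<le> 0 \<and> w = of_int z)" for w :: complex
  unfolding rGamma_eq_zero_iff nonpos_Ints_def by auto

lemma rGamma_pole_arg_eq_0_iff:
  "rGamma (pole_arg d s j) = 0 \<longleftrightarrow> (\<exists>z::int. z \<le> int d - int j + 1 \<and> tail_sum d s j = of_int z)"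
proof -
  have "pole_arg d s j = of_int z \<longleftrightarrow> tail_sum d s j = of_int (z + int d - int j + 1)" for z :: int
    unfolding pole_arg_def by (auto simp: algebra_simps)
  then have "rGamma (pole_arg d s j) = 0 \<longleftrightarrow> (\<exists>z::int. z \<le> 0 \<and> tail_sum d s j = of_int (z + int d - int j + 1))"
    unfolding rGamma_eq_0_iff_int by simp
  also have "\<dots> \<longleftrightarrow> (\<exists>z::int. z \<le> int d - int j + 1 \<and> tail_sum d s j = of_int z)"
  proof
    assume "\<exists>z::int. z \<le> 0 \<and> tail_sum d s j = of_int (z + int d - int j + 1)"
    then obtain z :: int where "z \<le> 0" "tail_sum d s j = of_int (z + int d - int j + 1)" by blast
    then show "\<exists>z::int. z \<le> int d - int j + 1 \<and> tail_sum d s j = of_int z"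
      by (intro exI[of _ "z + int d - int j + 1"]) simp
  next
    assume "\<exists>z::int. z \<le> int d - int j + 1 \<and> tail_sum d s j = of_int z"
    then obtain z :: int where "z \<le> int d - int j + 1" "tail_sum d s j = of_int z" by blast
    then show "\<exists>z::int. z \<le> 0 \<and> tail_sum d s j = of_int (z + int d - int j + 1)"
      by (intro exI[of _ "z - int d + int j - 1"]) simp
  qed
  finally show ?thesis .
qed

lemma sing_factor_eq_0_iff:
  assumes d: "d \<ge> 1"
  shows "sing_factor d s = 0 \<longleftrightarrow> s \<in> ez_singular d"
proof -
  have "s \<in> ez_singular d \<longleftrightarrow> (\<exists>j\<in>{1..d}. rGamma (pole_arg d s j) = 0 \<or> rGamma (s j) = 0)"
    unfolding ez_singular_def rGamma_pole_arg_eq_0_iff unfolding rGamma_eq_0_iff_int by auto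
  also have "\<dots> \<longleftrightarrow> (\<exists>j\<in>{1..d}. rGamma (pole_arg d s j) = 0) \<or> (\<exists>j\<in>{1..d}. rGamma (s j) = 0)" by blast
  also have "{1..d} = insert 1 {2..d}" using d by auto
  also have "(\<exists>j\<in>insert 1 {2..d}. rGamma (s j) = 0) \<longleftrightarrow> rGamma (s d) = 0 \<or> (\<exists>j\<in>{2..d}. rGamma (s (j - 1)) = 0)"
  proof -
    \<comment> \<open>The values \<open>s (j - 1)\<close> for \<open>j\<close> in
      \<open>{2..d}\<close> cover the indices below \<open>d\<close>; the index \<open>d\<close> is
      covered by the separate factor.\<close>
    have "insert 1 {2..d} = insert d ((\<lambda>j. j - 1) ` {2..d})"
    proof -
      have "x \<in> (\<lambda>j. j - 1) ` {2..d}" if "1 \<le> x" "x < d" for x using that by (intro image_eqI[of _ _ "x + 1"]) auto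
      moreover have "insert 1 {2..d} = {x. 1 \<le> x \<and> x < d} \<union> {d}" using d by auto
      ultimately show ?thesis using d by auto
    qed
    then show ?thesis by auto
  qed
  finally show ?thesis unfolding sing_factor_def by auto
qed

text \<open>The entire extension of \<open>bdry_coeff u n q * rGamma (u + 1)\<close>: dividing
  \<open>rGamma (u + 1)\<close> by \<open>pochhammer (u + 1) m\<close> gives
  \<open>rGamma (u + 1 + of_nat m)\<close>.\<close>

definition bdry_entire :: "complex \<Rightarrow> nat \<Rightarrow> nat \<Rightarrow> complex"
  where "bdry_entire u n q =
    (if q \<le> n then (-1) ^ q * (1/2) powr (u + of_nat q + 1) * rGamma (u + 1 + of_nat (q + 1))
     else (-1) ^ (n + 1) * rGamma (u + 1 + of_nat (n + 1)))"

lemma bdry_coeff_rGamma: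
  assumes "rGamma (u + 1) \<noteq> 0"
  shows "bdry_coeff u n q * rGamma (u + 1) = bdry_entire u n q"
proof -
  have "inverse (pochhammer (u + 1) m) * rGamma (u + 1) = rGamma (u + 1 + of_nat m)" for m
    using pochhammer_rGamma[of "u + 1" m] assms by (auto simp: field_simps)
  note * = this[of "q + 1"] this[of "n + 1"]
  show ?thesis
  proof (cases "q \<le> n")
    case True
    then show ?thesis unfolding bdry_coeff_def bdry_entire_def *[symmetric] by (simp only: if_True mult_ac)
  next
    case False
    then show ?thesis unfolding bdry_coeff_def bdry_entire_def *[symmetric] by (simp only: if_False mult_ac)
  qed
qed

lemma holomorphic_multi_bdry_entire:
  assumes "holomorphic_multi f S"
  shows "holomorphic_multi (\<lambda>z. bdry_entire (f z) n q) S"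
proof -
  have 1: "holomorphic_multi (\<lambda>z. (1/2 :: complex) powr (f z + of_nat q + 1)) S"
    by (rule holomorphic_multi_compose[where f = "\<lambda>w. (1/2) powr w" and T = UNIV])
       (auto intro!: holomorphic_multi_add holomorphic_multi_const assms holomorphic_intros)
  show ?thesis unfolding bdry_entire_def
    by (cases "q \<le> n")
       (simp_all only: if_True if_False, (intro holomorphic_multi_mult holomorphic_multi_const holomorphic_multi_rGamma holomorphic_multi_add assms 1)+)
qed

lemma u_v_pole_arg:
  "rGamma (u_exp d s a j + 1) * rGamma (v_exp d s a j + 1) = rGamma (pole_arg d s j) * rGamma (s (j - 1))"
proof -
  have "tail_sum d s j - of_nat d + of_nat j - 2 + 1 = pole_arg d s j" unfolding pole_arg_def by simp
  then show ?thesis unfolding u_exp_def v_exp_def by (cases "a j = 0") simp_all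
qed

text \<open>For each \<open>a\<close> and \<open>q\<close> one of the two reciprocal gamma factors
  at \<open>j\<close> absorbs the Pochhammer denominator, and the other stays as the entire factor
  \<open>rGamma (v + 1)\<close>. Agreement is claimed only off the zeros of
  \<open>sing_factor\<close>: where a denominator vanishes, \<open>bdry_coeff\<close> contains the
  default value of \<open>inverse 0\<close>.\<close>

lemma cleared_integral:
  fixes kern :: "complex ^ 'v::finite \<Rightarrow> real \<Rightarrow> complex" and e :: "nat \<Rightarrow> 'v"
    and \<Phi> :: "(nat \<Rightarrow> nat) \<Rightarrow> complex ^ 'v \<Rightarrow> (nat \<Rightarrow> real) \<Rightarrow> complex"
  assumes d: "d \<ge> 1" and X: "X \<in> sets borel" "X \<subseteq> {0..}" and tame: "\<And>a. tame_smooth d X (\<Phi> a)"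
    and kh: "\<And>x. x \<in> X \<Longrightarrow> holomorphic_multi (\<lambda>z. kern z x) UNIV"
    and km: "\<And>z. kern z \<in> borel_measurable borel"
    and kd: "\<And>z N. z \<in> strip_domain d n e \<Longrightarrow> \<exists>\<epsilon>>0. \<exists>Bd. integrable lborel Bd \<and> (\<forall>s\<in>ball z \<epsilon>. \<forall>x\<in>X. norm (kern s x) * (1 + x) ^ N \<le> Bd x)"
  shows "\<exists>H. holomorphic_multi H (strip_domain d n e) \<and>
    (\<forall>z\<in>strip_domain d n e. sing_factor d (coords e z) \<noteq> 0 \<longrightarrow>
      H z = sing_factor d (coords e z) * (LINT x|lborel. indicator X x *\<^sub>R (kern z x * ez_F d n (coords e z) (\<lambda>a. \<Phi> a z) x)))"
proof -
  let ?D = "strip_domain d n e" and ?A = "{2..d} \<rightarrow>\<^sub>E {0::nat, 1}" and ?Q = "Pi\<^sub>E {2..d} (\<lambda>j. {0..n j + 1})"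
  let ?G = "\<lambda>z. rGamma (pole_arg d (coords e z) 1) * rGamma (coords e z d)"
  define jj where "jj a q z x = indicator X x *\<^sub>R (kern z x * F_term d n (u_exp d (coords e z) a) (\<Phi> a z) q x)" for a q z x
  have J: "holomorphic_multi (\<lambda>z. LINT x|lborel. jj a q z x) ?D" "z \<in> ?D \<Longrightarrow> integrable lborel (jj a q z)" for a q z
  proof -
    interpret inner_integral d n e X "\<Phi> a" a q by unfold_locales (use X tame in auto)
    note oi = outer_integral[where kern = kern, OF kh km kd, unfolded FT_def]
    show "holomorphic_multi (\<lambda>z. LINT x|lborel. jj a q z x) ?D" unfolding jj_def by (rule oi(1))
    show "z \<in> ?D \<Longrightarrow> integrable lborel (jj a q z)" unfolding jj_def[abs_def] by (rule oi(2))
  qed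
  define c where "c a q z = (\<Prod>j\<in>{2..d}. bdry_coeff (u_exp d (coords e z) a j) (n j) (q j))" for a q z
  define b where "b a q z = (\<Prod>j\<in>{2..d}. bdry_entire (u_exp d (coords e z) a j) (n j) (q j) * rGamma (v_exp d (coords e z) a j + 1))" for a q z
  have lin: "(LINT x|lborel. indicator X x *\<^sub>R (kern z x * ez_F d n (coords e z) (\<lambda>a. \<Phi> a z) x))
      = (\<Sum>a\<in>?A. \<Sum>q\<in>?Q. c a q z * (LINT x|lborel. jj a q z x))" if z: "z \<in> ?D" for z
  proof -
    have "(LINT x|lborel. indicator X x *\<^sub>R (kern z x * ez_F d n (coords e z) (\<lambda>a. \<Phi> a z) x))
        = (LINT x|lborel. (\<Sum>a\<in>?A. \<Sum>q\<in>?Q. c a q z * jj a q z x))"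
    proof (rule Bochner_Integration.integral_cong[OF refl])
      fix x :: real
      show "indicator X x *\<^sub>R (kern z x * ez_F d n (coords e z) (\<lambda>a. \<Phi> a z) x) = (\<Sum>a\<in>?A. \<Sum>q\<in>?Q. c a q z * jj a q z x)"
      proof (cases "x \<in> X")
        case True
        note eq = ez_F_eq_sum[where \<Phi> = \<Phi> and z = z and f = "\<lambda>a. \<Phi> a z" and s = "coords e z" and n = n, OF d tame refl True]
        show ?thesis unfolding eq jj_def c_def sum_distrib_left scaleR_right.sum
          by (simp add: True) (simp only: mult_ac)
      qed (simp add: jj_def)
    qed
    also have "\<dots> = (\<Sum>a\<in>?A. \<Sum>q\<in>?Q. c a q z * (LINT x|lborel. jj a q z x))"
      by (simp add: Bochner_Integration.integral_sum J(2)[OF z])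
    finally show ?thesis .
  qed
  have cb: "sing_factor d (coords e z) * c a q z = ?G z * b a q z" if nz: "sing_factor d (coords e z) \<noteq> 0" for a q z
  proof -
    have "(\<Prod>j\<in>{2..d}. rGamma (pole_arg d (coords e z) j) * rGamma (coords e z (j - 1))) * c a q z = b a q z"
      unfolding c_def b_def prod.distrib[symmetric]
    proof (rule prod.cong[OF refl])
      fix j assume j: "j \<in> {2..d}"
      let ?u = "u_exp d (coords e z) a j" and ?v = "v_exp d (coords e z) a j"
      have "rGamma (pole_arg d (coords e z) j) * rGamma (coords e z (j - 1)) \<noteq> 0"
        using nz j unfolding sing_factor_def by auto
      then have u0: "rGamma (?u + 1) \<noteq> 0" unfolding u_v_pole_arg[symmetric, of d _ j a] by auto
      show "rGamma (pole_arg d (coords e z) j) * rGamma (coords e z (j - 1)) * bdry_coeff ?u (n j) (q j)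
          = bdry_entire ?u (n j) (q j) * rGamma (?v + 1)"
        unfolding u_v_pole_arg[symmetric, of d _ j a] bdry_coeff_rGamma[OF u0, symmetric] by (simp only: mult_ac)
    qed
    then show ?thesis unfolding sing_factor_def mult.assoc by simp
  qed
  show ?thesis
  proof (intro exI[of _ "\<lambda>z. ?G z * (\<Sum>a\<in>?A. \<Sum>q\<in>?Q. b a q z * (LINT x|lborel. jj a q z x))"] conjI ballI impI)
    show "holomorphic_multi (\<lambda>z. ?G z * (\<Sum>a\<in>?A. \<Sum>q\<in>?Q. b a q z * (LINT x|lborel. jj a q z x))) ?D"
      unfolding b_def
      by (intro holomorphic_multi_mult holomorphic_multi_sum holomorphic_multi_prod J(1) holomorphic_multi_rGamma holomorphic_multi_bdry_entire
          holomorphic_multi_add holomorphic_multi_const holomorphic_multi_pole_arg holomorphic_multi_coords holomorphic_multi_u_exp holomorphic_multi_v_exp)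
    fix z assume z: "z \<in> ?D" "sing_factor d (coords e z) \<noteq> 0"
    show "?G z * (\<Sum>a\<in>?A. \<Sum>q\<in>?Q. b a q z * (LINT x|lborel. jj a q z x)) = sing_factor d (coords e z) * (LINT x|lborel. indicator X x *\<^sub>R (kern z x * ez_F d n (coords e z) (\<lambda>a. \<Phi> a z) x))"
      unfolding lin[OF z(1)] sum_distrib_left mult.assoc[symmetric] cb[OF z(2)] ..
  qed
qed

section \<open>The cleared terms of the formula\<close>

definition exp_kernel :: "complex \<Rightarrow> real \<Rightarrow> complex"
  where "exp_kernel c x = (if 0 < x then exp (c * of_real (ln x)) else 0)"

lemma exp_kernel_eq: "0 < x \<Longrightarrow> exp_kernel c x = of_real x powr c"
  by (simp add: exp_kernel_def of_real_powr_eq_exp)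

lemma norm_exp_kernel: "0 < x \<Longrightarrow> norm (exp_kernel c x) = x powr Re c"
  by (simp add: exp_kernel_eq norm_of_real_powr)

lemma exp_kernel_measurable [measurable]: "exp_kernel c \<in> borel_measurable borel"
  unfolding exp_kernel_def[abs_def] by measurable

lemma holomorphic_multi_exp_kernel:
  assumes "holomorphic_multi c S"
  shows "holomorphic_multi (\<lambda>z. exp_kernel (c z) x) S"
proof (cases "0 < x")
  case True
  have "holomorphic_multi (\<lambda>z. exp (c z * of_real (ln x))) S"
    by (rule holomorphic_multi_compose[where f = exp and T = UNIV])
       (auto intro!: holomorphic_multi_mult assms holomorphic_multi_const holomorphic_intros)
  then show ?thesis using True by (simp add: exp_kernel_def)
qed (simp add: exp_kernel_def holomorphic_multi_const)

lemma ball_Re_greater: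
  assumes "holomorphic_multi c UNIV" "Re (c z) > m"
  obtains \<epsilon> where "\<epsilon> > 0" "\<And>s. s \<in> ball z \<epsilon> \<Longrightarrow> Re (c s) > m"
proof -
  have "open {s. \<forall>j\<in>{()}. Re (c s) > m}"
    by (rule open_Re_greater) (use assms(1) in auto)
  then have "open {s. Re (c s) > m}" by simp
  then show ?thesis using that assms(2) unfolding open_contains_ball by blast
qed

lemma cleared_phi_integral:
  fixes e :: "nat \<Rightarrow> 'v::finite"
  assumes d: "d \<ge> 1"
  shows "\<exists>H. holomorphic_multi H (strip_domain d n e) \<and>
    (\<forall>z\<in>strip_domain d n e. sing_factor d (coords e z) \<noteq> 0 \<longrightarrow>
      H z = sing_factor d (coords e z) * (LINT x:{0..1}|lborel.
         of_real x powr (tail_sum d (coords e z) 1 - of_nat d + of_nat (n 1)) * ez_F d n (coords e z) (ez_phi d n (coords e z)) x))"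
proof -
  define c where "c z = tail_sum d (coords e z) 1 - of_nat d + of_nat (n 1)" for z
  have ch: "holomorphic_multi c UNIV"
    unfolding c_def by (intro holomorphic_multi_add holomorphic_multi_diff holomorphic_multi_tail_sum holomorphic_multi_const)
  have kd: "\<exists>\<epsilon>>0. \<exists>Bd. integrable lborel Bd \<and> (\<forall>s\<in>ball z \<epsilon>. \<forall>x\<in>{0<..1}. norm (exp_kernel (c s) x) * (1 + x) ^ N \<le> Bd x)"
    if z: "z \<in> strip_domain d n e" for z N
  proof -
    have "1 \<in> {1..d}" using d by simp
    then have "Re (tail_sum d (coords e z) 1) > real d - real 1 - real (n 1)"
      using z unfolding strip_domain_def ez_domain_def by blast
    \<comment> \<open>The remaining condition of \<open>D\<close>, the one on
      \<open>tail_sum d s 1\<close>, is integrability of the phi integral at 0.\<close>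
    then have "Re (c z) > -1" unfolding c_def by simp
    then obtain m where m: "-1 < m" "m < Re (c z)" using dense by blast
    obtain \<epsilon> where e: "\<epsilon> > 0" "\<And>s. s \<in> ball z \<epsilon> \<Longrightarrow> Re (c s) > m" using ball_Re_greater[OF ch m(2)] by blast
    have "norm (exp_kernel (c s) x) * (1 + x) ^ N \<le> 2 ^ N * (indicator {0<..1} x * x powr m)" if "s \<in> ball z \<epsilon>" "x \<in> {0<..1}" for s x
    proof -
      have x: "0 < x" "x \<le> 1" using that(2) by auto
      have "x powr Re (c s) \<le> x powr m" by (rule powr_mono') (use x e(2)[OF that(1)] in auto)
      moreover have "(1 + x) ^ N \<le> 2 ^ N" by (rule power_mono) (use x in auto)
      ultimately have "x powr Re (c s) * (1 + x) ^ N \<le> x powr m * 2 ^ N" using x by (intro mult_mono) auto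
      then show ?thesis using x by (simp add: norm_exp_kernel mult.commute)
    qed
    moreover have "integrable lborel (\<lambda>x. 2 ^ N * (indicator {0<..1} x * x powr m) :: real)"
      by (intro integrable_mult_right has_integral_powr_unit(1) m(1))
    ultimately show ?thesis using e(1) by (intro exI[of _ \<epsilon>] conjI exI[of _ "\<lambda>x. 2 ^ N * (indicator {0<..1} x * x powr m)"]) auto
  qed
  have "(LINT x|lborel. indicator {0<..1} x *\<^sub>R (exp_kernel (c z) x * F x)) = (LINT x:{0..1}|lborel. of_real x powr c z * F x)"
    for z and F :: "real \<Rightarrow> complex"
    unfolding set_lebesgue_integral_def
  proof (rule Bochner_Integration.integral_cong[OF refl])
    fix x :: real
    show "indicator {0<..1} x *\<^sub>R (exp_kernel (c z) x * F x) = indicator {0..1} x *\<^sub>R (of_real x powr c z * F x)"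
      by (cases "x = 0") (auto simp: indicator_def exp_kernel_eq)
  qed
  note eq = this[unfolded c_def]
  have X: "{0<..1::real} \<in> sets borel" "{0<..1::real} \<subseteq> {0..}" by auto
  show ?thesis
    using cleared_integral[where X = "{0<..1}" and kern = "\<lambda>z. exp_kernel (c z)" and \<Phi> = "\<lambda>a z. ez_phi d n (coords e z) a" and n = n and e = e,
        OF d X tame_smooth_ez_phi[OF d] holomorphic_multi_exp_kernel[OF ch] exp_kernel_measurable kd]
    unfolding c_def eq .
qed

lemma integrable_Gamma_kernel: "integrable lborel (\<lambda>x. indicator {0..} x * (x powr real K / exp x) :: real)"
proof -
  have "((\<lambda>t. t powr real K / exp t) has_integral Gamma (real K + 1)) {0..}"
    using Gamma_integral_real[of "real K + 1"] by simp
  then have "((\<lambda>x. indicator {0..} x * (x powr real K / exp x)) has_integral Gamma (real K + 1)) {0..}"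
    by (rule has_integral_eq[rotated]) auto
  then have hi: "((\<lambda>x. indicator {0..} x * (x powr real K / exp x)) has_integral Gamma (real K + 1)) (UNIV :: real set)"
    by (rule has_integral_on_superset) auto
  from nn_integral_has_integral_lborel[OF _ _ hi]
  have nn: "(\<integral>\<^sup>+ x. ennreal (indicator {0..} x * (x powr real K / exp x)) \<partial>lborel) = ennreal (Gamma (real K + 1))" by simp
  show ?thesis
  proof (rule integrableI_nonneg)
    show "(\<integral>\<^sup>+ x. ennreal (indicator {0..} x * (x powr real K / exp x)) \<partial>lborel) < \<infinity>" unfolding nn by simp
  qed auto
qed

lemma cleared_psi_integral:
  fixes e :: "nat \<Rightarrow> 'v::finite"
  assumes d: "d \<ge> 1"
  shows "\<exists>H. holomorphic_multi H (strip_domain d n e) \<and>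
    (\<forall>z\<in>strip_domain d n e. sing_factor d (coords e z) \<noteq> 0 \<longrightarrow>
      H z = sing_factor d (coords e z) * (LINT x:{1..}|lborel.
         of_real x powr (tail_sum d (coords e z) 1 - of_nat d) / of_real (exp x - 1) * ez_F d n (coords e z) (ez_psi d (coords e z)) x))"
proof -
  define c where "c z = tail_sum d (coords e z) 1 - of_nat d" for z
  define kern where "kern z x = exp_kernel (c z) x / of_real (exp x - 1)" for z x
  have ch: "holomorphic_multi c UNIV"
    unfolding c_def by (intro holomorphic_multi_diff holomorphic_multi_tail_sum holomorphic_multi_const)
  have ch': "holomorphic_multi (\<lambda>z. - c z) UNIV"
    using holomorphic_multi_diff[OF holomorphic_multi_const[of 0] ch] by simp
  have kh: "holomorphic_multi (\<lambda>z. kern z x) UNIV" for x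
    using holomorphic_multi_mult[OF holomorphic_multi_exp_kernel[OF ch] holomorphic_multi_const[of "inverse (complex_of_real (exp x - 1))"]]
    unfolding kern_def divide_inverse .
  have km: "kern z \<in> borel_measurable borel" for z unfolding kern_def[abs_def] by measurable
  have kd: "\<exists>\<epsilon>>0. \<exists>Bd. integrable lborel Bd \<and> (\<forall>s\<in>ball z \<epsilon>. \<forall>x\<in>{1..}. norm (kern s x) * (1 + x) ^ N \<le> Bd x)"
    for z N
  proof -
    \<comment> \<open>An integer bound for the exponent near \<open>z\<close>. On
      \<open>x \<ge> 1\<close> also \<open>exp x - 1 \<ge> exp x / 2\<close>, so the kernel times
      any power of \<open>1 + x\<close> is dominated by a gamma integrand.\<close>
    obtain M :: nat where M: "Re (c z) < real M" using reals_Archimedean2 by blast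
    obtain \<epsilon> where e: "\<epsilon> > 0" "\<And>s. s \<in> ball z \<epsilon> \<Longrightarrow> Re (- c s) > - real M"
      using ball_Re_greater[OF ch', of "- real M" z] M by auto
    have "norm (kern s x) * (1 + x) ^ N \<le> 2 * 2 ^ N * (indicator {0..} x * (x powr real (M + N) / exp x))" if "s \<in> ball z \<epsilon>" "x \<in> {1..}" for s x
    proof -
      have x: "1 \<le> x" using that(2) by auto
      have "exp x \<ge> 1 + x" by (rule exp_ge_add_one_self)
      then have ex: "exp x / 2 \<le> exp x - 1" using x by linarith
      have "x powr Re (c s) \<le> x powr real M" by (rule powr_mono) (use x e(2)[OF that(1)] in auto)
      then have "x powr Re (c s) / (exp x - 1) \<le> x powr real M / (exp x / 2)"
        using ex x by (intro frac_le) auto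
      moreover have "(1 + x) ^ N \<le> (2 * x) ^ N" by (rule power_mono) (use x in auto)
      ultimately have "x powr Re (c s) / (exp x - 1) * (1 + x) ^ N \<le> x powr real M / (exp x / 2) * (2 * x) ^ N"
        using x by (intro mult_mono) auto
      also have "\<dots> = 2 * 2 ^ N * (x powr real (M + N) / exp x)"
        using x by (simp add: powr_add powr_realpow power_mult_distrib)
      finally have b: "x powr Re (c s) / (exp x - 1) * (1 + x) ^ N \<le> 2 * 2 ^ N * (x powr real (M + N) / exp x)" .
      have "norm (complex_of_real (exp x - 1)) = exp x - 1" unfolding norm_of_real using x by simp
      then have "norm (kern s x) = x powr Re (c s) / (exp x - 1)"
        unfolding kern_def norm_divide using x norm_exp_kernel[of x "c s"] by simp
      then show ?thesis using x b by simp
    qed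
    moreover have "integrable lborel (\<lambda>x. 2 * 2 ^ N * (indicator {0..} x * (x powr real (M + N) / exp x)) :: real)"
      by (intro integrable_mult_right integrable_Gamma_kernel)
    ultimately show ?thesis using e(1) by blast
  qed
  have "(LINT x|lborel. indicator {1..} x *\<^sub>R (kern z x * F x)) = (LINT x:{1..}|lborel. of_real x powr c z / of_real (exp x - 1) * F x)"
    for z and F :: "real \<Rightarrow> complex"
    unfolding set_lebesgue_integral_def
  proof (rule Bochner_Integration.integral_cong[OF refl])
    fix x :: real
    show "indicator {1..} x *\<^sub>R (kern z x * F x) = indicator {1..} x *\<^sub>R (of_real x powr c z / of_real (exp x - 1) * F x)"
      by (cases "x \<ge> 1") (auto simp: indicator_def exp_kernel_eq kern_def)
  qed
  note eq = this[unfolded c_def]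
  have t: "tame_smooth d {1..} (\<lambda>z. ez_psi d (coords e z) a)" for a
    by (rule tame_smooth_ez_psi) auto
  have X: "{1::real..} \<in> sets borel" "{1::real..} \<subseteq> {0..}" by auto
  show ?thesis
    using cleared_integral[where X = "{1..}" and kern = kern and \<Phi> = "\<lambda>a z. ez_psi d (coords e z) a" and n = n and e = e,
        OF d X t kh km kd]
    unfolding eq .
qed

text \<open>\<open>w + of_nat k\<close> is the last factor of \<open>pochhammer w (k + 1)\<close>,
  so it cancels from the factorisation of \<open>rGamma w\<close>.\<close>

lemma inverse_mult_rGamma:
  fixes w :: complex
  assumes "rGamma w \<noteq> 0"
  shows "1 / (w + of_nat k) * rGamma w = pochhammer w k * rGamma (w + of_nat (k + 1))"
proof -
  have eq: "rGamma w = pochhammer w k * (w + of_nat k) * rGamma (w + of_nat (k + 1))"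
    using pochhammer_rGamma[of w "k + 1"] by (simp add: pochhammer_Suc)
  then have nz: "w + of_nat k \<noteq> 0" using assms by auto
  have "1 / (w + of_nat k) * rGamma w = (w + of_nat k) / (w + of_nat k) * (pochhammer w k * rGamma (w + of_nat (k + 1)))"
    unfolding eq divide_inverse by (simp only: mult_ac mult_1)
  then show ?thesis unfolding divide_self[OF nz] mult_1 .
qed

text \<open>The poles of the beta function come from its two numerator gamma factors.
  \<open>rGamma v\<close> cancels one; \<open>rGamma w\<close> cancels the other up to
  \<open>pochhammer w p\<close>, because the shift by \<open>p\<close> moves the poles only to the
  left. The right-hand side is entire.\<close>

lemma Beta_mult_rGamma:
  fixes w :: complex
  assumes "rGamma w \<noteq> 0" "rGamma v \<noteq> 0"
  shows "Beta (w + of_nat p) v * (rGamma w * rGamma v) = pochhammer w p * rGamma (w + of_nat p + v)"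
proof -
  have 1: "rGamma w = pochhammer w p * rGamma (w + of_nat p)" by (rule pochhammer_rGamma)
  then have "rGamma (w + of_nat p) \<noteq> 0" using assms(1) by auto
  then have 2: "Gamma (w + of_nat p) * rGamma (w + of_nat p) = 1" "Gamma v * rGamma v = 1"
    using assms(2) unfolding rGamma_inverse_Gamma by (auto intro!: right_inverse)
  have "Beta (w + of_nat p) v = Gamma (w + of_nat p) * Gamma v * rGamma (w + of_nat p + v)"
    by (simp add: Beta_def rGamma_inverse_Gamma divide_inverse)
  then have "Beta (w + of_nat p) v * (rGamma w * rGamma v)
     = pochhammer w p * rGamma (w + of_nat p + v) * (Gamma (w + of_nat p) * rGamma (w + of_nat p)) * (Gamma v * rGamma v)"
    unfolding 1 by (simp only: mult_ac)
  then show ?thesis unfolding 2 by simp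
qed

lemma cleared_main_term:
  fixes e :: "nat \<Rightarrow> 'v::finite"
  assumes d: "d \<ge> 1"
  shows "\<exists>H. holomorphic_multi H (strip_domain d n e) \<and>
    (\<forall>z\<in>strip_domain d n e. sing_factor d (coords e z) \<noteq> 0 \<longrightarrow>
      H z = sing_factor d (coords e z) * (\<Sum>k=0..n 1. \<Sum>p\<in>compositions d k.
         bern_coeff d p * (1 / (tail_sum d (coords e z) 1 - of_nat d + of_nat k)) *
         (\<Prod>j=2..d. Beta (tail_sum d (coords e z) j - of_nat d + of_nat j + of_nat (tail_sum d p j) - 1) (coords e z (j - 1)))))"
proof (intro exI conjI ballI impI)
  let ?L = "\<lambda>z j. pole_arg d (coords e z) j"
  let ?H = "\<lambda>z. \<Sum>k=0..n 1. \<Sum>p\<in>compositions d k. bern_coeff d p * (pochhammer (?L z 1) k * rGamma (?L z 1 + of_nat (k + 1)))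
     * rGamma (coords e z d) * (\<Prod>j=2..d. pochhammer (?L z j) (tail_sum d p j) * rGamma (?L z j + of_nat (tail_sum d p j) + coords e z (j - 1)))"
  show "holomorphic_multi ?H (strip_domain d n e)"
    by (intro holomorphic_multi_sum holomorphic_multi_mult holomorphic_multi_prod holomorphic_multi_rGamma holomorphic_multi_pochhammer
        holomorphic_multi_add holomorphic_multi_const holomorphic_multi_pole_arg holomorphic_multi_coords)
  fix z assume nz: "sing_factor d (coords e z) \<noteq> 0"
  let ?s = "coords e z"
  have 1: "rGamma (?L z 1) \<noteq> 0" "\<And>j. j \<in> {2..d} \<Longrightarrow> rGamma (?L z j) \<noteq> 0 \<and> rGamma (?s (j - 1)) \<noteq> 0"
    using nz unfolding sing_factor_def by auto
  have L1: "tail_sum d ?s 1 - of_nat d = ?L z 1" by (simp add: pole_arg_def)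
  have Lj: "tail_sum d ?s j - of_nat d + of_nat j + of_nat p - 1 = ?L z j + of_nat p" for j p by (simp add: pole_arg_def)
  have P: "(\<Prod>j=2..d. pochhammer (?L z j) (tail_sum d p j) * rGamma (?L z j + of_nat (tail_sum d p j) + ?s (j - 1)))
     = (\<Prod>j=2..d. Beta (?L z j + of_nat (tail_sum d p j)) (?s (j - 1))) * (\<Prod>j=2..d. rGamma (?L z j) * rGamma (?s (j - 1)))" for p
    unfolding prod.distrib[symmetric, of "\<lambda>j. Beta (?L z j + of_nat (tail_sum d p j)) (?s (j - 1))"]
    by (rule prod.cong[OF refl], rule Beta_mult_rGamma[symmetric]) (use 1(2) in auto)
  show "?H z = sing_factor d ?s * (\<Sum>k=0..n 1. \<Sum>p\<in>compositions d k.
         bern_coeff d p * (1 / (tail_sum d ?s 1 - of_nat d + of_nat k)) *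
         (\<Prod>j=2..d. Beta (tail_sum d ?s j - of_nat d + of_nat j + of_nat (tail_sum d p j) - 1) (?s (j - 1))))"
    unfolding L1 Lj P inverse_mult_rGamma[OF 1(1), symmetric] sing_factor_def sum_distrib_left by (simp only: mult_ac)
qed

text \<open>The prefactor of the formula is itself a product of reciprocal gamma functions, hence
  entire, so only the three brackets have to be cleared.\<close>

theorem cleared_formula:
  fixes e :: "nat \<Rightarrow> 'v::finite"
  assumes d: "d \<ge> 1"
  obtains H where "holomorphic_multi H (strip_domain d n e)"
    "\<And>z. z \<in> strip_domain d n e \<Longrightarrow> sing_factor d (coords e z) \<noteq> 0 \<Longrightarrow> H z = sing_factor d (coords e z) * ez_formula d n (coords e z)"
proof -
  let ?P = "\<lambda>z. \<Prod>j=1..d. rGamma (coords e z j)"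
  obtain H1 where H1: "holomorphic_multi H1 (strip_domain d n e)"
    "\<forall>z\<in>strip_domain d n e. sing_factor d (coords e z) \<noteq> 0 \<longrightarrow>
      H1 z = sing_factor d (coords e z) * (\<Sum>k=0..n 1. \<Sum>p\<in>compositions d k.
         bern_coeff d p * (1 / (tail_sum d (coords e z) 1 - of_nat d + of_nat k)) *
         (\<Prod>j=2..d. Beta (tail_sum d (coords e z) j - of_nat d + of_nat j + of_nat (tail_sum d p j) - 1) (coords e z (j - 1))))"
    using cleared_main_term[OF d] by blast
  obtain H2 where H2: "holomorphic_multi H2 (strip_domain d n e)"
    "\<forall>z\<in>strip_domain d n e. sing_factor d (coords e z) \<noteq> 0 \<longrightarrow>
      H2 z = sing_factor d (coords e z) * (LINT x:{0..1}|lborel.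
         of_real x powr (tail_sum d (coords e z) 1 - of_nat d + of_nat (n 1)) * ez_F d n (coords e z) (ez_phi d n (coords e z)) x)"
    using cleared_phi_integral[OF d] by blast
  obtain H3 where H3: "holomorphic_multi H3 (strip_domain d n e)"
    "\<forall>z\<in>strip_domain d n e. sing_factor d (coords e z) \<noteq> 0 \<longrightarrow>
      H3 z = sing_factor d (coords e z) * (LINT x:{1..}|lborel.
         of_real x powr (tail_sum d (coords e z) 1 - of_nat d) / of_real (exp x - 1) * ez_F d n (coords e z) (ez_psi d (coords e z)) x)"
    using cleared_psi_integral[OF d] by blast
  show ?thesis
  proof (rule that[of "\<lambda>z. ?P z * (H1 z + H2 z + H3 z)"])
    show "holomorphic_multi (\<lambda>z. ?P z * (H1 z + H2 z + H3 z)) (strip_domain d n e)"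
      by (intro holomorphic_multi_mult holomorphic_multi_add holomorphic_multi_prod holomorphic_multi_rGamma holomorphic_multi_coords H1(1) H2(1) H3(1))
    fix z assume z: "z \<in> strip_domain d n e" "sing_factor d (coords e z) \<noteq> 0"
    have P: "1 / (\<Prod>j=1..d. Gamma (coords e z j)) = ?P z"
      unfolding rGamma_inverse_Gamma divide_inverse prod_inversef[symmetric] by simp
    have key: "p * (s * a + s * b + s * c) = s * (p * a + p * b + p * c)" for p s a b c :: complex
      by (simp add: algebra_simps)
    show "?P z * (H1 z + H2 z + H3 z) = sing_factor d (coords e z) * ez_formula d n (coords e z)"
      unfolding ez_formula_def P H1(2)[rule_format, OF z] H2(2)[rule_format, OF z] H3(2)[rule_format, OF z] by (rule key)
  qed
qed

section \<open>Analytic continuation\<close>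

lemma norm_ez_term: "norm (ez_term d s m) = (\<Prod>j=1..d. real (\<Sum>i=1..j. m i) powr (- Re (s j)))"
  unfolding ez_term_def prod_norm[symmetric]
proof (rule prod.cong[OF refl])
  fix j
  show "norm (of_nat (\<Sum>i=1..j. m i) powr (- s j)) = real (\<Sum>i=1..j. m i) powr (- Re (s j))"
    using norm_of_real_powr[OF of_nat_0_le_iff, of "\<Sum>i=1..j. m i" "- s j"] by simp
qed

lemma ez_index_partial_sum_ge_1:
  assumes "m \<in> ez_index d" "j \<in> {1..d}"
  shows "(\<Sum>i=1..j. m i) \<ge> 1"
proof -
  have "1 \<in> {1..j}" "1 \<in> {1..d}" using assms(2) by auto
  then have "m 1 \<le> (\<Sum>i=1..j. m i)" "m 1 \<ge> 1"
    using assms(1) by (auto intro!: member_le_sum simp: ez_index_def PiE_iff)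
  then show ?thesis by linarith
qed

lemma norm_ez_term_antimono:
  assumes m: "m \<in> ez_index d" and "\<And>j. j \<in> {1..d} \<Longrightarrow> Re (s j) \<le> Re (t j)"
  shows "norm (ez_term d t m) \<le> norm (ez_term d s m)"
  unfolding norm_ez_term
proof (rule prod_mono)
  fix j assume j: "j \<in> {1..d}"
  have "real (\<Sum>i=1..j. m i) \<ge> 1" using of_nat_mono[OF ez_index_partial_sum_ge_1[OF m j], where 'a = real] by (simp only: of_nat_1)
  then have "real (\<Sum>i=1..j. m i) powr (- Re (t j)) \<le> real (\<Sum>i=1..j. m i) powr (- Re (s j))"
    using assms(2)[OF j] by (intro powr_mono) auto
  then show "0 \<le> real (\<Sum>i=1..j. m i) powr (- Re (t j)) \<and> real (\<Sum>i=1..j. m i) powr (- Re (t j)) \<le> real (\<Sum>i=1..j. m i) powr (- Re (s j))"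
    by simp
qed

lemma ez_converges_mono:
  assumes "ez_converges d s" "\<And>j. j \<in> {1..d} \<Longrightarrow> Re (s j) \<le> Re (t j)"
  shows "ez_converges d t"
  using assms(1) unfolding ez_converges_def
  by (rule summable_on_comparison_test) (auto intro: norm_ez_term_antimono assms(2))

lemma integrable_ez_term:
  assumes "ez_converges d s"
  shows "integrable (count_space (ez_index d)) (ez_term d s)"
    and "ez_zeta d s = (LINT m|count_space (ez_index d). ez_term d s m)"
proof -
  have 1: "Infinite_Set_Sum.abs_summable_on (ez_term d s) (ez_index d)"
    using assms unfolding ez_converges_def abs_summable_equivalent .
  then show "integrable (count_space (ez_index d)) (ez_term d s)"
    unfolding Infinite_Set_Sum.abs_summable_on_def .
  show "ez_zeta d s = (LINT m|count_space (ez_index d). ez_term d s m)"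
    using infsetsum_infsum[OF 1] unfolding infsetsum_def ez_zeta_def by simp
qed

lemma holomorphic_multi_ez_term:
  assumes m: "m \<in> ez_index d"
  shows "holomorphic_multi (\<lambda>z. ez_term d (coords e z) m) S"
  unfolding ez_term_def
proof (rule holomorphic_multi_prod)
  fix j
  have "holomorphic_multi (\<lambda>z. - coords e z j) S"
    using holomorphic_multi_diff[OF holomorphic_multi_const[of 0] holomorphic_multi_coords] by simp
  then show "holomorphic_multi (\<lambda>z. of_nat (\<Sum>i=1..j. m i) powr (- coords e z j)) S"
    by (rule holomorphic_multi_compose[where f = "\<lambda>w. of_nat (\<Sum>i=1..j. m i) powr w" and T = UNIV])
       (auto intro!: holomorphic_intros)
qed

text \<open>The series is an integral over a counting measure, and its terms at \<open>a\<close>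
  dominate those at every point with larger real parts. The strict inequalities make the region open
  even if \<open>a\<close> lies on the boundary of convergence.\<close>

lemma holomorphic_multi_ez_zeta:
  fixes e :: "nat \<Rightarrow> 'v::finite"
  assumes a: "ez_converges d a"
  shows "holomorphic_multi (\<lambda>z. ez_zeta d (coords e z)) {z. \<forall>j\<in>{1..d}. Re (coords e z j) > Re (a j)}"
    (is "holomorphic_multi _ ?O")
proof -
  have op: "open ?O" by (rule open_Re_greater[OF holomorphic_multi_coords]) simp
  have conv: "ez_converges d (coords e z)" if "z \<in> ?O" for z
    by (rule ez_converges_mono[OF a]) (use that in \<open>auto intro: less_imp_le\<close>)
  have "holomorphic_multi (\<lambda>z. LINT m|count_space (ez_index d). ez_term d (coords e z) m) ?O"
  proof (rule holomorphic_multi_integral[OF op])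
    show "holomorphic_multi (\<lambda>z. ez_term d (coords e z) m) ?O" if "m \<in> space (count_space (ez_index d))" for m
      using that by (intro holomorphic_multi_ez_term) simp
    show "ez_term d (coords e z) \<in> borel_measurable (count_space (ez_index d))" for z by simp
    have "norm (ez_term d (coords e s) m) \<le> norm (ez_term d a m)" if "s \<in> ?O" "m \<in> ez_index d" for s m
      by (rule norm_ez_term_antimono) (use that in \<open>auto intro: less_imp_le\<close>)
    then show "\<exists>r>0. \<exists>B. integrable (count_space (ez_index d)) B \<and>
        (\<forall>s\<in>ball z r \<inter> ?O. \<forall>m\<in>space (count_space (ez_index d)). norm (ez_term d (coords e s) m) \<le> B m)" for z
      using integrable_norm[OF integrable_ez_term(1)[OF a]]
      by (intro exI[of _ 1] conjI exI[of _ "\<lambda>m. norm (ez_term d a m)"]) auto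
  qed
  then show ?thesis by (rule holomorphic_multi_cong[OF _ op]) (rule integrable_ez_term(2)[OF conv])
qed

text \<open>Makes sure that the points where the real formula is available lie in \<open>D\<close>
  and off the zeros of \<open>sing_factor\<close>, so that the cleared function can be evaluated
  there.\<close>

lemma large_point:
  assumes big: "\<And>j. j \<in> {1..d} \<Longrightarrow> Re (s j) > real d + 1" and d: "d \<ge> 1"
  shows "s \<in> ez_domain d n" "sing_factor d s \<noteq> 0"
proof -
  have t: "Re (tail_sum d s j) > real d + 1" if j: "j \<in> {1..d}" for j
  proof -
    have "Re (s i) \<ge> 0" if "i \<in> {j..d}" for i
    proof -
      have "i \<in> {1..d}" using j that by auto
      from big[OF this] show ?thesis by linarith
    qed
    then have "Re (s j) \<le> (\<Sum>i=j..d. Re (s i))" using j by (intro member_le_sum) auto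
    then show ?thesis using big[OF j] unfolding tail_sum_def Re_sum by linarith
  qed
  have s': "Re (s (j - 1)) > real d + 1" if "j \<in> {2..d}" for j by (rule big) (use that in auto)
  show "s \<in> ez_domain d n" unfolding ez_domain_def
  proof (intro CollectI conjI ballI)
    fix j assume "j \<in> {1..d}"
    from t[OF this] show "Re (tail_sum d s j) > real d - real j - real (n j)" by linarith
  next
    fix j assume "j \<in> {2..d}"
    from s'[OF this] show "Re (s (j - 1)) > - real (n j) - 1" by linarith
  qed
  have R: "rGamma w \<noteq> 0" if "Re w > 0" for w :: complex
    using that unfolding rGamma_eq_0_iff_int by auto
  have p: "rGamma (pole_arg d s j) \<noteq> 0" if j: "j \<in> {1..d}" for j
    by (rule R) (use t[OF j] j in \<open>simp add: pole_arg_def\<close>)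
  have g: "rGamma (s j) \<noteq> 0" if j: "j \<in> {1..d}" for j
    by (rule R) (use big[OF j] in linarith)
  have g': "rGamma (s (j - 1)) \<noteq> 0" if j: "j \<in> {2..d}" for j by (rule g) (use j in auto)
  show "sing_factor d s \<noteq> 0"
    unfolding sing_factor_def using p[of 1] p g[of d] g' d by simp
qed

section \<open>Continuation along complex lines\<close>

lemma coords_line: "coords e (p + w *s q) j = coords e p j + w * coords e q j"
  by (simp add: coords_def)

lemma tail_sum_line: "tail_sum d (coords e (p + w *s q)) j = tail_sum d (coords e p) j + w * tail_sum d (coords e q) j"
  unfolding tail_sum_def coords_line sum.distrib sum_distrib_left ..

lemma convex_strip_domain: "convex (strip_domain d n e)"
proof -
  have c: "m < u * a + v * b" if "0 \<le> u" "0 \<le> v" "u + v = 1" "m < a" "m < b" for u v a b m :: real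
    using convex_bound_lt[of "-a" "-m" "-b" u v] that by (simp add: algebra_simps)
  have eq: "Re (coords e (u *\<^sub>R x + v *\<^sub>R y) j) = u * Re (coords e x j) + v * Re (coords e y j)" for u v x y j
    by (simp add: coords_def)
  have eq': "Re (tail_sum d (coords e (u *\<^sub>R x + v *\<^sub>R y)) j) = u * Re (tail_sum d (coords e x) j) + v * Re (tail_sum d (coords e y) j)" for u v x y j
    unfolding tail_sum_def Re_sum eq sum.distrib sum_distrib_left ..
  show ?thesis
  proof (rule convexI)
    fix x y u v assume xy: "x \<in> strip_domain d n e" "y \<in> strip_domain d n e" and uv: "0 \<le> (u::real)" "0 \<le> v" "u + v = 1"
    show "u *\<^sub>R x + v *\<^sub>R y \<in> strip_domain d n e"
      unfolding strip_domain_def ez_domain_def mem_Collect_eq eq eq'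
      by (intro conjI ballI c[OF uv]) (use xy in \<open>auto simp: strip_domain_def ez_domain_def\<close>)
  qed
qed

lemma zero_islimpt_reals:
  assumes "open S" "0 \<in> S"
  shows "(0::complex) islimpt (S \<inter> {w. Im w = 0})"
  unfolding islimpt_approachable
proof (intro allI impI)
  fix \<epsilon> :: real assume "\<epsilon> > 0"
  obtain r where r: "r > 0" "ball 0 r \<subseteq> S" using assms open_contains_ball by blast
  let ?x = "complex_of_real (min r \<epsilon> / 2)"
  have "norm ?x = min r \<epsilon> / 2" using r(1) \<open>\<epsilon> > 0\<close> unfolding norm_of_real by simp
  then have n: "norm ?x < r" "norm ?x < \<epsilon>" "norm ?x > 0" using r(1) \<open>\<epsilon> > 0\<close> by (auto simp: min_def)
  then have "?x \<in> S" using r(2) by auto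
  moreover have "?x \<noteq> 0" using n(3) unfolding zero_less_norm_iff .
  ultimately show "\<exists>x'\<in>S \<inter> {w. Im w = 0}. x' \<noteq> 0 \<and> dist x' 0 < \<epsilon>"
    using n(2) unfolding dist_norm diff_zero by (intro bexI[of _ ?x] conjI IntI CollectI Im_complex_of_real)
qed

text \<open>
  The line \<open>w \<mapsto> Re z + w Im z\<close> is at real points for real \<open>w\<close> and passes through \<open>z\<close> at \<open>w = \<i>\<close>.
\<close>
lemma continuation_real_points:
  fixes e :: "nat \<Rightarrow> 'v::finite"
  assumes E: "holomorphic_multi E R" and R: "R = {z. \<forall>j\<in>{1..d}. Re (coords e z j) > m j}"
    and real: "\<And>z. z \<in> R \<Longrightarrow> (\<And>j. Im (coords e z j) = 0) \<Longrightarrow> E z = 0"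
    and z: "z \<in> R"
  shows "E z = 0"
proof -
  define p q :: "complex ^ 'v" where "p = (\<chi> i. of_real (Re (vec_nth z i)))" and "q = (\<chi> i. of_real (Im (vec_nth z i)))"
  have cp: "coords e p j = of_real (Re (coords e z j))" "coords e q j = of_real (Im (coords e z j))" for j
    by (simp_all add: coords_def p_def q_def)
  let ?S = "{w. p + w *s q \<in> R}"
  have zi: "p + \<i> *s q = z"
    unfolding vec_eq_iff by (simp add: p_def q_def complex_eq_iff)
  \<comment> \<open>Along this line the real part of the coordinate \<open>j\<close> is
    \<open>Re z_j + Re w * Im z_j\<close>, so each condition cuts out a half-plane, or all or
    nothing if \<open>Im z_j = 0\<close>; the intersection is convex.\<close>
  have Seq: "?S = (\<Inter>j\<in>{1..d}. {w. complex_of_real (Im (coords e z j)) \<bullet> w > m j - Re (coords e z j)})"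
    unfolding R by (auto simp: coords_line cp inner_complex_def algebra_simps)
  have op: "open ?S" unfolding Seq by (intro open_INT ballI open_halfspace_gt) simp
  have "convex ?S" unfolding Seq by (intro convex_INT convex_halfspace_gt)
  then have con: "connected ?S" by (rule convex_connected)
  have 0: "0 \<in> ?S" using z unfolding R by (simp add: coords_line cp)
  have "(\<lambda>w. E (p + w *s q)) \<i> = 0"
  proof (rule analytic_continuation[OF holomorphic_multi_line[OF E] op con _ 0 zero_islimpt_reals[OF op 0]])
    show "E (p + w *s q) = 0" if "w \<in> ?S \<inter> {w. Im w = 0}" for w
      by (rule real) (use that in \<open>auto simp: coords_line cp\<close>)
    show "\<i> \<in> ?S" using z zi by simp
  qed auto
  then show ?thesis unfolding zi .
qed

text \<open>\<open>z\<close> is any point of \<open>D\<close> at which the series converges,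
  possibly on the boundary of the region of convergence and possibly a zero of
  \<open>sing_factor\<close>. Hence \<open>E\<close> is shown to vanish only at points strictly
  beyond \<open>z\<close>, and the value at \<open>z\<close> is a limit.\<close>

lemma cleared_zeta:
  fixes e :: "nat \<Rightarrow> 'v::finite"
  assumes d: "d \<ge> 1" and H: "holomorphic_multi H (strip_domain d n e)"
    and Hf: "\<And>z. z \<in> strip_domain d n e \<Longrightarrow> sing_factor d (coords e z) \<noteq> 0 \<Longrightarrow> H z = sing_factor d (coords e z) * ez_formula d n (coords e z)"
    and z: "z \<in> strip_domain d n e" and conv: "ez_converges d (coords e z)"
  shows "H z = sing_factor d (coords e z) * ez_zeta d (coords e z)"
proof -
  let ?D = "strip_domain d n e" and ?c = "\<lambda>s. Re (coords e s j)"
  define E where "E s = H s - sing_factor d (coords e s) * ez_zeta d (coords e s)" for s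
  define O1 where "O1 = {s. \<forall>j\<in>{1..d}. Re (coords e s j) > Re (coords e z j)}"
  have E_hol: "holomorphic_multi E (?D \<inter> O1)"
    unfolding E_def[abs_def] O1_def
    by (intro holomorphic_multi_diff holomorphic_multi_mult holomorphic_multi_sing_factor
        holomorphic_multi_subset[OF H] holomorphic_multi_subset[OF holomorphic_multi_ez_zeta[OF conv]]) auto
  \<comment> \<open>Beyond \<open>z\<close> and large: here the series converges by monotonicity,
    \<open>sing_factor\<close> does not vanish, and the real points are covered by
    \<open>formula_real\<close>.\<close>
  define R where "R = {s. \<forall>j\<in>{1..d}. Re (coords e s j) > max (Re (coords e z j)) (real d + 1)}"
  have RD: "s \<in> ?D" "sing_factor d (coords e s) \<noteq> 0" "s \<in> O1" if "s \<in> R" for s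
  proof -
    have "Re (coords e s j) > real d + 1" if "j \<in> {1..d}" for j using \<open>s \<in> R\<close> that by (auto simp: R_def)
    from large_point[where s = "coords e s", OF this d] show "s \<in> ?D" "sing_factor d (coords e s) \<noteq> 0" by (auto simp: strip_domain_def)
    show "s \<in> O1" using that by (auto simp: R_def O1_def)
  qed
  have ER: "E s = 0" if s: "s \<in> R" for s
  proof (rule continuation_real_points[OF _ R_def _ s])
    show "holomorphic_multi E R" by (rule holomorphic_multi_subset[OF E_hol]) (use RD in auto)
    fix s assume sR: "s \<in> R" and im: "\<And>j. Im (coords e s j) = 0"
    have rc: "coords e s = (\<lambda>j. of_real (Re (coords e s j)))" by (rule ext) (simp add: complex_eq_iff im)
    interpret real_point d n e s "\<lambda>j. Re (coords e s j)"
      by unfold_locales (use d rc sR in \<open>auto simp: R_def\<close>)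
    have "ez_converges d (coords e s)"
      by (rule ez_converges_mono[OF conv]) (use RD(3)[OF sR] in \<open>auto simp: O1_def intro: less_imp_le\<close>)
    from formula_real[OF this] show "E s = 0" unfolding E_def Hf[OF RD(1,2)[OF sR]] by simp
  qed
  \<comment> \<open>The all-ones direction raises every real part, and no tail sum loses real part;
    a half-line from \<open>z\<close> therefore stays in \<open>D\<close> and in
    \<open>O1\<close>.\<close>
  define q :: "complex ^ 'v" where "q = (\<chi> i. 1)"
  have cq: "coords e q j = 1" for j by (simp add: coords_def q_def)
  let ?T = "{w. Re w > 0}"
  have TD: "z + w *s q \<in> ?D \<inter> O1" if w: "Re w > 0" for w
  proof -
    have "Re (w * (\<Sum>i=j..d. 1)) \<ge> 0" for j using w by simp
    then have "Re (tail_sum d (coords e (z + w *s q)) j) \<ge> Re (tail_sum d (coords e z) j)" for j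
      unfolding tail_sum_line unfolding tail_sum_def[of d "coords e q"] cq by simp
    moreover have "Re (coords e (z + w *s q) j) > Re (coords e z j)" for j unfolding coords_line cq using w by simp
    ultimately show ?thesis using z unfolding strip_domain_def ez_domain_def O1_def
      by (auto intro: less_le_trans less_trans)
  qed
  \<comment> \<open>For \<open>Re w > \<Lambda>\<close> each coordinate of \<open>z + w *s q\<close>
    has real part above \<open>real d + 1\<close> even if that of \<open>z\<close> is negative, so
    the point lies in \<open>R\<close>.\<close>
  define \<Lambda> where "\<Lambda> = (\<Sum>j\<in>{1..d}. \<bar>Re (coords e z j)\<bar>) + real d + 1"
  have \<Lambda>: "\<bar>Re (coords e z j)\<bar> \<le> \<Lambda> - real d - 1" if "j \<in> {1..d}" for j
    unfolding \<Lambda>_def using member_le_sum[OF that, of "\<lambda>j. \<bar>Re (coords e z j)\<bar>"] by simp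
  have \<Lambda>0: "\<Lambda> > 0" unfolding \<Lambda>_def by (intro add_nonneg_pos add_nonneg_nonneg sum_nonneg) auto
  have U0: "E (z + w *s q) = 0" if w: "Re w > \<Lambda>" for w
  proof (rule ER)
    have "max (Re (coords e z j)) (real d + 1) < Re (coords e z j) + Re w" if "j \<in> {1..d}" for j
      using \<Lambda>[OF that] w \<Lambda>0 by (auto simp: max_def)
    then show "z + w *s q \<in> R" unfolding R_def mem_Collect_eq coords_line cq by simp
  qed
  have EL: "E (z + w *s q) = 0" if w: "Re w > 0" for w
  proof (rule analytic_continuation[where f = "\<lambda>w. E (z + w *s q)" and S = ?T and U = "{w. Re w > \<Lambda>}" and \<xi> = "of_real (\<Lambda> + 1)"])
    show "(\<lambda>w. E (z + w *s q)) holomorphic_on ?T"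
      by (rule holomorphic_on_subset[OF holomorphic_multi_line[OF E_hol]]) (use TD in auto)
    show "open ?T" by (rule open_halfspace_Re_gt)
    show "connected ?T" by (intro convex_connected convex_halfspace_Re_gt)
    show "complex_of_real (\<Lambda> + 1) islimpt {w. Re w > \<Lambda>}"
      by (rule interior_limit_point) (simp add: interior_open open_halfspace_Re_gt)
  qed (use w \<Lambda>0 U0 in auto)
  \<comment> \<open>Points on the diagonal half-line tending to \<open>z\<close>; the terms of the
    series at \<open>z\<close> dominate the terms at all of them.\<close>
  define p where "p k = z + of_real (1 / real (Suc k)) *s q" for k
  have pc: "Re (coords e (p k) j) > Re (coords e z j)" for k j unfolding p_def coords_line cq by simp
  have plim: "p \<longlonglongrightarrow> z"
  proof (rule vec_tendstoI)
    fix i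
    have "(\<lambda>k. vec_nth z i + complex_of_real (1 / real (Suc k))) \<longlonglongrightarrow> vec_nth z i + complex_of_real 0"
      by (intro tendsto_add tendsto_const tendsto_of_real) (rule LIMSEQ_Suc[OF lim_1_over_n])
    then show "(\<lambda>k. vec_nth (p k) i) \<longlonglongrightarrow> vec_nth z i" by (simp add: p_def q_def)
  qed
  have lim: "(\<lambda>k. f (p k)) \<longlonglongrightarrow> f z" if "holomorphic_multi f ?D" for f
  proof -
    have "isCont f z" using holomorphic_multi_continuous_on[OF that] z open_strip_domain continuous_on_eq_continuous_at by blast
    then show ?thesis using plim by (rule isCont_tendsto_compose)
  qed
  have convk: "ez_converges d (coords e (p k))" for k
    by (rule ez_converges_mono[OF conv less_imp_le[OF pc]])
  have zlim: "(\<lambda>k. ez_zeta d (coords e (p k))) \<longlonglongrightarrow> ez_zeta d (coords e z)"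
    unfolding integrable_ez_term(2)[OF convk] integrable_ez_term(2)[OF conv]
  proof (rule integral_dominated_convergence[where w = "\<lambda>m. norm (ez_term d (coords e z) m)"])
    show "integrable (count_space (ez_index d)) (\<lambda>m. norm (ez_term d (coords e z) m))"
      by (rule integrable_norm[OF integrable_ez_term(1)[OF conv]])
    show "AE m in count_space (ez_index d). (\<lambda>k. ez_term d (coords e (p k)) m) \<longlonglongrightarrow> ez_term d (coords e z) m"
      by (rule AE_I2) (use lim[OF holomorphic_multi_ez_term] in auto)
    show "AE m in count_space (ez_index d). norm (ez_term d (coords e (p k)) m) \<le> norm (ez_term d (coords e z) m)" for k
      by (rule AE_I2) (auto intro!: norm_ez_term_antimono less_imp_le[OF pc])
  qed auto
  have "E (p k) = 0" for k unfolding p_def by (rule EL) simp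
  then have Hk: "H (p k) = sing_factor d (coords e (p k)) * ez_zeta d (coords e (p k))" for k by (simp add: E_def)
  have "(\<lambda>k. H (p k)) \<longlonglongrightarrow> sing_factor d (coords e z) * ez_zeta d (coords e z)"
    unfolding Hk by (intro tendsto_mult zlim lim[OF holomorphic_multi_sing_factor])
  with lim[OF H] show ?thesis by (rule LIMSEQ_unique)
qed

theorem theorem1:
  fixes d :: nat and n :: "nat \<Rightarrow> nat" and e :: "nat \<Rightarrow> 'd::finite"
  assumes "d \<ge> 2" and "bij_betw e {1..d} UNIV"
  defines "D \<equiv> {s :: complex ^ 'd. coords e s \<in> ez_domain d n}"
      and "Sing \<equiv> {s :: complex ^ 'd. coords e s \<in> ez_singular d}"
  shows "\<exists>Z :: complex ^ 'd \<Rightarrow> complex.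
           meromorphic_multi Z D \<and>
           (\<forall>s. ez_converges d (coords e s) \<longrightarrow> Z s = ez_zeta d (coords e s)) \<and>
           (\<forall>s \<in> D - Sing. Z s = ez_formula d n (coords e s)) \<and>
           holomorphic_multi Z (D - Sing)"
proof -
  have d: "d \<ge> 1" using assms(1) by simp
  let ?h = "\<lambda>s. sing_factor d (coords e s)"
  have D: "D = strip_domain d n e" unfolding D_def strip_domain_def ..
  have Sing: "s \<in> Sing \<longleftrightarrow> ?h s = 0" for s unfolding Sing_def sing_factor_eq_0_iff[OF d] by simp
  obtain H where H: "holomorphic_multi H D"
    "\<And>s. s \<in> D \<Longrightarrow> ?h s \<noteq> 0 \<Longrightarrow> H s = ?h s * ez_formula d n (coords e s)"
    unfolding D by (rule cleared_formula[OF d]) blast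
  have Hz: "H s = ?h s * ez_zeta d (coords e s)" if "s \<in> D" "ez_converges d (coords e s)" for s
    using cleared_zeta[OF d H[unfolded D] that[unfolded D]] .
  define Z where "Z s = (if s \<in> D \<and> ?h s \<noteq> 0 then H s / ?h s else ez_zeta d (coords e s))" for s
  have opD: "open D" unfolding D by (rule open_strip_domain)
  have "D - Sing = D \<inter> {s. ?h s \<noteq> 0}" using Sing by blast
  moreover have "open {s. ?h s \<noteq> 0}"
    by (intro open_Collect_neq continuous_on_holomorphic holomorphic_multi_sing_factor continuous_on_const)
  ultimately have opDS: "open (D - Sing)" using opD by (simp add: open_Int)
  \<comment> \<open>A point witnessing that the denominator \<open>?h\<close> does not vanish
    identically on \<open>D\<close>.\<close>
  define w :: "complex ^ 'd" where "w = (\<chi> i. of_nat d + 2)"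
  have "Re (coords e w j) > real d + 1" for j by (simp add: coords_def w_def)
  from large_point[where s = "coords e w", OF this d] have w: "w \<in> D" "?h w \<noteq> 0" by (auto simp: D_def)
  show ?thesis
  proof (intro exI[of _ Z] conjI ballI allI impI)
    show "meromorphic_multi Z D"
      unfolding meromorphic_multi_def
    proof
      fix z assume z: "z \<in> D"
      \<comment> \<open>\<open>D\<close> is convex and therefore itself an admissible neighbourhood
        of each of its points, with one quotient \<open>H / ?h\<close> for all.\<close>
      have "connected D" unfolding D by (intro convex_connected convex_strip_domain)
      then show "\<exists>U g h. open U \<and> connected U \<and> z \<in> U \<and> U \<subseteq> D \<and>
       holomorphic_multi g U \<and> holomorphic_multi h U \<and> (\<exists>w\<in>U. h w \<noteq> 0) \<and>
       (\<forall>w\<in>U. h w \<noteq> 0 \<longrightarrow> Z w = g w / h w)"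
        by (intro exI[of _ D] exI[of _ H] exI[of _ ?h])
           (use opD z H(1) w in \<open>auto simp: Z_def holomorphic_multi_sing_factor\<close>)
    qed
    show "Z s = ez_zeta d (coords e s)" if "ez_converges d (coords e s)" for s
      using Hz[OF _ that] by (simp add: Z_def)
    show "Z s = ez_formula d n (coords e s)" if "s \<in> D - Sing" for s
      using that H(2)[of s] by (simp add: Z_def Sing)
    have "holomorphic_multi (\<lambda>s. H s / ?h s) (D - Sing)"
      by (intro holomorphic_multi_divide holomorphic_multi_subset[OF H(1)] holomorphic_multi_sing_factor) (auto simp: Sing)
    then show "holomorphic_multi Z (D - Sing)"
      by (rule holomorphic_multi_cong[OF _ opDS]) (simp add: Z_def Sing)
  qed
qed

end
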